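(* Let $\mathbb{F}$ be a field and let $X$ be a topological space with $\dim_{\mathbb{F}} H_p(X;\mathbb{F})<\infty$ for all $p$. Let $\{\Delta_n\}_n$ be a transferred $A_\infty$-coalgebra structure on the reduced homology $\widetilde H_*(X)=\widetilde H_*(X;\mathbb{F})$, and set $k:=\min\{n\mid \Delta_n\neq 0\}$ if $\{n\mid\Delta_n\neq 0\}\neq\emptyset$, and $k:=+\infty$ otherwise. Then $k$ and the numbers $\dim\operatorname{Ker}\bigl(\Delta_m|_{\widetilde H_p(X)}\bigr)$ (for integers $m\le k$, $m\geq 1$, and $p\ge 0$) are independent of the choice of transferred $A_\infty$-coalgebra structure on $\widetilde H_*(X)$. Moreover, since homotopy equivalent spaces induce isomorphic transferred $A_\infty$-coalgebras, $k$ and every such number $\dim\operatorname{Ker}\bigl(\Delta_m|_{\widetilde H_p(X)}\bigr)$ are invariants of the homotopy type of $X$.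
   Context: All vector spaces and homology groups are over the field $\mathbb{F}$. An $A_\infty$-coalgebra structure $\{\Delta_n\}_{n\ge 1}$ on a graded vector space $C$ is a family of maps $\Delta_n\colon C\to C^{\otimes n}$ of degree $n-2$ such that for all $n\ge 1$ $$\sum_{i=1}^n\sum_{j=0}^{n-i}(-1)^{i+j+ij}\bigl(1^{\otimes n-i-j}\otimes\Delta_i\otimes 1^{\otimes j}\bigr)\,\Delta_{n-i+1}=0 .$$ It is called minimal if $\Delta_1=0$. Any differential graded coalgebra $(C,\partial,\Delta)$ is viewed as an $A_\infty$-coalgebra by setting $\Delta_1=\partial$, $\Delta_2=\Delta$ and $\Delta_n=0$ for all $n>2$; this structure is written $(C,\{\partial,\Delta,0,0,\dots\})$. A morphism of $A_\infty$-coalgebras $f\colon(C,\{\Delta_n\}_{n\ge1})\to(C',\{\Delta'_n\}_{n\ge1})$ is a family of maps $f_{(k)}\colon C\to {C'}^{\otimes k}$, $k\ge 1$, of degree $k-1$, such that for each $i\ge 1$ $$\sum_{\substack{p+q+k=i\\ q\ge 1,\ p,k\ge 0}}(1^{\otimes p}\otimes\Delta'_q\otimes 1^{\otimes k})f_{(p+k+1)}=\sum_{\substack{k_1+\dots+k_\ell=i\\ \ell,k_j\ge 1}}(f_{(k_1)}\otimes\dots\otimes f_{(k_\ell)})\Delta_\ell .$$ It is an isomorphism if $f_{(1)}$ is an isomorphism, and a quasi-isomorphism if $f_{(1)}$ induces an isomorphism in homology. A transferred $A_\infty$-coalgebra structure on $\widetilde H_*(X)$ (induced by $X$) is an $A_\infty$-coalgebra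 structure on the graded vector space $\widetilde H_*(X)$ that is minimal and quasi-isomorphic to the $A_\infty$-coalgebra $(\widetilde C_*(X),\{\widetilde\partial,\widetilde\Delta,0,0,\dots\})$ which is induced, at the level of reduced chains, by $(C_*(X),\{\partial,\Delta,0,0,\dots\})$, where $(C_*(X),\partial)$ is the singular chain complex of $X$ and $\Delta$ is an approximation to the diagonal.
   Formalization: Reduced chains use an explicit base point, fixed for X; homotopy equivalences must carry it into the path component of the other space's base point (automatic if path connected), and the morphism equation has the Koszul signs omitted in the text; without either the claim fails. *)

theory Defs
  imports "HOL-Homology.Homology" "HOL-Library.Extended_Nat"
begin

subsection \<open>Free vector spaces\<close>

definition fscale :: "'f::field \<Rightarrow> ('b \<Rightarrow>\<^sub>0 'f) \<Rightarrow> ('b \<Rightarrow>\<^sub>0 'f)" where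
  "fscale c v = Poly_Mapping.map ((*) c) v"

lemma lookup_fscale [simp]: "Poly_Mapping.lookup (fscale c v) b = c * Poly_Mapping.lookup v b"
  by (simp add: fscale_def Poly_Mapping.map.rep_eq when_def)

interpretation fv: vector_space "fscale :: 'f::field \<Rightarrow> ('b \<Rightarrow>\<^sub>0 'f) \<Rightarrow> ('b \<Rightarrow>\<^sub>0 'f)"
  by unfold_locales (auto intro!: poly_mapping_eqI simp: lookup_add algebra_simps)

abbreviation flinear :: "(('b \<Rightarrow>\<^sub>0 'f::field) \<Rightarrow> ('c \<Rightarrow>\<^sub>0 'f)) \<Rightarrow> bool" where
  "flinear \<equiv> Vector_Spaces.linear fscale fscale"

definition lin_ext :: "('b \<Rightarrow> ('c \<Rightarrow>\<^sub>0 'f::field)) \<Rightarrow> ('b \<Rightarrow>\<^sub>0 'f) \<Rightarrow> ('c \<Rightarrow>\<^sub>0 'f)" where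
  "lin_ext g v = (\<Sum>b\<in>Poly_Mapping.keys v. fscale (Poly_Mapping.lookup v b) (g b))"

abbreviation gen :: "'b \<Rightarrow> ('b \<Rightarrow>\<^sub>0 'f::field)" where
  "gen b \<equiv> Poly_Mapping.single b 1"

definition free_on :: "'b set \<Rightarrow> ('b \<Rightarrow>\<^sub>0 'f::field) set" where
  "free_on S = {v. Poly_Mapping.keys v \<subseteq> S}"

subsection \<open>Graded vector spaces and their tensor powers\<close>

text \<open>
  A graded vector space \<open>V\<close> is given by a homogeneous basis, that is, by a set \<open>S\<close> of pairs
  (degree, name): \<open>V\<close> is \<open>free_on S\<close>, and \<open>V\<^sub>p\<close> is spanned by the basis elements of degree \<open>p\<close>.
  Every graded vector space over a field is of this form up to isomorphism; the degrees are
  natural numbers because chain complexes and homology live in degrees \<open>p \<ge> 0\<close>.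
  Accordingly the \<open>n\<close>-th tensor power of \<open>V\<close> is free on the words of length \<open>n\<close> over \<open>S\<close>, the word
  \<open>[b\<^sub>1, \<dots>, b\<^sub>n]\<close> standing for \<open>b\<^sub>1 \<otimes> \<dots> \<otimes> b\<^sub>n\<close>, with degree the sum of the degrees.

  Linear maps out of \<open>V\<close> are represented by linear maps on the whole type; only their
  restriction to \<open>free_on S\<close> is ever constrained or used.
\<close>

type_synonym ('b, 'f) gvec = "(nat \<times> 'b) \<Rightarrow>\<^sub>0 'f"
type_synonym ('b, 'f) gten = "(nat \<times> 'b) list \<Rightarrow>\<^sub>0 'f"

definition gcomp :: "(nat \<times> 'b) set \<Rightarrow> nat \<Rightarrow> ('b, 'f::field) gvec set" where
  "gcomp S p = free_on {b \<in> S. fst b = p}"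

definition wdeg :: "(nat \<times> 'b) list \<Rightarrow> int" where
  "wdeg w = int (sum_list (map fst w))"

definition tpow :: "(nat \<times> 'b) set \<Rightarrow> nat \<Rightarrow> ('b, 'f::field) gten set" where
  "tpow S n = free_on {w. length w = n \<and> set w \<subseteq> S}"

definition tcomp :: "(nat \<times> 'b) set \<Rightarrow> nat \<Rightarrow> int \<Rightarrow> ('b, 'f::field) gten set" where
  "tcomp S n d = free_on {w. length w = n \<and> set w \<subseteq> S \<and> wdeg w = d}"

text \<open>The identification of \<open>V\<close> with its first tensor power, and its inverse.\<close>

definition letter :: "('b, 'f::field) gvec \<Rightarrow> ('b, 'f) gten" where
  "letter = lin_ext (\<lambda>b. gen [b])"

definition unletter :: "('b, 'f::field) gten \<Rightarrow> ('b, 'f) gvec" where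
  "unletter = lin_ext (\<lambda>w. if length w = 1 then gen (hd w) else 0)"

definition tmul :: "('b, 'f::field) gten \<Rightarrow> ('b, 'f) gten \<Rightarrow> ('b, 'f) gten" where
  "tmul x y = lin_ext (\<lambda>u. lin_ext (\<lambda>w. gen (u @ w)) y) x"

definition ksign :: "int \<Rightarrow> 'f::field" where
  "ksign e = (if even e then 1 else - 1)"

text \<open>
  Tensor products of maps follow the Koszul rule
  \<open>(f \<otimes> g) (x \<otimes> y) = (-1)\<^bsup>|g||x|\<^esup> f x \<otimes> g y\<close>.

  \<open>id_tensor_id a e f\<close> is \<open>1\<^bsup>\<otimes>a\<^esup> \<otimes> f \<otimes> 1\<^bsup>\<otimes>j\<^esup>\<close> for a map \<open>f\<close> of degree \<open>e\<close> from \<open>V\<close> to a tensor power;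
  it is applied to words of length \<open>a + 1 + j\<close> only, so \<open>j\<close> need not be passed.
\<close>

definition id_tensor_id ::
  "nat \<Rightarrow> int \<Rightarrow> (('b, 'f::field) gvec \<Rightarrow> ('b, 'f) gten) \<Rightarrow> ('b, 'f) gten \<Rightarrow> ('b, 'f) gten" where
  "id_tensor_id a e f = lin_ext (\<lambda>w.
     fscale (ksign (e * wdeg (take a w)))
       (tmul (gen (take a w)) (tmul (f (gen (w ! a))) (gen (drop (Suc a) w)))))"

text \<open>
  \<open>tensor_maps [(e\<^sub>1, f\<^sub>1), \<dots>, (e\<^sub>l, f\<^sub>l)]\<close> is \<open>f\<^sub>1 \<otimes> \<dots> \<otimes> f\<^sub>l\<close> on words of length \<open>l\<close>, where \<open>f\<^sub>i\<close> has
  degree \<open>e\<^sub>i\<close>.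
\<close>

fun tensor_maps_word ::
  "(int \<times> (('b, 'f::field) gvec \<Rightarrow> ('c, 'f) gten)) list \<Rightarrow> (nat \<times> 'b) list \<Rightarrow> ('c, 'f) gten" where
  "tensor_maps_word [] [] = gen []"
| "tensor_maps_word (ef # fs) (b # w) =
     fscale (ksign (sum_list (map fst fs) * int (fst b)))
       (tmul (snd ef (gen b)) (tensor_maps_word fs w))"
| "tensor_maps_word _ _ = 0"

definition tensor_maps ::
  "(int \<times> (('b, 'f::field) gvec \<Rightarrow> ('c, 'f) gten)) list \<Rightarrow> ('b, 'f) gten \<Rightarrow> ('c, 'f) gten" where
  "tensor_maps fs = lin_ext (tensor_maps_word fs)"

subsection \<open>Homology of a chain complex\<close>

definition cycles ::
  "(nat \<times> 'b) set \<Rightarrow> (('b, 'f::field) gvec \<Rightarrow> ('b, 'f) gvec) \<Rightarrow> nat \<Rightarrow> ('b, 'f) gvec set" where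
  "cycles S \<delta> p = {z \<in> gcomp S p. \<delta> z = 0}"

definition boundaries ::
  "(nat \<times> 'b) set \<Rightarrow> (('b, 'f::field) gvec \<Rightarrow> ('b, 'f) gvec) \<Rightarrow> nat \<Rightarrow> ('b, 'f) gvec set" where
  "boundaries S \<delta> p = \<delta> ` gcomp S (Suc p)"

text \<open>The quotient of the \<open>p\<close>-cycles by the \<open>p\<close>-boundaries is spanned by finitely many classes.\<close>

definition fin_dim_homology ::
  "(nat \<times> 'b) set \<Rightarrow> (('b, 'f::field) gvec \<Rightarrow> ('b, 'f) gvec) \<Rightarrow> nat \<Rightarrow> bool" where
  "fin_dim_homology S \<delta> p \<longleftrightarrow>
     (\<exists>B. finite B \<and> B \<subseteq> cycles S \<delta> p \<and> cycles S \<delta> p \<subseteq> fv.span (B \<union> boundaries S \<delta> p))"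

text \<open>
  The graded vector space with basis \<open>H\<close> is the homology of \<open>(S, \<delta>)\<close>, where \<open>cls p\<close> takes a \<open>p\<close>-cycle
  to its homology class: a linear surjection from the \<open>p\<close>-cycles whose kernel is the \<open>p\<close>-boundaries.
\<close>

definition is_homology ::
  "(nat \<times> 'b) set \<Rightarrow> (('b, 'f::field) gvec \<Rightarrow> ('b, 'f) gvec) \<Rightarrow>
   (nat \<times> 'h) set \<Rightarrow> (nat \<Rightarrow> ('b, 'f) gvec \<Rightarrow> ('h, 'f) gvec) \<Rightarrow> bool" where
  "is_homology S \<delta> H cls \<longleftrightarrow>
     (\<forall>p. flinear (cls p) \<and> cls p ` cycles S \<delta> p = gcomp H p \<and>
          (\<forall>z\<in>cycles S \<delta> p. cls p z = 0 \<longleftrightarrow> z \<in> boundaries S \<delta> p))"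

text \<open>The chain map \<open>g\<close> induces injections, respectively surjections, on the homology classes.\<close>

definition induces_homology_iso ::
  "(nat \<times> 'b) set \<Rightarrow> (('b, 'f::field) gvec \<Rightarrow> ('b, 'f) gvec) \<Rightarrow>
   (nat \<times> 'c) set \<Rightarrow> (('c, 'f) gvec \<Rightarrow> ('c, 'f) gvec) \<Rightarrow> (('b, 'f) gvec \<Rightarrow> ('c, 'f) gvec) \<Rightarrow> bool" where
  "induces_homology_iso S \<delta> S' \<delta>' g \<longleftrightarrow>
     (\<forall>p. (\<forall>z\<in>cycles S \<delta> p. g z \<in> boundaries S' \<delta>' p \<longrightarrow> z \<in> boundaries S \<delta> p) \<and>
          (\<forall>z'\<in>cycles S' \<delta>' p. \<exists>z\<in>cycles S \<delta> p. z' - g z \<in> boundaries S' \<delta>' p))"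

subsection \<open>A-infinity-coalgebras\<close>

definition ainf_coalgebra ::
  "(nat \<times> 'b) set \<Rightarrow> (nat \<Rightarrow> ('b, 'f::field) gvec \<Rightarrow> ('b, 'f) gten) \<Rightarrow> bool" where
  "ainf_coalgebra S \<Delta> \<longleftrightarrow>
     (\<forall>n\<ge>1. flinear (\<Delta> n) \<and> (\<forall>p. \<Delta> n ` gcomp S p \<subseteq> tcomp S n (int p + int n - 2))) \<and>
     (\<forall>n\<ge>1. \<forall>v\<in>free_on S.
        (\<Sum>i\<in>{1..n}. \<Sum>j\<in>{0..n-i}.
           fscale (ksign (int (i + j + i * j)))
             (id_tensor_id (n - i - j) (int i - 2) (\<Delta> i) (\<Delta> (n - i + 1) v))) = 0)"

definition minimal ::
  "(nat \<times> 'b) set \<Rightarrow> (nat \<Rightarrow> ('b, 'f::field) gvec \<Rightarrow> ('b, 'f) gten) \<Rightarrow> bool" where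
  "minimal S \<Delta> \<longleftrightarrow> (\<forall>v\<in>free_on S. \<Delta> 1 v = 0)"

text \<open>
  Signs in the morphism equations. On the desuspension, the maps
  \<open>s\<^sup>-\<^sup>1\<^bsup>\<otimes>n\<^esup> \<Delta>\<^sub>n s\<close> (degree \<open>-1\<close>) and \<open>s\<^sup>-\<^sup>1\<^bsup>\<otimes>k\<^esup> f\<^sub>k s\<close> (degree \<open>0\<close>) satisfy
  \<open>\<Sum> (1 \<otimes> \<Delta>\<^sub>i \<otimes> 1) \<Delta> = 0\<close> and \<open>\<Sum> (1 \<otimes> \<Delta>'\<^sub>q \<otimes> 1) f = \<Sum> (f \<otimes> \<dots> \<otimes> f) \<Delta>\<close> without any signs (coderivations and
  maps of cobar constructions). Moving the suspensions out by the Koszul rule turns the first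
  equation into the one in \<open>ainf_coalgebra\<close>, with its sign \<open>(-1)\<^bsup>i+j+ij\<^esup>\<close>, and the second into
  \<open>\<Sum> (-1)\<^bsup>p+qk\<^esup> (1\<^bsup>\<otimes>p\<^esup> \<otimes> \<Delta>'\<^sub>q \<otimes> 1\<^bsup>\<otimes>k\<^esup>) f = \<Sum> (-1)\<^bsup>e\<^esup> (f\<^bsub>k1\<^esub> \<otimes> \<dots> \<otimes> f\<^bsub>kl\<^esub>) \<Delta>\<^sub>l\<close> with \<open>e\<close> the sum of
  \<open>(k\<^sub>u - 1) k\<^sub>v\<close> over \<open>u < v\<close>. The equation is often printed with these signs suppressed; read
  literally for the unsuspended maps it is not compatible with the sign \<open>(-1)\<^bsup>i+j+ij\<^esup>\<close> unless
  the characteristic is 2.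
\<close>

fun comp_exponent :: "nat list \<Rightarrow> nat" where
  "comp_exponent [] = 0"
| "comp_exponent (k # ks) = (k - 1) * sum_list ks + comp_exponent ks"

definition ainf_morphism ::
  "(nat \<times> 'b) set \<Rightarrow> (nat \<Rightarrow> ('b, 'f::field) gvec \<Rightarrow> ('b, 'f) gten) \<Rightarrow>
   (nat \<times> 'c) set \<Rightarrow> (nat \<Rightarrow> ('c, 'f) gvec \<Rightarrow> ('c, 'f) gten) \<Rightarrow>
   (nat \<Rightarrow> ('b, 'f) gvec \<Rightarrow> ('c, 'f) gten) \<Rightarrow> bool" where
  "ainf_morphism S \<Delta> S' \<Delta>' f \<longleftrightarrow>
     (\<forall>k\<ge>1. flinear (f k) \<and> (\<forall>p. f k ` gcomp S p \<subseteq> tcomp S' k (int p + int k - 1))) \<and>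
     (\<forall>i\<ge>1. \<forall>v\<in>free_on S.
        (\<Sum>(p, q, k)\<in>{(p, q, k). p + q + k = i \<and> q \<ge> 1}.
           fscale (ksign (int (p + q * k))) (id_tensor_id p (int q - 2) (\<Delta>' q) (f (p + k + 1) v))) =
        (\<Sum>ks\<in>{ks. (\<forall>k\<in>set ks. k \<ge> 1) \<and> sum_list ks = i}.
           fscale (ksign (int (comp_exponent ks)))
             (tensor_maps (map (\<lambda>k. (int k - 1, f k)) ks) (\<Delta> (length ks) v))))"

definition ainf_isomorphism ::
  "(nat \<times> 'b) set \<Rightarrow> (nat \<Rightarrow> ('b, 'f::field) gvec \<Rightarrow> ('b, 'f) gten) \<Rightarrow>
   (nat \<times> 'c) set \<Rightarrow> (nat \<Rightarrow> ('c, 'f) gvec \<Rightarrow> ('c, 'f) gten) \<Rightarrow>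
   (nat \<Rightarrow> ('b, 'f) gvec \<Rightarrow> ('c, 'f) gten) \<Rightarrow> bool" where
  "ainf_isomorphism S \<Delta> S' \<Delta>' f \<longleftrightarrow>
     ainf_morphism S \<Delta> S' \<Delta>' f \<and> bij_betw (f 1) (free_on S) (tpow S' 1)"

definition ainf_quasi_iso ::
  "(nat \<times> 'b) set \<Rightarrow> (nat \<Rightarrow> ('b, 'f::field) gvec \<Rightarrow> ('b, 'f) gten) \<Rightarrow>
   (nat \<times> 'c) set \<Rightarrow> (nat \<Rightarrow> ('c, 'f) gvec \<Rightarrow> ('c, 'f) gten) \<Rightarrow>
   (nat \<Rightarrow> ('b, 'f) gvec \<Rightarrow> ('c, 'f) gten) \<Rightarrow> bool" where
  "ainf_quasi_iso S \<Delta> S' \<Delta>' f \<longleftrightarrow>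
     ainf_morphism S \<Delta> S' \<Delta>' f \<and>
     induces_homology_iso S (unletter \<circ> \<Delta> 1) S' (unletter \<circ> \<Delta>' 1) (unletter \<circ> f 1)"

text \<open>A quasi-isomorphism in either direction is accepted.\<close>

definition quasi_isomorphic ::
  "(nat \<times> 'b) set \<Rightarrow> (nat \<Rightarrow> ('b, 'f::field) gvec \<Rightarrow> ('b, 'f) gten) \<Rightarrow>
   (nat \<times> 'c) set \<Rightarrow> (nat \<Rightarrow> ('c, 'f) gvec \<Rightarrow> ('c, 'f) gten) \<Rightarrow> bool" where
  "quasi_isomorphic S \<Delta> S' \<Delta>' \<longleftrightarrow>
     (\<exists>f. ainf_quasi_iso S \<Delta> S' \<Delta>' f) \<or> (\<exists>f. ainf_quasi_iso S' \<Delta>' S \<Delta> f)"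

definition dg_coalgebra ::
  "(nat \<times> 'b) set \<Rightarrow> (('b, 'f::field) gvec \<Rightarrow> ('b, 'f) gvec) \<Rightarrow> (('b, 'f) gvec \<Rightarrow> ('b, 'f) gten) \<Rightarrow> bool"
  where
  "dg_coalgebra S \<delta> \<Delta> \<longleftrightarrow>
     flinear \<delta> \<and> \<delta> ` gcomp S 0 \<subseteq> {0} \<and> (\<forall>p. \<delta> ` gcomp S (Suc p) \<subseteq> gcomp S p) \<and>
     flinear \<Delta> \<and> (\<forall>p. \<Delta> ` gcomp S p \<subseteq> tcomp S 2 (int p)) \<and>
     (\<forall>v\<in>free_on S.
        \<delta> (\<delta> v) = 0 \<and>
        id_tensor_id 0 (- 1) (letter \<circ> \<delta>) (\<Delta> v) + id_tensor_id 1 (- 1) (letter \<circ> \<delta>) (\<Delta> v) = \<Delta> (\<delta> v) \<and>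
        id_tensor_id 0 0 \<Delta> (\<Delta> v) = id_tensor_id 1 0 \<Delta> (\<Delta> v))"

definition ainf_of_dg ::
  "(('b, 'f::field) gvec \<Rightarrow> ('b, 'f) gvec) \<Rightarrow> (('b, 'f) gvec \<Rightarrow> ('b, 'f) gten) \<Rightarrow>
   nat \<Rightarrow> ('b, 'f) gvec \<Rightarrow> ('b, 'f) gten" where
  "ainf_of_dg \<delta> \<Delta> n = (if n = 1 then letter \<circ> \<delta> else if n = 2 then \<Delta> else (\<lambda>_. 0))"

subsection \<open>Singular chains with field coefficients\<close>

text \<open>
  A singular simplex carries its dimension, since one extensional function may be a singular
  simplex of several dimensions.
\<close>

type_synonym 'a simplex = "(nat \<Rightarrow> real) \<Rightarrow> 'a"

definition simplices :: "'a topology \<Rightarrow> (nat \<times> 'a simplex) set" where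
  "simplices X = {(p, \<sigma>). singular_simplex p X \<sigma>}"

definition bd :: "('a simplex, 'f::field) gvec \<Rightarrow> ('a simplex, 'f) gvec" where
  "bd = lin_ext (\<lambda>(p, \<sigma>). if p = 0 then 0
          else (\<Sum>k\<le>p. fscale ((- 1) ^ k) (gen (p - 1, singular_face p k \<sigma>))))"

subsection \<open>Approximations to the diagonal\<close>

definition std_space :: "nat \<Rightarrow> (nat \<Rightarrow> real) topology" where
  "std_space p = subtopology (powertop_real UNIV) (standard_simplex p)"

definition push :: "('b \<Rightarrow> 'a) \<Rightarrow> ('b simplex, 'f::field) gten \<Rightarrow> ('a simplex, 'f) gten" where
  "push g = lin_ext (\<lambda>w. gen (map (\<lambda>(q, \<tau>). (q, simplex_map q g \<tau>)) w))"

text \<open>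
  By the Yoneda lemma a natural transformation from \<open>C\<^sub>*(X)\<close> to \<open>C\<^sub>*(X) \<otimes> C\<^sub>*(X)\<close> is the same as a
  family of elements \<open>D p\<close> of \<open>C\<^sub>*(\<Delta>\<^sup>p) \<otimes> C\<^sub>*(\<Delta>\<^sup>p)\<close>, the values on the identity simplices; its value on
  a singular simplex \<open>\<sigma>\<close> of dimension \<open>p\<close> is then the image of \<open>D p\<close> under \<open>\<sigma>\<close>.
\<close>

definition diag :: "(nat \<Rightarrow> ((nat \<Rightarrow> real) simplex, 'f::field) gten) \<Rightarrow>
    ('a simplex, 'f) gvec \<Rightarrow> ('a simplex, 'f) gten" where
  "diag D = lin_ext (\<lambda>(p, \<sigma>). push \<sigma> (D p))"

text \<open>
  A natural coassociative chain map taking each \<open>0\<close>-simplex \<open>x\<close> to \<open>x \<otimes> x\<close>. By naturality it is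
  enough to ask for a differential graded coalgebra on the chains of the standard simplices.
\<close>

definition diagonal_approximation :: "(nat \<Rightarrow> ((nat \<Rightarrow> real) simplex, 'f::field) gten) \<Rightarrow> bool" where
  "diagonal_approximation D \<longleftrightarrow>
     (\<forall>p. D p \<in> tcomp (simplices (std_space p)) 2 (int p)) \<and>
     D 0 = gen [(0, restrict id (standard_simplex 0)), (0, restrict id (standard_simplex 0))] \<and>
     (\<forall>p. dg_coalgebra (simplices (std_space p)) bd (diag D))"

subsection \<open>Reduced chains and transferred structures\<close>

text \<open>
  The reduced chains are the quotient of \<open>C\<^sub>*(X)\<close> by the line spanned by a base vertex \<open>x\<close>. As
  \<open>\<partial> x = 0\<close> and \<open>\<Delta> x = x \<otimes> x\<close>, this line is a subcoalgebra and the structure maps descend. The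
  quotient is free on the remaining singular simplices, and the quotient map on tensors drops
  every word in which the base vertex occurs.
\<close>

definition base_vertex :: "'a \<Rightarrow> nat \<times> 'a simplex" where
  "base_vertex x = (0, restrict (\<lambda>_. x) (standard_simplex 0))"

definition reduced_simplices :: "'a topology \<Rightarrow> 'a \<Rightarrow> (nat \<times> 'a simplex) set" where
  "reduced_simplices X x = simplices X - {base_vertex x}"

definition drop_base :: "'a \<Rightarrow> ('a simplex, 'f::field) gten \<Rightarrow> ('a simplex, 'f) gten" where
  "drop_base x = lin_ext (\<lambda>w. if base_vertex x \<in> set w then 0 else gen w)"

definition reduced_bd :: "'a \<Rightarrow> ('a simplex, 'f::field) gvec \<Rightarrow> ('a simplex, 'f) gvec" where
  "reduced_bd x = unletter \<circ> drop_base x \<circ> letter \<circ> bd"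

definition reduced_diag :: "(nat \<Rightarrow> ((nat \<Rightarrow> real) simplex, 'f::field) gten) \<Rightarrow> 'a \<Rightarrow>
    ('a simplex, 'f) gvec \<Rightarrow> ('a simplex, 'f) gten" where
  "reduced_diag D x = drop_base x \<circ> diag D"

definition is_reduced_homology ::
  "'a topology \<Rightarrow> 'a \<Rightarrow> (nat \<times> 'h) set \<Rightarrow>
   (nat \<Rightarrow> ('a simplex, 'f::field) gvec \<Rightarrow> ('h, 'f) gvec) \<Rightarrow> bool" where
  "is_reduced_homology X x H cls \<longleftrightarrow> is_homology (reduced_simplices X x) (reduced_bd x) H cls"

definition transferred ::
  "'a topology \<Rightarrow> 'a \<Rightarrow> (nat \<times> 'h) set \<Rightarrow> (nat \<Rightarrow> ('h, 'f::field) gvec \<Rightarrow> ('h, 'f) gten) \<Rightarrow> bool" where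
  "transferred X x H \<Delta> \<longleftrightarrow>
     (\<exists>cls :: nat \<Rightarrow> ('a simplex, 'f) gvec \<Rightarrow> ('h, 'f) gvec. is_reduced_homology X x H cls) \<and>
     ainf_coalgebra H \<Delta> \<and> minimal H \<Delta> \<and>
     (\<exists>D. diagonal_approximation D \<and>
          quasi_isomorphic H \<Delta>
            (reduced_simplices X x) (ainf_of_dg (reduced_bd x) (reduced_diag D x)))"

definition first_nonzero ::
  "(nat \<times> 'h) set \<Rightarrow> (nat \<Rightarrow> ('h, 'f::field) gvec \<Rightarrow> ('h, 'f) gten) \<Rightarrow> enat" where
  "first_nonzero H \<Delta> =
     (if \<exists>n\<ge>1. \<exists>v\<in>free_on H. \<Delta> n v \<noteq> 0
      then enat (LEAST n. n \<ge> 1 \<and> (\<exists>v\<in>free_on H. \<Delta> n v \<noteq> 0)) else \<infinity>)"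

definition ker_dim ::
  "(nat \<times> 'h) set \<Rightarrow> (nat \<Rightarrow> ('h, 'f::field) gvec \<Rightarrow> ('h, 'f) gten) \<Rightarrow> nat \<Rightarrow> nat \<Rightarrow> nat" where
  "ker_dim H \<Delta> m p = fv.dim {v \<in> gcomp H p. \<Delta> m v = 0}"

end

theory Submission imports Defs "HOL-Computational_Algebra.Formal_Power_Series" begin

text \<open>
  After desuspension, an \<open>A\<^sub>\<infinity>\<close>-coalgebra structure is a square-zero derivation of degree \<open>-1\<close> of the
  completed tensor algebra, and a morphism is an algebra homomorphism commuting with the derivations.
  Splitting a complex over the field into homology and a contractible part,
  one gets from the homotopy a minimal model with quasi-isomorphisms in both directions, all given by fixed
  point equations that are contracting for the length filtration. A quasi-isomorphism between minimal
  structures has an invertible linear part and hence is invertible, so minimal models are unique up to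
  isomorphism, and every zigzag of quasi-isomorphisms between them yields an isomorphism.

  It remains to connect the reduced singular coalgebras. Two approximations to the diagonal are
  related by a natural \<open>A\<^sub>\<infinity>\<close>-morphism, built on the standard simplices by acyclic models. A pointed
  homotopy equivalence pushes simplices forward. A change of base point along a path is a span of
  pointed homotopy equivalences out of \<open>Y\<close> with a whisker.

  Finally, if all operations below arity \<open>n\<close> vanish, the lowest coefficient of the morphism equation
  reads \<open>\<Delta>'\<^sub>n f\<^sub>1 = f\<^sub>1\<^bsup>\<otimes>n\<^esup> \<Delta>\<^sub>n\<close>, so the linear isomorphism \<open>f\<^sub>1\<close> identifies the kernels.
\<close>

text \<open>Handled arity by arity, the relations would be signed sums over trees. Here signs are
  absorbed once by \<open>conv\<close>, and every wanted map is obtained from an equation that gains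
  one order in the formal variable with each substitution. That a solution is a morphism is never
  computed directly: its defect satisfies a homogeneous equation of the same contracting kind and
  therefore vanishes.

  Comparing two diagonals is more than plain acyclic models. The diagonal of a p-simplex may contain
  the p-simplex itself next to a vertex, so the value sought in dimension p also occurs on the right
  of its own equation. The recursion over dimensions is therefore combined with a fixed point
  problem in each dimension.

  A quasi-isomorphism of a transferred structure may point either way, so minimal models are needed
  on both sides of a complex. Reduced chains depend on a base point while the given homotopies are
  free, so the path from the image of the base point to the other base point has to be followed
  separately.\<close>

unbundle no vec_syntax
unbundle fps_syntax

section \<open>Tensor algebras with a formal variable\<close>

text \<open>Makes words the free monoid. Convolution of finitely supported functions then turns
  \<open>gten\<close> into the tensor algebra, a ring over which power series can be formed.\<close>

instantiation list :: (type) monoid_add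
begin
definition zero_list :: "'a list" where "zero_list = []"
definition plus_list :: "'a list \<Rightarrow> 'a list \<Rightarrow> 'a list" where "plus_list = (@)"
instance by standard (auto simp: zero_list_def plus_list_def)
end

text \<open>The formal variable counts by how much a term is longer than expected, so a power series
  stands for an element of the completed tensor algebra.\<close>

type_synonym ('b, 'f) talg = "('b, 'f) gten fps"

section \<open>Linear extension and free subspaces\<close>

lemma lin_ext_superset:
  assumes "finite B" "Poly_Mapping.keys v \<subseteq> B"
  shows "lin_ext g v = (\<Sum>b\<in>B. fscale (Poly_Mapping.lookup v b) (g b))"
  unfolding lin_ext_def using assms
  by (intro sum.mono_neutral_left) (auto simp: in_keys_iff intro!: poly_mapping_eqI)

lemma fscale_0_left [simp]: "fscale 0 v = 0" and fscale_1 [simp]: "fscale 1 v = v"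
  and fscale_0_right [simp]: "fscale c 0 = 0"
  by (auto intro!: poly_mapping_eqI)

lemma fscale_add_left: "fscale (a + b) v = fscale a v + fscale b v"
  and fscale_add_right: "fscale a (v + w) = fscale a v + fscale a w"
  and fscale_fscale: "fscale a (fscale b v) = fscale (a * b) v"
  and fscale_minus_left: "fscale (- a) v = - fscale a v"
  and fscale_diff_right: "fscale a (v - w) = fscale a v - fscale a w"
  by (auto intro!: poly_mapping_eqI simp: lookup_add algebra_simps lookup_minus)

lemma fscale_sum: "fscale a (sum g A) = (\<Sum>x\<in>A. fscale a (g x))"
  by (induction A rule: infinite_finite_induct) (auto simp: fscale_add_right)

lemma keys_fscale: "Poly_Mapping.keys (fscale a v) \<subseteq> Poly_Mapping.keys v"
  by (auto simp: in_keys_iff)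

lemma lin_ext_add: "lin_ext g (v + w) = lin_ext g v + lin_ext g w"
proof -
  let ?B = "Poly_Mapping.keys v \<union> Poly_Mapping.keys w"
  have "Poly_Mapping.keys (v + w) \<subseteq> ?B" by (rule Poly_Mapping.keys_add)
  then show ?thesis
    by (simp add: lin_ext_superset[of ?B] lookup_add fscale_add_left sum.distrib)
qed

lemma lin_ext_scale: "lin_ext g (fscale c v) = fscale c (lin_ext g v)"
  by (simp add: lin_ext_superset[OF _ keys_fscale] lin_ext_superset[of "Poly_Mapping.keys v"]
      fscale_sum fscale_fscale)

lemma flinear_lin_ext: "flinear (lin_ext g)"
  by unfold_locales (auto simp: lin_ext_add lin_ext_scale)

lemma lin_ext_gen [simp]: "lin_ext g (gen b) = g b"
  by (simp add: lin_ext_def)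

lemma lin_ext_0 [simp]: "lin_ext g 0 = 0"
  by (simp add: lin_ext_def)

lemma poly_mapping_sum_monomials:
  "(\<Sum>k\<in>Poly_Mapping.keys v. Poly_Mapping.single k (Poly_Mapping.lookup v k)) = v"
  by (rule poly_mapping_eqI) (auto simp: lookup_sum lookup_single when_def in_keys_iff)

lemma expand_gen: "v = (\<Sum>b\<in>Poly_Mapping.keys v. fscale (Poly_Mapping.lookup v b) (gen b))"
proof -
  have "fscale (Poly_Mapping.lookup v b) (gen b) = Poly_Mapping.single b (Poly_Mapping.lookup v b)" for b
    by (rule poly_mapping_eqI) (simp add: lookup_single when_def)
  then show ?thesis using poly_mapping_sum_monomials[of v] by simp
qed

lemma flinear_module_hom: "flinear g \<Longrightarrow> module_hom fscale fscale g"
  by (simp add: Vector_Spaces.linear_def)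

lemma flinear_sum: "flinear g \<Longrightarrow> g (sum u A) = (\<Sum>x\<in>A. g (u x))"
  by (rule module_hom.sum[OF flinear_module_hom])

lemma flinearD:
  assumes "flinear g"
  shows "g (v + w) = g v + g w" "g (fscale c v) = fscale c (g v)" "g (v - w) = g v - g w" "g 0 = 0"
    "g (- v) = - g v"
  using flinear_module_hom[OF assms]
  by (rule module_hom.add module_hom.scale module_hom.diff module_hom.zero module_hom.neg)+

lemma flinear_eq_lin_ext:
  assumes "flinear g" shows "g v = lin_ext (\<lambda>b. g (gen b)) v"
proof -
  have "g v = g (\<Sum>b\<in>Poly_Mapping.keys v. fscale (Poly_Mapping.lookup v b) (gen b))"
    by (rule arg_cong[where f = g, OF expand_gen])
  also have "\<dots> = lin_ext (\<lambda>b. g (gen b)) v"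
    by (simp add: lin_ext_def flinear_sum[OF assms] flinearD[OF assms])
  finally show ?thesis .
qed

lemma lin_ext_gen_id: "lin_ext gen v = v"
  unfolding lin_ext_def by (rule expand_gen[symmetric])

lemma flinear_eq_on:
  assumes "flinear f" "flinear g" "\<And>b. b \<in> Poly_Mapping.keys v \<Longrightarrow> f (gen b) = g (gen b)"
  shows "f v = g v"
  unfolding flinear_eq_lin_ext[OF assms(1), of v] flinear_eq_lin_ext[OF assms(2), of v]
  by (simp add: lin_ext_def assms(3))

lemma lin_ext_cong: "(\<And>b. b \<in> Poly_Mapping.keys v \<Longrightarrow> f b = g b) \<Longrightarrow> lin_ext f v = lin_ext g v"
  by (simp add: lin_ext_def)

lemma lin_ext_comp:
  assumes "flinear h" shows "h (lin_ext g v) = lin_ext (\<lambda>b. h (g b)) v"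
  by (simp add: lin_ext_def flinear_sum[OF assms] flinearD[OF assms])

lemma free_on_0 [simp]: "0 \<in> free_on S" by (simp add: free_on_def)

lemma free_on_gen [simp]: "gen b \<in> free_on S \<longleftrightarrow> b \<in> S" by (simp add: free_on_def)

lemma free_on_add: "v \<in> free_on S \<Longrightarrow> w \<in> free_on S \<Longrightarrow> v + w \<in> free_on S"
  using Poly_Mapping.keys_add[of v w] by (auto simp: free_on_def)

lemma free_on_fscale: "v \<in> free_on S \<Longrightarrow> fscale c v \<in> free_on S"
  using keys_fscale[of c v] by (auto simp: free_on_def)

lemma free_on_diff: "v \<in> free_on S \<Longrightarrow> w \<in> free_on S \<Longrightarrow> v - w \<in> free_on S"
  using Poly_Mapping.keys_diff[of v w] by (auto simp: free_on_def)

lemma free_on_sum: "(\<And>x. x \<in> A \<Longrightarrow> g x \<in> free_on S) \<Longrightarrow> sum g A \<in> free_on S"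
  by (induction A rule: infinite_finite_induct) (auto simp: free_on_add)

lemma lin_ext_in: "(\<And>b. b \<in> Poly_Mapping.keys v \<Longrightarrow> g b \<in> free_on S) \<Longrightarrow> lin_ext g v \<in> free_on S"
  unfolding lin_ext_def by (intro free_on_sum free_on_fscale)

section \<open>The tensor product as multiplication in the monoid algebra of words\<close>

lemma single_Nil_mult: "Poly_Mapping.single [] c * (x :: ('b, 'f::field) gten) = fscale c x"
proof -
  have *: "Poly_Mapping.single [] c * Poly_Mapping.single k d = fscale c (Poly_Mapping.single k (d::'f))" for k :: "(nat \<times> 'b) list" and d
    by (rule poly_mapping_eqI) (simp add: mult_single plus_list_def lookup_single when_def)
  have "Poly_Mapping.single [] c * (\<Sum>k\<in>Poly_Mapping.keys x. Poly_Mapping.single k (Poly_Mapping.lookup x k))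
      = fscale c (\<Sum>k\<in>Poly_Mapping.keys x. Poly_Mapping.single k (Poly_Mapping.lookup x k))"
    by (simp only: sum_distrib_left fscale_sum *)
  then show ?thesis by (simp only: poly_mapping_sum_monomials)
qed

lemma mult_single_Nil: "(x :: ('b, 'f::field) gten) * Poly_Mapping.single [] c = fscale c x"
proof -
  have *: "Poly_Mapping.single k d * Poly_Mapping.single [] c = fscale c (Poly_Mapping.single k (d::'f))" for k :: "(nat \<times> 'b) list" and d
    by (rule poly_mapping_eqI) (simp add: mult_single plus_list_def lookup_single when_def)
  have "(\<Sum>k\<in>Poly_Mapping.keys x. Poly_Mapping.single k (Poly_Mapping.lookup x k)) * Poly_Mapping.single [] c
      = fscale c (\<Sum>k\<in>Poly_Mapping.keys x. Poly_Mapping.single k (Poly_Mapping.lookup x k))"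
    by (simp only: sum_distrib_right fscale_sum *)
  then show ?thesis by (simp only: poly_mapping_sum_monomials)
qed

lemma gten_one: "(1 :: ('b, 'f::field) gten) = gen []"
  unfolding zero_list_def[symmetric] by (rule single_one[symmetric])

lemma gen_mult_gen: "gen u * gen v = (gen (u @ v) :: ('b, 'f::field) gten)"
  by (simp add: mult_single plus_list_def)

lemma fscale_mult_left: "fscale c (x :: ('b, 'f::field) gten) * y = fscale c (x * y)"
  by (simp only: single_Nil_mult[symmetric] mult.assoc)

lemma fscale_mult_right: "(x :: ('b, 'f::field) gten) * fscale c y = fscale c (x * y)"
proof -
  have "x * fscale c y = (x * Poly_Mapping.single [] c) * y"
    by (simp only: single_Nil_mult[symmetric] mult.assoc)
  then show ?thesis by (simp only: mult_single_Nil fscale_mult_left)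
qed

lemma tmul_eq_mult: "tmul x y = x * (y :: ('b, 'f::field) gten)"
proof -
  have l: "flinear (\<lambda>y. gen u * (y :: ('b, 'f) gten))" for u
    by unfold_locales (auto simp: algebra_simps fscale_mult_right)
  have l2: "flinear (\<lambda>x. x * (y :: ('b, 'f) gten))"
    by unfold_locales (auto simp: algebra_simps fscale_mult_left)
  have "lin_ext (\<lambda>w. gen (u @ w)) y = gen u * y" for u
    using lin_ext_comp[OF l[of u], where g = "\<lambda>w. gen w" and v = y] by (simp add: lin_ext_gen_id gen_mult_gen)
  then show ?thesis
    using lin_ext_comp[OF l2, where g = "\<lambda>w. gen w" and v = x] by (simp add: tmul_def lin_ext_gen_id)
qed

text \<open>Scalars sit on the empty word, where they are central; linearity over the field can then
  be stated by ring multiplication alone.\<close>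

definition scal :: "'f \<Rightarrow> ('b, 'f::field) talg" where
  "scal c = fps_const (Poly_Mapping.single [] c)"

definition word :: "(nat \<times> 'b) list \<Rightarrow> ('b, 'f::field) talg" where
  "word w = fps_const (gen w)"

lemma scal_nth [simp]: "(scal c * X) $ n = fscale c (X $ n)"
  by (simp add: scal_def single_Nil_mult)

lemma scal_comm: "X * scal c = scal c * X"
  by (rule fps_ext) (simp add: scal_def mult_single_Nil single_Nil_mult)

lemma scal_left_comm: "X * (scal c * Y) = scal c * (X * Y)"
proof -
  have "X * (scal c * Y) = (X * scal c) * Y" by (simp only: mult.assoc)
  then show ?thesis by (simp only: scal_comm mult.assoc)
qed

lemma scal_scal: "scal a * (scal b * X) = scal (a * b) * X"
  by (rule fps_ext) (simp add: fscale_fscale)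

lemma scal_1 [simp]: "scal 1 = 1" and scal_0 [simp]: "scal 0 = 0"
  by (auto simp: scal_def gten_one[symmetric])

lemma scal_minus_1: "scal (- 1) * X = - X"
  by (rule fps_ext) (simp add: fscale_minus_left)

lemma word_Nil: "word [] = 1" by (simp add: word_def gten_one[symmetric])

lemma word_append: "word (u @ v) = word u * word v"
  by (simp add: word_def gen_mult_gen)

lemma word_Cons: "word (b # w) = word [b] * word w"
  using word_append[of "[b]" w] by simp

section \<open>Linear maps that commute with the formal variable\<close>

lemma fps_X_left_comm: "(X :: 'a::ring_1 fps) * (fps_X * Y) = fps_X * (X * Y)"
proof -
  have "X * (fps_X * Y) = (X * fps_X) * Y" by (simp only: mult.assoc)
  then show ?thesis by (simp only: fps_mult_fps_X_commute[symmetric] mult.assoc)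
qed

text \<open>Commuting with the variable makes a map continuous for the order of power series: a
  multiple of \<open>fps_X ^ n\<close> goes to a multiple of \<open>fps_X ^ n\<close>. Hence such a
  map is determined by its values on words (\<open>tlin_eq\<close>), although one series may involve
  infinitely many words.\<close>

definition tlin :: "(('b, 'f::field) talg \<Rightarrow> ('c, 'f) talg) \<Rightarrow> bool" where
  "tlin \<phi> \<longleftrightarrow> (\<forall>X Y. \<phi> (X + Y) = \<phi> X + \<phi> Y) \<and> (\<forall>c X. \<phi> (scal c * X) = scal c * \<phi> X) \<and>
     (\<forall>X. \<phi> (fps_X * X) = fps_X * \<phi> X)"

lemma tlinD:
  assumes "tlin \<phi>"
  shows tlin_add: "\<phi> (X + Y) = \<phi> X + \<phi> Y" and tlin_scal: "\<phi> (scal c * X) = scal c * \<phi> X"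
    and tlin_X: "\<phi> (fps_X * X) = fps_X * \<phi> X" and tlin_0: "\<phi> 0 = 0"
    and tlin_neg: "\<phi> (- X) = - \<phi> X" and tlin_diff: "\<phi> (X - Y) = \<phi> X - \<phi> Y"
    and tlin_X_power: "\<phi> (fps_X ^ n * X) = fps_X ^ n * \<phi> X"
proof -
  have a: "\<phi> (X + Y) = \<phi> X + \<phi> Y" and s: "\<phi> (scal c * X) = scal c * \<phi> X"
    and x: "\<phi> (fps_X * X) = fps_X * \<phi> X" for X Y c
    using assms by (auto simp: tlin_def)
  show "\<phi> (X + Y) = \<phi> X + \<phi> Y" "\<phi> (scal c * X) = scal c * \<phi> X" "\<phi> (fps_X * X) = fps_X * \<phi> X"
    by (rule a s x)+
  show "\<phi> 0 = 0" using s[of 0 0] by simp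
  have n: "\<phi> (- X) = - \<phi> X" for X using s[of "-1" X] by (simp add: scal_minus_1)
  then show "\<phi> (- X) = - \<phi> X" .
  show "\<phi> (X - Y) = \<phi> X - \<phi> Y" using a[of X "- Y"] n by simp
  show "\<phi> (fps_X ^ n * X) = fps_X ^ n * \<phi> X"
    by (induction n) (simp_all add: x mult.assoc)
qed

lemma tlin_sum: "tlin \<phi> \<Longrightarrow> \<phi> (sum g A) = (\<Sum>x\<in>A. \<phi> (g x))"
  by (induction A rule: infinite_finite_induct) (auto simp: tlin_add tlin_0)

named_theorems tlin_intros

lemma tlin_id [tlin_intros]: "tlin (\<lambda>X. X)" by (simp add: tlin_def)

lemma tlin_zero [tlin_intros]: "tlin (\<lambda>X. 0)" by (simp add: tlin_def)

lemma tlin_plus [tlin_intros]: "tlin \<phi> \<Longrightarrow> tlin \<psi> \<Longrightarrow> tlin (\<lambda>X. \<phi> X + \<psi> X)"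
  by (simp add: tlin_def algebra_simps)

lemma tlin_minus [tlin_intros]: "tlin \<phi> \<Longrightarrow> tlin \<psi> \<Longrightarrow> tlin (\<lambda>X. \<phi> X - \<psi> X)"
  by (simp add: tlin_def algebra_simps)

lemma tlin_uminus [tlin_intros]: "tlin \<phi> \<Longrightarrow> tlin (\<lambda>X. - \<phi> X)"
  by (simp add: tlin_def algebra_simps)

lemma tlin_mult_left [tlin_intros]: "tlin \<phi> \<Longrightarrow> tlin (\<lambda>X. A * \<phi> X)"
  by (simp add: tlin_def algebra_simps scal_left_comm fps_X_left_comm)

lemma tlin_mult_right [tlin_intros]: "tlin \<phi> \<Longrightarrow> tlin (\<lambda>X. \<phi> X * A)"
  by (simp add: tlin_def algebra_simps)

lemma tlin_compose: "tlin \<phi> \<Longrightarrow> tlin \<psi> \<Longrightarrow> tlin (\<lambda>X. \<phi> (\<psi> X))"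
  by (simp add: tlin_def)

lemma fps_split:
  "(X :: 'a::ring_1 fps) = (\<Sum>k\<le>n. fps_X ^ k * fps_const (X $ k)) + fps_X ^ Suc n * fps_shift (Suc n) X"
proof (rule fps_ext)
  fix m
  have "(\<Sum>k\<le>n. fps_X ^ k * fps_const (X $ k)) $ m = (\<Sum>k\<le>n. if m = k then X $ k else 0)"
    unfolding fps_sum_nth by (intro sum.cong refl) (auto simp: fps_X_power_mult_nth)
  also have "\<dots> = (if m \<le> n then X $ m else 0)" by simp
  finally show "X $ m = ((\<Sum>k\<le>n. fps_X ^ k * fps_const (X $ k)) + fps_X ^ Suc n * fps_shift (Suc n) X) $ m"
    unfolding fps_add_nth fps_X_power_mult_nth by (auto simp del: power_Suc)
qed

lemma fps_const_expand:
  "fps_const x = (\<Sum>w\<in>Poly_Mapping.keys x. scal (Poly_Mapping.lookup x w) * word w)"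
proof (rule fps_ext)
  fix n
  show "fps_const x $ n = (\<Sum>w\<in>Poly_Mapping.keys x. scal (Poly_Mapping.lookup x w) * word w) $ n"
    unfolding fps_sum_nth scal_nth by (simp add: word_def expand_gen[symmetric])
qed

text \<open>After splitting off the terms of order at most \<open>n\<close>, the remainder is a
  multiple of \<open>fps_X ^ Suc n\<close> and stays one, so only finitely many words reach
  coefficient \<open>n\<close>.\<close>

lemma tlin_nth:
  assumes "tlin \<phi>"
  shows "\<phi> X $ n = (\<Sum>k\<le>n. lin_ext (\<lambda>w. \<phi> (word w) $ (n - k)) (X $ k))"
proof -
  have c: "\<phi> (fps_const x) $ m = lin_ext (\<lambda>w. \<phi> (word w) $ m) x" for x m
    by (subst fps_const_expand)
      (simp only: tlin_sum[OF assms] tlin_scal[OF assms] fps_sum_nth scal_nth lin_ext_def)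
  have "\<phi> X = (\<Sum>k\<le>n. fps_X ^ k * \<phi> (fps_const (X $ k))) + fps_X ^ Suc n * \<phi> (fps_shift (Suc n) X)"
    by (subst fps_split[of X n]) (simp only: tlin_add[OF assms] tlin_sum[OF assms] tlin_X_power[OF assms])
  then have "\<phi> X $ n = (\<Sum>k\<le>n. \<phi> (fps_const (X $ k)) $ (n - k))"
    by (simp add: fps_sum_nth fps_X_power_mult_nth del: power_Suc)
  then show ?thesis by (simp only: c)
qed

lemma tlin_eq:
  assumes "tlin \<phi>" "tlin \<psi>" "\<And>k w. w \<in> Poly_Mapping.keys (X $ k) \<Longrightarrow> \<phi> (word w) = \<psi> (word w)"
  shows "\<phi> X = \<psi> X"
  by (rule fps_ext) (auto simp: tlin_nth[OF assms(1), of X] tlin_nth[OF assms(2), of X] assms(3)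
      intro!: sum.cong lin_ext_cong)

lemma tlin_ext:
  assumes "tlin \<phi>" "tlin \<psi>" "\<And>w. \<phi> (word w) = \<psi> (word w)"
  shows "\<phi> X = \<psi> X"
  using assms by (rule tlin_eq)

text \<open>By \<open>tlin_nth\<close> this Cauchy product is the only candidate for an extension of
  \<open>g\<close> from words. It always is one (\<open>tlin_text_lin\<close>), so homomorphisms and
  derivations can be defined by recursion on words.\<close>

definition text_lin :: "((nat \<times> 'b) list \<Rightarrow> ('c, 'f) talg) \<Rightarrow> ('b, 'f::field) talg \<Rightarrow> ('c, 'f) talg" where
  "text_lin g X = Abs_fps (\<lambda>n. \<Sum>k\<le>n. lin_ext (\<lambda>w. g w $ (n - k)) (X $ k))"

lemma tlin_text_lin [tlin_intros]: "tlin (text_lin g)"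
  unfolding tlin_def
proof (intro conjI allI)
  fix X Y c
  show "text_lin g (X + Y) = text_lin g X + text_lin g Y"
    by (rule fps_ext) (simp add: text_lin_def lin_ext_add sum.distrib)
  show "text_lin g (scal c * X) = scal c * text_lin g X"
    by (rule fps_ext) (simp add: text_lin_def lin_ext_scale fscale_sum)
  show "text_lin g (fps_X * X) = fps_X * text_lin g X"
  proof (rule fps_ext)
    fix n
    show "text_lin g (fps_X * X) $ n = (fps_X * text_lin g X) $ n"
      by (cases n) (simp_all add: text_lin_def sum.atMost_Suc_shift del: sum.atMost_Suc)
  qed
qed

lemma text_lin_word [simp]: "text_lin g (word w) = g w"
proof (rule fps_ext)
  fix n
  have "text_lin g (word w) $ n = (\<Sum>k\<le>n. if k = 0 then g w $ n else 0)"
    unfolding text_lin_def fps_nth_Abs_fps by (rule sum.cong) (auto simp: word_def)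
  then show "text_lin g (word w) $ n = g w $ n" by simp
qed

subsection \<open>Grading\<close>

text \<open>One notion for all support conditions: closure properties and the fixed point theorem
  are then proved once, for plain supports and for homogeneous elements alike.\<close>

definition fsupp :: "(nat \<Rightarrow> (nat \<times> 'b) list \<Rightarrow> bool) \<Rightarrow> ('b, 'f::field) talg set" where
  "fsupp Q = {X. \<forall>n. \<forall>w\<in>Poly_Mapping.keys (X $ n). Q n w}"

lemma fsupp_iff: "X \<in> fsupp Q \<longleftrightarrow> (\<forall>n. X $ n \<in> free_on {w. Q n w})"
  by (auto simp: fsupp_def free_on_def)

lemma fsupp_0: "0 \<in> fsupp Q"
  and fsupp_add: "X \<in> fsupp Q \<Longrightarrow> Y \<in> fsupp Q \<Longrightarrow> X + Y \<in> fsupp Q"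
  and fsupp_diff: "X \<in> fsupp Q \<Longrightarrow> Y \<in> fsupp Q \<Longrightarrow> X - Y \<in> fsupp Q"
  and fsupp_scal: "X \<in> fsupp Q \<Longrightarrow> scal c * X \<in> fsupp Q"
  by (auto simp: fsupp_iff free_on_add free_on_diff free_on_fscale)

lemma fsupp_uminus: "X \<in> fsupp Q \<Longrightarrow> - X \<in> fsupp Q"
  using fsupp_diff[OF fsupp_0] by fastforce

lemma fsupp_word: "word w \<in> fsupp Q \<longleftrightarrow> Q 0 w"
  by (auto simp: fsupp_def word_def fps_const_def)

lemma tlin_fsupp:
  assumes "tlin \<phi>" "X \<in> fsupp Q" "\<And>n w. Q n w \<Longrightarrow> fps_X ^ n * \<phi> (word w) \<in> fsupp Q'"
  shows "\<phi> X \<in> fsupp Q'"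
  unfolding fsupp_iff
proof
  fix n
  have "lin_ext (\<lambda>w. \<phi> (word w) $ (n - k)) (X $ k) \<in> free_on {w. Q' n w}" if k: "k \<le> n" for k
  proof (rule lin_ext_in)
    fix w assume "w \<in> Poly_Mapping.keys (X $ k)"
    then have "Q k w" using assms(2) by (auto simp: fsupp_def)
    from assms(3)[OF this] have "(fps_X ^ k * \<phi> (word w)) $ n \<in> free_on {w. Q' n w}"
      by (auto simp: fsupp_iff)
    then show "\<phi> (word w) $ (n - k) \<in> free_on {w. Q' n w}"
      using k by (simp add: fps_X_power_mult_nth)
  qed
  then show "\<phi> X $ n \<in> free_on {w. Q' n w}"
    unfolding tlin_nth[OF assms(1), of X] by (intro free_on_sum) auto
qed

text \<open>The degree of a word over the desuspension.\<close>

definition sdeg :: "(nat \<times> 'b) list \<Rightarrow> int" where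
  "sdeg w = wdeg w - int (length w)"

lemma wdeg_simps [simp]: "wdeg [] = 0" "wdeg (b # w) = int (fst b) + wdeg w"
  "wdeg (u @ w) = wdeg u + wdeg w"
  by (auto simp: wdeg_def)

lemma sdeg_simps [simp]: "sdeg [] = 0" "sdeg (b # w) = int (fst b) - 1 + sdeg w"
  "sdeg (u @ w) = sdeg u + sdeg w"
  by (auto simp: sdeg_def)

text \<open>Here the exponent of the variable is the word length minus \<open>l\<close>, so the
  variable carries no information of its own; it only turns the length filtration into the order of
  a series. The degree \<open>e\<close> is taken after desuspension.\<close>

definition homog :: "(nat \<times> 'b) set \<Rightarrow> nat \<Rightarrow> int \<Rightarrow> ('b, 'f::field) talg set" where
  "homog S l e = fsupp (\<lambda>n w. set w \<subseteq> S \<and> length w = l + n \<and> sdeg w = e)"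

definition homs :: "(nat \<times> 'b) set \<Rightarrow> ('b, 'f::field) talg set" where
  "homs S = fsupp (\<lambda>n w. set w \<subseteq> S)"

lemma hom_homs: "X \<in> homog S l e \<Longrightarrow> X \<in> homs S"
  by (auto simp: homog_def homs_def fsupp_def)

lemma hom_0 [simp]: "0 \<in> homog S l e"
  and hom_add: "X \<in> homog S l e \<Longrightarrow> Y \<in> homog S l e \<Longrightarrow> X + Y \<in> homog S l e"
  and hom_diff: "X \<in> homog S l e \<Longrightarrow> Y \<in> homog S l e \<Longrightarrow> X - Y \<in> homog S l e"
  and hom_scal: "X \<in> homog S l e \<Longrightarrow> scal c * X \<in> homog S l e"
  and hom_uminus: "X \<in> homog S l e \<Longrightarrow> - X \<in> homog S l e"
  by (auto simp: homog_def fsupp_0 fsupp_add fsupp_diff fsupp_scal fsupp_uminus)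

lemma homs_0 [simp]: "0 \<in> homs S"
  and homs_add: "X \<in> homs S \<Longrightarrow> Y \<in> homs S \<Longrightarrow> X + Y \<in> homs S"
  and homs_diff: "X \<in> homs S \<Longrightarrow> Y \<in> homs S \<Longrightarrow> X - Y \<in> homs S"
  and homs_scal: "X \<in> homs S \<Longrightarrow> scal c * X \<in> homs S"
  and homs_uminus: "X \<in> homs S \<Longrightarrow> - X \<in> homs S"
  by (auto simp: homs_def fsupp_0 fsupp_add fsupp_diff fsupp_scal fsupp_uminus)

lemma hom_word: "set w \<subseteq> S \<Longrightarrow> length w = l \<Longrightarrow> sdeg w = e \<Longrightarrow> word w \<in> homog S l e"
  by (simp add: homog_def fsupp_word)

lemma homs_word: "set w \<subseteq> S \<Longrightarrow> word w \<in> homs S"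
  by (simp add: homs_def fsupp_word)

lemma hom_X_power: "X \<in> homog S (l + n) e \<Longrightarrow> fps_X ^ n * X \<in> homog S l e"
  unfolding homog_def fsupp_iff
proof
  fix m
  assume *: "\<forall>k. X $ k \<in> free_on {w. set w \<subseteq> S \<and> length w = l + n + k \<and> sdeg w = e}"
  show "(fps_X ^ n * X) $ m \<in> free_on {w. set w \<subseteq> S \<and> length w = l + m \<and> sdeg w = e}"
  proof (cases "m < n")
    case False
    then have "l + n + (m - n) = l + m" by simp
    then show ?thesis using *[rule_format, of "m - n"] False by (simp add: fps_X_power_mult_nth)
  qed (simp add: fps_X_power_mult_nth)
qed

lemma homs_X_power: "X \<in> homs S \<Longrightarrow> fps_X ^ n * X \<in> homs S"
  by (auto simp: homs_def fsupp_iff fps_X_power_mult_nth)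

text \<open>The shift of the length may be negative, so it is passed as a difference
  \<open>c - d\<close> of natural numbers.\<close>

lemma tlin_hom:
  assumes "tlin \<phi>" "X \<in> homog S l e"
    "\<And>w. set w \<subseteq> S \<Longrightarrow> sdeg w = e \<Longrightarrow> l \<le> length w \<Longrightarrow> \<phi> (word w) \<in> homog S' (length w + c - d) (e + m)"
    "d \<le> l + c"
  shows "\<phi> X \<in> homog S' (l + c - d) (e + m)"
  unfolding homog_def
proof (rule tlin_fsupp[OF assms(1) assms(2)[unfolded homog_def]])
  fix n and w :: "(nat \<times> 'a) list"
  assume w: "set w \<subseteq> S \<and> length w = l + n \<and> sdeg w = e"
  then have "\<phi> (word w) \<in> homog S' ((l + c - d) + n) (e + m)"
    using assms(3)[of w] assms(4) by (simp add: algebra_simps)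
  from hom_X_power[OF this]
  show "fps_X ^ n * \<phi> (word w) \<in> fsupp (\<lambda>n w. set w \<subseteq> S' \<and> length w = l + c - d + n \<and> sdeg w = e + m)"
    by (simp add: homog_def)
qed

lemma tlin_hom0:
  assumes "tlin \<phi>" "X \<in> homog S l e"
    "\<And>w. set w \<subseteq> S \<Longrightarrow> sdeg w = e \<Longrightarrow> l \<le> length w \<Longrightarrow> \<phi> (word w) \<in> homog S' (length w) (e + m)"
  shows "\<phi> X \<in> homog S' l (e + m)"
  using tlin_hom[OF assms(1,2), where c=0 and d=0] assms(3) by simp

lemma tlin_homs:
  assumes "tlin \<phi>" "X \<in> homs S" "\<And>w. set w \<subseteq> S \<Longrightarrow> \<phi> (word w) \<in> homs S'"
  shows "\<phi> X \<in> homs S'"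
  unfolding homs_def
  by (rule tlin_fsupp[OF assms(1) assms(2)[unfolded homs_def]])
    (rule homs_X_power[unfolded homs_def], rule assms(3)[unfolded homs_def])

lemma tlin_eq_homs:
  assumes "tlin \<phi>" "tlin \<psi>" "X \<in> homs S" "\<And>w. set w \<subseteq> S \<Longrightarrow> \<phi> (word w) = \<psi> (word w)"
  shows "\<phi> X = \<psi> X"
  by (rule tlin_eq[OF assms(1,2)]) (use assms(3,4) in \<open>auto simp: homs_def fsupp_def\<close>)

lemma hom_mult:
  assumes "X \<in> homog S l e" "Y \<in> homog S l' e'"
  shows "X * Y \<in> homog S (l + l') (e + e')"
proof -
  have ww: "word u * word w \<in> homog S (length u + length w) (sdeg u + sdeg w)"
    if "set u \<subseteq> S" "set w \<subseteq> S" for u w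
    unfolding word_append[symmetric] using that by (intro hom_word) auto
  have wY: "word u * Y \<in> homog S (length u + l') (sdeg u + e')" if u: "set u \<subseteq> S" for u
    using tlin_hom[OF tlin_mult_left[OF tlin_id, of "word u"] assms(2), of S "length u" 0 "sdeg u"] ww[OF u]
    by (auto simp: algebra_simps)
  have "X * Y \<in> homog S (l + l' - 0) (e + e')"
    by (rule tlin_hom[OF tlin_mult_right[OF tlin_id, of Y] assms(1)]) (use wY in \<open>auto simp: algebra_simps\<close>)
  then show ?thesis by simp
qed

lemma homs_mult:
  assumes "X \<in> homs S" "Y \<in> homs S"
  shows "X * Y \<in> homs S"
proof -
  have wY: "word u * Y \<in> homs S" if u: "set u \<subseteq> S" for u
    by (rule tlin_homs[OF tlin_mult_left[OF tlin_id, of "word u"] assms(2)])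
      (use u in \<open>auto simp: word_append[symmetric] intro!: homs_word\<close>)
  show ?thesis
    by (rule tlin_homs[OF tlin_mult_right[OF tlin_id, of Y] assms(1)]) (use wY in auto)
qed

subsection \<open>Signs, algebra maps and derivations\<close>

lemma ksign_add: "ksign (a + b) = ksign a * ksign b"
  and ksign_0 [simp]: "ksign 0 = 1" and ksign_1 [simp]: "ksign 1 = - 1" and ksign_m1 [simp]: "ksign (- 1) = - 1"
  and ksign_minus: "ksign (- a) = ksign a"
  and ksign_sq [simp]: "ksign a * ksign a = 1" 
  by (auto simp: ksign_def)

lemma ksign_diff: "ksign (a - b) = ksign a * ksign b"
  using ksign_add[of a "- b"] by (simp add: ksign_minus)

lemma ksign_cong: "even (a - b) \<Longrightarrow> ksign a = ksign b"
  by (auto simp: ksign_def)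

text \<open>The grading involution. It expresses the Koszul sign in the Leibniz rule of an odd
  derivation for arbitrary elements, homogeneous or not.\<close>

definition smap :: "('b, 'f::field) talg \<Rightarrow> ('b, 'f) talg" where
  "smap = text_lin (\<lambda>w. scal (ksign (sdeg w)) * word w)"

lemma tlin_smap: "tlin smap" unfolding smap_def by (rule tlin_text_lin)

lemma tlin_smap_comp [tlin_intros]: "tlin \<phi> \<Longrightarrow> tlin (\<lambda>X. smap (\<phi> X))"
  by (rule tlin_compose[OF tlin_smap])

lemma smap_word: "smap (word w) = scal (ksign (sdeg w)) * word w"
  by (simp add: smap_def)

lemma smap_hom:
  assumes "X \<in> homog S l e" shows "smap X = scal (ksign e) * X"
  by (rule tlin_eq[OF tlin_smap tlin_mult_left[OF tlin_id]])
    (use assms in \<open>auto simp: homog_def fsupp_def smap_word\<close>)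

lemma scal_mult_scal: "(scal a * X) * (scal b * Y) = scal (a * b) * (X * Y)"
  by (metis mult.assoc scal_comm scal_scal)

lemma smap_mult: "smap (X * Y) = smap X * smap Y"
proof -
  have 1: "smap (X * word w) = smap X * smap (word w)" for w :: "(nat \<times> 'a) list" and X :: "('a, 'b) talg"
    by (rule tlin_ext[of _ _ X]) (intro tlin_intros, intro tlin_intros, simp add: word_append[symmetric] smap_word
        scal_mult_scal ksign_add)
  show ?thesis
    by (rule tlin_ext[of _ _ Y]) (intro tlin_intros, intro tlin_intros, rule 1)
qed

lemma smap_1 [simp]: "smap 1 = 1" using smap_word[of "[]"] by (simp add: word_Nil)

section \<open>Algebra homomorphisms out of a tensor algebra\<close>

definition amap :: "(nat \<times> 'b \<Rightarrow> ('c, 'f::field) talg) \<Rightarrow> ('b, 'f) talg \<Rightarrow> ('c, 'f) talg" where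
  "amap g = text_lin (\<lambda>w. prod_list (map g w))"

lemma tlin_amap: "tlin (amap g)" unfolding amap_def by (rule tlin_text_lin)

lemma tlin_amap_comp [tlin_intros]: "tlin \<phi> \<Longrightarrow> tlin (\<lambda>X. amap g (\<phi> X))"
  by (rule tlin_compose[OF tlin_amap])

lemma amap_word: "amap g (word w) = prod_list (map g w)"
  by (simp add: amap_def)

lemma amap_1 [simp]: "amap g 1 = 1" using amap_word[of g "[]"] by (simp add: word_Nil)

lemma amap_letter [simp]: "amap g (word [b]) = g b" by (simp add: amap_word)

lemma amap_mult: "amap g (X * Y) = amap g X * amap g Y"
proof -
  have 1: "amap g (X * word w) = amap g X * amap g (word w)" for w X
    by (rule tlin_ext[of _ _ X]) (intro tlin_intros, intro tlin_intros, simp add: word_append[symmetric] amap_word)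
  show ?thesis
    by (rule tlin_ext[of _ _ Y]) (intro tlin_intros, intro tlin_intros, rule 1)
qed

lemma amap_word_Cons: "amap g (word (b # w)) = g b * amap g (word w)"
  by (simp add: amap_word)

lemma amap_eq_homs:
  assumes "X \<in> homs S" "\<And>b. b \<in> S \<Longrightarrow> g b = g' b" shows "amap g X = amap g' X"
proof (rule tlin_eq_homs[OF tlin_amap tlin_amap assms(1)])
  fix w assume "set w \<subseteq> S"
  then have "map g w = map g' w" using assms(2) by (auto intro!: map_cong)
  then show "amap g (word w) = amap g' (word w)" by (simp only: amap_word)
qed

lemma amap_comp: "amap g (amap h X) = amap (\<lambda>b. amap g (h b)) X"
proof (rule tlin_ext[of _ _ X])
  fix w show "amap g (amap h (word w)) = amap (\<lambda>b. amap g (h b)) (word w)"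
    by (induction w) (simp_all add: word_Nil amap_word_Cons amap_mult)
qed (intro tlin_intros)+

lemma amap_id: "amap (\<lambda>b. word [b]) X = X"
proof (rule tlin_ext[of _ _ X])
  fix w :: "(nat \<times> 'a) list" show "amap (\<lambda>b. word [b]) (word w) = (word w :: ('a, 'b) talg)"
    by (induction w) (simp_all add: word_Nil amap_word_Cons word_Cons[symmetric])
qed (intro tlin_intros)+

lemma amap_hom:
  assumes X: "X \<in> homog S l e" and g: "\<And>b. b \<in> S \<Longrightarrow> g b \<in> homog S' 1 (sdeg [b])"
  shows "amap g X \<in> homog S' l e"
proof -
  have "amap g (word w) \<in> homog S' (length w) (sdeg w)" if "set w \<subseteq> S" for w
    using that
  proof (induction w)
    case Nil
    then show ?case unfolding word_Nil amap_1 unfolding word_Nil[symmetric] by (auto intro: hom_word)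
  next
    case (Cons b w)
    from hom_mult[OF g[of b] Cons.IH] Cons.prems show ?case
      by (auto simp: amap_word_Cons)
  qed
  then have "amap g X \<in> homog S' l (e + 0)"
    by (intro tlin_hom0[OF tlin_amap X]) auto
  then show ?thesis by simp
qed

lemma amap_homs:
  assumes X: "X \<in> homs S" and g: "\<And>b. b \<in> S \<Longrightarrow> g b \<in> homs S'"
  shows "amap g X \<in> homs S'"
proof -
  have "amap g (word w) \<in> homs S'" if "set w \<subseteq> S" for w
    using that
  proof (induction w)
    case Nil
    then show ?case unfolding word_Nil amap_1 unfolding word_Nil[symmetric] by (auto intro: homs_word)
  next
    case (Cons b w)
    then show ?case
      by (auto simp: amap_word_Cons intro!: homs_mult g)
  qed
  then show ?thesis by (intro tlin_homs[OF tlin_amap X]) auto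
qed

lemma smap_amap:
  assumes g: "\<And>b. b \<in> S \<Longrightarrow> g b \<in> homog S' 1 (sdeg [b])" and X: "X \<in> homs S"
  shows "smap (amap g X) = amap g (smap X)"
proof (rule tlin_eq_homs[OF _ _ X])
  fix w :: "(nat \<times> 'a) list" assume w: "set w \<subseteq> S"
  then have "amap g (word w) \<in> homog S' (length w) (sdeg w)"
    by (intro amap_hom[OF hom_word g]) auto
  from smap_hom[OF this] show "smap (amap g (word w)) = amap g (smap (word w))"
    by (simp add: smap_word tlin_scal[OF tlin_amap])
qed (intro tlin_intros)+

section \<open>Odd derivations of a tensor algebra\<close>

fun der_word :: "(nat \<times> 'b \<Rightarrow> ('b, 'f::field) talg) \<Rightarrow> (nat \<times> 'b) list \<Rightarrow> ('b, 'f) talg" where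
  "der_word d [] = 0"
| "der_word d (b # w) = d b * word w + smap (word [b]) * der_word d w"

definition der :: "(nat \<times> 'b \<Rightarrow> ('b, 'f::field) talg) \<Rightarrow> ('b, 'f) talg \<Rightarrow> ('b, 'f) talg" where
  "der d = text_lin (der_word d)"

lemma tlin_der: "tlin (der d)" unfolding der_def by (rule tlin_text_lin)

lemma tlin_der_comp [tlin_intros]: "tlin \<phi> \<Longrightarrow> tlin (\<lambda>X. der d (\<phi> X))"
  by (rule tlin_compose[OF tlin_der])

lemma der_word_eq [simp]: "der d (word w) = der_word d w" by (simp add: der_def)

lemma der_1 [simp]: "der d 1 = 0" using der_word_eq[of d "[]"] by (simp add: word_Nil)

lemma der_letter: "der d (word [b]) = d b" by (simp add: word_Nil)

lemma der_mult: "der d (X * Y) = der d X * Y + smap X * der d Y"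
proof -
  have 0: "der d (word u * word w) = der d (word u) * word w + smap (word u) * der d (word w)" for u w
  proof (induction u)
    case (Cons b u)
    have "der d (word (b # u) * word w) = d b * (word u * word w) + smap (word [b]) * der d (word u * word w)"
      by (simp add: word_append[symmetric])
    also have "\<dots> = der d (word (b # u)) * word w + smap (word (b # u)) * der d (word w)"
      by (simp only: arg_cong[OF word_Cons[of b u], of smap] Cons.IH der_word_eq der_word.simps smap_mult distrib_left distrib_right mult.assoc add.assoc)
    finally show ?case .
  qed (simp add: word_Nil)
  have 1: "der d (X * word w) = der d X * word w + smap X * der d (word w)" for w X
    by (rule tlin_ext[of _ _ X]) (intro tlin_intros, intro tlin_intros, rule 0)
  show ?thesis
    by (rule tlin_ext[of _ _ Y]) (intro tlin_intros, intro tlin_intros, rule 1)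
qed

lemma der_hom:
  assumes X: "X \<in> homog S l e" and d: "\<And>b. b \<in> S \<Longrightarrow> d b \<in> homog S 1 (sdeg [b] + m)"
  shows "der d X \<in> homog S l (e + m)"
proof (rule tlin_hom0[OF tlin_der X])
  fix w :: "(nat \<times> 'a) list" assume "set w \<subseteq> S" "sdeg w = e"
  then show "der d (word w) \<in> homog S (length w) (e + m)"
  proof (induction w arbitrary: e)
    case (Cons b w)
    have 1: "d b * word w \<in> homog S (1 + length w) (sdeg [b] + m + sdeg w)"
      using Cons.prems by (intro hom_mult d hom_word) auto
    have 2: "word [b] * der_word d w \<in> homog S (1 + length w) (sdeg [b] + (sdeg w + m))"
      using Cons.prems Cons.IH[of "sdeg w"] by (intro hom_mult hom_word) auto
    then have 3: "scal (ksign (sdeg [b])) * word [b] * der_word d w \<in> homog S (1 + length w) (sdeg [b] + (sdeg w + m))"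
      by (simp add: hom_scal mult.assoc)
    show ?case using 1 3 Cons.prems(2) by (auto simp: smap_word algebra_simps intro!: hom_add)
  qed auto
qed

lemma der_homs:
  assumes X: "X \<in> homs S" and d: "\<And>b. b \<in> S \<Longrightarrow> d b \<in> homs S"
  shows "der d X \<in> homs S"
proof (rule tlin_homs[OF tlin_der X])
  fix w :: "(nat \<times> 'a) list" assume "set w \<subseteq> S"
  then show "der d (word w) \<in> homs S"
  proof (induction w)
    case (Cons b w)
    then show ?case by (auto simp: smap_word mult.assoc intro!: homs_add homs_mult homs_scal homs_word d)
  qed auto
qed

lemma smap_der:
  assumes d: "\<And>b. b \<in> S \<Longrightarrow> d b \<in> homog S 1 (sdeg [b] - 1)" and X: "X \<in> homs S"
  shows "smap (der d X) = - der d (smap X)"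
proof (rule tlin_eq_homs[OF _ _ X])
  fix w :: "(nat \<times> 'a) list" assume w: "set w \<subseteq> S"
  then have "der d (word w) \<in> homog S (length w) (sdeg w + - 1)"
    by (intro der_hom[OF hom_word]) (use d in auto)
  from smap_hom[OF this] show "smap (der d (word w)) = - der d (smap (word w))"
    by (simp add: smap_word tlin_scal[OF tlin_der] ksign_diff scal_scal[symmetric] scal_minus_1
       tlin_neg[OF tlin_mult_left[OF tlin_id]] del: der_word_eq)
      (metis mult.commute scal_minus_1 scal_scal mult_minus1_right)
qed (intro tlin_intros)+

lemma smap_smap: "smap (smap X) = X"
  by (rule tlin_ext[of _ _ X])
    (intro tlin_intros, intro tlin_intros, simp add: smap_word tlin_scal[OF tlin_smap] scal_scal)

subsection \<open>Fixed points\<close>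

text \<open>Congruence modulo the \<open>n\<close>-th power of the variable, the measure of
  closeness in all contraction arguments.\<close>

definition agree :: "nat \<Rightarrow> 'a::zero fps \<Rightarrow> 'a fps \<Rightarrow> bool" where
  "agree n X Y \<longleftrightarrow> (\<forall>k<n. X $ k = Y $ k)"

lemma agree_refl [simp]: "agree n X X" and agree_0 [simp]: "agree 0 X Y"
  by (auto simp: agree_def)

lemma agree_sym: "agree n X Y \<Longrightarrow> agree n Y X" by (auto simp: agree_def)

lemma agree_trans: "agree n X Y \<Longrightarrow> agree n Y Z \<Longrightarrow> agree n X Z" by (auto simp: agree_def)

lemma agree_add: "agree n X X' \<Longrightarrow> agree n Y Y' \<Longrightarrow> agree n (X + Y) (X' + Y' :: 'a::ring_1 fps)"
  and agree_diff: "agree n X X' \<Longrightarrow> agree n Y Y' \<Longrightarrow> agree n (X - Y) (X' - Y')"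
  and agree_uminus: "agree n X X' \<Longrightarrow> agree n (- X) (- X')"
  by (auto simp: agree_def)

lemma agree_mult: "agree n X X' \<Longrightarrow> agree n Y Y' \<Longrightarrow> agree n (X * Y) (X' * Y' :: 'a::ring_1 fps)"
  by (auto simp: agree_def fps_mult_nth intro!: sum.cong)

lemma agree_all: "(\<And>n. agree n X Y) \<Longrightarrow> X = Y"
  by (rule fps_ext) (auto simp: agree_def)

lemma agree_tlin: "tlin \<phi> \<Longrightarrow> agree n X Y \<Longrightarrow> agree n (\<phi> X) (\<phi> Y)"
  by (auto simp: agree_def tlin_nth[of \<phi> X] tlin_nth[of \<phi> Y] intro!: sum.cong)

text \<open>A map without constant terms on words raises the order by one. This is the source of
  contraction when the unknown enters linearly.\<close>

lemma agree_tlin_raise: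
  assumes "tlin \<phi>" "agree n X Y" "X \<in> homs S" "Y \<in> homs S" "\<And>w. set w \<subseteq> S \<Longrightarrow> \<phi> (word w) $ 0 = 0"
  shows "agree (Suc n) (\<phi> X) (\<phi> Y)"
  unfolding agree_def
proof (intro allI impI)
  fix k assume k: "k < Suc n"
  have "lin_ext (\<lambda>w. \<phi> (word w) $ (k - i)) (X $ i) = lin_ext (\<lambda>w. \<phi> (word w) $ (k - i)) (Y $ i)"
    if i: "i \<le> k" for i
  proof (cases "i = n")
    case True
    then have "k - i = 0" using k by auto
    moreover have "set w \<subseteq> S" if "w \<in> Poly_Mapping.keys (X $ i) \<union> Poly_Mapping.keys (Y $ i)" for w
      using assms(3,4) that unfolding homs_def fsupp_def by blast
    ultimately show ?thesis by (simp add: lin_ext_def assms(5))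
  next
    case False
    then have "X $ i = Y $ i" using assms(2) i k by (auto simp: agree_def)
    then show ?thesis by simp
  qed
  then show "\<phi> X $ k = \<phi> Y $ k" by (auto simp: tlin_nth[OF assms(1), of X] tlin_nth[OF assms(1), of Y] intro!: sum.cong)
qed

lemma agree_amap:
  assumes "X \<in> homs S" "\<And>b. b \<in> S \<Longrightarrow> agree n (g b) (g' b)" shows "agree n (amap g X) (amap g' X)"
proof -
  have "agree n (amap g (word w)) (amap g' (word w))" if "set w \<subseteq> S" for w
    using that by (induction w) (auto simp: word_Nil amap_word_Cons assms(2) intro!: agree_mult)
  then have *: "set w \<subseteq> S \<Longrightarrow> k < n \<Longrightarrow> amap g (word w) $ k = amap g' (word w) $ k" for w k by (auto simp: agree_def)
  have s: "w \<in> Poly_Mapping.keys (X $ k) \<Longrightarrow> set w \<subseteq> S" for w k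
    using assms(1) by (auto simp: homs_def fsupp_def)
  show ?thesis
    by (auto simp: agree_def tlin_nth[OF tlin_amap, of _ X] intro!: sum.cong lin_ext_cong * dest: s)
qed

text \<open>An argument without constant term is \<open>fps_X\<close> times another series, and the
  factor pulled out gains one order. This is the source of contraction when the unknown is the
  homomorphism itself.\<close>

lemma agree_Suc_amap:
  assumes "X \<in> homs S" "X $ 0 = 0" "\<And>b. b \<in> S \<Longrightarrow> agree n (g b) (g' b)"
  shows "agree (Suc n) (amap g X) (amap g' X)"
proof -
  have X: "X = fps_X * fps_shift 1 X" 
    by (rule fps_ext) (use assms(2) in \<open>auto simp: fps_X_mult_nth\<close>)
  have "fps_shift 1 X \<in> homs S" using assms(1) by (auto simp: homs_def fsupp_def)
  from agree_amap[of _ S n g g', OF this] assms(3)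
  have "agree n (amap g (fps_shift 1 X)) (amap g' (fps_shift 1 X))" by auto
  then have "agree (Suc n) (fps_X * amap g (fps_shift 1 X)) (fps_X * amap g' (fps_shift 1 X))"
    by (auto simp: agree_def fps_X_mult_nth)
  then show ?thesis by (subst (1 2) X) (simp only: tlin_X[OF tlin_amap])
qed

text \<open>Banach's fixed point theorem for the order of power series. The index runs over
  generators, so that a whole homomorphism can be the unknown, and contraction is asked only within
  the supports \<open>Q\<close>, where the recursions make sense.\<close>

lemma fps_fixed_point:
  fixes G :: "('i \<Rightarrow> ('b, 'f::field) talg) \<Rightarrow> 'i \<Rightarrow> ('b, 'f) talg"
  assumes contr: "\<And>n g g'. \<forall>i. g i \<in> fsupp (Q i) \<Longrightarrow> \<forall>i. g' i \<in> fsupp (Q i) \<Longrightarrow> \<forall>i. agree n (g i) (g' i) \<Longrightarrow> \<forall>i. agree (Suc n) (G g i) (G g' i)"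
    and closed: "\<And>g. \<forall>i. g i \<in> fsupp (Q i) \<Longrightarrow> \<forall>i. G g i \<in> fsupp (Q i)"
  shows "\<exists>g. (\<forall>i. G g i = g i) \<and> (\<forall>i. g i \<in> fsupp (Q i))"
proof -
  define it where "it = (\<lambda>n. (G ^^ n) (\<lambda>i. 0))"
  have itS: "it (Suc n) = G (it n)" for n by (simp add: it_def)
  have mem: "\<forall>i. it n i \<in> fsupp (Q i)" for n
    by (induction n) (auto simp: itS closed, simp add: it_def fsupp_0)
  have step: "\<forall>i. agree n (it n i) (it (Suc n) i)" for n
    by (induction n) (simp, simp only: itS, rule contr, auto simp: mem itS[symmetric])
  have far: "\<forall>i. agree n (it n i) (it (n + m) i)" for n m
  proof (induction m)
    case (Suc m)
    have "agree n (it (n + m) i) (it (n + Suc m) i)" for i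
      using step[of "n + m"] by (auto simp: agree_def)
    with Suc show ?case by (metis agree_trans)
  qed simp
  \<comment> \<open>Iterate \<open>Suc n\<close> already has its final coefficient \<open>n\<close>,
    so the diagonal of the iterates is their limit.\<close>
  define g where "g = (\<lambda>i. Abs_fps (\<lambda>n. it (Suc n) i $ n))"
  have ag: "agree n (it n i) (g i)" for n i
    unfolding agree_def
  proof (intro allI impI)
    fix k assume "k < n"
    then have "agree (Suc k) (it (Suc k) i) (it n i)" using far[of "Suc k" "n - Suc k"] by simp
    then show "it n i $ k = g i $ k" by (simp add: agree_def g_def)
  qed
  have gQ: "\<forall>i. g i \<in> fsupp (Q i)"
  proof (auto simp: fsupp_def g_def)
    fix i n w assume "w \<in> Poly_Mapping.keys (it (Suc n) i $ n)"
    then show "Q i n w" using mem[of "Suc n"] by (auto simp: fsupp_def)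
  qed
  have "agree n (G g i) (g i)" for n i
  proof -
    have "\<forall>i. agree (Suc n) (G (it n) i) (G g i)" by (rule contr[OF mem gQ]) (use ag in auto)
    then have "agree (Suc n) (it (Suc n) i) (G g i)" by (simp add: itS)
    with ag[of "Suc n" i] have "agree (Suc n) (G g i) (g i)" by (meson agree_sym agree_trans)
    then show ?thesis by (auto simp: agree_def)
  qed
  then have "\<forall>i. G g i = g i" by (auto intro: agree_all)
  with gQ show ?thesis by blast
qed

subsection \<open>Linear parts\<close>

lemma letter_gen [simp]: "letter (gen b) = gen [b]" by (simp add: letter_def)

lemma unletter_gen [simp]: "unletter (gen [b]) = gen b" by (simp add: unletter_def)

lemma flinear_letter: "flinear letter" and flinear_unletter: "flinear unletter"
  by (auto simp: letter_def unletter_def flinear_lin_ext)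

lemma flinear_compose: "flinear f \<Longrightarrow> flinear g \<Longrightarrow> flinear (\<lambda>x. f (g x))"
  by unfold_locales (auto simp: flinearD[of f] flinearD[of g])

lemma flinear_id: "flinear (\<lambda>x. x)" by unfold_locales auto

lemma flinear_diff: "flinear f \<Longrightarrow> flinear g \<Longrightarrow> flinear (\<lambda>x. f x - g x)"
  by unfold_locales (auto simp: flinearD[of f] flinearD[of g] fscale_diff_right)

lemma flinear_plus: "flinear f \<Longrightarrow> flinear g \<Longrightarrow> flinear (\<lambda>x. f x + g x)"
  by unfold_locales (auto simp: flinearD[of f] flinearD[of g] fscale_add_right)

lemma flinear_zero: "flinear (\<lambda>x. 0)"
  by unfold_locales auto

lemma unletter_letter [simp]: "unletter (letter v) = v"
  by (rule flinear_eq_on[OF flinear_compose[OF flinear_unletter flinear_letter] flinear_id]) simp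

lemma letter_unletter:
  assumes "x \<in> free_on {w. length w = 1}" shows "letter (unletter x) = x"
proof (rule flinear_eq_on[OF flinear_compose[OF flinear_letter flinear_unletter] flinear_id])
  fix w assume "w \<in> Poly_Mapping.keys x"
  then have "length w = 1" using assms by (auto simp: free_on_def)
  then obtain b where "w = [b]" by (auto simp: length_Suc_conv)
  then show "letter (unletter (gen w)) = gen w" by simp
qed

lemma flinear_free_on:
  assumes "flinear g" "\<And>b. b \<in> S \<Longrightarrow> g (gen b) \<in> free_on S'" "v \<in> free_on S"
  shows "g v \<in> free_on S'"
  unfolding flinear_eq_lin_ext[OF assms(1), of v]
  by (rule lin_ext_in) (use assms in \<open>auto simp: free_on_def\<close>)

lemma flinear_eq_free_on:
  assumes "flinear f" "flinear g" "\<And>b. b \<in> S \<Longrightarrow> f (gen b) = g (gen b)" "v \<in> free_on S"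
  shows "f v = g v"
  by (rule flinear_eq_on[OF assms(1,2)]) (use assms(3,4) in \<open>auto simp: free_on_def\<close>)

lemma gcomp_free_on: "v \<in> gcomp S p \<Longrightarrow> v \<in> free_on S"
  by (auto simp: gcomp_def free_on_def)

lemma gcomp_gen [simp]: "gen b \<in> gcomp S p \<longleftrightarrow> b \<in> S \<and> fst b = p"
  by (auto simp: gcomp_def)

lemma gcomp_0 [simp]: "0 \<in> gcomp S p"
  and gcomp_add: "v \<in> gcomp S p \<Longrightarrow> w \<in> gcomp S p \<Longrightarrow> v + w \<in> gcomp S p"
  and gcomp_diff: "v \<in> gcomp S p \<Longrightarrow> w \<in> gcomp S p \<Longrightarrow> v - w \<in> gcomp S p"
  and gcomp_fscale: "v \<in> gcomp S p \<Longrightarrow> fscale c v \<in> gcomp S p"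
  by (auto simp: gcomp_def free_on_add free_on_diff free_on_fscale)

lemma flinear_gcomp:
  assumes "flinear g" "\<And>b. b \<in> S \<Longrightarrow> fst b = p \<Longrightarrow> g (gen b) \<in> gcomp S' q" "v \<in> gcomp S p"
  shows "g v \<in> gcomp S' q"
  using flinear_free_on[OF assms(1), of "{b \<in> S. fst b = p}" "{b \<in> S'. fst b = q}" v] assms(2,3)
  by (auto simp: gcomp_def)

section \<open>Vectors as elements of length one, and linear parts\<close>

definition emb :: "('b, 'f::field) gvec \<Rightarrow> ('b, 'f) talg" where
  "emb v = fps_const (letter v)"

lemma emb_gen [simp]: "emb (gen b) = word [b]" by (simp add: emb_def word_def)

lemma emb_0 [simp]: "emb 0 = 0" by (simp add: emb_def flinearD[OF flinear_letter])

lemma emb_add: "emb (v + w) = emb v + emb w"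
  and emb_fscale: "emb (fscale c v) = scal c * emb v"
  and emb_diff: "emb (v - w) = emb v - emb w"
  and emb_uminus: "emb (- v) = - emb v"
  by (auto simp: emb_def flinearD[OF flinear_letter] scal_def single_Nil_mult intro!: fps_ext)

lemma emb_lin_ext:
  "emb (lin_ext g v) = (\<Sum>b\<in>Poly_Mapping.keys v. scal (Poly_Mapping.lookup v b) * emb (g b))"
proof -
  have "emb (\<Sum>b\<in>A. fscale (l b) (g b)) = (\<Sum>b\<in>A. scal (l b) * emb (g b))" if "finite A" for A l
    using that by induction (auto simp: emb_add emb_fscale)
  then show ?thesis by (simp add: lin_ext_def)
qed

lemma tlin_emb:
  assumes "tlin \<phi>" "flinear L" "\<And>b. b \<in> Poly_Mapping.keys v \<Longrightarrow> \<phi> (word [b]) = emb (L (gen b))"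
  shows "\<phi> (emb v) = emb (L v)"
proof -
  have "\<phi> (emb v) = \<phi> (emb (lin_ext (\<lambda>b. gen b) v))" by (simp add: lin_ext_gen_id)
  also have "\<dots> = (\<Sum>b\<in>Poly_Mapping.keys v. scal (Poly_Mapping.lookup v b) * \<phi> (word [b]))"
    by (simp add: emb_lin_ext tlin_sum[OF assms(1)] tlin_scal[OF assms(1)])
  also have "\<dots> = (\<Sum>b\<in>Poly_Mapping.keys v. scal (Poly_Mapping.lookup v b) * emb (L (gen b)))"
    by (simp add: assms(3))
  also have "\<dots> = emb (lin_ext (\<lambda>b. L (gen b)) v)" by (simp only: emb_lin_ext)
  also have "\<dots> = emb (L v)" by (simp only: flinear_eq_lin_ext[OF assms(2), of v])
  finally show ?thesis .
qed

lemma homog_sum: "(\<And>x. x \<in> A \<Longrightarrow> g x \<in> homog S l e) \<Longrightarrow> sum g A \<in> homog S l e"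
  by (induction A rule: infinite_finite_induct) (auto intro: hom_add)

lemma emb_homog:
  assumes "v \<in> gcomp S p" "e = int p - 1" shows "emb v \<in> homog S 1 e"
proof -
  have "emb (lin_ext (\<lambda>b. gen b) v) \<in> homog S 1 e"
    unfolding emb_lin_ext
    by (intro homog_sum hom_scal) (use assms in \<open>auto simp: gcomp_def free_on_def intro!: hom_word\<close>)
  then show ?thesis by (simp add: lin_ext_gen_id)
qed

text \<open>The component of arity one: the differential when \<open>g\<close> is a structure, the
  underlying chain map when \<open>g\<close> is a morphism.\<close>

definition lpart :: "(nat \<times> 'b \<Rightarrow> ('c, 'f::field) talg) \<Rightarrow> ('b, 'f) gvec \<Rightarrow> ('c, 'f) gvec" where
  "lpart g = lin_ext (\<lambda>b. unletter (g b $ 0))"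

lemma flinear_lpart: "flinear (lpart g)" by (simp add: lpart_def flinear_lin_ext)

lemma lpart_gen [simp]: "lpart g (gen b) = unletter (g b $ 0)" by (simp add: lpart_def)

lemma homog_nth0:
  assumes "X \<in> homog S 1 e"
  shows "X $ 0 \<in> free_on {[b] | b. b \<in> S \<and> int (fst b) = e + 1}"
proof -
  have "w \<in> {[b] | b. b \<in> S \<and> int (fst b) = e + 1}" if "w \<in> Poly_Mapping.keys (X $ 0)" for w
  proof -
    have w: "set w \<subseteq> S" "length w = 1" "sdeg w = e" using assms that by (auto simp: homog_def fsupp_def)
    then obtain b where "w = [b]" by (auto simp: length_Suc_conv)
    with w show ?thesis by (intro CollectI exI[of _ b]) auto
  qed
  then show ?thesis by (auto simp: free_on_def)
qed

lemma unletter_nth0: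
  assumes "X \<in> homog S 1 e"
  shows "letter (unletter (X $ 0)) = X $ 0" "unletter (X $ 0) \<in> free_on {b \<in> S. int (fst b) = e + 1}"
proof -
  note X = homog_nth0[OF assms]
  have "X $ 0 \<in> free_on {w. length w = 1}" using X by (auto simp: free_on_def)
  then show "letter (unletter (X $ 0)) = X $ 0" by (rule letter_unletter)
  show "unletter (X $ 0) \<in> free_on {b \<in> S. int (fst b) = e + 1}"
    by (rule flinear_free_on[OF flinear_unletter _ X]) auto
qed

lemma unletter_gcomp:
  assumes "X \<in> homog S 1 e" "e = int p - 1" shows "unletter (X $ 0) \<in> gcomp S p"
  using unletter_nth0(2)[OF assms(1)] assms(2) by (simp add: gcomp_def)

lemma lpart_gcomp:
  assumes "\<And>b. b \<in> S \<Longrightarrow> g b \<in> homog S' 1 (sdeg [b])" "v \<in> gcomp S p"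
  shows "lpart g v \<in> gcomp S' p"
  by (rule flinear_gcomp[OF flinear_lpart _ assms(2)]) (use unletter_gcomp[OF assms(1)] in auto)

lemma lpart_free_on:
  assumes "\<And>b. b \<in> S \<Longrightarrow> g b \<in> homog S' 1 (sdeg [b] + m)" "v \<in> free_on S"
  shows "lpart g v \<in> free_on S'"
  by (rule flinear_free_on[OF flinear_lpart _ assms(2)])
    (use unletter_nth0(2)[OF assms(1)] in \<open>auto simp: free_on_def\<close>)

text \<open>The constant coefficient of an element of \<open>homog S 1 e\<close> has words of length
  one only, and higher coefficients cannot reach order 0. So on linear parts every
  \<open>tlin\<close> map reduces to a linear map of vectors.\<close>

lemma tlin_nth0:
  assumes "tlin \<phi>" "X \<in> homog S 1 e" "\<And>b. b \<in> S \<Longrightarrow> \<phi> (word [b]) $ 0 = letter (L (gen b))" "flinear L"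
  shows "\<phi> X $ 0 = letter (L (unletter (X $ 0)))"
proof -
  have "\<phi> X $ 0 = lin_ext (\<lambda>w. \<phi> (word w) $ 0) (X $ 0)" by (simp add: tlin_nth[OF assms(1), of X])
  also have "\<dots> = letter (L (unletter (X $ 0)))"
    by (rule flinear_eq_free_on[OF flinear_lin_ext flinear_compose[OF flinear_letter flinear_compose[OF assms(4) flinear_unletter]]
          _ homog_nth0[OF assms(2)]])
      (use assms(3) in auto)
  finally show ?thesis .
qed

subsection \<open>Structures and morphisms without signs\<close>

text \<open>The square of an odd derivation is again a derivation, so the condition on generators
  gives it everywhere (\<open>ainf_der_der\<close>).\<close>

definition ainf :: "(nat \<times> 'b) set \<Rightarrow> (nat \<times> 'b \<Rightarrow> ('b, 'f::field) talg) \<Rightarrow> bool" where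
  "ainf S d \<longleftrightarrow> (\<forall>b\<in>S. d b \<in> homog S 1 (sdeg [b] - 1) \<and> der d (d b) = 0)"

definition mor :: "(nat \<times> 'b) set \<Rightarrow> (nat \<times> 'b \<Rightarrow> ('b, 'f::field) talg) \<Rightarrow>
    (nat \<times> 'c) set \<Rightarrow> (nat \<times> 'c \<Rightarrow> ('c, 'f) talg) \<Rightarrow> (nat \<times> 'b \<Rightarrow> ('c, 'f) talg) \<Rightarrow> bool" where
  "mor S d S' d' F \<longleftrightarrow> (\<forall>b\<in>S. F b \<in> homog S' 1 (sdeg [b]) \<and> der d' (F b) = amap F (d b))"

lemma ainf_homog: "ainf S d \<Longrightarrow> b \<in> S \<Longrightarrow> d b \<in> homog S 1 (sdeg [b] - 1)"
  and ainf_homs: "ainf S d \<Longrightarrow> b \<in> S \<Longrightarrow> d b \<in> homs S"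
  by (auto simp: ainf_def intro: hom_homs)

lemma mor_homog: "mor S d S' d' F \<Longrightarrow> b \<in> S \<Longrightarrow> F b \<in> homog S' 1 (sdeg [b])"
  and mor_homs: "mor S d S' d' F \<Longrightarrow> b \<in> S \<Longrightarrow> F b \<in> homs S'"
  by (auto simp: mor_def intro: hom_homs)

lemma der_der_general:
  assumes d: "\<And>b. b \<in> S \<Longrightarrow> d b \<in> homog S 1 (sdeg [b] - 1)" and z: "\<And>b. b \<in> S \<Longrightarrow> der d (d b) = 0"
    and X: "X \<in> homs S"
  shows "der d (der d X) = 0"
proof (rule tlin_eq_homs[OF _ tlin_zero X])
  fix w assume "set w \<subseteq> S"
  then show "der d (der d (word w)) = 0"
  proof (induction w)
    case (Cons b w)
    \<comment> \<open>The derivation is odd, so the two mixed terms of its square on a product have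
      opposite signs.\<close>
    have s: "smap (d b) = - der d (smap (word [b]))"
      using smap_der[OF d homs_word[where w = "[b]" and S = S]] Cons.prems by (simp add: der_letter del: der_word_eq)
    show ?case using Cons z[of b]
      by (simp add: tlin_add[OF tlin_der] der_mult s smap_smap)
  qed (simp add: tlin_0[OF tlin_der])
qed (intro tlin_intros)

lemma ainf_der_der: "ainf S d \<Longrightarrow> X \<in> homs S \<Longrightarrow> der d (der d X) = 0"
  by (rule der_der_general[of S]) (auto simp: ainf_def)

text \<open>Both sides obey the same Leibniz rule along \<open>amap F\<close>, because
  \<open>F\<close> preserves degrees and so commutes with \<open>smap\<close>; agreement on
  generators therefore spreads to all words.\<close>

lemma der_amap_eq:
  assumes hom: "\<And>b. b \<in> S \<Longrightarrow> F b \<in> homog S' 1 (sdeg [b])" "\<And>b. b \<in> S \<Longrightarrow> d b \<in> homs S"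
    and eq: "\<And>b. b \<in> S \<Longrightarrow> der d' (F b) = amap F (d b)" and X: "X \<in> homs S"
  shows "der d' (amap F X) = amap F (der d X)"
proof (rule tlin_eq_homs[OF _ _ X])
  fix w assume "set w \<subseteq> S"
  then show "der d' (amap F (word w)) = amap F (der d (word w))"
  proof (induction w)
    case (Cons b w)
    have "smap (F b) = amap F (smap (word [b]))"
      using smap_amap[OF hom(1) homs_word[where w = "[b]" and S = S]] Cons.prems by simp
    then show ?case using Cons eq[of b]
      by (simp add: amap_word_Cons der_mult amap_mult tlin_add[OF tlin_amap])
  qed (simp add: amap_word tlin_0[OF tlin_amap])
qed (intro tlin_intros)+

lemma mor_der:
  assumes "ainf S d" "mor S d S' d' F" "X \<in> homs S"
  shows "der d' (amap F X) = amap F (der d X)"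
  by (rule der_amap_eq[of S F S']) (use assms in \<open>auto simp: mor_def ainf_homs\<close>)

lemma mor_comp:
  assumes "ainf S d" "ainf S' d'" "mor S d S' d' F" "mor S' d' S'' d'' G"
  shows "mor S d S'' d'' (\<lambda>b. amap G (F b))"
  unfolding mor_def
proof (intro ballI conjI)
  fix b assume b: "b \<in> S"
  show "amap G (F b) \<in> homog S'' 1 (sdeg [b])"
    by (rule amap_hom[OF mor_homog[OF assms(3) b] mor_homog[OF assms(4)]])
  have "der d'' (amap G (F b)) = amap G (der d' (F b))"
    by (rule mor_der[OF assms(2,4) mor_homs[OF assms(3) b]])
  also have "\<dots> = amap (\<lambda>b. amap G (F b)) (d b)" using assms(3) b by (simp add: mor_def amap_comp)
  finally show "der d'' (amap G (F b)) = amap (\<lambda>b. amap G (F b)) (d b)" .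
qed

lemma lpart_comp:
  assumes "\<And>b. b \<in> S \<Longrightarrow> F b \<in> homog S' 1 (sdeg [b])" "\<And>b. b \<in> S' \<Longrightarrow> G b \<in> homog S'' 1 (sdeg [b])" "v \<in> free_on S"
  shows "lpart (\<lambda>b. amap G (F b)) v = lpart G (lpart F v)"
proof (rule flinear_eq_free_on[OF flinear_lpart flinear_compose[OF flinear_lpart flinear_lpart] _ assms(3)])
  fix b assume b: "b \<in> S"
  have "amap G (F b) $ 0 = letter (lpart G (unletter (F b $ 0)))"
    by (rule tlin_nth0[OF tlin_amap assms(1)[OF b] _ flinear_lpart]) (auto simp: unletter_nth0[OF assms(2)])
  then show "lpart (\<lambda>b. amap G (F b)) (gen b) = lpart G (lpart F (gen b))" by simp
qed

section \<open>Chain complexes and isomorphisms in homology\<close>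

definition chain_complex :: "(nat \<times> 'b) set \<Rightarrow> (('b, 'f::field) gvec \<Rightarrow> ('b, 'f) gvec) \<Rightarrow> bool" where
  "chain_complex S \<delta> \<longleftrightarrow> flinear \<delta> \<and> (\<forall>v\<in>gcomp S 0. \<delta> v = 0) \<and>
     (\<forall>p. \<forall>v\<in>gcomp S (Suc p). \<delta> v \<in> gcomp S p) \<and> (\<forall>v\<in>free_on S. \<delta> (\<delta> v) = 0)"

definition chain_morphism :: "(nat \<times> 'b) set \<Rightarrow> (('b, 'f::field) gvec \<Rightarrow> ('b, 'f) gvec) \<Rightarrow>
    (nat \<times> 'c) set \<Rightarrow> (('c, 'f) gvec \<Rightarrow> ('c, 'f) gvec) \<Rightarrow> (('b, 'f) gvec \<Rightarrow> ('c, 'f) gvec) \<Rightarrow> bool" where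
  "chain_morphism S \<delta> S' \<delta>' g \<longleftrightarrow> flinear g \<and> (\<forall>p. \<forall>v\<in>gcomp S p. g v \<in> gcomp S' p) \<and>
     (\<forall>v\<in>free_on S. \<delta>' (g v) = g (\<delta> v))"

lemma ainf_complex:
  assumes "ainf S d" shows "chain_complex S (lpart d)"
  unfolding chain_complex_def
proof (intro conjI ballI allI)
  show "flinear (lpart d)" by (rule flinear_lpart)
  show "lpart d v = 0" if "v \<in> gcomp S 0" for v
  proof (rule flinear_eq_free_on[OF flinear_lpart flinear_zero _ that[unfolded gcomp_def]])
    fix b assume b: "b \<in> {b \<in> S. fst b = 0}"
    then have "unletter (d b $ 0) \<in> free_on {c \<in> S. int (fst c) = sdeg [b] - 1 + 1}"
      using unletter_nth0(2)[OF ainf_homog[OF assms, of b]] by simp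
    then have "Poly_Mapping.keys (unletter (d b $ 0)) = {}" using b unfolding free_on_def by fastforce
    then show "lpart d (gen b) = 0" by simp
  qed
  show "lpart d v \<in> gcomp S p" if "v \<in> gcomp S (Suc p)" for p v
    by (rule flinear_gcomp[OF flinear_lpart _ that]) (use unletter_gcomp[OF ainf_homog[OF assms]] in auto)
  show "lpart d (lpart d v) = 0" if "v \<in> free_on S" for v
  proof (rule flinear_eq_free_on[OF flinear_compose[OF flinear_lpart flinear_lpart] flinear_zero _ that])
    fix b assume b: "b \<in> S"
    have "der d (d b) $ 0 = letter (lpart d (unletter (d b $ 0)))"
      by (rule tlin_nth0[OF tlin_der ainf_homog[OF assms b] _ flinear_lpart])
        (auto simp: unletter_nth0[OF ainf_homog[OF assms]] word_Nil)
    moreover have "der d (d b) = 0" using assms b by (simp add: ainf_def)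
    ultimately have "letter (lpart d (unletter (d b $ 0))) = 0" by simp
    then have "unletter (letter (lpart d (unletter (d b $ 0)))) = 0" by (simp add: flinearD[OF flinear_unletter] del: unletter_letter)
    then show "lpart d (lpart d (gen b)) = 0" by simp
  qed
qed

lemma mor_chain:
  assumes "ainf S d" "ainf S' d'" "mor S d S' d' F"
  shows "chain_morphism S (lpart d) S' (lpart d') (lpart F)"
  unfolding chain_morphism_def
proof (intro conjI ballI allI)
  show "flinear (lpart F)" by (rule flinear_lpart)
  show "lpart F v \<in> gcomp S' p" if "v \<in> gcomp S p" for p v
    using lpart_gcomp[OF mor_homog[OF assms(3)] that] .
  show "lpart d' (lpart F v) = lpart F (lpart d v)" if "v \<in> free_on S" for v
  proof (rule flinear_eq_free_on[OF flinear_compose[OF flinear_lpart flinear_lpart] flinear_compose[OF flinear_lpart flinear_lpart] _ that])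
    fix b assume b: "b \<in> S"
    have "der d' (F b) $ 0 = letter (lpart d' (unletter (F b $ 0)))"
      by (rule tlin_nth0[OF tlin_der mor_homog[OF assms(3) b] _ flinear_lpart])
        (auto simp: unletter_nth0[OF ainf_homog[OF assms(2)]] word_Nil)
    moreover have "amap F (d b) $ 0 = letter (lpart F (unletter (d b $ 0)))"
      by (rule tlin_nth0[OF tlin_amap ainf_homog[OF assms(1) b] _ flinear_lpart])
        (auto simp: unletter_nth0[OF mor_homog[OF assms(3)]])
    moreover have "der d' (F b) = amap F (d b)" using assms(3) b by (simp add: mor_def)
    ultimately have "unletter (letter (lpart d' (unletter (F b $ 0)))) = unletter (letter (lpart F (unletter (d b $ 0))))" by simp
    then show "lpart d' (lpart F (gen b)) = lpart F (lpart d (gen b))" by simp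
  qed
qed

lemma cycles_chain:
  assumes "chain_morphism S \<delta> S' \<delta>' g" "z \<in> cycles S \<delta> p" shows "g z \<in> cycles S' \<delta>' p"
  using assms by (auto simp: chain_morphism_def cycles_def gcomp_free_on flinearD(4))

lemma boundaries_chain:
  assumes "chain_morphism S \<delta> S' \<delta>' g" "z \<in> boundaries S \<delta> p" shows "g z \<in> boundaries S' \<delta>' p"
proof -
  from assms(2) obtain y where y: "y \<in> gcomp S (Suc p)" "z = \<delta> y" by (auto simp: boundaries_def)
  then have "g z = \<delta>' (g y)" "g y \<in> gcomp S' (Suc p)"
    using assms(1) gcomp_free_on[OF y(1)] by (auto simp: chain_morphism_def)
  then show ?thesis by (auto simp: boundaries_def)
qed

lemma boundaries_add:
  assumes "flinear \<delta>" "x \<in> boundaries S \<delta> p" "y \<in> boundaries S \<delta> p" shows "x + y \<in> boundaries S \<delta> p"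
  using assms(2,3) unfolding boundaries_def
  by (auto simp: flinearD(1)[OF assms(1), symmetric] intro!: imageI gcomp_add)

lemma homology_iso_comp:
  assumes c: "chain_morphism S \<delta> S' \<delta>' g" "chain_morphism S' \<delta>' S'' \<delta>'' h" and l: "flinear \<delta>''"
    and i: "induces_homology_iso S \<delta> S' \<delta>' g" "induces_homology_iso S' \<delta>' S'' \<delta>'' h"
    and k: "\<And>v. v \<in> free_on S \<Longrightarrow> k v = h (g v)"
  shows "induces_homology_iso S \<delta> S'' \<delta>'' k"
  unfolding induces_homology_iso_def
proof (intro allI conjI ballI impI)
  fix p z assume z: "z \<in> cycles S \<delta> p" and b: "k z \<in> boundaries S'' \<delta>'' p"
  have "z \<in> free_on S" using z by (auto simp: cycles_def gcomp_free_on)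
  then show "z \<in> boundaries S \<delta> p"
    using i z b k cycles_chain[OF c(1) z] by (auto simp: induces_homology_iso_def)
next
  fix p z assume z: "z \<in> cycles S'' \<delta>'' p"
  then obtain y where y: "y \<in> cycles S' \<delta>' p" "z - h y \<in> boundaries S'' \<delta>'' p"
    using i(2) unfolding induces_homology_iso_def by blast
  then obtain x where x: "x \<in> cycles S \<delta> p" "y - g x \<in> boundaries S' \<delta>' p"
    using i(1) unfolding induces_homology_iso_def by blast
  have "x \<in> free_on S" using x by (auto simp: cycles_def gcomp_free_on)
  then have e: "z - k x = (z - h y) + h (y - g x)"
    using c(2) by (simp add: k chain_morphism_def flinearD(3))
  have "z - k x \<in> boundaries S'' \<delta>'' p"
    unfolding e by (rule boundaries_add[OF l y(2) boundaries_chain[OF c(2) x(2)]])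
  then show "\<exists>z'\<in>cycles S \<delta> p. z - k z' \<in> boundaries S'' \<delta>'' p" using x(1) by blast
qed

definition qi :: "(nat \<times> 'b) set \<Rightarrow> (nat \<times> 'b \<Rightarrow> ('b, 'f::field) talg) \<Rightarrow>
    (nat \<times> 'c) set \<Rightarrow> (nat \<times> 'c \<Rightarrow> ('c, 'f) talg) \<Rightarrow> (nat \<times> 'b \<Rightarrow> ('c, 'f) talg) \<Rightarrow> bool" where
  "qi S d S' d' F \<longleftrightarrow> mor S d S' d' F \<and> induces_homology_iso S (lpart d) S' (lpart d') (lpart F)"

lemma qi_comp:
  assumes "ainf S d" "ainf S' d'" "ainf S'' d''" "qi S d S' d' F" "qi S' d' S'' d'' G"
  shows "qi S d S'' d'' (\<lambda>b. amap G (F b))"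
proof -
  have m: "mor S d S' d' F" "mor S' d' S'' d'' G" using assms(4,5) by (auto simp: qi_def)
  have "induces_homology_iso S (lpart d) S'' (lpart d'') (lpart (\<lambda>b. amap G (F b)))"
    by (rule homology_iso_comp[OF mor_chain[OF assms(1,2) m(1)] mor_chain[OF assms(2,3) m(2)] flinear_lpart])
      (use assms(4,5) lpart_comp[OF mor_homog[OF m(1)] mor_homog[OF m(2)]] in \<open>auto simp: qi_def\<close>)
  then show ?thesis using mor_comp[OF assms(1,2) m] by (simp add: qi_def)
qed

definition mini :: "(nat \<times> 'b) set \<Rightarrow> (nat \<times> 'b \<Rightarrow> ('b, 'f::field) talg) \<Rightarrow> bool" where
  "mini S d \<longleftrightarrow> (\<forall>b\<in>S. d b $ 0 = 0)"

subsection \<open>Inverting morphisms\<close>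

text \<open>Write \<open>amap F\<close> as \<open>P + N\<close>, where \<open>P\<close> extends the
  linear part multiplicatively and has inverse \<open>R\<close>, while \<open>N\<close> raises the
  order. A right inverse on generators is a fixed point of G = R (b - N G). It commutes with the
  derivations because \<open>amap F\<close> is injective and both sides of the morphism equation
  have the same image.\<close>

lemma mor_inverse:
  fixes S :: "(nat \<times> 's) set" and S' :: "(nat \<times> 't) set" and d :: "nat \<times> 's \<Rightarrow> ('s, 'f::field) talg"
  assumes a: "ainf S d" "ainf S' d'" and F: "mor S d S' d' F" and J: "flinear J"
    and Jg: "\<And>p v. v \<in> gcomp S' p \<Longrightarrow> J v \<in> gcomp S p"
    and FJ: "\<And>v. v \<in> free_on S' \<Longrightarrow> lpart F (J v) = v"
    and JF: "\<And>v. v \<in> free_on S \<Longrightarrow> J (lpart F v) = v"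
  shows "\<exists>G. mor S' d' S d G \<and> (\<forall>b\<in>S'. G b $ 0 = letter (J (gen b)))"
proof -
  define P where "P = amap (\<lambda>b. emb (lpart F (gen b)))"
  define R where "R = amap (\<lambda>b. emb (J (gen b)))"
  define N where "N = (\<lambda>X. amap F X - P X)"
  have tP: "tlin P" and tR: "tlin R" and tN: "tlin N"
    unfolding P_def R_def N_def by (intro tlin_intros)+
  have Pe: "P (emb v) = emb (lpart F v)" for v
    by (rule tlin_emb[OF tP flinear_lpart]) (simp add: P_def)
  have Re: "R (emb v) = emb (J v)" for v
    by (rule tlin_emb[OF tR J]) (simp add: R_def)
  have Jgen: "b \<in> S' \<Longrightarrow> J (gen b) \<in> gcomp S (fst b)" for b by (rule Jg) simp
  have Fgen: "b \<in> S \<Longrightarrow> lpart F (gen b) \<in> gcomp S' (fst b)" for b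
    by (rule lpart_gcomp[OF mor_homog[OF F]]) auto
  have RP: "R (P X) = X" if "X \<in> homs S" for X
  proof -
    have "R (P X) = amap (\<lambda>b. R (emb (lpart F (gen b)))) X" by (simp add: R_def P_def amap_comp)
    also have "\<dots> = amap (\<lambda>b. word [b]) X"
      by (rule amap_eq_homs[OF that]) (simp add: Re JF[of "gen _", simplified lpart_gen] del: lpart_gen emb_gen, simp add: JF del: lpart_gen)
    finally show ?thesis by (simp add: amap_id)
  qed
  have PR: "P (R X) = X" if "X \<in> homs S'" for X
  proof -
    have "P (R X) = amap (\<lambda>b. P (emb (J (gen b)))) X" by (simp add: R_def P_def amap_comp)
    also have "\<dots> = amap (\<lambda>b. word [b]) X"
      by (rule amap_eq_homs[OF that]) (simp add: Pe FJ)
    finally show ?thesis by (simp add: amap_id)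
  qed
  have N0: "N (word w) $ 0 = 0" if "set w \<subseteq> S" for w
  proof -
    have "agree 1 (amap F (word w)) (P (word w))"
      unfolding P_def by (rule agree_amap[OF homs_word[OF that]])
        (auto simp: agree_def emb_def unletter_nth0[OF mor_homog[OF F]])
    then show ?thesis by (simp add: N_def agree_def)
  qed
  have Phom: "P X \<in> homog S' l e" if "X \<in> homog S l e" for X l e
    unfolding P_def by (rule amap_hom[OF that], rule emb_homog[OF Fgen]) auto
  have Rhom: "R X \<in> homog S l e" if "X \<in> homog S' l e" for X l e
    unfolding R_def by (rule amap_hom[OF that], rule emb_homog[OF Jgen]) auto
  have Fhom: "amap F X \<in> homog S' l e" if "X \<in> homog S l e" for X l e
    by (rule amap_hom[OF that mor_homog[OF F]])
  define Q where "Q = (\<lambda>b n w. set w \<subseteq> S \<and> length w = 1 + n \<and> sdeg w = sdeg [b :: nat \<times> 't])"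
  have Q: "fsupp (Q b) = homog S 1 (sdeg [b])" for b by (simp add: Q_def homog_def)
  define GG where "GG = (\<lambda>g b. if b \<in> S' then R (word [b] - N (g b)) else 0)"
  have "\<exists>G. (\<forall>b. GG G b = G b) \<and> (\<forall>b. G b \<in> fsupp (Q b))"
  proof (rule fps_fixed_point)
    fix n :: nat and g g' :: "nat \<times> 't \<Rightarrow> ('s, 'f) talg"
    assume g: "\<forall>b. g b \<in> fsupp (Q b)" "\<forall>b. g' b \<in> fsupp (Q b)" and ag: "\<forall>b. agree n (g b) (g' b)"
    have "agree (Suc n) (N (g b)) (N (g' b))" for b
      by (rule agree_tlin_raise[OF tN ag[rule_format] _ _ N0]) (use g Q hom_homs in blast)+
    then show "\<forall>b. agree (Suc n) (GG g b) (GG g' b)"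
      by (auto simp: GG_def intro!: agree_tlin[OF tR] agree_diff)
  next
    fix g :: "nat \<times> 't \<Rightarrow> ('s, 'f) talg"
    assume g: "\<forall>b. g b \<in> fsupp (Q b)"
    show "\<forall>b. GG g b \<in> fsupp (Q b)"
      using g unfolding Q GG_def N_def by (auto intro!: Rhom hom_diff Fhom Phom hom_word)
  qed
  then obtain G where G: "\<And>b. GG G b = G b" "\<And>b. G b \<in> homog S 1 (sdeg [b])"
    unfolding Q by blast
  have Ghs: "G b \<in> homs S" for b by (rule hom_homs[OF G(2)])
  have FG: "amap F (G b) = word [b]" if b: "b \<in> S'" for b
  proof -
    have h: "word [b] - N (G b) \<in> homs S'"
      using b hom_homs[OF Fhom[OF G(2)]] hom_homs[OF Phom[OF G(2)]] unfolding N_def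
      by (intro homs_diff homs_word) auto
    have "P (G b) = P (R (word [b] - N (G b)))" using G(1)[of b] b by (simp add: GG_def)
    also have "\<dots> = word [b] - N (G b)" by (rule PR[OF h])
    finally show ?thesis by (simp add: N_def)
  qed
  have N0': "N X $ 0 = 0" if "X \<in> homs S" for X
    using agree_tlin_raise[OF tN _ that _ N0, of 0 0] by (auto simp: agree_def tlin_0[OF tN])
  \<comment> \<open>If \<open>amap F\<close> kills \<open>X\<close>, then X = R (- N X), and each
    substitution raises the order of \<open>X\<close> by one.\<close>
  have inj: "X = 0" if X: "X \<in> homs S" "amap F X = 0" for X
  proof (rule agree_all)
    fix n
    have e: "X = R (- N X)" using RP[OF X(1)] X(2) by (simp add: N_def)
    show "agree n X 0"
    proof (induction n)
      case (Suc n)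
      have "agree (Suc n) (N X) (N 0)"
        by (rule agree_tlin_raise[OF tN Suc X(1) _ N0]) auto
      then have "agree (Suc n) (R (- N X)) (R (- N 0))" by (intro agree_tlin[OF tR] agree_uminus)
      then show ?case using e by (simp add: tlin_0[OF tN] tlin_0[OF tR])
    qed simp
  qed
  have "mor S' d' S d G"
    unfolding mor_def
  proof (intro ballI conjI)
    fix b assume b: "b \<in> S'"
    show "G b \<in> homog S 1 (sdeg [b])" by (rule G(2))
    have 1: "amap F (der d (G b)) = d' b"
      using mor_der[OF a(1) F Ghs[of b]] FG[OF b] der_letter[of d' b] by simp
    have "amap F (amap G (d' b)) = amap (\<lambda>b. amap F (G b)) (d' b)" by (rule amap_comp)
    also have "\<dots> = amap (\<lambda>b. word [b]) (d' b)"
      by (rule amap_eq_homs[OF ainf_homs[OF a(2) b] FG])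
    finally have 2: "amap F (amap G (d' b)) = d' b" by (simp add: amap_id)
    have "der d (G b) - amap G (d' b) = 0"
      by (rule inj) (use 1 2 in \<open>auto simp: tlin_diff[OF tlin_amap] intro!: homs_diff der_homs Ghs ainf_homs[OF a(1)] amap_homs[OF ainf_homs[OF a(2) b]]\<close>)
    then show "der d (G b) = amap G (d' b)" by simp
  qed
  moreover have "G b $ 0 = letter (J (gen b))" if b: "b \<in> S'" for b
  proof -
    have "agree 1 (word [b] - N (G b)) (word [b])" using N0'[OF Ghs] by (simp add: agree_def)
    from agree_tlin[OF tR this] have "R (word [b] - N (G b)) $ 0 = R (word [b]) $ 0" by (simp add: agree_def)
    then show ?thesis using G(1)[of b] b by (simp add: GG_def R_def emb_def)
  qed
  ultimately show ?thesis by blast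
qed

text \<open>With vanishing differentials every element is a cycle and only 0 is a boundary, so an
  isomorphism in homology is a bijection in each degree.\<close>

lemma mini_qi_linear_inverse:
  assumes a: "ainf S d" "ainf S' d'" and m: "mini S d" "mini S' d'" and F: "qi S d S' d' F"
  shows "\<exists>J. flinear J \<and> (\<forall>p. \<forall>v\<in>gcomp S' p. J v \<in> gcomp S p) \<and> (\<forall>v\<in>free_on S'. lpart F (J v) = v) \<and>
     (\<forall>v\<in>free_on S. J (lpart F v) = v)"
proof -
  have z: "lpart d v = 0" if "v \<in> free_on S" for v
    by (rule flinear_eq_free_on[OF flinear_lpart flinear_zero _ that]) (use m(1) in \<open>auto simp: mini_def flinearD[OF flinear_unletter]\<close>)
  have z': "lpart d' v = 0" if "v \<in> free_on S'" for v
    by (rule flinear_eq_free_on[OF flinear_lpart flinear_zero _ that]) (use m(2) in \<open>auto simp: mini_def flinearD[OF flinear_unletter]\<close>)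
  have c: "cycles S (lpart d) p = gcomp S p" "cycles S' (lpart d') p = gcomp S' p" for p
    using z z' by (auto simp: cycles_def gcomp_free_on)
  have b: "boundaries S (lpart d) p = {0}" "boundaries S' (lpart d') p = {0}" for p
  proof -
    show "boundaries S (lpart d) p = {0}"
      unfolding boundaries_def by (auto simp: z[OF gcomp_free_on[of _ S "Suc p"]] intro!: image_eqI[where x = 0])
    show "boundaries S' (lpart d') p = {0}"
      unfolding boundaries_def by (auto simp: z'[OF gcomp_free_on[of _ S' "Suc p"]] intro!: image_eqI[where x = 0])
  qed
  have M: "mor S d S' d' F" using F by (simp add: qi_def)
  have inj: "v = 0" if "v \<in> gcomp S p" "lpart F v = 0" for p v
    using F that by (auto simp: qi_def induces_homology_iso_def c b)
  have surj: "\<exists>v\<in>gcomp S p. lpart F v = u" if "u \<in> gcomp S' p" for p u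
  proof -
    have "\<exists>v\<in>gcomp S p. u - lpart F v \<in> {0}"
      using F that by (auto simp: qi_def induces_homology_iso_def c b)
    then show ?thesis by auto
  qed
  \<comment> \<open>Preimages are taken in the degree of the generator, so that \<open>J\<close>
    respects the grading.\<close>
  define j where "j = (\<lambda>b. SOME v. v \<in> gcomp S (fst b) \<and> lpart F v = gen b)"
  have j: "j b \<in> gcomp S (fst b)" "lpart F (j b) = gen b" if "b \<in> S'" for b
    unfolding j_def using someI_ex[of "\<lambda>v. v \<in> gcomp S (fst b) \<and> lpart F v = gen b"] surj[of "gen b" "fst b"] that
    by auto
  define J where "J = lin_ext j"
  have lJ: "flinear J" by (simp add: J_def flinear_lin_ext)
  have Jg: "J v \<in> gcomp S p" if "v \<in> gcomp S' p" for p v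
    by (rule flinear_gcomp[OF lJ _ that]) (use j in \<open>auto simp: J_def\<close>)
  have FJ: "lpart F (J v) = v" if "v \<in> free_on S'" for v
    by (rule flinear_eq_free_on[OF flinear_compose[OF flinear_lpart lJ] flinear_id _ that])
      (use j in \<open>auto simp: J_def\<close>)
  have JF: "J (lpart F v) = v" if "v \<in> free_on S" for v
  proof (rule flinear_eq_free_on[OF flinear_compose[OF lJ flinear_lpart] flinear_id _ that])
    fix b assume b: "b \<in> S"
    have g: "lpart F (gen b) \<in> gcomp S' (fst b)"
      by (rule lpart_gcomp[OF mor_homog[OF M]]) (use b in auto)
    then have "lpart F (J (lpart F (gen b)) - gen b) = 0"
      using FJ[OF gcomp_free_on[OF g]] by (simp add: flinearD[OF flinear_lpart] del: lpart_gen)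
    moreover have "J (lpart F (gen b)) - gen b \<in> gcomp S (fst b)"
      using Jg[OF g] b by (intro gcomp_diff) auto
    ultimately show "J (lpart F (gen b)) = gen b" using inj by fastforce
  qed
  show ?thesis using lJ Jg FJ JF by blast
qed

subsection \<open>Twisted derivations\<close>

text \<open>A derivation that acts on what it has passed by \<open>a\<close> and on the rest by the
  identity. For \<open>a\<close> the projection to homology and \<open>g\<close> the homotopy it is
  the sum of (incl proj) x ... x h x 1 x ... x 1 over all positions of h.\<close>

fun tder_word :: "(nat \<times> 'b \<Rightarrow> ('b, 'f::field) talg) \<Rightarrow> (nat \<times> 'b \<Rightarrow> ('b, 'f) talg) \<Rightarrow> (nat \<times> 'b) list \<Rightarrow> ('b, 'f) talg" where
  "tder_word a g [] = 0"
| "tder_word a g (b # w) = g b * word w + smap (a b) * tder_word a g w"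

definition tder :: "(nat \<times> 'b \<Rightarrow> ('b, 'f::field) talg) \<Rightarrow> (nat \<times> 'b \<Rightarrow> ('b, 'f) talg) \<Rightarrow> ('b, 'f) talg \<Rightarrow> ('b, 'f) talg" where
  "tder a g = text_lin (tder_word a g)"

lemma tlin_tder: "tlin (tder a g)" unfolding tder_def by (rule tlin_text_lin)

lemma tlin_tder_comp [tlin_intros]: "tlin \<phi> \<Longrightarrow> tlin (\<lambda>X. tder a g (\<phi> X))"
  by (rule tlin_compose[OF tlin_tder])

lemma tder_word_eq [simp]: "tder a g (word w) = tder_word a g w" by (simp add: tder_def)

lemma tder_letter: "tder a g (word [b]) = g b" by (simp add: word_Nil)

lemma tder_1 [simp]: "tder a g 1 = 0" using tder_word_eq[of a g "[]"] by (simp add: word_Nil)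

lemma tder_mult: "tder a g (X * Y) = tder a g X * Y + smap (amap a X) * tder a g Y"
proof -
  have 0: "tder a g (word u * word w) = tder a g (word u) * word w + smap (amap a (word u)) * tder a g (word w)" for u w
  proof (induction u)
    case (Cons b u)
    have "tder a g (word (b # u) * word w) = g b * (word u * word w) + smap (a b) * tder a g (word u * word w)"
      by (simp add: word_append[symmetric])
    also have "\<dots> = tder a g (word (b # u)) * word w + smap (amap a (word (b # u))) * tder a g (word w)"
      by (simp only: amap_word_Cons Cons.IH tder_word_eq tder_word.simps smap_mult distrib_left distrib_right mult.assoc add.assoc)
    finally show ?case .
  qed (simp add: word_Nil)
  have 1: "tder a g (X * word w) = tder a g X * word w + smap (amap a X) * tder a g (word w)" for w X
    by (rule tlin_ext[of _ _ X]) (intro tlin_intros, intro tlin_intros, rule 0)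
  show ?thesis
    by (rule tlin_ext[of _ _ Y]) (intro tlin_intros, intro tlin_intros, rule 1)
qed

lemma tder_hom:
  assumes X: "X \<in> homog S l e" and a: "\<And>b. b \<in> S \<Longrightarrow> a b \<in> homog S 1 (sdeg [b])"
    and g: "\<And>b. b \<in> S \<Longrightarrow> g b \<in> homog S 1 (sdeg [b] + m)"
  shows "tder a g X \<in> homog S l (e + m)"
proof (rule tlin_hom0[OF tlin_tder X])
  fix w :: "(nat \<times> 'a) list" assume "set w \<subseteq> S" "sdeg w = e"
  then show "tder a g (word w) \<in> homog S (length w) (e + m)"
  proof (induction w arbitrary: e)
    case (Cons b w)
    have 1: "g b * word w \<in> homog S (1 + length w) (sdeg [b] + m + sdeg w)"
      using Cons.prems by (intro hom_mult g hom_word) auto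
    have ab: "a b \<in> homog S 1 (sdeg [b])" using Cons.prems by (intro a) auto
    have 2: "a b * tder_word a g w \<in> homog S (1 + length w) (sdeg [b] + (sdeg w + m))"
      using Cons.prems Cons.IH[of "sdeg w"] by (intro hom_mult ab) auto
    then have 3: "scal (ksign (sdeg [b])) * a b * tder_word a g w \<in> homog S (1 + length w) (sdeg [b] + (sdeg w + m))"
      by (simp add: hom_scal mult.assoc)
    show ?case using 1 3 Cons.prems(2) by (auto simp: smap_hom[OF ab] algebra_simps intro!: hom_add)
  qed auto
qed

lemma smap_odd:
  fixes \<phi> :: "('b, 'f::field) talg \<Rightarrow> ('c, 'f) talg"
  assumes "tlin \<phi>" "\<And>w. set w \<subseteq> S \<Longrightarrow> \<phi> (word w) \<in> homog S' (length w) (sdeg w + m)" "odd m" "X \<in> homs S"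
  shows "smap (\<phi> X) = - \<phi> (smap X)"
proof (rule tlin_eq_homs[OF _ _ assms(4)])
  fix w assume w: "set w \<subseteq> S"
  have "scal (ksign (sdeg w + m)) * Y = - (scal (ksign (sdeg w)) * Y)" for w and Y :: "('c, 'f) talg"
    using assms(3) by (auto simp: ksign_def scal_minus_1)
  with smap_hom[OF assms(2)[OF w]] show "smap (\<phi> (word w)) = - \<phi> (smap (word w))"
    by (simp add: smap_word tlin_scal[OF assms(1)])
qed (intro tlin_intros tlin_compose[OF assms(1)] assms(1))+

lemma der_add: "der (\<lambda>b. d b + d' b) X = der d X + der d' X"
proof (rule tlin_ext[of _ _ X])
  fix w show "der (\<lambda>b. d b + d' b) (word w) = der d (word w) + der d' (word w)"
    by (induction w) (auto simp: algebra_simps)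
qed (intro tlin_intros)+

text \<open>Recursions are stated on generators but must be used at vectors such as
  \<open>h (gen b)\<close>; linearity of both sides in the vector carries them over.\<close>

definition emblin :: "(('b, 'f::field) gvec \<Rightarrow> ('c, 'f) talg) \<Rightarrow> bool" where
  "emblin f \<longleftrightarrow> (\<forall>v w. f (v + w) = f v + f w) \<and> (\<forall>c v. f (fscale c v) = scal c * f v)"

lemma emblin_tlin: "tlin \<phi> \<Longrightarrow> flinear L \<Longrightarrow> emblin (\<lambda>v. \<phi> (emb (L v)))"
  by (simp add: emblin_def flinearD[of L] emb_add emb_fscale tlin_add tlin_scal)

lemma emblin_diff: "emblin f \<Longrightarrow> emblin g \<Longrightarrow> emblin (\<lambda>v. f v - g v)"
  by (simp add: emblin_def algebra_simps)

lemma emblin_sum: "emblin f \<Longrightarrow> f (sum u A) = (\<Sum>x\<in>A. f (u x))"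
proof (induction A rule: infinite_finite_induct)
  case empty
  have "f (fscale 0 0) = scal 0 * f 0" using empty by (simp only: emblin_def)
  then show ?case by simp
next
  case (infinite A)
  have "f (fscale 0 0) = scal 0 * f 0" using infinite by (simp only: emblin_def)
  then show ?case using infinite by simp
qed (simp add: emblin_def)

lemma emblin_eq:
  assumes "emblin f" "emblin g" "\<And>b. b \<in> S \<Longrightarrow> f (gen b) = g (gen b)" "v \<in> free_on S"
  shows "f v = g v"
proof -
  have e: "h v = (\<Sum>b\<in>Poly_Mapping.keys v. scal (Poly_Mapping.lookup v b) * h (gen b))" if h: "emblin h" for h
  proof -
    have "h v = h (\<Sum>b\<in>Poly_Mapping.keys v. fscale (Poly_Mapping.lookup v b) (gen b))"
      by (rule arg_cong[where f = h, OF expand_gen])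
    also have "\<dots> = (\<Sum>b\<in>Poly_Mapping.keys v. scal (Poly_Mapping.lookup v b) * h (gen b))"
      unfolding emblin_sum[OF h] using h by (simp add: emblin_def)
    finally show ?thesis .
  qed
  show ?thesis unfolding e[OF assms(1)] e[OF assms(2)]
    by (rule sum.cong) (use assms(3,4) in \<open>auto simp: free_on_def\<close>)
qed

text \<open>\<open>E\<close> stands for the failure of a homomorphism to commute with derivations.
  It obeys a Leibniz rule (\<open>defect_mor_cons\<close>), so its order on words is at least its
  order on letters, and an argument without constant term gains one more. A recursion expressing the
  defect on letters by the defect on such an argument then forces it to vanish.\<close>

lemma defect_agree:
  assumes E: "tlin E" and nil: "E 1 = 0"
    and cons: "\<And>b w. b \<in> S \<Longrightarrow> set w \<subseteq> S \<Longrightarrow> E (word (b # w)) = E (word [b]) * A b w + B b w * E (word w)"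
    and n: "\<And>b. b \<in> S \<Longrightarrow> agree n (E (word [b])) 0" and X: "X \<in> homs S"
  shows "agree n (E X) 0" "X $ 0 = 0 \<Longrightarrow> agree (Suc n) (E X) 0"
proof -
  have "agree n (E (word w)) 0" if "set w \<subseteq> S" for w
    using that
  proof (induction w)
    case (Cons b w)
    have "agree n (E (word [b]) * A b w + B b w * E (word w)) (0 * A b w + B b w * 0)"
      using Cons n[of b] by (intro agree_add agree_mult) auto
    then show ?case using cons[of b w] Cons.prems by simp
  qed (simp add: word_Nil nil)
  then have w: "E (word w) $ k = 0" if "set w \<subseteq> S" "k < n" for w k using that by (auto simp: agree_def)
  have ks: "set w \<subseteq> S" if "w \<in> Poly_Mapping.keys (X $ k)" for w k
    using X that by (auto simp: homs_def fsupp_def)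
  have z: "lin_ext (\<lambda>w. E (word w) $ i) (X $ k) = 0" if "i < n" for i k
    using w[OF ks that] by (simp add: lin_ext_def)
  show "agree n (E X) 0"
    by (auto simp: agree_def tlin_nth[OF E, of X] intro!: sum.neutral z)
  show "agree (Suc n) (E X) 0" if X0: "X $ 0 = 0"
    unfolding agree_def
  proof (intro allI impI)
    fix k assume k: "k < Suc n"
    have "lin_ext (\<lambda>w. E (word w) $ (k - i)) (X $ i) = 0" if "i \<le> k" for i
    proof (cases "i = 0")
      case False
      then have "k - i < n" using k that by linarith
      then show ?thesis by (rule z)
    qed (simp add: X0)
    then show "E X $ k = 0 $ k" by (simp add: tlin_nth[OF E, of X])
  qed
qed

lemma defect_mor_cons:
  assumes "\<And>b. b \<in> S \<Longrightarrow> F b \<in> homog S' 1 (sdeg [b])" "b \<in> S"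
  shows "amap F (der d (word (b # w))) - der d' (amap F (word (b # w))) =
    (amap F (der d (word [b])) - der d' (amap F (word [b]))) * amap F (word w)
     + smap (F b) * (amap F (der d (word w)) - der d' (amap F (word w)))"
proof -
  have s: "smap (F b) = amap F (smap (word [b]))"
    using smap_amap[OF assms(1) homs_word[where w = "[b]" and S = S]] assms(2) by simp
  show ?thesis
    by (simp add: amap_word_Cons der_mult amap_mult tlin_add[OF tlin_amap] s word_Nil algebra_simps)
qed

text \<open>A strong deformation retraction of the linear complex onto its homology
  \<open>M\<close>, which has zero differential. The last three assumptions are the side conditions
  that make the homotopy on tensors square to zero and compose to zero with projection and
  inclusion.\<close>

locale split_complex =
  fixes S :: "(nat \<times> 'b) set" and d :: "nat \<times> 'b \<Rightarrow> ('b, 'f::field) talg"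
    and M :: "(nat \<times> 'm) set"
    and proj :: "('b, 'f) gvec \<Rightarrow> ('m, 'f) gvec" and incl :: "('m, 'f) gvec \<Rightarrow> ('b, 'f) gvec"
    and h :: "('b, 'f) gvec \<Rightarrow> ('b, 'f) gvec"
  assumes ainf: "ainf S d"
    and lin: "flinear proj" "flinear incl" "flinear h"
    and proj_gcomp: "v \<in> gcomp S p \<Longrightarrow> proj v \<in> gcomp M p"
    and incl_gcomp: "m \<in> gcomp M p \<Longrightarrow> incl m \<in> gcomp S p"
    and h_gcomp: "v \<in> gcomp S p \<Longrightarrow> h v \<in> gcomp S (Suc p)"
    and d_incl: "m \<in> free_on M \<Longrightarrow> lpart d (incl m) = 0"
    and proj_d: "v \<in> free_on S \<Longrightarrow> proj (lpart d v) = 0"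
    and proj_incl: "m \<in> free_on M \<Longrightarrow> proj (incl m) = m"
    and homotopy: "v \<in> free_on S \<Longrightarrow> lpart d (h v) + h (lpart d v) = v - incl (proj v)"
    and hh: "v \<in> free_on S \<Longrightarrow> h (h v) = 0"
    and h_incl: "m \<in> free_on M \<Longrightarrow> h (incl m) = 0"
    and proj_h: "v \<in> free_on S \<Longrightarrow> proj (h v) = 0"
begin

abbreviation "\<delta> \<equiv> lpart d"

text \<open>The derivation is split into its linear part \<open>d0\<close> and the perturbation
  \<open>t\<close>, which raises the length and drives the recursions.\<close>

definition "d0 b = emb (\<delta> (gen b))"
definition "t b = d b - d0 b"

lemma d0_homog: "b \<in> S \<Longrightarrow> d0 b \<in> homog S 1 (sdeg [b] - 1)"
proof -
  assume b: "b \<in> S"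
  have "d0 b = fps_const (d b $ 0)" by (simp add: d0_def emb_def unletter_nth0(1)[OF ainf_homog[OF ainf b]])
  moreover have "fps_const (d b $ 0) \<in> homog S 1 (sdeg [b] - 1)"
    using ainf_homog[OF ainf b] by (auto simp: homog_def fsupp_def fps_const_def)
  ultimately show ?thesis by simp
qed

lemma t_homog: "b \<in> S \<Longrightarrow> t b \<in> homog S 1 (sdeg [b] - 1)"
  unfolding t_def by (intro hom_diff ainf_homog[OF ainf] d0_homog)

lemma t_nth0: "b \<in> S \<Longrightarrow> t b $ 0 = 0"
  by (simp add: t_def d0_def emb_def unletter_nth0(1)[OF ainf_homog[OF ainf]])

lemma der_split: "der d X = der d0 X + der t X"
  using der_add[of d0 t X] by (simp add: t_def)

lemma der_d0_emb: "v \<in> free_on S \<Longrightarrow> der d0 (emb v) = emb (\<delta> v)"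
  by (rule tlin_emb[OF tlin_der flinear_lpart]) (simp add: der_letter d0_def del: der_word_eq)

lemma der_t_word0: "set w \<subseteq> S \<Longrightarrow> der t (word w) $ 0 = 0"
  by (induction w) (auto simp: t_nth0 fps_mult_nth)

lemma der_t_nth0: "X \<in> homs S \<Longrightarrow> der t X $ 0 = 0"
  using agree_tlin_raise[OF tlin_der agree_0 _ homs_0 der_t_word0, of X] by (auto simp: agree_def tlin_0[OF tlin_der])

lemma der_t_homog: "X \<in> homog S l e \<Longrightarrow> der t X \<in> homog S l (e - 1)"
  using der_hom[where X = X and S = S and l = l and e = e and d = t and m = "- 1"] t_homog by simp

lemma emb_homs: "v \<in> free_on S \<Longrightarrow> emb v \<in> homs S"
  by (auto simp: homs_def fsupp_def emb_def fps_const_def letter_def lin_ext_def free_on_def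
      dest!: subsetD[OF Poly_Mapping.keys_sum] subsetD[OF keys_fscale] split: if_splits)

lemma der_t_homs: "X \<in> homs S \<Longrightarrow> der t X \<in> homs S"
  by (rule der_homs) (auto intro: hom_homs[OF t_homog])

lemma der_d_homs: "X \<in> homs S \<Longrightarrow> der d X \<in> homs S"
  by (rule der_homs) (auto intro: ainf_homs[OF ainf])

lemma \<delta>_free_on: "v \<in> free_on S \<Longrightarrow> \<delta> v \<in> free_on S"
  using lpart_free_on[of S d S "- 1" v] ainf_homog[OF ainf] by simp

lemma lin_free_on:
  shows "v \<in> free_on S \<Longrightarrow> h v \<in> free_on S" "v \<in> free_on S \<Longrightarrow> proj v \<in> free_on M" "m \<in> free_on M \<Longrightarrow> incl m \<in> free_on S"
  by (erule flinear_free_on[OF lin(3), rotated] flinear_free_on[OF lin(1), rotated] flinear_free_on[OF lin(2), rotated],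
      use h_gcomp proj_gcomp incl_gcomp gcomp_free_on gcomp_gen in blast)+

lemma \<delta>\<delta>: "v \<in> free_on S \<Longrightarrow> \<delta> (\<delta> v) = 0"
  using ainf_complex[OF ainf] by (simp add: chain_complex_def)

text \<open>Expand d (d v) = 0 along d = d0 + t. On \<delta> v the linear part contributes nothing,
  as \<delta> (\<delta> v) = 0.\<close>

lemma der_t_emb_\<delta>: "v \<in> free_on S \<Longrightarrow> der t (emb (\<delta> v)) = - der d (der t (emb v))"
proof -
  assume v: "v \<in> free_on S"
  have "0 = der d (der d (emb v))" using ainf_der_der[OF ainf emb_homs[OF v]] by simp
  also have "der d (emb v) = emb (\<delta> v) + der t (emb v)" by (simp add: der_split der_d0_emb[OF v])
  also have "der d \<dots> = der d (emb (\<delta> v)) + der d (der t (emb v))" by (simp add: tlin_add[OF tlin_der])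
  also have "der d (emb (\<delta> v)) = der t (emb (\<delta> v))"
    by (simp add: der_split[of "emb (\<delta> v)"] der_d0_emb[OF \<delta>_free_on[OF v]] \<delta>\<delta>[OF v])
  finally show ?thesis by (simp add: eq_neg_iff_add_eq_0)
qed

lemma d0_d0: "X \<in> homs S \<Longrightarrow> der d0 (der d0 X) = 0"
proof (rule der_der_general[OF d0_homog])
  fix b assume b: "b \<in> S"
  have "\<delta> (gen b) \<in> free_on S" by (rule \<delta>_free_on) (use b in simp)
  then have "der d0 (emb (\<delta> (gen b))) = 0" using b by (simp add: der_d0_emb \<delta>\<delta> del: lpart_gen)
  then show "der d0 (d0 b) = 0" by (simp only: d0_def[of b])
qed

lemma lpart_mini:
  assumes "mini M dM" "m \<in> free_on M" shows "lpart dM m = 0"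
  by (rule flinear_eq_free_on[OF flinear_lpart flinear_zero _ assms(2)])
    (use assms(1) in \<open>auto simp: mini_def flinearD[OF flinear_unletter]\<close>)

lemma boundaries_mini: "mini M dM \<Longrightarrow> boundaries M (lpart dM) p = {0}"
  unfolding boundaries_def
  by (auto simp: lpart_mini gcomp_free_on[of _ M "Suc p"] intro!: image_eqI[where x = 0])

lemma proj_homology_iso:
  assumes "mini M dM" "\<And>v. v \<in> free_on S \<Longrightarrow> lpart g v = proj v"
  shows "induces_homology_iso S \<delta> M (lpart dM) (lpart g)"
  unfolding induces_homology_iso_def boundaries_mini[OF assms(1)]
proof (intro allI conjI ballI impI)
  fix p z assume z: "z \<in> cycles S \<delta> p" "lpart g z \<in> {0}"
  then have "z \<in> gcomp S p" "\<delta> z = 0" by (auto simp: cycles_def)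
  then have "z = \<delta> (h z)" "h z \<in> gcomp S (Suc p)"
    using homotopy[of z] assms(2)[of z] z(2) h_gcomp by (auto simp: gcomp_free_on flinearD(4)[OF lin(2)] flinearD(4)[OF lin(3)])
  then show "z \<in> boundaries S \<delta> p" unfolding boundaries_def by blast
next
  fix p z assume "z \<in> cycles M (lpart dM) p"
  then have z: "z \<in> gcomp M p" "z \<in> free_on M" by (auto simp: cycles_def gcomp_free_on)
  then have "incl z \<in> cycles S \<delta> p" "z - lpart g (incl z) \<in> {0}"
    using incl_gcomp d_incl proj_incl lin_free_on(3) by (auto simp: cycles_def assms(2))
  then show "\<exists>v\<in>cycles S \<delta> p. z - lpart g v \<in> {0}" by blast
qed

lemma incl_homology_iso:
  assumes "mini M dM" "\<And>v. v \<in> free_on M \<Longrightarrow> lpart g v = incl v"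
  shows "induces_homology_iso M (lpart dM) S \<delta> (lpart g)"
  unfolding induces_homology_iso_def boundaries_mini[OF assms(1)]
proof (intro allI conjI ballI impI)
  fix p z assume "z \<in> cycles M (lpart dM) p" and b: "lpart g z \<in> boundaries S \<delta> p"
  then have z: "z \<in> gcomp M p" "z \<in> free_on M" by (auto simp: cycles_def gcomp_free_on)
  from b obtain y where y: "incl z = \<delta> y" "y \<in> gcomp S (Suc p)" using assms(2)[OF z(2)] by (auto simp: boundaries_def)
  then have "proj (incl z) = 0" using proj_d[OF gcomp_free_on[OF y(2)]] by simp
  then show "z \<in> {0}" using proj_incl[OF z(2)] by simp
next
  fix p z assume "z \<in> cycles S \<delta> p"
  then have z: "z \<in> gcomp S p" "z \<in> free_on S" "\<delta> z = 0" by (auto simp: cycles_def gcomp_free_on)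
  have "z - incl (proj z) = \<delta> (h z)" using homotopy[OF z(2)] z(3) by (simp add: flinearD(4)[OF lin(3)])
  then have "z - lpart g (proj z) \<in> boundaries S \<delta> p"
    using h_gcomp[OF z(1)] assms(2)[OF gcomp_free_on[OF proj_gcomp[OF z(1)]]] unfolding boundaries_def by auto
  moreover have "proj z \<in> cycles M (lpart dM) p"
    using proj_gcomp[OF z(1)] lpart_mini[OF assms(1) gcomp_free_on[OF proj_gcomp[OF z(1)]]] by (simp add: cycles_def)
  ultimately show "\<exists>v\<in>cycles M (lpart dM) p. z - lpart g v \<in> boundaries S \<delta> p" by blast
qed

subsection \<open>The projection onto a minimal model\<close>

text \<open>The recursion \<open>P v = proj v - P (t (h v))\<close> for the values of \<open>P\<close> on generators.\<close>

theorem minimal_model_below: "\<exists>dM g. ainf M dM \<and> mini M dM \<and> qi S d M dM g"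
proof -
  define u where "u = (\<lambda>b. der t (emb (h (gen b))))"
  have hb: "b \<in> S \<Longrightarrow> h (gen b) \<in> gcomp S (Suc (fst b))" for b by (rule h_gcomp) simp
  have u: "u b \<in> homog S 1 (sdeg [b])" if "b \<in> S" for b
  proof -
    have "emb (h (gen b)) \<in> homog S 1 (sdeg [b] + 1)" by (rule emb_homog[OF hb[OF that]]) simp
    from der_t_homog[OF this] show ?thesis by (simp add: u_def)
  qed
  have u0: "u b $ 0 = 0" if "b \<in> S" for b
    unfolding u_def by (rule der_t_nth0[OF emb_homs[OF gcomp_free_on[OF hb[OF that]]]])
  define Q where "Q = (\<lambda>b n w. set w \<subseteq> M \<and> length w = 1 + n \<and> sdeg w = sdeg [b :: nat \<times> 'b])"
  have Q: "fsupp (Q b) = homog M 1 (sdeg [b])" for b by (simp add: Q_def homog_def)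
  \<comment> \<open>\<open>u b\<close> has no constant term since \<open>t\<close> raises the
    length; this makes \<open>G\<close> contracting although the unknown enters
    multiplicatively.\<close>
  define G where "G = (\<lambda>g b. if b \<in> S then emb (proj (gen b)) - amap g (u b) else 0)"
  have "\<exists>g. (\<forall>b. G g b = g b) \<and> (\<forall>b. g b \<in> fsupp (Q b))"
  proof (rule fps_fixed_point)
    fix n :: nat and g g' :: "nat \<times> 'b \<Rightarrow> ('m, 'f) talg"
    assume ag: "\<forall>b. agree n (g b) (g' b)"
    have "agree (Suc n) (amap g (u b)) (amap g' (u b))" if "b \<in> S" for b
      by (rule agree_Suc_amap[OF hom_homs[OF u[OF that]] u0[OF that]]) (use ag in auto)
    then show "\<forall>b. agree (Suc n) (G g b) (G g' b)"
      by (auto simp: G_def intro!: agree_diff)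
  next
    fix g :: "nat \<times> 'b \<Rightarrow> ('m, 'f) talg"
    assume g: "\<forall>b. g b \<in> fsupp (Q b)"
    have gh: "g b \<in> homog M 1 (sdeg [b])" for b using g Q by blast
    have "emb (proj (gen b)) - amap g (u b) \<in> homog M 1 (sdeg [b])" if "b \<in> S" for b
    proof (rule hom_diff)
      show "emb (proj (gen b)) \<in> homog M 1 (sdeg [b])"
        by (rule emb_homog[OF proj_gcomp[of "gen b" "fst b"]]) (use that in auto)
      show "amap g (u b) \<in> homog M 1 (sdeg [b])" by (rule amap_hom[OF u[OF that] gh])
    qed
    then show "\<forall>b. G g b \<in> fsupp (Q b)" unfolding Q G_def by (metis hom_0)
  qed
  then obtain g where g1: "\<And>b. G g b = g b" and g2: "\<And>b. g b \<in> homog M 1 (sdeg [b])"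
    unfolding Q by blast
  have gS: "g b = emb (proj (gen b)) - amap g (u b)" if "b \<in> S" for b
    using g1[of b] that by (simp add: G_def)
  define P where "P = amap g"
  have tP: "tlin P" by (simp add: P_def tlin_amap)
  have Pv: "P (emb v) = emb (proj v) - P (der t (emb (h v)))" if "v \<in> free_on S" for v
    by (rule emblin_eq[OF emblin_tlin[OF tP flinear_id] emblin_diff[OF emblin_tlin[OF tlin_id lin(1)]
          emblin_tlin[OF tlin_compose[OF tP tlin_der] lin(3)]] _ that])
      (use gS in \<open>simp add: P_def u_def\<close>)
  \<comment> \<open>The only possible value: \<open>P\<close> sends \<open>incl m\<close> to
    \<open>m\<close> because \<open>h\<close> kills \<open>incl m\<close>, and \<open>d\<close> of
    the cycle \<open>incl m\<close> reduces to its part \<open>t\<close>.\<close>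
  define dM where "dM = (\<lambda>b. P (der t (emb (incl (gen b)))))"
  have ib: "b \<in> M \<Longrightarrow> incl (gen b) \<in> gcomp S (fst b)" for b by (rule incl_gcomp) simp
  have tib: "der t (emb (incl (gen b))) \<in> homog S 1 (sdeg [b] - 1)" if "b \<in> M" for b
    using der_t_homog[OF emb_homog[OF ib[OF that] refl]] by simp
  have dMh: "dM b \<in> homog M 1 (sdeg [b] - 1)" if "b \<in> M" for b
    unfolding dM_def P_def by (rule amap_hom[OF tib[OF that] g2])
  have dM0: "dM b $ 0 = 0" if "b \<in> M" for b
  proof -
    have "der t (emb (incl (gen b))) $ 0 = 0"
      by (rule der_t_nth0[OF emb_homs[OF gcomp_free_on[OF ib[OF that]]]])
    then have "agree 1 (der t (emb (incl (gen b)))) 0" by (simp add: agree_def)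
    from agree_tlin[OF tP this] show ?thesis by (simp add: dM_def agree_def tlin_0[OF tP])
  qed
  have dMm: "der dM (emb m) = P (der t (emb (incl m)))" if "m \<in> free_on M" for m
    by (rule emblin_eq[OF emblin_tlin[OF tlin_der flinear_id] emblin_tlin[OF tlin_compose[OF tP tlin_der] lin(2)] _ that])
      (simp add: dM_def der_letter del: der_word_eq)
  define E where "E = (\<lambda>X. P (der d X) - der dM (P X))"
  have tE: "tlin E" unfolding E_def P_def by (intro tlin_intros)
  \<comment> \<open>Insert the recursion at v and at \<delta> v and replace h (\<delta> v) by the
    homotopy identity. Everything cancels except the defect on t (h v), an argument without constant
    term.\<close>
  have E1: "E (emb v) = - E (der t (emb (h v)))" if v: "v \<in> free_on S" for v
  proof -
    have hv: "h v \<in> free_on S" by (rule lin_free_on(1)[OF v])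
    have dv: "\<delta> v \<in> free_on S" by (rule \<delta>_free_on[OF v])
    have hd: "h (\<delta> v) = v - incl (proj v) - \<delta> (h v)" using homotopy[OF v] by (simp add: algebra_simps)
    have "P (emb (\<delta> v)) = - P (der t (emb (h (\<delta> v))))" by (simp add: Pv[OF dv] proj_d[OF v])
    also have "\<dots> = - P (der t (emb v)) + P (der t (emb (incl (proj v)))) + P (der t (emb (\<delta> (h v))))"
      by (simp add: hd emb_diff tlin_diff[OF tlin_der] tlin_diff[OF tP])
    finally have 1: "P (der d (emb v)) = P (der t (emb (incl (proj v)))) + P (der t (emb (\<delta> (h v))))"
      by (simp add: der_split der_d0_emb[OF v] tlin_add[OF tP])
    have 2: "der dM (P (emb v)) = P (der t (emb (incl (proj v)))) - der dM (P (der t (emb (h v))))"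
      by (simp add: Pv[OF v] tlin_diff[OF tlin_der] dMm[OF lin_free_on(2)[OF v]])
    show ?thesis
      by (simp add: E_def 1 2 der_t_emb_\<delta>[OF hv] tlin_neg[OF tP])
  qed
  have hs: "emb (h (gen b)) \<in> homs S" if "b \<in> S" for b by (rule emb_homs[OF gcomp_free_on[OF hb[OF that]]])
  have Econs: "E (word (b # w)) = E (word [b]) * P (word w) + smap (g b) * E (word w)" if "b \<in> S" for b w
    unfolding E_def P_def by (rule defect_mor_cons[OF g2 that])
  have En: "\<forall>b\<in>S. agree n (E (word [b])) 0" for n
  proof (induction n)
    case (Suc n)
    show ?case
    proof
      fix b assume b: "b \<in> S"
      have "agree (Suc n) (E (u b)) 0"
        by (rule defect_agree(2)[OF tE _ Econs, of S]) (use Suc b u0 hom_homs[OF u] in \<open>auto simp: E_def P_def tlin_0[OF tlin_amap]\<close>)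
      then have "agree (Suc n) (- E (u b)) 0" by (simp add: agree_def)
      then show "agree (Suc n) (E (word [b])) 0" using E1[of "gen b"] b by (simp add: u_def)
    qed
  qed simp
  have E0: "E X = 0" if "X \<in> homs S" for X
    by (rule agree_all, rule defect_agree(1)[OF tE _ Econs, of S]) (use that En in \<open>auto simp: E_def P_def tlin_0[OF tlin_amap]\<close>)
  have "mor S d M dM g"
    unfolding mor_def
  proof (intro ballI conjI g2)
    fix b assume b: "b \<in> S"
    have "E (word [b]) = 0" by (rule E0) (use b in \<open>auto intro: homs_word\<close>)
    then show "der dM (g b) = amap g (d b)" by (simp add: E_def P_def word_Nil)
  qed
  moreover have aM: "ainf M dM"
    unfolding ainf_def
  proof (intro ballI conjI dMh)
    fix b assume b: "b \<in> M"
    have i: "incl (gen b) \<in> free_on S" by (rule gcomp_free_on[OF ib[OF b]])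
    \<comment> \<open>On the cycle \<open>incl m\<close> the perturbation equals all of
      \<open>d\<close>, so applying \<open>d\<close> again gives 0, and the vanishing defect carries
      this over to \<open>dM\<close>.\<close>
    have "E (der t (emb (incl (gen b)))) = 0" by (rule E0) (rule hom_homs[OF tib[OF b]])
    then have "der dM (dM b) = P (der d (der t (emb (incl (gen b)))))" by (simp add: E_def dM_def)
    also have "der d (der t (emb (incl (gen b)))) = 0"
      using der_t_emb_\<delta>[OF i] d_incl[of "gen b"] b by (simp add: tlin_0[OF tlin_der])
    finally show "der dM (dM b) = 0" by (simp add: tlin_0[OF tP])
  qed
  moreover have m: "mini M dM" using dM0 by (simp add: mini_def)
  moreover have "lpart g v = proj v" if "v \<in> free_on S" for v
  proof (rule flinear_eq_free_on[OF flinear_lpart lin(1) _ that])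
    fix b assume b: "b \<in> S"
    have "agree 1 (u b) 0" using u0[OF b] by (simp add: agree_def)
    from agree_tlin[OF tP this] have "amap g (u b) $ 0 = 0" by (simp add: agree_def tlin_0[OF tlin_amap] P_def)
    then show "lpart g (gen b) = proj (gen b)" using gS[OF b] by (simp add: emb_def)
  qed
  ultimately show ?thesis using proj_homology_iso[OF m] unfolding qi_def by blast
qed

subsection \<open>The inclusion of a minimal model\<close>

text \<open>The homotopy of the tensor algebra induced by \<open>h\<close>, \<open>incl\<close> and \<open>proj\<close>.\<close>

definition "ip b = emb (incl (proj (gen b)))"
definition "hh_gen b = emb (h (gen b))"
definition "HH = tder ip hh_gen"
definition "IP = amap ip"
definition "II = amap (\<lambda>b. emb (incl (gen b)))"
definition "PP = amap (\<lambda>b. emb (proj (gen b)))"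

lemma tlins: "tlin HH" "tlin IP" "tlin II" "tlin PP"
  unfolding HH_def IP_def II_def PP_def by (rule tlin_tder tlin_amap)+

lemma ip_homog: "b \<in> S \<Longrightarrow> ip b \<in> homog S 1 (sdeg [b])"
  unfolding ip_def by (rule emb_homog[OF incl_gcomp[OF proj_gcomp[of "gen b" "fst b"]]]) auto

lemma hh_homog: "b \<in> S \<Longrightarrow> hh_gen b \<in> homog S 1 (sdeg [b] + 1)"
  unfolding hh_gen_def by (rule emb_homog[OF h_gcomp[of "gen b" "fst b"]]) auto

lemma HH_homog: "X \<in> homog S l e \<Longrightarrow> HH X \<in> homog S l (e + 1)"
  unfolding HH_def by (rule tder_hom[OF _ ip_homog hh_homog])

lemma HH_homs: "X \<in> homs S \<Longrightarrow> HH X \<in> homs S"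
  by (rule tlin_homs[OF tlins(1)]) (auto intro!: hom_homs[OF HH_homog[OF hom_word]])

lemma IP_homog: "X \<in> homog S l e \<Longrightarrow> IP X \<in> homog S l e"
  unfolding IP_def by (rule amap_hom[OF _ ip_homog])

lemma PP_homog: "X \<in> homog S l e \<Longrightarrow> PP X \<in> homog M l e"
  unfolding PP_def by (rule amap_hom, assumption, rule emb_homog[OF proj_gcomp[of "gen _" "fst _"]]) auto

lemma II_homog: "X \<in> homog M l e \<Longrightarrow> II X \<in> homog S l e"
  unfolding II_def by (rule amap_hom, assumption, rule emb_homog[OF incl_gcomp[of "gen _" "fst _"]]) auto

lemma HH_emb: "v \<in> free_on S \<Longrightarrow> HH (emb v) = emb (h v)"
  by (rule tlin_emb[OF tlins(1) lin(3)]) (simp add: HH_def tder_letter hh_gen_def del: tder_word_eq)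

lemma II_emb: "II (emb v) = emb (incl v)"
  by (rule tlin_emb[OF tlins(3) lin(2)]) (simp add: II_def)

lemma PP_emb: "PP (emb v) = emb (proj v)"
  by (rule tlin_emb[OF tlins(4) lin(1)]) (simp add: PP_def)

lemma IP_eq: "IP X = II (PP X)"
  by (simp add: IP_def II_def PP_def amap_comp, simp add: II_emb[unfolded II_def] ip_def[abs_def])

lemma PP_II: "X \<in> homs M \<Longrightarrow> PP (II X) = X"
proof -
  assume X: "X \<in> homs M"
  have "PP (II X) = amap (\<lambda>b. PP (emb (incl (gen b)))) X" by (simp add: PP_def II_def amap_comp)
  also have "\<dots> = amap (\<lambda>b. word [b]) X"
    by (rule amap_eq_homs[OF X]) (simp add: PP_emb proj_incl)
  finally show ?thesis by (simp add: amap_id)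
qed

lemma HH_mult: "HH (X * Y) = HH X * Y + smap (IP X) * HH Y"
  by (simp add: HH_def IP_def tder_mult)

lemma smap_HH: "X \<in> homs S \<Longrightarrow> smap (HH X) = - HH (smap X)"
  by (rule smap_odd[OF tlins(1), of S S 1]) (auto intro!: HH_homog hom_word)

lemma smap_IP: "X \<in> homs S \<Longrightarrow> smap (IP X) = IP (smap X)"
  unfolding IP_def by (rule smap_amap[OF ip_homog])

lemma smap_d0: "X \<in> homs S \<Longrightarrow> smap (der d0 X) = - der d0 (smap X)"
  by (rule smap_der[OF d0_homog])

lemma letter_facts:
  assumes b: "b \<in> S"
  shows "der d0 (IP (word [b])) = 0" "IP (der d0 (word [b])) = 0" "HH (HH (word [b])) = 0"
    "IP (HH (word [b])) = 0" "HH (IP (word [b])) = 0" "PP (HH (word [b])) = 0"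
    "der d0 (HH (word [b])) + HH (der d0 (word [b])) = word [b] - IP (word [b])"
proof -
  have g: "gen b \<in> free_on S" using b by simp
  note f = g lin_free_on(1)[OF g] lin_free_on(2)[OF g] \<delta>_free_on[OF g] lin_free_on(3)[OF lin_free_on(2)[OF g]]
  have e: "word [b] = emb (gen b)" by simp
  show "der d0 (IP (word [b])) = 0" "IP (der d0 (word [b])) = 0" "HH (HH (word [b])) = 0"
    "IP (HH (word [b])) = 0" "HH (IP (word [b])) = 0" "PP (HH (word [b])) = 0"
    "der d0 (HH (word [b])) + HH (der d0 (word [b])) = word [b] - IP (word [b])"
    unfolding e IP_eq using homotopy[OF g]
    by (simp_all add: II_emb PP_emb HH_emb der_d0_emb f d_incl proj_d hh h_incl proj_h flinearD(4)[OF lin(2)]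
        emb_add[symmetric] emb_diff[symmetric] b tlin_0[OF tlins(3)] del: emb_gen lpart_gen)
qed

text \<open>Induction on the word. In the product rule the mixed terms contain \<open>d0\<close>
  after \<open>IP\<close> or \<open>IP\<close> after \<open>d0\<close>, which vanish on letters, or
  they cancel in pairs by the sign in \<open>smap_HH\<close>.\<close>

lemma homotopy_tensor: "X \<in> homs S \<Longrightarrow> der d0 (HH X) + HH (der d0 X) = X - IP X"
proof (rule tlin_eq_homs[of "\<lambda>X. der d0 (HH X) + HH (der d0 X)" "\<lambda>X. X - IP X" X S])
  fix w assume "set w \<subseteq> S"
  then show "der d0 (HH (word w)) + HH (der d0 (word w)) = word w - IP (word w)"
  proof (induction w)
    case (Cons b w)
    define X :: "('b, 'f) talg" where "X = word [b]"
    define Y :: "('b, 'f) talg" where "Y = word w"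
    have b: "b \<in> S" using Cons.prems by simp
    note L = letter_facts[OF b, folded X_def]
    have X: "X \<in> homs S" unfolding X_def by (rule homs_word) (use b in simp)
    have IPX: "IP X \<in> homs S" unfolding X_def by (rule hom_homs[OF IP_homog[OF hom_word]]) (use b in auto)
    have HX: "HH X \<in> homs S" by (rule HH_homs[OF X])
    have s1: "der d0 (smap (IP X)) = 0" using smap_d0[OF IPX] L(1) by (simp add: smap_def[symmetric] tlin_0[OF tlin_smap])
    have s2: "HH (smap X) = - smap (HH X)" using smap_HH[OF X] by simp
    have s3: "smap (IP (smap X)) = IP X" using smap_IP[OF X] smap_smap[of "IP X"] by simp
    have IH: "der d0 (HH Y) + HH (der d0 Y) = Y - IP Y" using Cons by (simp add: Y_def)
    have "der d0 (HH (X * Y)) + HH (der d0 (X * Y)) =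
      (der d0 (HH X) + HH (der d0 X)) * Y + IP X * (der d0 (HH Y) + HH (der d0 Y))"
      by (simp add: HH_mult der_mult tlin_add[OF tlin_der] tlin_add[OF tlins(1)] s1 s2 s3 L(2) tlin_0[OF tlin_smap]
          smap_smap algebra_simps)
    also have "\<dots> = X * Y - IP (X * Y)"
      unfolding L(7) IH by (simp add: algebra_simps IP_def amap_mult)
    finally show ?case by (simp add: X_def Y_def word_Cons[symmetric] del: der_word_eq)
  next
    case Nil
    have "HH 1 = 0" by (simp add: HH_def)
    then show ?case unfolding word_Nil by (simp add: tlin_0[OF tlin_der] tlin_0[OF tlins(1)] IP_def)
  qed
qed (intro tlin_intros tlin_compose[OF tlins(1)] tlin_compose[OF tlin_der] tlins tlin_der)+

lemma HH_1: "HH 1 = 0" using tder_word_eq[of ip hh_gen "[]"] by (simp add: HH_def word_Nil)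

text \<open>Expanding the square on a product produces h h, incl proj h and h incl proj on the first
  letter; the side conditions kill all three.\<close>

lemma HH_HH: "X \<in> homs S \<Longrightarrow> HH (HH X) = 0"
proof (rule tlin_eq_homs[OF tlin_compose[OF tlins(1) tlins(1)] tlin_zero])
  fix w assume "set w \<subseteq> S"
  then show "HH (HH (word w)) = 0"
  proof (induction w)
    case (Cons b w)
    define X :: "('b, 'f) talg" where "X = word [b]"
    define Y :: "('b, 'f) talg" where "Y = word w"
    have b: "b \<in> S" using Cons.prems by simp
    note L = letter_facts[OF b, folded X_def]
    have IPX: "IP X \<in> homs S" unfolding X_def by (rule hom_homs[OF IP_homog[OF hom_word]]) (use b in auto)
    have "HH (smap (IP X)) = 0" using smap_HH[OF IPX] L(5) by (simp add: tlin_0[OF tlin_smap])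
    then have "HH (HH (X * Y)) = 0" using Cons L
      by (simp add: HH_mult tlin_add[OF tlins(1)] tlin_0[OF tlin_smap] Y_def)
    then show ?case by (simp add: X_def Y_def word_Cons[symmetric])
  qed (simp add: word_Nil HH_1 tlin_0[OF tlins(1)])
qed

lemma PP_HH: "X \<in> homs S \<Longrightarrow> PP (HH X) = 0"
proof (rule tlin_eq_homs[OF tlin_compose[OF tlins(4) tlins(1)] tlin_zero])
  fix w assume "set w \<subseteq> S"
  then show "PP (HH (word w)) = 0"
  proof (induction w)
    case (Cons b w)
    define X :: "('b, 'f) talg" where "X = word [b]"
    define Y :: "('b, 'f) talg" where "Y = word w"
    have b: "b \<in> S" using Cons.prems by simp
    have m: "PP (A * B) = PP A * PP B" for A B by (simp add: PP_def amap_mult)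
    have "PP (HH (X * Y)) = 0" using Cons letter_facts(6)[OF b]
      by (simp add: HH_mult tlin_add[OF tlins(4)] m Y_def X_def)
    then show ?case by (simp add: X_def Y_def word_Cons[symmetric])
  qed (simp add: word_Nil HH_1 tlin_0[OF tlins(4)])
qed

lemma HH_II: "X \<in> homs M \<Longrightarrow> HH (II X) = 0"
proof (rule tlin_eq_homs[OF tlin_compose[OF tlins(1) tlins(3)] tlin_zero])
  fix w assume "set w \<subseteq> M"
  then show "HH (II (word w)) = 0"
  proof (induction w)
    case (Cons b w)
    have g: "gen b \<in> free_on M" using Cons.prems by simp
    have "HH (emb (incl (gen b))) = 0"
      using HH_emb[OF lin_free_on(3)[OF g]] h_incl[OF g] by simp
    then have "HH (emb (incl (gen b)) * II (word w)) = 0" using Cons by (simp add: HH_mult)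
    then show ?case by (simp add: II_def amap_word_Cons)
  qed (simp add: word_Nil HH_1 II_def)
qed

text \<open>The inclusion solves J = II - HH t J. It is solved on generators, and the side
  conditions spread the equation to all words (\<open>Jw\<close>). The differential of the model is
  \<open>PP\<close> after \<open>t\<close> on these solutions, and \<open>PP\<close> is a left
  inverse of \<open>J\<close>.\<close>

theorem minimal_model_above: "\<exists>dM g. ainf M dM \<and> mini M dM \<and> qi M dM S d g"
proof -
  define Q where "Q = (\<lambda>b n w. set w \<subseteq> S \<and> length w = 1 + n \<and> sdeg w = sdeg [b :: nat \<times> 'm])"
  have Q: "fsupp (Q b) = homog S 1 (sdeg [b])" for b by (simp add: Q_def homog_def)
  have ib: "b \<in> M \<Longrightarrow> incl (gen b) \<in> gcomp S (fst b)" for b by (rule incl_gcomp) simp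
  have HTh: "HH (der t X) \<in> homog S l e" if "X \<in> homog S l e" for X l e
    using HH_homog[OF der_t_homog[OF that]] by simp
  have HTraise: "agree (Suc n) (HH (der t X)) (HH (der t Y))" if "agree n X Y" "X \<in> homs S" "Y \<in> homs S" for X Y n
    by (rule agree_tlin[OF tlins(1) agree_tlin_raise[OF tlin_der that der_t_word0]])
  define G where "G = (\<lambda>g b. if b \<in> M then emb (incl (gen b)) - HH (der t (g b)) else 0)"
  have "\<exists>g. (\<forall>b. G g b = g b) \<and> (\<forall>b. g b \<in> fsupp (Q b))"
  proof (rule fps_fixed_point)
    fix n :: nat and g g' :: "nat \<times> 'm \<Rightarrow> ('b, 'f) talg"
    assume g: "\<forall>b. g b \<in> fsupp (Q b)" "\<forall>b. g' b \<in> fsupp (Q b)" and ag: "\<forall>b. agree n (g b) (g' b)"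
    have "agree (Suc n) (HH (der t (g b))) (HH (der t (g' b)))" for b
      by (rule HTraise[OF ag[rule_format]]) (use g Q hom_homs in blast)+
    then show "\<forall>b. agree (Suc n) (G g b) (G g' b)"
      by (auto simp: G_def intro!: agree_diff)
  next
    fix g :: "nat \<times> 'm \<Rightarrow> ('b, 'f) talg"
    assume g: "\<forall>b. g b \<in> fsupp (Q b)"
    have "emb (incl (gen b)) - HH (der t (g b)) \<in> homog S 1 (sdeg [b])" if "b \<in> M" for b
    proof (rule hom_diff)
      show "emb (incl (gen b)) \<in> homog S 1 (sdeg [b])"
        by (rule emb_homog[OF ib[OF that]]) simp
      show "HH (der t (g b)) \<in> homog S 1 (sdeg [b])" by (rule HTh) (use g Q in blast)
    qed
    then show "\<forall>b. G g b \<in> fsupp (Q b)" unfolding Q G_def by (metis hom_0)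
  qed
  then obtain g where g1: "\<And>b. G g b = g b" and g2: "\<And>b. g b \<in> homog S 1 (sdeg [b])"
    unfolding Q by blast
  have gM: "g b = II (word [b]) - HH (der t (g b))" if "b \<in> M" for b
    using g1[of b] that by (simp add: G_def II_def)
  define J where "J = amap g"
  have tJ: "tlin J" by (simp add: J_def tlin_amap)
  have Jh: "J X \<in> homs S" if "X \<in> homs M" for X
    unfolding J_def by (rule amap_homs[OF that hom_homs[OF g2]])
  have IIh: "II X \<in> homs S" if "X \<in> homs M" for X
    by (rule tlin_homs[OF tlins(3) that]) (auto intro!: hom_homs[OF II_homog[OF hom_word]])
  have HJ0: "HH Y = 0" if "Y = II X - HH (der t Y)" "X \<in> homs M" "Y \<in> homs S" for X Y
  proof -
    have "HH Y = HH (II X - HH (der t Y))" using that(1) by simp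
    then show ?thesis using HH_II[OF that(2)] HH_HH[OF der_t_homs[OF that(3)]] by (simp add: tlin_diff[OF tlins(1)])
  qed
  have PJ: "PP Y = X" if "Y = II X - HH (der t Y)" "X \<in> homs M" "Y \<in> homs S" for X Y
  proof -
    have "PP Y = PP (II X - HH (der t Y))" using that(1) by simp
    then show ?thesis using PP_II[OF that(2)] PP_HH[OF der_t_homs[OF that(3)]] by (simp add: tlin_diff[OF tlins(4)])
  qed
  \<comment> \<open>The equation itself yields HH U = 0 and IP U = II of the generator for each
    solution U. With these two facts the product of two solutions is a solution.\<close>
  have Jw: "J X = II X - HH (der t (J X))" if "X \<in> homs M" for X
  proof (rule tlin_eq_homs[OF tJ _ that])
    show "tlin (\<lambda>X. II X - HH (der t (J X)))"
      by (intro tlin_minus tlins tlin_compose[OF tlins(1)] tlin_compose[OF tlin_der] tJ)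
  next
    fix w assume "set w \<subseteq> M"
    then show "J (word w) = II (word w) - HH (der t (J (word w)))"
    proof (induction w)
      case Nil
      then show ?case by (simp add: word_Nil J_def II_def tlin_0[OF tlins(1)])
    next
      case (Cons b w)
      define U where "U = g b"
      define V where "V = J (word w)"
      define i where "i = II (word [b])"
      have b: "b \<in> M" and w: "set w \<subseteq> M" using Cons.prems by auto
      have hb: "word [b] \<in> (homs M :: ('m, 'f) talg set)" "word w \<in> (homs M :: ('m, 'f) talg set)"
        using b w by (auto intro!: homs_word)
      have U: "U \<in> homs S" "U = i - HH (der t U)" using hom_homs[OF g2] gM[OF b] by (auto simp: U_def i_def)
      have V: "V \<in> homs S" "V = II (word w) - HH (der t V)" using Jh[OF hb(2)] Cons.IH[OF w] by (auto simp: V_def)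
      have HU: "HH U = 0" by (rule HJ0[OF U(2)[unfolded i_def] hb(1) U(1)])
      have HV: "HH V = 0" by (rule HJ0[OF V(2) hb(2) V(1)])
      have IPU: "IP U = i" using PJ[OF U(2)[unfolded i_def] hb(1) U(1)] by (simp add: IP_eq i_def)
      have "HH (smap U) = 0" using smap_HH[OF U(1)] HU by (simp add: tlin_0[OF tlin_smap])
      moreover have "smap (IP (smap U)) = i" using smap_IP[OF U(1)] smap_smap[of "IP U"] IPU by simp
      ultimately have "HH (der t (U * V)) = HH (der t U) * V + i * HH (der t V)"
        by (simp add: der_mult tlin_add[OF tlins(1)] HH_mult HV)
      also have "HH (der t U) = i - U" using U(2) by (simp add: algebra_simps)
      also have "HH (der t V) = II (word w) - V" using V(2) by (simp add: algebra_simps)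
      also have "(i - U) * V + i * (II (word w) - V) = i * II (word w) - U * V" by (simp add: algebra_simps)
      also have "i * II (word w) = II (word (b # w))" by (simp add: i_def II_def amap_word)
      finally show ?case by (simp add: J_def amap_word_Cons U_def V_def)
    qed
  qed
  define dM where "dM = (\<lambda>b. PP (der t (g b)))"
  have dMh: "dM b \<in> homog M 1 (sdeg [b] - 1)" for b
    unfolding dM_def by (rule PP_homog[OF der_t_homog[OF g2]])
  have dM0: "dM b $ 0 = 0" for b
  proof -
    have "agree 1 (der t (g b)) 0" using der_t_nth0[OF hom_homs[OF g2]] by (simp add: agree_def)
    from agree_tlin[OF tlins(4) this] show ?thesis by (simp add: dM_def agree_def tlin_0[OF tlins(4)])
  qed
  \<comment> \<open>Both sides solve Z = II (dM b) - HH (t Z). The right side gains one order over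
    Z, so there is only one solution.\<close>
  have dJ: "der d (g b) = J (dM b)" if b: "b \<in> M" for b
  proof -
    define X where "X = der d (g b)"
    have gh: "g b \<in> homs S" by (rule hom_homs[OF g2])
    have Xh: "X \<in> homs S" unfolding X_def by (rule der_d_homs[OF gh])
    have th: "der t (g b) \<in> homs S" by (rule der_t_homs[OF gh])
    have gf: "gen b \<in> free_on M" using b by simp
    have "der d0 (II (word [b])) = 0"
      using der_d0_emb[OF lin_free_on(3)[OF gf]] d_incl[OF gf] by (simp add: II_def del: lpart_gen)
    then have "der d0 (g b) = - der d0 (HH (der t (g b)))"
      using arg_cong[OF gM[OF b], of "der d0"] by (simp add: tlin_diff[OF tlin_der])
    moreover have "der d0 (HH (der t (g b))) = der t (g b) - IP (der t (g b)) - HH (der d0 (der t (g b)))"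
      using homotopy_tensor[OF th] by (simp add: algebra_simps)
    ultimately have 1: "X = IP (der t (g b)) + HH (der d0 (der t (g b)))"
      by (simp add: X_def der_split)
    have "0 = der d X" unfolding X_def using ainf_der_der[OF ainf gh] by simp
    also have "\<dots> = der d0 X + der t X" by (rule der_split)
    also have "der d0 X = der d0 (der t (g b))" unfolding X_def der_split by (simp add: tlin_add[OF tlin_der] d0_d0[OF gh])
    finally have "der d0 (der t (g b)) = - der t X" by (simp add: eq_neg_iff_add_eq_0)
    with 1 have X: "X = II (dM b) - HH (der t X)" by (simp add: IP_eq dM_def tlin_neg[OF tlins(1)])
    define Y where "Y = J (dM b)"
    have dMb: "dM b \<in> homs M" by (rule hom_homs[OF dMh])
    have Yh: "Y \<in> homs S" unfolding Y_def by (rule Jh[OF dMb])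
    have Y: "Y = II (dM b) - HH (der t Y)" unfolding Y_def by (rule Jw[OF dMb])
    have "agree n X Y" for n
    proof (induction n)
      case (Suc n)
      have "agree (Suc n) (II (dM b) - HH (der t X)) (II (dM b) - HH (der t Y))"
        by (intro agree_diff agree_refl HTraise Suc Xh Yh)
      then show ?case using X Y by simp
    qed simp
    then show ?thesis unfolding X_def[symmetric] Y_def[symmetric] by (rule agree_all)
  qed
  have "mor M dM S d g" unfolding mor_def using g2 dJ by (simp add: J_def)
  moreover have "ainf M dM"
    unfolding ainf_def
  proof (intro ballI conjI dMh)
    fix b assume b: "b \<in> M"
    have h1: "dM b \<in> homs M" by (rule hom_homs[OF dMh])
    have h2: "der dM (dM b) \<in> homs M" by (rule der_homs[OF h1 hom_homs[OF dMh]])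
    \<comment> \<open>\<open>PP\<close> inverts \<open>J\<close> from the left, so the square of
      \<open>dM\<close> vanishes because the square of \<open>d\<close> does.\<close>
    have "J (der dM (dM b)) = der d (J (dM b))"
      unfolding J_def by (rule der_amap_eq[OF g2 hom_homs[OF dMh] _ h1, symmetric]) (use dJ in \<open>simp add: J_def\<close>)
    also have "\<dots> = der d (der d (g b))" by (simp add: dJ[OF b])
    also have "\<dots> = 0" by (rule ainf_der_der[OF ainf hom_homs[OF g2]])
    finally have "PP (J (der dM (dM b))) = 0" by (simp add: tlin_0[OF tlins(4)])
    then show "der dM (dM b) = 0" using PJ[OF Jw[OF h2] h2 Jh[OF h2]] by simp
  qed
  moreover have m: "mini M dM" using dM0 by (simp add: mini_def)
  moreover have "lpart g v = incl v" if "v \<in> free_on M" for v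
  proof (rule flinear_eq_free_on[OF flinear_lpart lin(2) _ that])
    fix b assume b: "b \<in> M"
    have "agree 1 (HH (der t (g b))) (HH (der t 0))"
      using HTraise[OF agree_0 hom_homs[OF g2[of b]], of 0] by simp
    then have "HH (der t (g b)) $ 0 = 0" by (simp add: agree_def tlin_0[OF tlin_der] tlin_0[OF tlins(1)])
    then have "g b $ 0 = letter (incl (gen b))" using arg_cong[OF gM[OF b], of "\<lambda>X. X $ 0"] by (simp add: II_def emb_def)
    then show "lpart g (gen b) = incl (gen b)" by simp
  qed
  ultimately show ?thesis using incl_homology_iso[OF m] unfolding qi_def by blast
qed

end

subsection \<open>Splitting a chain complex\<close>

interpretation fvp: vector_space_pair "fscale :: 'f::field \<Rightarrow> ('b \<Rightarrow>\<^sub>0 'f) \<Rightarrow> _" "fscale :: 'f \<Rightarrow> ('c \<Rightarrow>\<^sub>0 'f) \<Rightarrow> _"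
  by unfold_locales

lemma subspace_gcomp: "fv.subspace (gcomp S p)"
  by (rule fv.subspaceI) (auto simp: gcomp_add gcomp_fscale)

lemma subspace_image: "flinear g \<Longrightarrow> fv.subspace V \<Longrightarrow> fv.subspace (g ` V)"
  by (rule fvp.linear_subspace_image)

lemma subspace_projection:
  assumes "fv.subspace V"
  shows "\<exists>\<beta>. flinear \<beta> \<and> (\<forall>v. \<beta> v \<in> V) \<and> (\<forall>v\<in>V. \<beta> v = v)"
  using fvp.linear_exists_left_inverse_on[OF flinear_id assms] by (auto simp: image_subset_iff)

lemma homogeneous_ext:
  assumes g: "\<And>p. flinear (g p)" and v: "v \<in> gcomp S p"
  shows "lin_ext (\<lambda>b. g (fst b) (gen b)) v = g p v"
  unfolding flinear_eq_lin_ext[OF g, of _ v] by (rule lin_ext_cong) (use v in \<open>auto simp: gcomp_def free_on_def\<close>)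

lemma free_on_gen_eq:
  assumes "flinear f" "flinear g" "\<And>p v. v \<in> gcomp S p \<Longrightarrow> f v = g v" "v \<in> free_on S"
  shows "f v = g v"
  by (rule flinear_eq_free_on[OF assms(1,2) _ assms(4)]) (use assms(3)[of "gen _" "fst _"] in auto)

text \<open>In each degree choose a section \<open>g\<close> of the differential over the boundaries
  \<open>B\<close> and a projection \<open>\<beta>\<close> onto \<open>B\<close>. The cycles then
  split into \<open>B\<close> and the cycles killed by \<open>\<beta>\<close>, and the latter
  represent homology.\<close>

lemma split_exists:
  fixes S :: "(nat \<times> 'b) set" and d :: "nat \<times> 'b \<Rightarrow> ('b, 'f::field) talg"
  assumes a: "ainf S d"
  shows "\<exists>(M :: (nat \<times> ('b, 'f) gvec) set) proj incl h. split_complex S d M proj incl h"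
proof -
  define \<delta> where "\<delta> = lpart d"
  have cc: "chain_complex S \<delta>" unfolding \<delta>_def by (rule ainf_complex[OF a])
  have ld: "flinear \<delta>" and d0: "\<And>v. v \<in> gcomp S 0 \<Longrightarrow> \<delta> v = 0"
    and dS: "\<And>v p. v \<in> gcomp S (Suc p) \<Longrightarrow> \<delta> v \<in> gcomp S p"
    and dd: "\<And>v. v \<in> free_on S \<Longrightarrow> \<delta> (\<delta> v) = 0"
    using cc by (auto simp: chain_complex_def)
  have dp: "\<delta> v \<in> gcomp S (p - 1)" if "v \<in> gcomp S p" for p v
    using dS[of v "p - 1"] d0[of v] that by (cases p) auto
  define B where "B = (\<lambda>p. \<delta> ` gcomp S (Suc p))"
  have BS: "B p \<subseteq> gcomp S p" for p using dS by (auto simp: B_def)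
  have sB: "fv.subspace (B p)" for p unfolding B_def by (rule subspace_image[OF ld subspace_gcomp])
  have "\<exists>g. g ` UNIV \<subseteq> gcomp S (Suc p) \<and> flinear g \<and> (\<forall>v\<in>\<delta> ` gcomp S (Suc p). \<delta> (g v) = v)" for p
    using fvp.linear_exists_right_inverse_on[OF ld subspace_gcomp, of S "Suc p"] by auto
  then obtain g where g: "\<And>p v. g p v \<in> gcomp S (Suc p)" "\<And>p. flinear (g p)" "\<And>p v. v \<in> B p \<Longrightarrow> \<delta> (g p v) = v"
    unfolding B_def by (metis range_subsetD)
  obtain \<beta> where \<beta>: "\<And>p. flinear (\<beta> p)" "\<And>p v. \<beta> p v \<in> B p" "\<And>p v. v \<in> B p \<Longrightarrow> \<beta> p v = v"
    using subspace_projection[OF sB] by metis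
  \<comment> \<open>Projects onto the cycles. In degree 0 the index \<open>p - 1\<close> is again 0,
    which is harmless because \<delta> v = 0 there.\<close>
  define z where "z = (\<lambda>p v. v - g (p - 1) (\<delta> v))"
  have lz: "flinear (z p)" for p
    unfolding z_def by (rule flinear_diff[OF flinear_id flinear_compose[OF g(2) ld]])
  have zg: "z p v \<in> gcomp S p" and zc: "\<delta> (z p v) = 0" if v: "v \<in> gcomp S p" for p v
  proof (atomize (full), cases p)
    case 0
    then show "z p v \<in> gcomp S p \<and> \<delta> (z p v) = 0" using d0[of v] v
      by (simp add: z_def flinearD(4)[OF g(2)])
  next
    case (Suc q)
    have "\<delta> v \<in> B q" using v Suc by (auto simp: B_def)
    then show "z p v \<in> gcomp S p \<and> \<delta> (z p v) = 0" using v Suc g(1)[of q] g(3)[of "\<delta> v" q]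
      by (auto simp: z_def flinearD[OF ld] intro: gcomp_diff)
  qed
  have zid: "z p v = v" if "\<delta> v = 0" for p v using that by (simp add: z_def flinearD(4)[OF g(2)])
  have zgB: "z (Suc p) (g p v) = 0" if "v \<in> B p" for p v using g(3)[OF that] by (simp add: z_def)
  \<comment> \<open>The complement of the boundaries inside the cycles: the harmonic part.\<close>
  define Hp where "Hp = (\<lambda>p. {v \<in> gcomp S p. \<delta> v = 0 \<and> \<beta> p v = 0})"
  have sH: "fv.subspace (Hp p)" for p
    by (rule fv.subspaceI) (auto simp: Hp_def gcomp_add gcomp_fscale flinearD[OF ld] flinearD[OF \<beta>(1)])
  have "\<exists>C. C \<subseteq> Hp p \<and> fv.independent C \<and> Hp p \<subseteq> fv.span C" for p
    using fv.maximal_independent_subset[of "Hp p"] by metis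
  then obtain C where C: "\<And>p. C p \<subseteq> Hp p" "\<And>p. fv.independent (C p)" "\<And>p. Hp p \<subseteq> fv.span (C p)" by metis
  \<comment> \<open>Basis vectors of the harmonic part serve as the names of the new generators, so
    the inclusion just evaluates a name.\<close>
  define M where "M = {(p, x). x \<in> C p}"
  define incl :: "(('b, 'f) gvec, 'f) gvec \<Rightarrow> ('b, 'f) gvec" where "incl = lin_ext snd"
  have li: "flinear incl" by (simp add: incl_def flinear_lin_ext)
  have iH: "incl m \<in> Hp p" if "m \<in> gcomp M p" for m p
  proof -
    have "snd b \<in> Hp p" if "b \<in> Poly_Mapping.keys m" for b
      using that \<open>m \<in> gcomp M p\<close> C(1) by (force simp: gcomp_def free_on_def M_def)
    then show ?thesis unfolding incl_def lin_ext_def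
      by (intro fv.subspace_sum[OF sH] fv.subspace_scale[OF sH])
  qed
  have inj: "inj_on incl (gcomp M p)" for p
  proof (rule inj_onI)
    fix m m' assume m: "m \<in> gcomp M p" "m' \<in> gcomp M p" and e: "incl m = incl m'"
    define n where "n = m - m'"
    have n: "n \<in> gcomp M p" using m by (simp add: n_def gcomp_diff)
    have keys: "Poly_Mapping.keys n \<subseteq> {p} \<times> C p" using n by (force simp: gcomp_def free_on_def M_def)
    have "0 = incl n" using e by (simp add: n_def flinearD[OF li])
    also have "\<dots> = (\<Sum>b\<in>Poly_Mapping.keys n. fscale (Poly_Mapping.lookup n b) (snd b))" by (simp add: incl_def lin_ext_def)
    also have "\<dots> = (\<Sum>x\<in>snd ` Poly_Mapping.keys n. fscale (Poly_Mapping.lookup n (p, x)) x)"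
      by (subst sum.reindex) (use keys in \<open>auto simp: inj_on_def intro!: sum.cong\<close>)
    finally have s: "(\<Sum>x\<in>snd ` Poly_Mapping.keys n. fscale (Poly_Mapping.lookup n (p, x)) x) = 0" by simp
    have "Poly_Mapping.lookup n b = 0" if b: "b \<in> Poly_Mapping.keys n" for b
    proof -
      have "Poly_Mapping.lookup n (p, snd b) = 0"
        by (rule fv.independentD[OF C(2)[of p] _ _ s]) (use keys b in auto)
      then show ?thesis using keys b by (metis SigmaD1 prod.collapse singletonD subsetD)
    qed
    then have "n = 0" by (metis in_keys_iff lookup_zero poly_mapping_eqI)
    then show "m = m'" by (simp add: n_def)
  qed
  have "\<exists>c. range c \<subseteq> gcomp M p \<and> flinear c \<and> (\<forall>v\<in>gcomp M p. c (incl v) = v)" for p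
    using fvp.linear_exists_left_inverse_on[OF li subspace_gcomp inj] by blast
  then obtain c where c: "\<And>p v. c p v \<in> gcomp M p" "\<And>p. flinear (c p)" "\<And>p v. v \<in> gcomp M p \<Longrightarrow> c p (incl v) = v"
    by (metis range_subsetD)
  have ic: "incl (c p u) = u" if "u \<in> Hp p" for p u
  proof -
    have "fv.subspace (incl ` gcomp M p)" by (rule subspace_image[OF li subspace_gcomp])
    moreover have "C p \<subseteq> incl ` gcomp M p"
    proof
      fix x assume "x \<in> C p"
      then have "gen (p, x) \<in> gcomp M p" "incl (gen (p, x)) = x" by (auto simp: M_def incl_def)
      then show "x \<in> incl ` gcomp M p" by (metis imageI)
    qed
    ultimately have "fv.span (C p) \<subseteq> incl ` gcomp M p" by (intro fv.span_minimal)
    then have "u \<in> incl ` gcomp M p" using C(3)[of p] that by blast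
    then obtain m where "m \<in> gcomp M p" "u = incl m" by blast
    then show ?thesis using c(3) by simp
  qed
  \<comment> \<open>The homotopy lifts the boundary part of the cycle part of \<open>v\<close> back
    along the differential; \<open>harm\<close> is what remains of that cycle part.\<close>
  define hp where "hp = (\<lambda>p v. g p (\<beta> p (z p v)))"
  define harm where "harm = (\<lambda>p v. z p v - \<beta> p (z p v))"
  define pp where "pp = (\<lambda>p v. c p (harm p v))"
  have lhp: "flinear (hp p)" for p unfolding hp_def by (rule flinear_compose[OF g(2) flinear_compose[OF \<beta>(1) lz]])
  have lha: "flinear (harm p)" for p unfolding harm_def by (rule flinear_diff[OF lz flinear_compose[OF \<beta>(1) lz]])
  have lpp: "flinear (pp p)" for p unfolding pp_def by (rule flinear_compose[OF c(2) lha])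
  have Bd: "\<delta> v = 0" if "v \<in> B p" for v p
    using that dd by (auto simp: B_def gcomp_free_on)
  have haH: "harm p v \<in> Hp p" if "v \<in> gcomp S p" for p v
    using zg[OF that] zc[OF that] \<beta>(2)[of p "z p v"] BS[of p] Bd[of "\<beta> p (z p v)" p] \<beta>(3)[OF \<beta>(2)]
    by (auto simp: Hp_def harm_def flinearD[OF ld] flinearD[OF \<beta>(1)] intro!: gcomp_diff)
  define h where "h = lin_ext (\<lambda>b. hp (fst b) (gen b))"
  define proj where "proj = lin_ext (\<lambda>b. pp (fst b) (gen b))"
  have lh: "flinear h" and lp: "flinear proj" by (auto simp: h_def proj_def flinear_lin_ext)
  have h: "h v = hp p v" and pr: "proj v = pp p v" if "v \<in> gcomp S p" for v p
    unfolding h_def proj_def by (rule homogeneous_ext[OF lhp that] homogeneous_ext[OF lpp that])+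
  have hg: "h v \<in> gcomp S (Suc p)" if "v \<in> gcomp S p" for v p
    by (simp add: h[OF that] hp_def g(1))
  have H_S: "v \<in> gcomp S p" if "v \<in> Hp p" for v p using that by (simp add: Hp_def)
  have harmH: "harm p v = v" "hp p v = 0" if "v \<in> Hp p" for v p
    using that zid by (auto simp: Hp_def harm_def hp_def flinearD(4)[OF g(2)])
  have ip: "incl (proj v) = harm p v" if "v \<in> gcomp S p" for p v
    using ic[OF haH[OF that]] by (simp add: pr[OF that] pp_def)
  have "split_complex S d M proj incl h"
  proof (rule split_complex.intro, unfold \<delta>_def[symmetric])
    show "ainf S d" by (rule a)
    show "flinear proj" "flinear incl" "flinear h" by (rule lp li lh)+
    show "proj v \<in> gcomp M p" if "v \<in> gcomp S p" for v p by (simp add: pr[OF that] pp_def c(1))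
    show "incl m \<in> gcomp S p" if "m \<in> gcomp M p" for m p by (rule H_S[OF iH[OF that]])
    show "h v \<in> gcomp S (Suc p)" if "v \<in> gcomp S p" for v p by (rule hg[OF that])
    show "\<delta> (incl m) = 0" if "m \<in> free_on M" for m
      by (rule free_on_gen_eq[OF flinear_compose[OF ld li] flinear_zero _ that]) (use iH in \<open>auto simp: Hp_def\<close>)
    show "proj (\<delta> v) = 0" if "v \<in> free_on S" for v
    proof (rule free_on_gen_eq[OF flinear_compose[OF lp ld] flinear_zero _ that])
      fix p and v :: "('b, 'f) gvec" assume v: "v \<in> gcomp S p"
      show "proj (\<delta> v) = 0"
      proof (cases p)
        case 0
        then show ?thesis using d0[of v] v by (simp add: flinearD[OF lp])
      next
        case (Suc q)
        have b: "\<delta> v \<in> B q" using v Suc by (auto simp: B_def)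
        have "harm q (\<delta> v) = 0" using zid[OF Bd[OF b]] \<beta>(3)[OF b] by (simp add: harm_def)
        then show ?thesis using pr[OF subsetD[OF BS b]] by (simp add: pp_def flinearD(4)[OF c(2)])
      qed
    qed
    show "proj (incl m) = m" if "m \<in> free_on M" for m
      by (rule free_on_gen_eq[OF flinear_compose[OF lp li] flinear_id _ that])
        (use pr[OF H_S[OF iH]] harmH(1)[OF iH] c(3) in \<open>simp add: pp_def\<close>)
    show "\<delta> (h v) + h (\<delta> v) = v - incl (proj v)" if "v \<in> free_on S" for v
    proof (rule free_on_gen_eq[of "\<lambda>v. \<delta> (h v) + h (\<delta> v)" "\<lambda>v. v - incl (proj v)", OF _ _ _ that])
      show "flinear (\<lambda>v. \<delta> (h v) + h (\<delta> v))" "flinear (\<lambda>v. v - incl (proj v))"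
        by (rule flinear_plus flinear_diff flinear_compose[OF ld lh] flinear_compose[OF lh ld] flinear_id flinear_compose[OF li lp])+
      fix p and v :: "('b, 'f) gvec" assume v: "v \<in> gcomp S p"
      have 1: "\<delta> (h v) = \<beta> p (z p v)" using g(3)[OF \<beta>(2)] by (simp add: h[OF v] hp_def)
      have 2: "h (\<delta> v) = v - z p v"
      proof (cases p)
        case 0
        then show ?thesis using d0[of v] v by (simp add: flinearD[OF lh] zid)
      next
        case (Suc q)
        have b: "\<delta> v \<in> B q" using v Suc by (auto simp: B_def)
        show ?thesis using h[OF subsetD[OF BS b]] zid[OF Bd[OF b]] \<beta>(3)[OF b] Suc by (simp add: hp_def z_def)
      qed
      show "\<delta> (h v) + h (\<delta> v) = v - incl (proj v)"
        unfolding 1 2 ip[OF v] by (simp add: harm_def)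
    qed
    show "h (h v) = 0" if "v \<in> free_on S" for v
    proof (rule free_on_gen_eq[OF flinear_compose[OF lh lh] flinear_zero _ that])
      fix p and v :: "('b, 'f) gvec" assume v: "v \<in> gcomp S p"
      show "h (h v) = 0" unfolding h[OF hg[OF v]] unfolding h[OF v] unfolding hp_def
        by (simp add: zgB[OF \<beta>(2)] flinearD(4)[OF g(2)] flinearD(4)[OF \<beta>(1)])
    qed
    show "h (incl m) = 0" if "m \<in> free_on M" for m
      by (rule free_on_gen_eq[OF flinear_compose[OF lh li] flinear_zero _ that])
        (use h[OF H_S[OF iH]] harmH(2)[OF iH] in simp)
    show "proj (h v) = 0" if "v \<in> free_on S" for v
    proof (rule free_on_gen_eq[OF flinear_compose[OF lp lh] flinear_zero _ that])
      fix p and v :: "('b, 'f) gvec" assume v: "v \<in> gcomp S p"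
      show "proj (h v) = 0" unfolding pr[OF hg[OF v]] unfolding h[OF v] unfolding hp_def pp_def harm_def
        by (simp add: zgB[OF \<beta>(2)] flinearD(4)[OF c(2)] flinearD(4)[OF \<beta>(1)])
    qed
  qed
  then show ?thesis by blast
qed

subsection \<open>Uniqueness of minimal models\<close>

lemma mini_lpart:
  assumes "mini S d" "v \<in> free_on S" shows "lpart d v = 0"
  by (rule flinear_eq_free_on[OF flinear_lpart flinear_zero _ assms(2)])
    (use assms(1) in \<open>auto simp: mini_def flinearD[OF flinear_unletter]\<close>)

lemma mini_cycles: "mini S d \<Longrightarrow> cycles S (lpart d) p = gcomp S p"
  by (auto simp: cycles_def gcomp_free_on mini_lpart)

lemma mini_boundaries: "mini S d \<Longrightarrow> boundaries S (lpart d) p = {0}"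
  unfolding boundaries_def
  by (auto simp: mini_lpart gcomp_free_on[of _ S "Suc p"] intro!: image_eqI[where x = 0])

lemma mini_qi_inverse:
  fixes S :: "(nat \<times> 's) set" and d :: "nat \<times> 's \<Rightarrow> ('s, 'f::field) talg"
    and S' :: "(nat \<times> 't) set"
  assumes a: "ainf S d" "ainf S' d'" and m: "mini S d" "mini S' d'" and F: "qi S d S' d' F"
  shows "\<exists>G. qi S' d' S d G"
proof -
  from mini_qi_linear_inverse[OF assms] obtain J where J: "flinear J" "\<And>p v. v \<in> gcomp S' p \<Longrightarrow> J v \<in> gcomp S p"
    "\<And>v. v \<in> free_on S' \<Longrightarrow> lpart F (J v) = v" "\<And>v. v \<in> free_on S \<Longrightarrow> J (lpart F v) = v" by metis
  have M: "mor S d S' d' F" using F by (simp add: qi_def)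
  from mor_inverse[OF a M J] obtain G where G: "mor S' d' S d G" "\<And>b. b \<in> S' \<Longrightarrow> G b $ 0 = letter (J (gen b))" by blast
  have l: "lpart G v = J v" if "v \<in> free_on S'" for v
    by (rule flinear_eq_free_on[OF flinear_lpart J(1) _ that]) (simp add: G(2))
  have "induces_homology_iso S' (lpart d') S (lpart d) (lpart G)"
    unfolding induces_homology_iso_def mini_cycles[OF m(1)] mini_cycles[OF m(2)] mini_boundaries[OF m(1)] mini_boundaries[OF m(2)]
  proof (intro allI conjI ballI impI)
    fix p and z :: "('t, 'f) gvec" assume z: "z \<in> gcomp S' p" "lpart G z \<in> {0}"
    then have "J z = 0" using l gcomp_free_on by fastforce
    then show "z \<in> {0}" using J(3)[OF gcomp_free_on[OF z(1)]] by (simp add: flinearD(4)[OF flinear_lpart])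
  next
    fix p and z :: "('s, 'f) gvec" assume z: "z \<in> gcomp S p"
    have "lpart F z \<in> gcomp S' p" by (rule lpart_gcomp[OF mor_homog[OF M] z])
    moreover then have "z - lpart G (lpart F z) \<in> {0}"
      using l[OF gcomp_free_on] J(4)[OF gcomp_free_on[OF z]] by simp
    ultimately show "\<exists>y\<in>gcomp S' p. z - lpart G y \<in> {0}" by blast
  qed
  then show ?thesis using G(1) by (auto simp: qi_def)
qed

text \<open>For a minimal model M mapping to S, the composite M to S to H joins minimal structures
  and is invertible; H to M to S is the arrow wanted.\<close>

lemma minimal_model_reverse:
  fixes S :: "(nat \<times> 's) set" and d :: "nat \<times> 's \<Rightarrow> ('s, 'f::field) talg"
  assumes "ainf H dH" "mini H dH" "ainf S d" "qi S d H dH F"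
  shows "\<exists>G. qi H dH S d G"
proof -
  obtain M :: "(nat \<times> ('s, 'f) gvec) set" and proj incl h where "split_complex S d M proj incl h"
    using split_exists[OF assms(3)] by blast
  then obtain dM I where M: "ainf M dM" "mini M dM" and I: "qi M dM S d I"
    using split_complex.minimal_model_above by blast
  obtain R where "qi H dH M dM R"
    using mini_qi_inverse[OF M(1) assms(1) M(2) assms(2) qi_comp[OF M(1) assms(3,1) I assms(4)]] by blast
  then show ?thesis using qi_comp[OF assms(1) M(1) assms(3) _ I] by blast
qed

text \<open>Compose both arrows with a projection of S onto a minimal model M. The maps H to M and K
  to M join minimal structures, so the second can be inverted.\<close>

lemma minimal_models_isomorphic:
  fixes S :: "(nat \<times> 's) set" and d :: "nat \<times> 's \<Rightarrow> ('s, 'f::field) talg"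
  assumes "ainf H dH" "mini H dH" "ainf K dK" "mini K dK" "ainf S d" "qi H dH S d F" "qi K dK S d G"
  shows "\<exists>R. qi H dH K dK R"
proof -
  obtain M :: "(nat \<times> ('s, 'f) gvec) set" and proj incl h where "split_complex S d M proj incl h"
    using split_exists[OF assms(5)] by blast
  then obtain dM P where M: "ainf M dM" "mini M dM" and P: "qi S d M dM P"
    using split_complex.minimal_model_below by blast
  obtain R where "qi M dM K dK R"
    using mini_qi_inverse[OF assms(3) M(1) assms(4) M(2) qi_comp[OF assms(3,5) M(1) assms(7) P]] by blast
  then show ?thesis using qi_comp[OF assms(1) M(1) assms(3) qi_comp[OF assms(1,5) M(1) assms(6) P]] by blast
qed

text \<open>Moves a minimal model across an arrow that points the wrong way. A model M of S maps to
  A through S, so H and M are both models of A and are isomorphic; then continue from M to S to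
  B.\<close>

lemma minimal_model_span:
  fixes S :: "(nat \<times> 's) set" and d :: "nat \<times> 's \<Rightarrow> ('s, 'f::field) talg"
  assumes "ainf H dH" "mini H dH" "ainf A dA" "ainf B dB" "ainf S d" "qi H dH A dA F" "qi S d A dA L" "qi S d B dB R"
  shows "\<exists>G. qi H dH B dB G"
proof -
  obtain M :: "(nat \<times> ('s, 'f) gvec) set" and proj incl h where "split_complex S d M proj incl h"
    using split_exists[OF assms(5)] by blast
  then obtain dM I where M: "ainf M dM" "mini M dM" and I: "qi M dM S d I"
    using split_complex.minimal_model_above by blast
  obtain Q where Q: "qi H dH M dM Q"
    using minimal_models_isomorphic[OF assms(1,2) M assms(3,6) qi_comp[OF M(1) assms(5,3) I assms(7)]] by blast
  show ?thesis
    using qi_comp[OF assms(1,5,4) qi_comp[OF assms(1) M(1) assms(5) Q I] assms(8)] by blast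
qed

subsection \<open>Removing the Koszul signs\<close>

lemma ksign_eqI: "a = b + 2 * c \<Longrightarrow> ksign a = ksign b"
  by (rule ksign_cong) simp

text \<open>\<open>tau w\<close> is the exponent of the sign of the \<open>n\<close>-fold tensor power of the desuspension on a word of length \<open>n\<close>.\<close>

fun tau :: "(nat \<times> 'b) list \<Rightarrow> int" where
  "tau [] = 0"
| "tau (b # w) = int (length w) * int (fst b) + tau w"

lemma tau_append: "tau (u @ v) = tau u + tau v + wdeg u * int (length v)"
  by (induction u) (auto simp: algebra_simps)

definition sig :: "('b, 'f::field) gten \<Rightarrow> ('b, 'f) gten" where
  "sig = lin_ext (\<lambda>w. fscale (ksign (tau w)) (gen w))"

lemma flinear_sig: "flinear sig" by (simp add: sig_def flinear_lin_ext)

lemma sig_gen: "sig (gen w) = fscale (ksign (tau w)) (gen w)" by (simp add: sig_def)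

lemma sig_sig [simp]: "sig (sig x) = x"
  by (rule flinear_eq_on[OF flinear_compose[OF flinear_sig flinear_sig] flinear_id])
    (simp add: sig_gen flinearD(2)[OF flinear_sig] fscale_fscale)

lemma sig_inj: "sig x = sig y \<longleftrightarrow> x = y" by (metis sig_sig)

lemma sig_free_on: "sig x \<in> free_on A \<longleftrightarrow> x \<in> free_on A"
proof -
  have "sig y \<in> free_on A" if "y \<in> free_on A" for y
    by (rule flinear_free_on[OF flinear_sig _ that]) (auto simp: sig_gen intro!: free_on_fscale)
  then show ?thesis by (metis sig_sig)
qed

lemma sig_letter [simp]: "sig (letter v) = letter v"
  by (rule flinear_eq_on[OF flinear_compose[OF flinear_sig flinear_letter] flinear_letter]) (simp add: sig_gen)

lemma flinear_mult_left: "flinear (\<lambda>y. x * (y :: ('b, 'f::field) gten))"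
  by unfold_locales (auto simp: algebra_simps fscale_mult_right)

lemma flinear_mult_right: "flinear (\<lambda>x. x * (y :: ('b, 'f::field) gten))"
  by unfold_locales (auto simp: algebra_simps fscale_mult_left)

lemma flinear_fscale: "flinear (fscale c)"
  by unfold_locales (auto simp: fscale_add_right fscale_fscale mult.commute)

lemma free_on_mult:
  assumes "x \<in> free_on A" "y \<in> free_on B" "\<And>u v. u \<in> A \<Longrightarrow> v \<in> B \<Longrightarrow> u @ v \<in> C"
  shows "(x :: ('b, 'f::field) gten) * y \<in> free_on C"
proof -
  have "gen u * y \<in> free_on C" if "u \<in> A" for u
    by (rule flinear_free_on[OF flinear_mult_left _ assms(2)]) (use that assms(3) in \<open>auto simp: gen_mult_gen\<close>)
  then show ?thesis by (rule flinear_free_on[OF flinear_mult_right _ assms(1)])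
qed

text \<open>The sign comes from moving the \<open>n\<close> desuspensions of the second factor past
  the first factor, which has degree \<open>g\<close>.\<close>

lemma sig_mult:
  assumes "x \<in> free_on {w. wdeg w = g}" "y \<in> free_on {w. length w = n}"
  shows "sig (x * y) = fscale (ksign (g * int n)) (sig x * sig y)"
proof (rule flinear_eq_free_on[OF flinear_compose[OF flinear_sig flinear_mult_right]
      flinear_compose[OF flinear_fscale flinear_compose[OF flinear_mult_right flinear_sig]] _ assms(1)])
  fix u :: "(nat \<times> 'a) list" assume u: "u \<in> {w. wdeg w = g}"
  show "sig (gen u * y) = fscale (ksign (g * int n)) (sig (gen u) * sig y)"
  proof (rule flinear_eq_free_on[OF flinear_compose[OF flinear_sig flinear_mult_left]
      flinear_compose[OF flinear_fscale flinear_compose[OF flinear_mult_left flinear_sig]] _ assms(2)])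
    fix v :: "(nat \<times> 'a) list" assume "v \<in> {w. length w = n}"
    with u show "sig (gen u * gen v) = fscale (ksign (g * int n)) (sig (gen u) * sig (gen v))"
      by (simp add: sig_gen gen_mult_gen fscale_mult_left fscale_mult_right fscale_fscale tau_append ksign_add mult_ac)
  qed
qed

text \<open>Covers structures (\<open>e = 2\<close>) and morphisms (\<open>e = 1\<close>) at
  once.\<close>

definition graded_ops :: "(nat \<times> 'b) set \<Rightarrow> (nat \<times> 'c) set \<Rightarrow> int \<Rightarrow>
    (nat \<Rightarrow> ('b, 'f::field) gvec \<Rightarrow> ('c, 'f) gten) \<Rightarrow> bool" where
  "graded_ops S S' e \<Delta> \<longleftrightarrow>
     (\<forall>n\<ge>1. flinear (\<Delta> n) \<and> (\<forall>b\<in>S. \<Delta> n (gen b) \<in> tcomp S' n (int (fst b) + int n - e)))"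

lemma graded_opsD:
  assumes "graded_ops S S' e \<Delta>"
  shows "flinear (\<Delta> (Suc n))" "b \<in> S \<Longrightarrow> \<Delta> (Suc n) (gen b) \<in> tcomp S' (Suc n) (int (fst b) + int (Suc n) - e)"
  using assms le_add1[of 1 n] unfolding graded_ops_def plus_1_eq_Suc by blast+

lemma graded_ops_iff:
  fixes \<Delta> :: "nat \<Rightarrow> ('b, 'f::field) gvec \<Rightarrow> ('c, 'f) gten"
  shows "graded_ops S S' e \<Delta> \<longleftrightarrow>
     (\<forall>n\<ge>1. flinear (\<Delta> n) \<and> (\<forall>p. \<Delta> n ` gcomp S p \<subseteq> tcomp S' n (int p + int n - e)))"
proof -
  have "(\<forall>b\<in>S. \<Delta> n (gen b) \<in> tcomp S' n (int (fst b) + int n - e)) \<longleftrightarrow>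
    (\<forall>p. \<Delta> n ` gcomp S p \<subseteq> tcomp S' n (int p + int n - e))" if "flinear (\<Delta> n)" for n
  proof
    assume *: "\<forall>b\<in>S. \<Delta> n (gen b) \<in> tcomp S' n (int (fst b) + int n - e)"
    show "\<forall>p. \<Delta> n ` gcomp S p \<subseteq> tcomp S' n (int p + int n - e)"
    proof (intro allI image_subsetI)
      fix p and v :: "('b, 'f) gvec" assume "v \<in> gcomp S p"
      then show "\<Delta> n v \<in> tcomp S' n (int p + int n - e)"
        unfolding gcomp_def tcomp_def by (rule flinear_free_on[OF that, rotated]) (use * in \<open>auto simp: tcomp_def\<close>)
    qed
  next
    assume *: "\<forall>p. \<Delta> n ` gcomp S p \<subseteq> tcomp S' n (int p + int n - e)"
    have "gen b \<in> gcomp S (fst b)" if "b \<in> S" for b using that by simp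
    then show "\<forall>b\<in>S. \<Delta> n (gen b) \<in> tcomp S' n (int (fst b) + int n - e)" using * by blast
  qed
  then show ?thesis unfolding graded_ops_def by blast
qed

text \<open>All operations in one series, desuspended by \<open>sig\<close>. Coefficient
  \<open>n\<close> holds arity \<open>n + 1\<close>, so that the exponent is the excess of the
  length over one.\<close>

definition conv :: "(nat \<Rightarrow> ('b, 'f::field) gvec \<Rightarrow> ('c, 'f) gten) \<Rightarrow> nat \<times> 'b \<Rightarrow> ('c, 'f) talg" where
  "conv \<Delta> b = Abs_fps (\<lambda>n. sig (\<Delta> (Suc n) (gen b)))"

lemma conv_nth [simp]: "conv \<Delta> b $ n = sig (\<Delta> (Suc n) (gen b))" by (simp add: conv_def)

lemma conv_homog:
  assumes "graded_ops S S' e \<Delta>" "b \<in> S" shows "conv \<Delta> b \<in> homog S' 1 (int (fst b) - e)"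
proof -
  have "conv \<Delta> b $ n \<in> free_on {w. set w \<subseteq> S' \<and> length w = 1 + n \<and> sdeg w = int (fst b) - e}" for n
  proof -
    have "\<Delta> (Suc n) (gen b) \<in> tcomp S' (Suc n) (int (fst b) + int (Suc n) - e)"
      by (rule graded_opsD(2)[OF assms])
    then show ?thesis unfolding conv_nth sig_free_on by (auto simp: tcomp_def sdeg_def free_on_def)
  qed
  then show ?thesis by (simp add: homog_def fsupp_iff)
qed

lemma tlin_const_nth:
  assumes "tlin \<phi>" shows "\<phi> (fps_const x) $ m = lin_ext (\<lambda>w. \<phi> (word w) $ m) x"
proof -
  have "\<phi> (fps_const x) $ m = (\<Sum>k\<le>m. if k = 0 then lin_ext (\<lambda>w. \<phi> (word w) $ m) x else 0)"
    unfolding tlin_nth[OF assms, of "fps_const x"] by (rule sum.cong) auto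
  then show ?thesis by simp
qed

lemma tlin_nth_const:
  assumes "tlin \<phi>" shows "\<phi> X $ n = (\<Sum>k\<le>n. \<phi> (fps_const (X $ k)) $ (n - k))"
  unfolding tlin_const_nth[OF assms] by (rule tlin_nth[OF assms])

lemma der_word_nth:
  "der_word d w $ m = (\<Sum>a<length w. fscale (ksign (sdeg (take a w)))
     (gen (take a w) * ((d (w ! a) $ m) * gen (drop (Suc a) w))))"
proof (induction w)
  case (Cons b w)
  have "(d b * word w) $ m = d b $ m * gen w" by (simp add: word_def)
  moreover have "(smap (word [b]) * der_word d w) $ m = fscale (ksign (sdeg [b])) (gen [b] * der_word d w $ m)"
    by (simp add: smap_word mult.assoc, simp add: word_def)
  ultimately show ?case
    unfolding length_Cons sum.lessThan_Suc_shift
    by (simp add: Cons.IH sum_distrib_left fscale_sum gten_one[symmetric] fscale_mult_right fscale_fscale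
        ksign_add mult.assoc[symmetric] gen_mult_gen)
qed simp

lemma flinear_id_tensor_id: "flinear (id_tensor_id a e f)"
  by (simp add: id_tensor_id_def flinear_lin_ext)

lemma flinear_sum_fun: "(\<And>i. i \<in> A \<Longrightarrow> flinear (f i)) \<Longrightarrow> flinear (\<lambda>x. \<Sum>i\<in>A. f i x)"
proof (induction A rule: infinite_finite_induct)
  case (insert i A)
  then show ?case by (simp add: flinear_plus)
qed (simp_all add: flinear_zero)

text \<open>With p = a letters before the operation, q = m + 1 its arity and k = l - a - 1 letters
  after it, desuspension produces exactly the sign exponent p + q k of the morphism
  equation.\<close>

lemma der_conv_const:
  assumes g: "graded_ops S S 2 \<Delta>" and x: "x \<in> free_on {w. set w \<subseteq> S \<and> length w = l}"
  shows "der (conv \<Delta>) (fps_const (sig x)) $ m =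
    sig (\<Sum>a<l. fscale (ksign (int a + int (Suc m) * int (l - Suc a))) (id_tensor_id a (int (Suc m) - 2) (\<Delta> (Suc m)) x))"
proof (rule flinear_eq_free_on[OF _ _ _ x])
  show "flinear (\<lambda>x. der (conv \<Delta>) (fps_const (sig x)) $ m)"
    unfolding tlin_const_nth[OF tlin_der] by (rule flinear_compose[OF flinear_lin_ext flinear_sig])
  show "flinear (\<lambda>x. sig (\<Sum>a<l. fscale (ksign (int a + int (Suc m) * int (l - Suc a))) (id_tensor_id a (int (Suc m) - 2) (\<Delta> (Suc m)) x)))"
    by (intro flinear_compose[OF flinear_sig] flinear_sum_fun flinear_compose[OF flinear_fscale] flinear_id_tensor_id)
  fix w assume "w \<in> {w. set w \<subseteq> S \<and> length w = l}"
  then have w: "set w \<subseteq> S" "length w = l" by auto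
  have "fscale (ksign (tau w)) (fscale (ksign (sdeg (take a w))) (gen (take a w) * (conv \<Delta> (w ! a) $ m * gen (drop (Suc a) w)))) =
     sig (fscale (ksign (int a + int (Suc m) * int (l - Suc a))) (id_tensor_id a (int (Suc m) - 2) (\<Delta> (Suc m)) (gen w)))"
    if a: "a < l" for a
  proof -
    define u v c where "u = take a w" and "v = drop (Suc a) w" and "c = w ! a"
    have wuv: "w = u @ c # v" using a w by (simp add: u_def v_def c_def id_take_nth_drop)
    have cS: "c \<in> S" using a w by (auto simp: c_def)
    have lu: "length u = a" using a w by (simp add: u_def)
    have lv: "length v = l - Suc a" using w by (simp add: v_def)
    define y where "y = \<Delta> (Suc m) (gen c)"
    define g where "g = int (fst c) + int (Suc m) - 2"
    have "y \<in> tcomp S (Suc m) g" using graded_opsD(2)[OF g cS] by (simp add: y_def g_def)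
    then have y: "y \<in> free_on {w. wdeg w = g}" "y \<in> free_on {w. length w = Suc m}" by (auto simp: tcomp_def free_on_def)
    have yv: "y * gen v \<in> free_on {w. length w = Suc m + length v}"
      by (rule free_on_mult[OF y(2), of _ "{v}"]) auto
    have s: "sig (gen u * (y * gen v)) = fscale (ksign (wdeg u * int (Suc m + length v) + g * int (length v) + tau u + tau v))
        (gen u * (sig y * gen v))"
    proof -
      have s1: "sig (y * gen v) = fscale (ksign (g * int (length v))) (sig y * sig (gen v))"
        by (rule sig_mult[OF y(1)]) simp
      have s2: "sig (gen u * (y * gen v)) = fscale (ksign (wdeg u * int (Suc m + length v))) (sig (gen u) * sig (y * gen v))"
        by (rule sig_mult[OF _ yv]) simp
      show ?thesis unfolding s2 s1 sig_gen
        by (simp only: fscale_mult_left fscale_mult_right fscale_fscale ksign_add mult_ac)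
    qed
    \<comment> \<open>Exhibits the difference of the two sign exponents as an explicit even
      number.\<close>
    have "tau w + sdeg u = (int a + int (Suc m) * int (length v)) + (int (Suc m) - 2) * wdeg u
        + (wdeg u * int (Suc m + length v) + g * int (length v) + tau u + tau v)
        - 2 * (int (Suc m) * wdeg u + int a + int (Suc m) * int (length v) - 2 * wdeg u - int (length v))"
      by (simp add: wuv tau_append g_def sdeg_def lu algebra_simps)
    then have sgn: "ksign (tau w + sdeg u) = (ksign ((int a + int (Suc m) * int (length v)) + (int (Suc m) - 2) * wdeg u
        + (wdeg u * int (Suc m + length v) + g * int (length v) + tau u + tau v)) :: 'b)"
      by (intro ksign_cong) simp
    have "id_tensor_id a (int (Suc m) - 2) (\<Delta> (Suc m)) (gen w) =
        fscale (ksign ((int (Suc m) - 2) * wdeg u)) (gen u * (y * gen v))"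
      by (simp add: id_tensor_id_def tmul_eq_mult u_def v_def y_def c_def)
    then have "sig (fscale (ksign (int a + int (Suc m) * int (l - Suc a))) (id_tensor_id a (int (Suc m) - 2) (\<Delta> (Suc m)) (gen w))) =
      fscale (ksign (int a + int (Suc m) * int (length v)) * (ksign ((int (Suc m) - 2) * wdeg u) *
        ksign (wdeg u * int (Suc m + length v) + g * int (length v) + tau u + tau v))) (gen u * (sig y * gen v))"
      by (simp only: flinearD(2)[OF flinear_sig] s fscale_fscale lv[symmetric] mult.assoc)
    also have "\<dots> = fscale (ksign (tau w + sdeg u)) (gen u * (sig y * gen v))"
      unfolding sgn by (simp only: ksign_add mult.assoc)
    finally show ?thesis by (simp add: fscale_fscale ksign_add u_def v_def y_def c_def)
  qed
  then show "der (conv \<Delta>) (fps_const (sig (gen w))) $ m =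
     sig (\<Sum>a<l. fscale (ksign (int a + int (Suc m) * int (l - Suc a))) (id_tensor_id a (int (Suc m) - 2) (\<Delta> (Suc m)) (gen w)))"
    unfolding tlin_const_nth[OF tlin_der] sig_gen lin_ext_scale flinear_sum[OF flinear_sig]
    by (simp add: der_word_nth w fscale_sum)
qed

text \<open>Put i for the arity of the outer operation and j for the letters after it, so a = n - i
  - j stand before it. Then n + i + j + i j and a + i j differ by 2 (i + j). The defining relation
  thus appears up to the global sign of \<open>n\<close>.\<close>

lemma conv_ainf:
  assumes "ainf_coalgebra S \<Delta>" shows "ainf S (conv \<Delta>)"
proof -
  have g: "graded_ops S S 2 \<Delta>" using assms by (auto simp: ainf_coalgebra_def graded_ops_iff)
  have "der (conv \<Delta>) (conv \<Delta> b) $ m = 0" if b: "b \<in> S" for b m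
  proof -
    define n where "n = Suc m"
    have "der (conv \<Delta>) (conv \<Delta> b) $ m = (\<Sum>k\<le>m. der (conv \<Delta>) (fps_const (sig (\<Delta> (Suc k) (gen b)))) $ (m - k))"
      by (subst tlin_nth_const[OF tlin_der]) simp
    also have "\<dots> = (\<Sum>k\<le>m. sig (\<Sum>a<Suc k. fscale (ksign (int a + int (Suc (m - k)) * int (Suc k - Suc a)))
        (id_tensor_id a (int (Suc (m - k)) - 2) (\<Delta> (Suc (m - k))) (\<Delta> (Suc k) (gen b)))))"
    proof (rule sum.cong[OF refl], rule der_conv_const[OF g])
      fix k
      have "\<Delta> (Suc k) (gen b) \<in> tcomp S (Suc k) (int (fst b) + int (Suc k) - 2)" by (rule graded_opsD(2)[OF g b])
      then show "\<Delta> (Suc k) (gen b) \<in> free_on {w. set w \<subseteq> S \<and> length w = Suc k}" by (auto simp: tcomp_def free_on_def)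
    qed
    also have "\<dots> = sig (\<Sum>k\<le>m. \<Sum>a<Suc k. fscale (ksign (int a + int (Suc (m - k)) * int (Suc k - Suc a)))
        (id_tensor_id a (int (Suc (m - k)) - 2) (\<Delta> (Suc (m - k))) (\<Delta> (Suc k) (gen b))))"
      by (simp only: flinear_sum[OF flinear_sig])
    also have "(\<Sum>k\<le>m. \<Sum>a<Suc k. fscale (ksign (int a + int (Suc (m - k)) * int (Suc k - Suc a)))
        (id_tensor_id a (int (Suc (m - k)) - 2) (\<Delta> (Suc (m - k))) (\<Delta> (Suc k) (gen b)))) =
      (\<Sum>i\<in>{1..n}. \<Sum>j\<in>{0..n-i}. fscale (ksign (int n)) (fscale (ksign (int (i + j + i * j)))
             (id_tensor_id (n - i - j) (int i - 2) (\<Delta> i) (\<Delta> (n - i + 1) (gen b)))))"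
    proof (rule sum.reindex_bij_witness[of _ "\<lambda>i. n - i" "\<lambda>k. n - k"])
      fix k assume k: "k \<in> {..m}"
      show "(\<Sum>j\<in>{0..n-(n-k)}. fscale (ksign (int n)) (fscale (ksign (int ((n-k) + j + (n-k) * j)))
             (id_tensor_id (n - (n-k) - j) (int (n-k) - 2) (\<Delta> (n-k)) (\<Delta> (n - (n-k) + 1) (gen b))))) =
        (\<Sum>a<Suc k. fscale (ksign (int a + int (Suc (m - k)) * int (Suc k - Suc a)))
        (id_tensor_id a (int (Suc (m - k)) - 2) (\<Delta> (Suc (m - k))) (\<Delta> (Suc k) (gen b))))"
      proof (rule sum.reindex_bij_witness[of _ "\<lambda>a. k - a" "\<lambda>j. k - j"])
        fix j assume j: "j \<in> {0..n-(n-k)}"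
        have e: "Suc (m - k) = n - k" "n - (n - k) = k" "k - (k - j) = j" "Suc k - Suc (k - j) = j" using k j by (auto simp: n_def)
        have "int n + int ((n - k) + j + (n - k) * j) = (int (k - j) + int (n - k) * int j) + 2 * (int (n - k) + int j)"
        proof -
          have "int n = int (n - k) + int (k - j) + int j" using k j by (simp add: n_def of_nat_diff)
          moreover have "N = r + q + i \<Longrightarrow> N + (r + i + r * i) = q + r * i + 2 * (r + i)" for N r q i :: int
            by simp
          ultimately show ?thesis unfolding of_nat_add of_nat_mult by blast
        qed
        then have "(ksign (int n + int ((n - k) + j + (n - k) * j)) :: 'b) = ksign (int (k - j) + int (n - k) * int j)"
          by (rule ksign_eqI)
        then show "fscale (ksign (int (k - j) + int (Suc (m - k)) * int (Suc k - Suc (k - j))))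
            (id_tensor_id (k - j) (int (Suc (m - k)) - 2) (\<Delta> (Suc (m - k))) (\<Delta> (Suc k) (gen b))) =
          fscale (ksign (int n)) (fscale (ksign (int ((n-k) + j + (n-k) * j)))
             (id_tensor_id (n - (n-k) - j) (int (n-k) - 2) (\<Delta> (n-k)) (\<Delta> (n - (n-k) + 1) (gen b))))"
          unfolding fscale_fscale ksign_add[symmetric] e by simp
      qed (use k in \<open>auto simp: n_def\<close>)
    qed (auto simp: n_def)
    also have "\<dots> = fscale (ksign (int n)) 0"
    proof -
      have n1: "n \<ge> 1" and bf: "gen b \<in> free_on S" using b by (auto simp: n_def)
      have "(\<Sum>i\<in>{1..n}. \<Sum>j\<in>{0..n-i}. fscale (ksign (int (i + j + i * j)))
             (id_tensor_id (n - i - j) (int i - 2) (\<Delta> i) (\<Delta> (n - i + 1) (gen b)))) = 0"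
        using assms n1 bf unfolding ainf_coalgebra_def by blast
      then show ?thesis by (simp only: fscale_sum[symmetric])
    qed
    finally show ?thesis by (simp add: flinearD(4)[OF flinear_sig])
  qed
  then have "der (conv \<Delta>) (conv \<Delta> b) = 0" if "b \<in> S" for b using that by (intro fps_ext) simp
  then show ?thesis using conv_homog[OF g] by (auto simp: ainf_def)
qed

section \<open>Compositions of an integer and the signs of tensor products of maps\<close>

definition comps :: "nat \<Rightarrow> nat \<Rightarrow> nat list set" where
  "comps l n = {ks. length ks = l \<and> (\<forall>k\<in>set ks. k \<ge> 1) \<and> sum_list ks = n}"

lemma finite_comps_all: "finite {ks. (\<forall>k\<in>set ks. k \<ge> 1) \<and> sum_list ks = (n::nat)}"
proof (rule finite_subset)
  have len: "length ks \<le> sum_list ks" if "\<forall>k\<in>set ks. k \<ge> 1" for ks :: "nat list"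
    using that by (induction ks) auto
  show "{ks. (\<forall>k\<in>set ks. k \<ge> 1) \<and> sum_list ks = n} \<subseteq> {ks. set ks \<subseteq> {..n} \<and> length ks \<le> n}"
    using len member_le_sum_list by fastforce
  show "finite {ks. set ks \<subseteq> {..n} \<and> length ks \<le> n}" by (rule finite_lists_length_le) simp
qed

lemma finite_comps: "finite (comps l n)"
  by (rule finite_subset[OF _ finite_comps_all[of n]]) (auto simp: comps_def)

text \<open>An iterated Cauchy product. Trading each exponent for the arity, which is larger by one,
  turns exponents with sum m into compositions of m plus the length.\<close>

lemma amap_word_nth:
  "amap F (word w) $ m = (\<Sum>ks\<in>comps (length w) (m + length w). prod_list (map2 (\<lambda>k b. F b $ (k - 1)) ks w))"
proof (induction w arbitrary: m)
  case Nil
  have "comps 0 m = (if m = 0 then {[]} else {})" by (auto simp: comps_def)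
  then show ?case by (simp add: amap_word)
next
  case (Cons b w)
  let ?l = "length w"
  have "amap F (word (b # w)) $ m = (\<Sum>i\<le>m. F b $ i * amap F (word w) $ (m - i))"
    by (simp add: amap_word_Cons fps_mult_nth atMost_atLeast0)
  also have "\<dots> = (\<Sum>i\<le>m. \<Sum>ks\<in>comps ?l (m - i + ?l). F b $ i * prod_list (map2 (\<lambda>k b. F b $ (k - 1)) ks w))"
    by (simp add: Cons.IH sum_distrib_left)
  also have "\<dots> = (\<Sum>(i, ks)\<in>(SIGMA i:{..m}. comps ?l (m - i + ?l)). F b $ i * prod_list (map2 (\<lambda>k b. F b $ (k - 1)) ks w))"
    by (rule sum.Sigma) (auto simp: finite_comps)
  also have "\<dots> = (\<Sum>ks\<in>comps (Suc ?l) (m + Suc ?l). prod_list (map2 (\<lambda>k b. F b $ (k - 1)) ks (b # w)))"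
  proof (rule sum.reindex_bij_witness[of _ "\<lambda>ks. (hd ks - 1, tl ks)" "\<lambda>(i, ks). Suc i # ks"])
    fix ks assume ks: "ks \<in> comps (Suc ?l) (m + Suc ?l)"
    then obtain k ks' where k: "ks = k # ks'" "k \<ge> 1" by (cases ks) (auto simp: comps_def)
    then have k': "ks' \<in> comps ?l (m + Suc ?l - k)" using ks by (auto simp: comps_def)
    have len: "length xs \<le> sum_list xs" if "\<forall>k\<in>set xs. k \<ge> 1" for xs :: "nat list"
      using that by (induction xs) auto
    have "?l \<le> sum_list ks'" using k' len[of ks'] by (auto simp: comps_def)
    then have "k - 1 \<le> m" "m - (k - 1) + ?l = m + Suc ?l - k" using ks k by (auto simp: comps_def)
    then show "(hd ks - 1, tl ks) \<in> (SIGMA i:{..m}. comps ?l (m - i + ?l))" using k k' by simp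
    show "(case (hd ks - 1, tl ks) of (i, ks) \<Rightarrow> Suc i # ks) = ks" using k by simp
  qed (auto simp: comps_def)
  finally show ?case by simp
qed

text \<open>\<open>comp_exponent\<close> collects the signs for moving the desuspensions of later
  outputs past an earlier map of degree k - 1, while \<open>tau w\<close> belongs to the source
  word. The length claim rides along because \<open>sig_mult\<close> asks for the length of the
  second factor.\<close>

lemma tensor_word_sig:
  fixes f :: "nat \<Rightarrow> ('b, 'f::field) gvec \<Rightarrow> ('c, 'f) gten"
  assumes f: "graded_ops S S' 1 f"
  shows "length ks = length w \<Longrightarrow> \<forall>k\<in>set ks. k \<ge> 1 \<Longrightarrow> set w \<subseteq> S \<Longrightarrow>
    prod_list (map2 (\<lambda>k b. conv f b $ (k - 1)) ks w) = fscale (ksign (int (comp_exponent ks) + tau w))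
       (sig (tensor_maps_word (map (\<lambda>k. (int k - 1, f k)) ks) w)) \<and>
    tensor_maps_word (map (\<lambda>k. (int k - 1, f k)) ks) w \<in> free_on {w. length w = sum_list ks}"
proof (induction ks w rule: list_induct2')
  case 1
  then show ?case by (simp add: sig_gen gten_one)
next
  case (4 k ks b w)
  define y where "y = f k (gen b)"
  define z where "z = tensor_maps_word (map (\<lambda>k. (int k - 1, f k)) ks) w"
  define g where "g = int (fst b) + int k - 1"
  have k: "k = Suc (k - 1)" using 4 by simp
  have y: "y \<in> tcomp S' k g" using graded_opsD(2)[OF f, of b "k - 1"] 4 k by (simp add: y_def g_def)
  then have y': "y \<in> free_on {w. wdeg w = g}" "y \<in> free_on {w. length w = k}" by (auto simp: tcomp_def free_on_def)
  have IH: "prod_list (map2 (\<lambda>k b. conv f b $ (k - 1)) ks w) = fscale (ksign (int (comp_exponent ks) + tau w)) (sig z)"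
    "z \<in> free_on {w. length w = sum_list ks}"
    using 4 by (auto simp: z_def)
  have T: "tensor_maps_word (map (\<lambda>k. (int k - 1, f k)) (k # ks)) (b # w) =
      fscale (ksign ((int (sum_list ks) - int (length w)) * int (fst b))) (y * z)"
  proof -
    have "sum_list (map fst (map (\<lambda>k. (int k - 1, f k)) ks)) = int (sum_list ks) - int (length ks)"
      by (induction ks) auto
    then show ?thesis using 4 by (simp add: y_def z_def tmul_eq_mult)
  qed
  have "y * z \<in> free_on {w. length w = sum_list (k # ks)}"
    by (rule free_on_mult[OF y'(2) IH(2)]) auto
  then have 2: "tensor_maps_word (map (\<lambda>k. (int k - 1, f k)) (k # ks)) (b # w) \<in> free_on {w. length w = sum_list (k # ks)}"
    unfolding T by (rule free_on_fscale)
  have k1: "int (k - 1) = int k - 1" using k by simp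
  have ce: "int (comp_exponent (k # ks)) = (int k - 1) * int (sum_list ks) + int (comp_exponent ks)"
    by (simp only: comp_exponent.simps of_nat_add of_nat_mult k1)
  have "(int (comp_exponent (k # ks)) + tau (b # w)) + (int (sum_list ks) - int (length w)) * int (fst b) + g * int (sum_list ks)
      = (int (comp_exponent ks) + tau w) + 2 * (int (fst b) * int (sum_list ks) + (int k - 1) * int (sum_list ks))"
    by (simp add: g_def ce algebra_simps del: comp_exponent.simps)
  then have sgn: "(ksign ((int (comp_exponent (k # ks)) + tau (b # w)) + (int (sum_list ks) - int (length w)) * int (fst b) + g * int (sum_list ks)) :: 'f)
      = ksign (int (comp_exponent ks) + tau w)"
    by (intro ksign_cong) simp
  have "fscale (ksign (int (comp_exponent (k # ks)) + tau (b # w))) (sig (tensor_maps_word (map (\<lambda>k. (int k - 1, f k)) (k # ks)) (b # w)))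
    = fscale (ksign ((int (comp_exponent (k # ks)) + tau (b # w)) + (int (sum_list ks) - int (length w)) * int (fst b) + g * int (sum_list ks))) (sig y * sig z)"
    unfolding T flinearD(2)[OF flinear_sig] sig_mult[OF y'(1) IH(2)] fscale_fscale by (simp only: ksign_add mult.assoc)
  also have "\<dots> = sig y * fscale (ksign (int (comp_exponent ks) + tau w)) (sig z)"
    by (simp only: sgn fscale_mult_right)
  also have "\<dots> = prod_list (map2 (\<lambda>k b. conv f b $ (k - 1)) (k # ks) (b # w))"
    unfolding IH(1)[symmetric] using k by (simp add: y_def)
  finally show ?case using 2 by simp
qed auto

lemma flinear_tensor_maps: "flinear (tensor_maps fs)"
  by (simp add: tensor_maps_def flinear_lin_ext)

lemma amap_conv_const:
  fixes f :: "nat \<Rightarrow> ('b, 'f::field) gvec \<Rightarrow> ('c, 'f) gten"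
  assumes f: "graded_ops S S' 1 f" and x: "x \<in> free_on {w. set w \<subseteq> S \<and> length w = l}"
  shows "amap (conv f) (fps_const (sig x)) $ m =
    sig (\<Sum>ks\<in>comps l (m + l). fscale (ksign (int (comp_exponent ks))) (tensor_maps (map (\<lambda>k. (int k - 1, f k)) ks) x))"
proof (rule flinear_eq_free_on[OF _ _ _ x])
  show "flinear (\<lambda>x. amap (conv f) (fps_const (sig x)) $ m)"
    unfolding tlin_const_nth[OF tlin_amap] by (rule flinear_compose[OF flinear_lin_ext flinear_sig])
  show "flinear (\<lambda>x. sig (\<Sum>ks\<in>comps l (m + l). fscale (ksign (int (comp_exponent ks))) (tensor_maps (map (\<lambda>k. (int k - 1, f k)) ks) x)))"
    by (intro flinear_compose[OF flinear_sig] flinear_sum_fun flinear_compose[OF flinear_fscale] flinear_tensor_maps)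
  fix w assume "w \<in> {w. set w \<subseteq> S \<and> length w = l}"
  then have w: "set w \<subseteq> S" "length w = l" by auto
  have "fscale (ksign (tau w)) (prod_list (map2 (\<lambda>k b. conv f b $ (k - 1)) ks w)) =
    sig (fscale (ksign (int (comp_exponent ks))) (tensor_maps (map (\<lambda>k. (int k - 1, f k)) ks) (gen w)))"
    if "ks \<in> comps l (m + l)" for ks
  proof -
    have "length ks = length w" "\<forall>k\<in>set ks. k \<ge> 1" using that w by (auto simp: comps_def)
    from conjunct1[OF tensor_word_sig[OF f this w(1)]]
    have "fscale (ksign (tau w)) (prod_list (map2 (\<lambda>k b. conv f b $ (k - 1)) ks w)) =
      fscale (ksign (tau w) * (ksign (int (comp_exponent ks)) * ksign (tau w))) (sig (tensor_maps_word (map (\<lambda>k. (int k - 1, f k)) ks) w))"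
      by (simp only: fscale_fscale ksign_add)
    also have "ksign (tau w) * (ksign (int (comp_exponent ks)) * ksign (tau w)) = (ksign (int (comp_exponent ks)) :: 'f)"
      by (simp add: mult.left_commute)
    finally show ?thesis by (simp add: flinearD(2)[OF flinear_sig] tensor_maps_def)
  qed
  then show "amap (conv f) (fps_const (sig (gen w))) $ m =
     sig (\<Sum>ks\<in>comps l (m + l). fscale (ksign (int (comp_exponent ks))) (tensor_maps (map (\<lambda>k. (int k - 1, f k)) ks) (gen w)))"
    unfolding tlin_const_nth[OF tlin_amap] sig_gen lin_ext_scale flinear_sum[OF flinear_sig]
    by (simp add: amap_word_nth w fscale_sum)
qed

lemma morphism_equation:
  fixes \<Delta> :: "nat \<Rightarrow> ('b, 'f::field) gvec \<Rightarrow> ('b, 'f) gten"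
  assumes g: "graded_ops S S 2 \<Delta>" "graded_ops S' S' 2 \<Delta>'" and f: "graded_ops S S' 1 f" and b: "b \<in> S"
  shows "der (conv \<Delta>') (conv f b) $ m = sig (\<Sum>(p, q, k)\<in>{(p, q, k). p + q + k = Suc m \<and> q \<ge> 1}.
           fscale (ksign (int (p + q * k))) (id_tensor_id p (int q - 2) (\<Delta>' q) (f (p + k + 1) (gen b))))" (is "?A = sig ?B")
    and "amap (conv f) (conv \<Delta> b) $ m = sig (\<Sum>ks\<in>{ks. (\<forall>k\<in>set ks. k \<ge> 1) \<and> sum_list ks = Suc m}.
           fscale (ksign (int (comp_exponent ks)))
             (tensor_maps (map (\<lambda>k. (int k - 1, f k)) ks) (\<Delta> (length ks) (gen b))))" (is "?C = sig ?D")
proof -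
  have "?A = (\<Sum>K\<le>m. der (conv \<Delta>') (fps_const (sig (f (Suc K) (gen b)))) $ (m - K))"
    by (subst tlin_nth_const[OF tlin_der]) simp
  also have "\<dots> = (\<Sum>K\<le>m. sig (\<Sum>a<Suc K. fscale (ksign (int a + int (Suc (m - K)) * int (Suc K - Suc a)))
      (id_tensor_id a (int (Suc (m - K)) - 2) (\<Delta>' (Suc (m - K))) (f (Suc K) (gen b)))))"
  proof (rule sum.cong[OF refl], rule der_conv_const[OF g(2)])
    fix K
    have "f (Suc K) (gen b) \<in> tcomp S' (Suc K) (int (fst b) + int (Suc K) - 1)" by (rule graded_opsD(2)[OF f b])
    then show "f (Suc K) (gen b) \<in> free_on {w. set w \<subseteq> S' \<and> length w = Suc K}" by (auto simp: tcomp_def free_on_def)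
  qed
  also have "\<dots> = sig (\<Sum>K\<le>m. \<Sum>a<Suc K. fscale (ksign (int a + int (Suc (m - K)) * int (Suc K - Suc a)))
      (id_tensor_id a (int (Suc (m - K)) - 2) (\<Delta>' (Suc (m - K))) (f (Suc K) (gen b))))"
    by (simp only: flinear_sum[OF flinear_sig])
  also have "(\<Sum>K\<le>m. \<Sum>a<Suc K. fscale (ksign (int a + int (Suc (m - K)) * int (Suc K - Suc a)))
      (id_tensor_id a (int (Suc (m - K)) - 2) (\<Delta>' (Suc (m - K))) (f (Suc K) (gen b)))) =
    (\<Sum>(K, a)\<in>(SIGMA K:{..m}. {..<Suc K}). fscale (ksign (int a + int (Suc (m - K)) * int (Suc K - Suc a)))
      (id_tensor_id a (int (Suc (m - K)) - 2) (\<Delta>' (Suc (m - K))) (f (Suc K) (gen b))))"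
    by (rule sum.Sigma) auto
  also have "\<dots> = ?B"
    by (rule sum.reindex_bij_witness[of _ "\<lambda>(p, q, k). (p + k, p)" "\<lambda>(K, a). (a, Suc (m - K), K - a)"])
      (auto simp: of_nat_diff algebra_simps)
  finally show "?A = sig ?B" .
  have "?C = (\<Sum>K\<le>m. amap (conv f) (fps_const (sig (\<Delta> (Suc K) (gen b)))) $ (m - K))"
    by (subst tlin_nth_const[OF tlin_amap]) simp
  also have "\<dots> = (\<Sum>K\<le>m. sig (\<Sum>ks\<in>comps (Suc K) (m - K + Suc K). fscale (ksign (int (comp_exponent ks)))
      (tensor_maps (map (\<lambda>k. (int k - 1, f k)) ks) (\<Delta> (Suc K) (gen b)))))"
  proof (rule sum.cong[OF refl], rule amap_conv_const[OF f])
    fix K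
    have "\<Delta> (Suc K) (gen b) \<in> tcomp S (Suc K) (int (fst b) + int (Suc K) - 2)" by (rule graded_opsD(2)[OF g(1) b])
    then show "\<Delta> (Suc K) (gen b) \<in> free_on {w. set w \<subseteq> S \<and> length w = Suc K}" by (auto simp: tcomp_def free_on_def)
  qed
  also have "\<dots> = sig (\<Sum>K\<le>m. \<Sum>ks\<in>comps (Suc K) (m - K + Suc K). fscale (ksign (int (comp_exponent ks)))
      (tensor_maps (map (\<lambda>k. (int k - 1, f k)) ks) (\<Delta> (Suc K) (gen b))))"
    by (simp only: flinear_sum[OF flinear_sig])
  also have "(\<Sum>K\<le>m. \<Sum>ks\<in>comps (Suc K) (m - K + Suc K). fscale (ksign (int (comp_exponent ks)))
      (tensor_maps (map (\<lambda>k. (int k - 1, f k)) ks) (\<Delta> (Suc K) (gen b)))) =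
    (\<Sum>(K, ks)\<in>(SIGMA K:{..m}. comps (Suc K) (m - K + Suc K)). fscale (ksign (int (comp_exponent ks)))
      (tensor_maps (map (\<lambda>k. (int k - 1, f k)) ks) (\<Delta> (Suc K) (gen b))))"
    by (rule sum.Sigma) (auto simp: finite_comps)
  also have "\<dots> = ?D"
  proof (rule sum.reindex_bij_witness[of _ "\<lambda>ks. (length ks - 1, ks)" "\<lambda>(K, ks). ks"])
    fix ks assume ks: "ks \<in> {ks. (\<forall>k\<in>set ks. k \<ge> 1) \<and> sum_list ks = Suc m}"
    have len: "length xs \<le> sum_list xs" if "\<forall>k\<in>set xs. k \<ge> 1" for xs :: "nat list"
      using that by (induction xs) auto
    have "length ks \<le> Suc m" "ks \<noteq> []" using ks len[of ks] by auto
    then show "(length ks - 1, ks) \<in> (SIGMA K:{..m}. comps (Suc K) (m - K + Suc K))"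
      using ks by (cases ks) (auto simp: comps_def)
  qed (auto simp: comps_def)
  finally show "?C = sig ?D" .
qed

text \<open>\<open>sig\<close> is injective, so the signed equation in arity m + 1 is exactly
  coefficient m of the equation between derivations.\<close>

lemma ainf_morphism_iff_mor:
  fixes \<Delta> :: "nat \<Rightarrow> ('b, 'f::field) gvec \<Rightarrow> ('b, 'f) gten"
  assumes g: "graded_ops S S 2 \<Delta>" "graded_ops S' S' 2 \<Delta>'" and f: "graded_ops S S' 1 f"
  shows "ainf_morphism S \<Delta> S' \<Delta>' f \<longleftrightarrow> mor S (conv \<Delta>) S' (conv \<Delta>') (conv f)"
proof -
  let ?B = "\<lambda>i v. (\<Sum>(p, q, k)\<in>{(p, q, k). p + q + k = i \<and> q \<ge> 1}.
           fscale (ksign (int (p + q * k))) (id_tensor_id p (int q - 2) (\<Delta>' q) (f (p + k + 1) v)))"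
  let ?D = "\<lambda>i v. (\<Sum>ks\<in>{ks. (\<forall>k\<in>set ks. k \<ge> 1) \<and> sum_list ks = i}.
           fscale (ksign (int (comp_exponent ks)))
             (tensor_maps (map (\<lambda>k. (int k - 1, f k)) ks) (\<Delta> (length ks) v)))"
  have lf: "flinear (f (n + 1))" for n using graded_opsD(1)[OF f, of n] by simp
  have lB: "flinear (?B (Suc m))" for m
    unfolding case_prod_beta
    by (intro flinear_sum_fun flinear_compose[OF flinear_fscale] flinear_compose[OF flinear_id_tensor_id] lf)
  have lD: "flinear (?D (Suc m))" for m
  proof (rule flinear_sum_fun)
    fix ks assume "ks \<in> {ks. (\<forall>k\<in>set ks. k \<ge> 1) \<and> sum_list ks = Suc m}"
    then have "length ks = Suc (length ks - 1)" by (cases ks) auto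
    then have "flinear (\<Delta> (length ks))" using graded_opsD(1)[OF g(1), of "length ks - 1"] by simp
    then show "flinear (\<lambda>v. fscale (ksign (int (comp_exponent ks)))
             (tensor_maps (map (\<lambda>k. (int k - 1, f k)) ks) (\<Delta> (length ks) v)))"
      by (intro flinear_compose[OF flinear_fscale] flinear_compose[OF flinear_tensor_maps])
  qed
  have "(\<forall>i\<ge>1. \<forall>v\<in>free_on S. ?B i v = ?D i v) \<longleftrightarrow> (\<forall>m. \<forall>b\<in>S. ?B (Suc m) (gen b) = ?D (Suc m) (gen b))"
  proof
    assume *: "\<forall>m. \<forall>b\<in>S. ?B (Suc m) (gen b) = ?D (Suc m) (gen b)"
    show "\<forall>i\<ge>1. \<forall>v\<in>free_on S. ?B i v = ?D i v"
    proof (intro allI impI ballI)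
      fix i :: nat and v :: "('b, 'f) gvec" assume i: "1 \<le> i" and v: "v \<in> free_on S"
      then obtain m where m: "i = Suc m" by (cases i) auto
      show "?B i v = ?D i v"
        unfolding m by (rule flinear_eq_free_on[OF lB lD _ v]) (use * in blast)
    qed
  next
    assume *: "\<forall>i\<ge>1. \<forall>v\<in>free_on S. ?B i v = ?D i v"
    show "\<forall>m. \<forall>b\<in>S. ?B (Suc m) (gen b) = ?D (Suc m) (gen b)"
    proof (intro allI ballI)
      fix m b assume "b \<in> S"
      then have "gen b \<in> free_on S" by simp
      moreover have "1 \<le> Suc m" by simp
      ultimately show "?B (Suc m) (gen b) = ?D (Suc m) (gen b)" using * by blast
    qed
  qed
  also have "\<dots> \<longleftrightarrow> (\<forall>m. \<forall>b\<in>S. der (conv \<Delta>') (conv f b) $ m = amap (conv f) (conv \<Delta> b) $ m)"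
  proof (intro all_cong1 ball_cong refl)
    fix m b assume b: "b \<in> S"
    show "(?B (Suc m) (gen b) = ?D (Suc m) (gen b)) = (der (conv \<Delta>') (conv f b) $ m = amap (conv f) (conv \<Delta> b) $ m)"
      unfolding morphism_equation[OF g f b] sig_inj ..
  qed
  also have "\<dots> \<longleftrightarrow> mor S (conv \<Delta>) S' (conv \<Delta>') (conv f)"
    using conv_homog[OF f] by (auto simp: mor_def fps_eq_iff)
  finally show ?thesis
    using f unfolding ainf_morphism_def graded_ops_iff by blast
qed

lemma lpart_conv:
  assumes "graded_ops S S' e \<Delta>" "v \<in> free_on S"
  shows "lpart (conv \<Delta>) v = unletter (\<Delta> 1 v)"
proof (rule flinear_eq_free_on[OF flinear_lpart flinear_compose[OF flinear_unletter] _ assms(2)])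
  show "flinear (\<Delta> 1)" using graded_opsD(1)[OF assms(1), of 0] by simp
  fix b assume b: "b \<in> S"
  have "\<Delta> (Suc 0) (gen b) \<in> free_on {w. length w = 1}"
    using graded_opsD(2)[OF assms(1) b, of 0] by (auto simp: tcomp_def free_on_def)
  from letter_unletter[OF this] have "sig (\<Delta> (Suc 0) (gen b)) = \<Delta> (Suc 0) (gen b)" by (metis sig_letter)
  then show "lpart (conv \<Delta>) (gen b) = unletter (\<Delta> 1 (gen b))" by simp
qed

subsection \<open>Differential graded coalgebras\<close>

lemma id_tensor_id_zero [simp]: "id_tensor_id a e f 0 = 0"
  by (simp add: id_tensor_id_def)

lemma id_tensor_id_zero_map [simp]: "id_tensor_id a e (\<lambda>_. 0) v = 0"
proof -
  have "id_tensor_id a e (\<lambda>_. 0) v = lin_ext (\<lambda>w. 0) v"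
    by (simp add: id_tensor_id_def tmul_eq_mult)
  then show ?thesis by (simp add: lin_ext_def)
qed

lemma id_tensor_id_letter:
  assumes "flinear f" shows "id_tensor_id 0 e f (letter v) = f v"
proof (rule flinear_eq_on[OF flinear_compose[OF flinear_id_tensor_id flinear_letter] assms])
  fix b show "id_tensor_id 0 e f (letter (gen b)) = f (gen b)"
    by (simp add: id_tensor_id_def tmul_eq_mult gten_one[symmetric])
qed

text \<open>The relations in arities 1, 2 and 3 are the square zero condition, the co-Leibniz rule
  and coassociativity. From arity 4 on, the arities of the two operations in a summand add up to at
  least 5, so one of them exceeds 2.\<close>

lemma dg_coalgebra_ainf:
  assumes dg: "dg_coalgebra S \<delta> \<Delta>" shows "ainf_coalgebra S (ainf_of_dg \<delta> \<Delta>)"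
proof -
  have l: "flinear \<delta>" "flinear \<Delta>" using dg by (auto simp: dg_coalgebra_def)
  have "flinear (ainf_of_dg \<delta> \<Delta> n)" for n
    using l flinear_compose[OF flinear_letter l(1)] flinear_zero by (auto simp: ainf_of_dg_def comp_def)
  moreover have "ainf_of_dg \<delta> \<Delta> n v \<in> tcomp S n (int p + int n - 2)" if n: "1 \<le> n" and v: "v \<in> gcomp S p" for n p v
  proof -
    have lt: "letter u \<in> tcomp S 1 (int q)" if "u \<in> gcomp S q" for u :: "('a, 'b) gvec" and q
      unfolding tcomp_def by (rule flinear_free_on[OF flinear_letter _ that[unfolded gcomp_def]]) auto
    have "letter (\<delta> v) \<in> tcomp S 1 (int p - 1)"
    proof (cases p)
      case 0
      then have "\<delta> v = 0" using dg v by (auto simp: dg_coalgebra_def)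
      then show ?thesis by (simp add: tcomp_def flinearD(4)[OF flinear_letter])
    next
      case (Suc q)
      have "\<delta> ` gcomp S (Suc q) \<subseteq> gcomp S q" using dg by (simp add: dg_coalgebra_def)
      then have "\<delta> v \<in> gcomp S q" using v Suc by blast
      from lt[OF this] Suc show ?thesis by simp
    qed
    moreover have "\<Delta> ` gcomp S p \<subseteq> tcomp S 2 (int p)" using dg by (simp add: dg_coalgebra_def)
    then have "\<Delta> v \<in> tcomp S 2 (int p)" using v by blast
    moreover have "0 \<in> tcomp S n (int p + int n - 2)" by (simp add: tcomp_def)
    ultimately show ?thesis by (auto simp: ainf_of_dg_def)
  qed
  moreover have "(\<Sum>i\<in>{1..n}. \<Sum>j\<in>{0..n-i}. fscale (ksign (int (i + j + i * j)))
             (id_tensor_id (n - i - j) (int i - 2) (ainf_of_dg \<delta> \<Delta> i) (ainf_of_dg \<delta> \<Delta> (n - i + 1) v))) = 0"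
    if n: "1 \<le> n" and v: "v \<in> free_on S" for n v
  proof -
    have dd: "\<delta> (\<delta> v) = 0"
      and leib: "id_tensor_id 0 (- 1) (letter \<circ> \<delta>) (\<Delta> v) + id_tensor_id 1 (- 1) (letter \<circ> \<delta>) (\<Delta> v) = \<Delta> (\<delta> v)"
      and coass: "id_tensor_id 0 0 \<Delta> (\<Delta> v) = id_tensor_id 1 0 \<Delta> (\<Delta> v)"
      using dg v by (auto simp: dg_coalgebra_def)
    have ld: "flinear (letter \<circ> \<delta>)" using flinear_compose[OF flinear_letter l(1)] by (simp add: comp_def)
    have zero: "letter (0 :: ('a, 'b) gvec) = 0" by (rule flinearD(4)[OF flinear_letter])
    consider "n = 1" | "n = 2" | "n = 3" | "n \<ge> 4" using n by linarith
    then show ?thesis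
    proof cases
      case 1
      then show ?thesis
        by (simp add: ainf_of_dg_def id_tensor_id_letter[OF ld] dd zero)
    next
      case 2
      have "{1..2::nat} = {1, 2}" "{0..1::nat} = {0, 1}" "{0..0::nat} = {0}" by auto
      then show ?thesis unfolding 2 leib[symmetric]
        by (simp add: ainf_of_dg_def ksign_def id_tensor_id_letter[OF l(2)] leib[symmetric] fscale_minus_left)
    next
      case 3
      have "{1..3::nat} = {1, 2, 3}" "{0..2::nat} = {0, 1, 2}" "{0..1::nat} = {0, 1}" "{0..0::nat} = {0}" by auto
      then show ?thesis unfolding 3
        by (simp add: ainf_of_dg_def ksign_def coass fscale_minus_left)
    next
      case 4
      have "id_tensor_id (n - i - j) (int i - 2) (ainf_of_dg \<delta> \<Delta> i) (ainf_of_dg \<delta> \<Delta> (n - i + 1) v) = 0"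
        if "i \<in> {1..n}" for i j
      proof (cases "i \<le> 2")
        case True
        then have "n - i + 1 \<noteq> 1" "n - i + 1 \<noteq> 2" using 4 by auto
        then have "ainf_of_dg \<delta> \<Delta> (n - i + 1) v = 0" by (simp add: ainf_of_dg_def)
        then show ?thesis by simp
      next
        case False
        then have "ainf_of_dg \<delta> \<Delta> i = (\<lambda>_. 0)" by (simp add: ainf_of_dg_def)
        then show ?thesis by simp
      qed
      then show ?thesis by simp
    qed
  qed
  ultimately show ?thesis unfolding ainf_coalgebra_def by blast
qed

lemma conv_dg: "conv (ainf_of_dg \<delta> \<Delta>) b = emb (\<delta> (gen b)) + fps_X * fps_const (sig (\<Delta> (gen b)))"
proof (rule fps_ext)
  fix n :: nat
  consider "n = 0" | "n = 1" | "n \<ge> 2" by linarith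
  then show "conv (ainf_of_dg \<delta> \<Delta>) b $ n = (emb (\<delta> (gen b)) + fps_X * fps_const (sig (\<Delta> (gen b)))) $ n"
    by cases (auto simp: ainf_of_dg_def emb_def flinearD(4)[OF flinear_sig])
qed

subsection \<open>Singular chains\<close>

definition sing :: "(nat \<Rightarrow> ((nat \<Rightarrow> real) simplex, 'f::field) gten) \<Rightarrow> nat \<times> 'a simplex \<Rightarrow> ('a simplex, 'f) talg" where
  "sing D = conv (ainf_of_dg bd (diag D))"

definition rsing :: "(nat \<Rightarrow> ((nat \<Rightarrow> real) simplex, 'f::field) gten) \<Rightarrow> 'a \<Rightarrow> nat \<times> 'a simplex \<Rightarrow> ('a simplex, 'f) talg" where
  "rsing D x = conv (ainf_of_dg (reduced_bd x) (reduced_diag D x))"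

definition push_simplex :: "('b \<Rightarrow> 'a) \<Rightarrow> nat \<times> 'b simplex \<Rightarrow> nat \<times> 'a simplex" where
  "push_simplex g = (\<lambda>(q, \<tau>). (q, simplex_map q g \<tau>))"

lemma fst_push_simplex [simp]: "fst (push_simplex g b) = fst b"
  by (simp add: push_simplex_def case_prod_beta)

definition push_vec :: "('b \<Rightarrow> 'a) \<Rightarrow> ('b simplex, 'f::field) gvec \<Rightarrow> ('a simplex, 'f) gvec" where
  "push_vec g = lin_ext (\<lambda>b. gen (push_simplex g b))"

definition push_alg :: "('b \<Rightarrow> 'a) \<Rightarrow> ('b simplex, 'f::field) talg \<Rightarrow> ('a simplex, 'f) talg" where
  "push_alg g = amap (\<lambda>b. word [push_simplex g b])"

lemma tlin_push_alg: "tlin (push_alg g)" by (simp add: push_alg_def tlin_amap)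

lemma push_eq: "push g = lin_ext (\<lambda>w. gen (map (push_simplex g) w))"
  by (simp add: push_def push_simplex_def)

lemma flinear_push: "flinear (push g)" by (simp add: push_eq flinear_lin_ext)

lemma flinear_push_vec: "flinear (push_vec g)" by (simp add: push_vec_def flinear_lin_ext)

lemma amap_letters: "amap (\<lambda>b. word [\<phi> b]) (word w) = word (map \<phi> w)"
  by (induction w) (auto simp: word_Nil amap_word_Cons word_Cons[symmetric])

lemma tlin_const:
  assumes "tlin \<phi>" "flinear L" "\<And>w. w \<in> Poly_Mapping.keys y \<Longrightarrow> \<phi> (word w) = fps_const (L (gen w))"
  shows "\<phi> (fps_const y) = fps_const (L y)"
proof (rule fps_ext)
  fix n
  have "\<phi> (fps_const y) $ n = lin_ext (\<lambda>w. fps_const (L (gen w)) $ n) y"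
    unfolding tlin_const_nth[OF assms(1)] by (rule lin_ext_cong) (simp add: assms(3))
  also have "\<dots> = fps_const (L y) $ n"
    by (cases "n = 0") (auto simp: flinear_eq_lin_ext[OF assms(2), of y], auto simp: lin_ext_def)
  finally show "\<phi> (fps_const y) $ n = fps_const (L y) $ n" .
qed

lemma push_alg_const: "push_alg g (fps_const y) = fps_const (push g y)"
  by (rule tlin_const[OF tlin_push_alg flinear_push]) (simp add: push_alg_def amap_letters push_eq, simp add: word_def)

lemma push_alg_emb: "push_alg g (emb v) = emb (push_vec g v)"
  by (rule tlin_emb[OF tlin_push_alg flinear_push_vec]) (simp add: push_alg_def push_vec_def)

lemma tau_push: "tau (map (push_simplex g) w) = tau w"
  by (induction w) auto

lemma sig_push: "sig (push g y) = push g (sig y)"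
  by (rule flinear_eq_on[OF flinear_compose[OF flinear_sig flinear_push] flinear_compose[OF flinear_push flinear_sig]])
    (simp add: push_eq sig_gen tau_push lin_ext_scale)

lemma push_simplex_face:
  assumes "k \<le> p" "0 < p"
  shows "singular_face p k (simplex_map p g \<sigma>) = simplex_map (p - 1) g (singular_face p k \<sigma>)"
proof -
  have "singular_face p k (simplex_map p g \<sigma>) = simplex_map (p - Suc 0) g (\<sigma> \<circ> simplical_face k)"
    using assms by (intro singular_face_simplex_map) auto
  then show ?thesis by (auto simp: simplex_map_def singular_face_def restrict_def)
qed

lemma bd_gen: "p \<noteq> 0 \<Longrightarrow> bd (gen (p, \<sigma>)) = (\<Sum>k\<le>p. fscale ((- 1) ^ k) (gen (p - 1, singular_face p k \<sigma>)))"
  and bd_gen_0: "bd (gen (0, \<sigma>)) = 0"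
  by (simp_all add: bd_def)

lemma push_vec_bd:
  fixes g :: "'b \<Rightarrow> 'a" and v :: "('b simplex, 'f::field) gvec"
  shows "push_vec g (bd v) = bd (push_vec g v)"
proof -
  have lb: "flinear bd" by (simp add: bd_def flinear_lin_ext)
  show ?thesis
  proof (rule flinear_eq_on[OF flinear_compose[OF flinear_push_vec lb] flinear_compose[OF lb flinear_push_vec]])
    fix b :: "nat \<times> 'b simplex"
    obtain p \<sigma> where b: "b = (p, \<sigma>)" by (cases b)
    show "push_vec g (bd (gen b)) = bd (push_vec g (gen b))"
    proof (cases "p = 0")
      case True
      then show ?thesis by (simp add: b push_vec_def push_simplex_def bd_gen_0 flinearD(4)[OF lb])
    next
      case False
      show ?thesis
        using False unfolding b bd_gen[OF False] flinear_sum[OF flinear_push_vec] flinearD(2)[OF flinear_push_vec]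
        by (simp add: push_vec_def push_simplex_def bd_gen push_simplex_face)
    qed
  qed
qed

text \<open>\<open>simplex_map\<close> cuts its result off outside the standard simplex; composition
  is respected because the simplices in \<open>y\<close> take their values inside it.\<close>

lemma push_push:
  assumes "y \<in> free_on {w. set w \<subseteq> simplices (std_space q)}"
  shows "push g (push \<tau> y) = push (simplex_map q g \<tau>) y"
proof (rule flinear_eq_free_on[OF flinear_compose[OF flinear_push flinear_push] flinear_push _ assms])
  fix w assume w: "w \<in> {w. set w \<subseteq> simplices (std_space q)}"
  have "push_simplex g (push_simplex \<tau> b) = push_simplex (simplex_map q g \<tau>) b" if "b \<in> simplices (std_space q)" for b
  proof -
    obtain r \<rho> where b: "b = (r, \<rho>)" by (cases b)
    have r: "singular_simplex r (std_space q) \<rho>" using that by (simp add: simplices_def b)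
    then have "\<rho> t \<in> standard_simplex q" if "t \<in> standard_simplex r" for t
      using that by (auto simp: singular_simplex_def std_space_def continuous_map_def)
    then have "simplex_map r g (simplex_map r \<tau> \<rho>) = simplex_map r (simplex_map q g \<tau>) \<rho>"
      by (auto simp: simplex_map_def restrict_def)
    then show ?thesis by (simp add: push_simplex_def b)
  qed
  then have "map (push_simplex g) (map (push_simplex \<tau>) w) = map (push_simplex (simplex_map q g \<tau>)) w"
    using w by auto
  then show "push g (push \<tau> (gen w)) = push (simplex_map q g \<tau>) (gen w)"
    by (simp only: push_eq lin_ext_gen)
qed

text \<open>The model for acyclic models: every p-simplex is the image of this one under itself
  (\<open>push_id_simplex\<close>).\<close>

definition id_simplex :: "nat \<Rightarrow> nat \<times> (nat \<Rightarrow> real) simplex" where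
  "id_simplex p = (p, restrict id (standard_simplex p))"

lemma id_simplex_in: "id_simplex p \<in> simplices (std_space p)"
  by (auto simp: id_simplex_def simplices_def singular_simplex_def std_space_def intro!: continuous_map_eq[OF continuous_map_id])

lemma fst_id_simplex [simp]: "fst (id_simplex p) = p" by (simp add: id_simplex_def)

lemma push_id_simplex: "(p, \<sigma>) \<in> simplices X \<Longrightarrow> push_simplex \<sigma> (id_simplex p) = (p, \<sigma>)"
  by (auto simp: push_simplex_def id_simplex_def simplices_def singular_simplex_def simplex_map_def restrict_def extensional_def)

lemma push_simplex_in:
  "b \<in> simplices T \<Longrightarrow> continuous_map T X g \<Longrightarrow> push_simplex g b \<in> simplices X"
  by (auto simp: push_simplex_def simplices_def intro: singular_simplex_simplex_map)

lemma simplex_continuous: "(p, \<sigma>) \<in> simplices X \<Longrightarrow> continuous_map (std_space p) X \<sigma>"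
  by (simp add: simplices_def singular_simplex_def std_space_def)

lemma flinear_bd: "flinear bd" by (simp add: bd_def flinear_lin_ext)

lemma flinear_diag: "flinear (diag D)" by (simp add: diag_def flinear_lin_ext)

lemma homog_UNIV_letter: "word [b] \<in> homog UNIV 1 (sdeg [b])" by (rule hom_word) auto

lemma homs_UNIV [simp]: "X \<in> homs UNIV" by (simp add: homs_def fsupp_def)

lemma homog_letter: "b \<in> S \<Longrightarrow> word [b] \<in> homog S 1 (int (fst b) - 1)"
  by (rule hom_word) auto

locale approximation =
  fixes D :: "nat \<Rightarrow> ((nat \<Rightarrow> real) simplex, 'f::field) gten"
  assumes approx: "diagonal_approximation D"
begin

lemma D_words: "D p \<in> free_on {w. set w \<subseteq> simplices (std_space p)}"
  using approx by (auto simp: diagonal_approximation_def tcomp_def free_on_def)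

lemma push_alg_sing:
  fixes g :: "'b \<Rightarrow> 'a"
  shows "push_alg g (sing D b) = sing D (push_simplex g b)"
proof -
  obtain q \<tau> where b: "b = (q, \<tau>)" by (cases b)
  have "push g (diag D (gen b)) = diag D (gen (push_simplex g b))"
    by (simp add: diag_def b push_simplex_def push_push[OF D_words])
  moreover have "push_vec g (bd (gen b) :: ('b simplex, 'f) gvec) = bd (gen (push_simplex g b))"
    unfolding push_vec_bd by (simp add: push_vec_def)
  ultimately show ?thesis
    by (simp add: sing_def conv_dg tlin_add[OF tlin_push_alg] push_alg_emb tlin_X[OF tlin_push_alg] push_alg_const
        sig_push[symmetric])
qed

lemma push_alg_der: "push_alg g (der (sing D) X) = der (sing D) (push_alg g X)"
  unfolding push_alg_def
proof (rule der_amap_eq[of UNIV _ UNIV, symmetric])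
  fix b show "word [push_simplex g b] \<in> homog UNIV 1 (sdeg [b])" by (rule hom_word) auto
  show "der (sing D) (word [push_simplex g b]) = amap (\<lambda>b. word [push_simplex g b]) (sing D b)"
    using push_alg_sing[of g b] by (simp add: der_letter push_alg_def del: der_word_eq)
qed auto

lemma push_alg_hom:
  assumes "X \<in> homog (simplices T) l e" "continuous_map T Y g" shows "push_alg g X \<in> homog (simplices Y) l e"
  unfolding push_alg_def
  by (rule amap_hom[OF assms(1)], rule hom_word) (use push_simplex_in assms(2) in auto)

lemma ainf_std: "ainf (simplices (std_space p)) (sing D)"
  unfolding sing_def
  by (rule conv_ainf[OF dg_coalgebra_ainf]) (use approx in \<open>simp add: diagonal_approximation_def\<close>)

lemma sing_pushed:
  assumes "(p, \<sigma>) \<in> simplices X" shows "sing D (p, \<sigma>) = push_alg \<sigma> (sing D (id_simplex p))"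
  by (simp add: push_alg_sing push_id_simplex[OF assms])

text \<open>The axioms on standard simplices suffice, since the value on any simplex is pushed
  forward from the identity simplex and pushing commutes with the derivation.\<close>

lemma ainf_sing: "ainf (simplices X) (sing D)"
  unfolding ainf_def
proof (intro ballI conjI)
  fix b assume "b \<in> simplices X"
  then obtain p \<sigma> where b: "b = (p, \<sigma>)" "(p, \<sigma>) \<in> simplices X" by (cases b) auto
  note eq = sing_pushed[OF b(2)]
  have "sing D (id_simplex p) \<in> homog (simplices (std_space p)) 1 (sdeg [id_simplex p] - 1)"
    by (rule ainf_homog[OF ainf_std id_simplex_in])
  from push_alg_hom[OF this simplex_continuous[OF b(2)]]
  show "sing D b \<in> homog (simplices X) 1 (sdeg [b] - 1)" by (simp add: b(1) eq)
  have "der (sing D) (sing D (id_simplex p)) = 0" using ainf_std[of p] id_simplex_in[of p] unfolding ainf_def by blast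
  then show "der (sing D) (sing D b) = 0"
    by (simp add: b(1) eq push_alg_der[symmetric] tlin_0[OF tlin_push_alg])
qed

end

subsection \<open>Reduced singular chains\<close>

text \<open>Dividing by the base vertex as an algebra homomorphism: the letter is sent to 0, which
  kills every word containing it.\<close>

definition drop_letter :: "'a \<Rightarrow> nat \<times> 'a simplex \<Rightarrow> ('a simplex, 'f::field) talg" where
  "drop_letter x b = (if b = base_vertex x then 0 else word [b])"

definition drop_alg :: "'a \<Rightarrow> ('a simplex, 'f::field) talg \<Rightarrow> ('a simplex, 'f) talg" where
  "drop_alg x = amap (drop_letter x)"

lemma tlin_drop_alg: "tlin (drop_alg x)" by (simp add: drop_alg_def tlin_amap)

lemma flinear_drop_base: "flinear (drop_base x)" by (simp add: drop_base_def flinear_lin_ext)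

lemma drop_alg_word: "drop_alg x (word w) = (if base_vertex x \<in> set w then 0 else word w)"
  by (induction w) (auto simp: drop_alg_def drop_letter_def amap_word_Cons word_Nil word_Cons[symmetric])

lemma drop_alg_const: "drop_alg x (fps_const y) = fps_const (drop_base x y)"
  by (rule tlin_const[OF tlin_drop_alg flinear_drop_base]) (simp add: drop_alg_word drop_base_def, simp add: word_def)

lemma sig_drop_base: "sig (drop_base x y) = drop_base x (sig y)"
  by (rule flinear_eq_on[OF flinear_compose[OF flinear_sig flinear_drop_base] flinear_compose[OF flinear_drop_base flinear_sig]])
    (simp add: drop_base_def sig_gen lin_ext_scale flinearD(4)[OF flinear_sig])

lemma letter_free_on: "letter v \<in> free_on {w. length w = 1}"
  unfolding letter_def by (rule lin_ext_in) simp

lemma emb_reduced_bd: "emb (reduced_bd x v) = drop_alg x (emb (bd v))"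
proof -
  have "drop_base x (letter (bd v)) \<in> free_on {w. length w = 1}"
    by (rule flinear_free_on[OF flinear_drop_base _ letter_free_on]) (auto simp: drop_base_def)
  then show ?thesis by (simp add: emb_def reduced_bd_def drop_alg_const letter_unletter)
qed

lemma rsing_eq: "rsing D x b = drop_alg x (sing D b)"
  by (simp add: rsing_def sing_def conv_dg emb_reduced_bd tlin_add[OF tlin_drop_alg] tlin_X[OF tlin_drop_alg]
      drop_alg_const reduced_diag_def sig_drop_base)

lemma base_vertex_in: "x \<in> topspace X \<Longrightarrow> base_vertex x \<in> simplices X"
  by (auto simp: base_vertex_def simplices_def singular_simplex_def)

lemma drop_letter_hom: "b \<in> simplices X \<Longrightarrow> drop_letter x b \<in> homog (reduced_simplices X x) 1 (sdeg [b])"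
  using homog_letter[of b "reduced_simplices X x"] by (auto simp: drop_letter_def reduced_simplices_def)

lemma drop_alg_hom: "Y \<in> homog (simplices X) l e \<Longrightarrow> drop_alg x Y \<in> homog (reduced_simplices X x) l e"
  unfolding drop_alg_def by (rule amap_hom[OF _ drop_letter_hom])

context approximation begin

text \<open>The base vertex has no boundary and its diagonal is a word in itself, so the ideal it
  generates is stable under the derivation.\<close>

lemma rsing_base:
  fixes x :: 'a
  shows "rsing D x (base_vertex x) = 0"
proof -
  let ?s = "restrict (\<lambda>_. x) (standard_simplex 0)"
  have D0: "D 0 = gen [id_simplex 0, id_simplex 0]" using approx by (simp add: diagonal_approximation_def id_simplex_def)
  have "push_simplex ?s (id_simplex 0) = base_vertex x"
    by (auto simp: push_simplex_def id_simplex_def base_vertex_def simplex_map_def restrict_def)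
  then have "diag D (gen (base_vertex x)) = gen [base_vertex x, base_vertex x]"
    by (simp add: diag_def base_vertex_def[of x] D0 push_eq) 
  moreover have "bd (gen (base_vertex x)) = (0 :: ('a simplex, 'f) gvec)" by (simp add: bd_def base_vertex_def)
  moreover have "drop_base x (gen [base_vertex x, base_vertex x]) = (0 :: ('a simplex, 'f) gten)"
    by (simp add: drop_base_def)
  ultimately show ?thesis
    by (simp add: rsing_eq sing_def conv_dg tlin_X[OF tlin_drop_alg] drop_alg_const sig_drop_base[symmetric] flinearD(4)[OF flinear_sig])
qed

lemma drop_alg_der: "drop_alg x (der (sing D) X) = der (rsing D x) (drop_alg x X)"
  unfolding drop_alg_def
proof (rule der_amap_eq[of UNIV _ UNIV, symmetric])
  fix b
  show "drop_letter x b \<in> homog UNIV 1 (sdeg [b])"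
    unfolding drop_letter_def by (simp only: homog_UNIV_letter hom_0 split: if_split) simp
  show "der (rsing D x) (drop_letter x b) = amap (drop_letter x) (sing D b)"
    using rsing_eq[of D x b] rsing_base[of x]
    by (auto simp: drop_letter_def der_letter tlin_0[OF tlin_der] drop_alg_def simp del: der_word_eq)
qed auto

lemma ainf_rsing: "ainf (reduced_simplices X x) (rsing D x)"
  unfolding ainf_def
proof (intro ballI conjI)
  fix b assume b: "b \<in> reduced_simplices X x"
  then have bX: "b \<in> simplices X" by (simp add: reduced_simplices_def)
  show "rsing D x b \<in> homog (reduced_simplices X x) 1 (sdeg [b] - 1)"
    unfolding rsing_eq by (rule drop_alg_hom[OF ainf_homog[OF ainf_sing bX]])
  have "der (sing D) (sing D b) = 0" using ainf_sing bX by (auto simp: ainf_def)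
  then show "der (rsing D x) (rsing D x b) = 0"
    by (simp add: rsing_eq[of D x b] drop_alg_der[symmetric] tlin_0[OF tlin_drop_alg])
qed

end

lemma lpart_rsing: "lpart (rsing D x) v = reduced_bd x v"
proof -
  have l: "flinear (reduced_bd x)"
    using flinear_compose[OF flinear_unletter flinear_compose[OF flinear_drop_base flinear_compose[OF flinear_letter flinear_bd]]]
    by (simp add: reduced_bd_def comp_def)
  show ?thesis
    by (rule flinear_eq_on[OF flinear_lpart l]) (simp add: rsing_def conv_dg emb_def)
qed

text \<open>The condition \<open>base\<close> says that the base vertex lands in the kernel of the
  quotient map of the target, which is what descent to the quotients requires.\<close>

lemma reduced_mor:
  fixes D D' :: "nat \<Rightarrow> ((nat \<Rightarrow> real) simplex, 'f::field) gten"
  assumes D: "diagonal_approximation D" "diagonal_approximation D'"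
    and F: "\<And>b. b \<in> simplices X \<Longrightarrow> F b \<in> homog (simplices Y) 1 (sdeg [b])"
    and eq: "\<And>b. b \<in> simplices X \<Longrightarrow> der (sing D') (F b) = amap F (sing D b)"
    and base: "drop_alg y (F (base_vertex x)) = 0"
  shows "mor (reduced_simplices X x) (rsing D x) (reduced_simplices Y y) (rsing D' y) (\<lambda>b. drop_alg y (F b))"
  unfolding mor_def
proof (intro ballI conjI)
  interpret D: approximation D by unfold_locales (rule D)
  interpret D': approximation D' by unfold_locales (rule D)
  fix b assume "b \<in> reduced_simplices X x"
  then have bX: "b \<in> simplices X" by (simp add: reduced_simplices_def)
  show "drop_alg y (F b) \<in> homog (reduced_simplices Y y) 1 (sdeg [b])"
    by (rule drop_alg_hom[OF F[OF bX]])
  have "amap (\<lambda>b. drop_alg y (F b)) (drop_alg x Z) = drop_alg y (amap F Z)" for Z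
  proof -
    have "amap (\<lambda>b. drop_alg y (F b)) (drop_letter x b) = drop_alg y (F b)" for b
      using base by (auto simp: drop_letter_def tlin_0[OF tlin_amap])
    then show ?thesis unfolding drop_alg_def amap_comp by simp
  qed
  then show "der (rsing D' y) (drop_alg y (F b)) = amap (\<lambda>b. drop_alg y (F b)) (rsing D x b)"
    by (simp add: rsing_eq D'.drop_alg_der[symmetric] eq[OF bX])
qed

subsection \<open>Contracting homotopies\<close>

text \<open>Change of coefficients from integral chains; the dimension is recorded next to each
  simplex.\<close>

definition toF :: "nat \<Rightarrow> 'a chain \<Rightarrow> ('a simplex, 'f::field) gvec" where
  "toF p c = (\<Sum>\<sigma>\<in>Poly_Mapping.keys c. fscale (of_int (Poly_Mapping.lookup c \<sigma>)) (gen (p, \<sigma>)))"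

lemma toF_superset:
  assumes "finite B" "Poly_Mapping.keys c \<subseteq> B"
  shows "toF p c = (\<Sum>\<sigma>\<in>B. fscale (of_int (Poly_Mapping.lookup c \<sigma>)) (gen (p, \<sigma>)))"
  unfolding toF_def using assms by (intro sum.mono_neutral_left) (auto simp: in_keys_iff)

lemma toF_0 [simp]: "toF p 0 = 0" by (simp add: toF_def)

lemma toF_of [simp]: "toF p (frag_of \<sigma>) = gen (p, \<sigma>)"
  by (simp add: toF_def)

lemma toF_diff: "toF p (a - b) = toF p a - toF p b"
proof -
  let ?B = "Poly_Mapping.keys a \<union> Poly_Mapping.keys b"
  have "Poly_Mapping.keys (a - b) \<subseteq> ?B" by (rule Poly_Mapping.keys_diff)
  then show ?thesis
    by (simp add: toF_superset[of ?B] lookup_minus sum_subtractf[symmetric])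
      (rule sum.cong, auto intro!: poly_mapping_eqI simp: lookup_minus algebra_simps)
qed

lemma toF_minus: "toF p (- a) = - toF p a"
  using toF_diff[of p 0 a] by simp

lemma toF_add: "toF p (a + b) = toF p a + toF p b"
  using toF_diff[of p a "- b"] by (simp add: toF_minus)

lemma toF_sum: "toF p (sum g A) = (\<Sum>x\<in>A. toF p (g x))"
  by (induction A rule: infinite_finite_induct) (auto simp: toF_add)

lemma toF_sign: "toF p (frag_cmul ((- 1) ^ k) a) = fscale ((- 1) ^ k) (toF p a)"
  by (cases "even k") (auto simp: toF_minus fscale_minus_left)

lemma toF_gcomp: "singular_chain p X c \<Longrightarrow> toF p c \<in> gcomp (simplices X) p"
  unfolding toF_def gcomp_def
  by (intro free_on_sum free_on_fscale) (auto simp: singular_chain_def simplices_def)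

lemma toF_boundary: "toF p (chain_boundary (Suc p) c) = bd (toF (Suc p) c)"
  using subset_UNIV[of "Poly_Mapping.keys c"]
proof (induction c rule: frag_induction)
  case (one \<sigma>)
  show ?case
    by (simp add: chain_boundary_of toF_sum toF_sign bd_gen del: sum.atMost_Suc)
qed (auto simp: chain_boundary_diff toF_diff flinearD[OF flinear_bd])

text \<open>The identity is homotopic to a constant map, so \<open>c\<close> is homologous to its
  image in a one-point space, where every cycle of positive dimension bounds.\<close>

lemma contractible_cycle_boundary:
  assumes h: "homotopic_with (\<lambda>_. True) X X id (\<lambda>_. a)" and a: "a \<in> topspace X"
    and p: "1 \<le> p" and c: "singular_chain p X c" "chain_boundary p c = 0"
  shows "\<exists>d. singular_chain (Suc p) X d \<and> chain_boundary (Suc p) d = c"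
proof -
  have cyc: "singular_relcycle p X {} c" using c by (simp add: singular_cycle)
  have h': "homotopic_with (\<lambda>h. h \<in> {} \<rightarrow> {}) X X id (\<lambda>_. a)"
    by (rule homotopic_with_mono[OF h]) auto
  have 1: "singular_relboundary p X {} (chain_map p id c - chain_map p (\<lambda>_. a) c)"
    using homotopic_imp_homologous_rel_chain_maps[OF h' cyc] by (simp add: homologous_rel_def)
  have "continuous_map X (subtopology X {a}) (\<lambda>_. a)" using a by (simp add: continuous_map_in_subtopology)
  from singular_relcycle_chain_map[OF cyc this]
  have "singular_relcycle p (subtopology X {a}) {} (chain_map p (\<lambda>_. a) c)" by simp
  moreover have "topspace (subtopology X {a}) = {a}" using a by auto
  ultimately have "singular_relboundary p (subtopology X {a}) {} (chain_map p (\<lambda>_. a) c)"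
    using singular_boundary_eq_cycle_singleton[of "subtopology X {a}" a p] p by simp
  moreover have "{a} \<subseteq> topspace X" using a by simp
  ultimately have "singular_relboundary p (subtopology X (topspace X)) {} (chain_map p (\<lambda>_. a) c)"
    by (rule singular_boundary_mono[rotated])
  then have 2: "singular_relboundary p X {} (chain_map p (\<lambda>_. a) c)" by simp
  have "chain_map p id c = c" by (rule chain_map_id_gen[OF c(1)]) simp
  then have "singular_relboundary p X {} c" using singular_relboundary_add[OF 1 2] by simp
  then show ?thesis by (simp add: singular_boundary)
qed

text \<open>The augmentation followed by the inclusion of the vertex \<open>a\<close>: the chain map
  to which the identity of a contractible space is contracted.\<close>

definition vertex_proj :: "'a \<Rightarrow> ('a simplex, 'f::field) gvec \<Rightarrow> ('a simplex, 'f) gvec" where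
  "vertex_proj a = lin_ext (\<lambda>b. if fst b = 0 then gen (base_vertex a) else 0)"

lemma flinear_vertex_proj: "flinear (vertex_proj a)" by (simp add: vertex_proj_def flinear_lin_ext)

lemma singular_chain_extend_frag:
  assumes "singular_chain p X c" "\<And>\<sigma>. singular_simplex p X \<sigma> \<Longrightarrow> singular_chain q X (k \<sigma>)"
  shows "singular_chain q X (frag_extend k c)"
  by (rule singular_chain_extend) (use assms in \<open>auto simp: singular_chain_def\<close>)

text \<open>The contraction is chosen dimension by dimension: a simplex minus the contraction of its
  boundary is a cycle, hence a boundary, and any chain that it bounds may serve as the next
  value.\<close>

lemma integral_contraction:
  fixes X :: "'a topology"
  assumes h: "homotopic_with (\<lambda>_. True) X X id (\<lambda>_. a)" and a: "a \<in> topspace X"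
  shows "\<exists>K. \<forall>p. (\<forall>\<sigma>. singular_simplex p X \<sigma> \<longrightarrow> singular_chain (Suc p) X (K p \<sigma>)) \<and>
     (p = 0 \<longrightarrow> (\<forall>\<sigma>. singular_simplex 0 X \<sigma> \<longrightarrow> chain_boundary 1 (K 0 \<sigma>) = frag_of \<sigma> - frag_of (snd (base_vertex a)))) \<and>
     (\<forall>\<sigma>. singular_simplex (Suc p) X \<sigma> \<longrightarrow> chain_boundary (Suc (Suc p)) (K (Suc p) \<sigma>) =
        frag_of \<sigma> - frag_extend (K p) (chain_boundary (Suc p) (frag_of \<sigma>)))"
proof -
  define ch where "ch = (\<lambda>p k. \<forall>\<sigma>. singular_simplex p X \<sigma> \<longrightarrow> singular_chain (Suc p) X (k \<sigma>))"
  define st where "st = (\<lambda>p k k'. \<forall>\<sigma>. singular_simplex (Suc p) X \<sigma> \<longrightarrow> chain_boundary (Suc (Suc p)) (k' \<sigma>) =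
        frag_of \<sigma> - frag_extend k (chain_boundary (Suc p) (frag_of (\<sigma> :: (nat \<Rightarrow> real) \<Rightarrow> 'a))))"
  \<comment> \<open>The invariant of the recursion: it makes a simplex of the next dimension minus
    the contraction of its boundary a cycle.\<close>
  define J where "J = (\<lambda>p k. \<forall>\<tau>. singular_simplex (Suc p) X \<tau> \<longrightarrow>
        chain_boundary (Suc p) (frag_extend k (chain_boundary (Suc p) (frag_of (\<tau> :: (nat \<Rightarrow> real) \<Rightarrow> 'a)))) = chain_boundary (Suc p) (frag_of \<tau>))"
  define st0 where "st0 = (\<lambda>k. \<forall>\<sigma>. singular_simplex 0 X \<sigma> \<longrightarrow> chain_boundary 1 (k \<sigma>) = frag_of \<sigma> - frag_of (snd (base_vertex a)))"
  have "\<exists>K. \<forall>p. (ch p (K p) \<and> J p (K p) \<and> (p = 0 \<longrightarrow> st0 (K p))) \<and> st p (K p) (K (Suc p))"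
  proof (rule dependent_nat_choice)
    have ex0: "\<exists>d. singular_chain 1 X d \<and> chain_boundary 1 d = frag_of \<sigma> - frag_of (snd (base_vertex a))"
      if s: "singular_simplex 0 X \<sigma>" for \<sigma>
    proof -
      have cyc: "singular_relcycle 0 X {} (frag_of \<sigma>)" using s by (simp add: singular_cycle singular_chain_of chain_boundary_of)
      have h': "homotopic_with (\<lambda>h. h \<in> {} \<rightarrow> {}) X X id (\<lambda>_. a)"
        by (rule homotopic_with_mono[OF h]) auto
      have "singular_relboundary 0 X {} (chain_map 0 id (frag_of \<sigma>) - chain_map 0 (\<lambda>_. a) (frag_of \<sigma>))"
        using homotopic_imp_homologous_rel_chain_maps[OF h' cyc] by (simp add: homologous_rel_def)
      moreover have "simplex_map 0 id \<sigma> = \<sigma>" by (rule simplex_map_id_gen[OF s]) simp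
      moreover have "simplex_map 0 (\<lambda>_. a) \<sigma> = snd (base_vertex a)"
        by (auto simp: simplex_map_def base_vertex_def)
      ultimately show ?thesis by (simp add: singular_boundary del: simplex_map_id)
    qed
    then obtain k where k: "\<And>\<sigma>. singular_simplex 0 X \<sigma> \<Longrightarrow> singular_chain 1 X (k \<sigma>) \<and> chain_boundary 1 (k \<sigma>) = frag_of \<sigma> - frag_of (snd (base_vertex a))"
      by metis
    have "J 0 k"
      unfolding J_def
    proof (intro allI impI)
      fix \<tau> assume t: "singular_simplex (Suc 0) X \<tau>"
      have f: "singular_simplex 0 X (singular_face 1 i \<tau>)" if "i \<le> 1" for i
        using singular_simplex_singular_face[of 1 X \<tau> i] t that by simp
      have b: "chain_boundary (Suc 0) (frag_of \<tau>) = frag_of (singular_face 1 0 \<tau>) - frag_of (singular_face 1 1 \<tau>)"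
        by (simp add: chain_boundary_of)
      show "chain_boundary (Suc 0) (frag_extend k (chain_boundary (Suc 0) (frag_of \<tau>))) = chain_boundary (Suc 0) (frag_of \<tau>)"
        unfolding b using k[OF f[of 0]] k[OF f[of 1]] by (simp add: frag_extend_diff chain_boundary_diff)
    qed
    then show "\<exists>k. ch 0 k \<and> J 0 k \<and> (0 = 0 \<longrightarrow> st0 k)" using k by (auto simp: ch_def st0_def)
  next
    fix k p assume k: "ch p k \<and> J p k \<and> (p = 0 \<longrightarrow> st0 k)"
    have ext: "singular_chain (Suc p) X (frag_extend k c)" if "singular_chain p X c" for c
      using singular_chain_extend_frag[OF that] k by (simp add: ch_def)
    have "\<exists>d. singular_chain (Suc (Suc p)) X d \<and>
        chain_boundary (Suc (Suc p)) d = frag_of \<sigma> - frag_extend k (chain_boundary (Suc p) (frag_of \<sigma>))"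
      if s: "singular_simplex (Suc p) X \<sigma>" for \<sigma>
    proof (rule contractible_cycle_boundary[OF h a])
      have sc: "singular_chain (Suc p) X (frag_of \<sigma>)" using s by (simp add: singular_chain_of)
      show "singular_chain (Suc p) X (frag_of \<sigma> - frag_extend k (chain_boundary (Suc p) (frag_of \<sigma>)))"
        by (intro singular_chain_diff sc ext singular_chain_boundary_alt)
      show "chain_boundary (Suc p) (frag_of \<sigma> - frag_extend k (chain_boundary (Suc p) (frag_of \<sigma>))) = 0"
        using k s by (simp add: chain_boundary_diff J_def)
    qed simp
    then obtain k' where k': "\<And>\<sigma>. singular_simplex (Suc p) X \<sigma> \<Longrightarrow> singular_chain (Suc (Suc p)) X (k' \<sigma>) \<and>
        chain_boundary (Suc (Suc p)) (k' \<sigma>) = frag_of \<sigma> - frag_extend k (chain_boundary (Suc p) (frag_of \<sigma>))"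
      by metis
    have bk: "chain_boundary (Suc (Suc p)) (frag_extend k' c) = c - frag_extend k (chain_boundary (Suc p) c)"
      if "singular_chain (Suc p) X c" for c
    proof -
      have "Poly_Mapping.keys c \<subseteq> singular_simplex_set (Suc p) X" using that by (simp add: singular_chain_def)
      then show ?thesis
        by (induction c rule: frag_induction) (use k' in \<open>auto simp: frag_extend_diff chain_boundary_diff\<close>)
    qed
    have "J (Suc p) k'"
      unfolding J_def
    proof (intro allI impI)
      fix \<tau> assume t: "singular_simplex (Suc (Suc p)) X \<tau>"
      have sc: "singular_chain (Suc (Suc p)) X (frag_of \<tau>)" using t by (simp add: singular_chain_of)
      have "chain_boundary (Suc p) (chain_boundary (Suc (Suc p)) (frag_of \<tau>)) = 0"
        using chain_boundary_boundary_alt[OF sc] by simp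
      then show "chain_boundary (Suc (Suc p)) (frag_extend k' (chain_boundary (Suc (Suc p)) (frag_of \<tau>))) = chain_boundary (Suc (Suc p)) (frag_of \<tau>)"
        using bk[OF singular_chain_boundary_alt[OF sc]] by simp
    qed
    moreover have "ch (Suc p) k'" "st p k k'" using k' by (auto simp: ch_def st_def)
    ultimately show "\<exists>k'. (ch (Suc p) k' \<and> J (Suc p) k' \<and> (Suc p = 0 \<longrightarrow> st0 k')) \<and> st p k k'" by blast
  qed
  then obtain K where "\<forall>p. (ch p (K p) \<and> J p (K p) \<and> (p = 0 \<longrightarrow> st0 (K p))) \<and> st p (K p) (K (Suc p))" by blast
  then have "\<forall>p. ch p (K p) \<and> (p = 0 \<longrightarrow> st0 (K 0)) \<and> st p (K p) (K (Suc p))" by blast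
  then show ?thesis unfolding ch_def st0_def st_def by blast
qed

lemma chain_contraction:
  fixes X :: "'a topology"
  assumes "homotopic_with (\<lambda>_. True) X X id (\<lambda>_. a)" and a: "a \<in> topspace X"
  shows "\<exists>h :: ('a simplex, 'f::field) gvec \<Rightarrow> _. flinear h \<and> (\<forall>p. \<forall>v\<in>gcomp (simplices X) p. h v \<in> gcomp (simplices X) (Suc p)) \<and>
    (\<forall>v\<in>free_on (simplices X). bd (h v) + h (bd v) = v - vertex_proj a v)"
proof -
  obtain K where K: "\<And>p \<sigma>. singular_simplex p X \<sigma> \<Longrightarrow> singular_chain (Suc p) X (K p \<sigma>)"
    "\<And>\<sigma>. singular_simplex 0 X \<sigma> \<Longrightarrow> chain_boundary 1 (K 0 \<sigma>) = frag_of \<sigma> - frag_of (snd (base_vertex a))"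
    "\<And>p \<sigma>. singular_simplex (Suc p) X \<sigma> \<Longrightarrow> chain_boundary (Suc (Suc p)) (K (Suc p) \<sigma>) =
        frag_of \<sigma> - frag_extend (K p) (chain_boundary (Suc p) (frag_of \<sigma>))"
    using integral_contraction[OF assms] by metis
  define h :: "('a simplex, 'f::field) gvec \<Rightarrow> ('a simplex, 'f::field) gvec"
    where "h = lin_ext (\<lambda>b. toF (Suc (fst b)) (K (fst b) (snd b)))"
  have lh: "flinear h" by (simp add: h_def flinear_lin_ext)
  have hg: "h (gen (p, \<sigma>)) = toF (Suc p) (K p \<sigma>)" for p \<sigma> by (simp add: h_def)
  have hF: "h (toF p c) = toF (Suc p) (frag_extend (K p) c)" for p c
    using subset_UNIV[of "Poly_Mapping.keys c"]
    by (induction c rule: frag_induction) (auto simp: hg flinearD[OF lh] toF_diff frag_extend_diff)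
  have "h v \<in> gcomp (simplices X) (Suc p)" if "v \<in> gcomp (simplices X) p" for v p
    by (rule flinear_gcomp[OF lh _ that]) (use toF_gcomp[OF K(1)] in \<open>auto simp: hg simplices_def\<close>)
  moreover have "bd (h v) + h (bd v) = v - vertex_proj a v" if "v \<in> free_on (simplices X)" for v
  proof (rule flinear_eq_free_on[OF _ _ _ that])
    show "flinear (\<lambda>v. bd (h v) + h (bd v))" "flinear (\<lambda>v. v - vertex_proj a v)"
      by (rule flinear_plus flinear_diff flinear_id flinear_compose[OF flinear_bd lh] flinear_compose[OF lh flinear_bd] flinear_vertex_proj)+
    fix b assume "b \<in> simplices X"
    then obtain p \<sigma> where b: "b = (p, \<sigma>)" and s: "singular_simplex p X \<sigma>" by (cases b) (auto simp: simplices_def)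
    show "bd (h (gen b)) + h (bd (gen b)) = gen b - vertex_proj a (gen b)"
    proof (cases p)
      case 0
      have "(0, snd (base_vertex a)) = base_vertex a" by (simp add: base_vertex_def)
      then show ?thesis using K(2)[of \<sigma>] s 0
        by (simp add: b hg toF_boundary[symmetric] toF_diff bd_gen_0 flinearD(4)[OF lh] vertex_proj_def)
    next
      case (Suc q)
      have "bd (gen (Suc q, \<sigma>)) = (toF q (chain_boundary (Suc q) (frag_of \<sigma>)) :: ('a simplex, 'f) gvec)" by (simp add: toF_boundary)
      then show ?thesis using K(3)[of q \<sigma>] s Suc
        by (simp add: b hg toF_boundary[symmetric] toF_diff hF vertex_proj_def)
    qed
  qed
  ultimately show ?thesis using lh by blast
qed

lemma std_space_contractible:
  "contractible_space (std_space p)"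
proof -
  define e :: "nat \<Rightarrow> real" where "e = (\<lambda>j. if j = 0 then 1 else 0)"
  have e: "e \<in> standard_simplex p" unfolding e_def by (rule basis_in_standard_simplex[THEN iffD2]) simp
  let ?P = "prod_topology (top_of_set {0..1::real}) (std_space p)"
  define h where "h = (\<lambda>(t, x). \<lambda>i. (1 - t) * x i + t * e i)"
  have fst: "continuous_map ?P euclideanreal fst"
    using continuous_map_fst[of "top_of_set {0..1::real}" "std_space p"] by (rule continuous_map_into_fulltopology)
  have proj: "continuous_map (std_space p) euclideanreal (\<lambda>x. x i)" for i
    unfolding std_space_def by (intro continuous_map_from_subtopology continuous_map_product_projection) simp
  have snd: "continuous_map ?P euclideanreal (\<lambda>z. snd z i)" for i
    using continuous_map_compose[OF continuous_map_snd proj] by (simp add: o_def)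
  have "continuous_map ?P (powertop_real UNIV) h"
    unfolding continuous_map_componentwise_UNIV h_def case_prod_beta
    by (intro allI continuous_map_add continuous_map_real_mult continuous_map_diff continuous_map_const[THEN iffD2] fst snd) auto
  moreover have "h z \<in> standard_simplex p" if "z \<in> topspace ?P" for z
    using that convex_standard_simplex[of "snd z" p e "fst z"] e by (auto simp: h_def std_space_def case_prod_beta)
  ultimately have "continuous_map ?P (std_space p) h"
    by (auto simp: std_space_def continuous_map_in_subtopology)
  then have "homotopic_with (\<lambda>_. True) (std_space p) (std_space p) id (\<lambda>_. e)"
    unfolding homotopic_with_def by (intro exI[of _ h]) (auto simp: h_def)
  then show ?thesis unfolding contractible_space_def by blast
qed

lemma contractible_contraction:
  fixes X :: "'a topology"
  assumes "contractible_space X" "topspace X \<noteq> {}"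
  shows "\<exists>a (h :: ('a simplex, 'f::field) gvec \<Rightarrow> _). a \<in> topspace X \<and> flinear h \<and> (\<forall>p. \<forall>v\<in>gcomp (simplices X) p. h v \<in> gcomp (simplices X) (Suc p)) \<and>
    (\<forall>v\<in>free_on (simplices X). bd (h v) + h (bd v) = v - vertex_proj a v)"
proof -
  obtain a where a: "homotopic_with (\<lambda>_. True) X X id (\<lambda>_. a)" using assms(1) by (auto simp: contractible_space_def)
  then have "continuous_map X X (\<lambda>_. a)" by (rule homotopic_with_imp_continuous_maps[THEN conjunct2])
  then have "a \<in> topspace X" using assms(2) by (auto simp: continuous_map_def)
  with chain_contraction[OF a this] show ?thesis by blast
qed

lemma std_space_nonempty: "topspace (std_space p) \<noteq> {}"
  by (simp add: std_space_def nonempty_standard_simplex)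

subsection \<open>Homotopy invariance\<close>

lemma bd_gcomp: "v \<in> gcomp (simplices X) (Suc p) \<Longrightarrow> bd v \<in> gcomp (simplices X) p"
proof (rule flinear_gcomp[OF flinear_bd])
  fix b assume "b \<in> simplices X" "fst b = Suc p"
  then obtain \<sigma> where b: "b = (Suc p, \<sigma>)" "singular_simplex (Suc p) X \<sigma>" by (cases b) (auto simp: simplices_def)
  then have "singular_chain (Suc p) X (frag_of \<sigma>)" by (simp add: singular_chain_of)
  from toF_gcomp[OF singular_chain_boundary_alt[OF this]] show "bd (gen b) \<in> gcomp (simplices X) p"
    by (simp add: b toF_boundary)
qed

lemma bd_gcomp_0: "v \<in> gcomp S 0 \<Longrightarrow> bd v = 0"
  unfolding gcomp_def by (rule flinear_eq_free_on[OF flinear_bd flinear_zero]) (auto simp: bd_gen_0)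

lemma bd_bd: "v \<in> free_on (simplices X) \<Longrightarrow> bd (bd v) = 0"
proof (rule flinear_eq_free_on[OF flinear_compose[OF flinear_bd flinear_bd] flinear_zero])
  fix b assume b: "b \<in> simplices X"
  obtain p \<sigma> where e: "b = (p, \<sigma>)" by (cases b)
  have s: "singular_chain p X (frag_of \<sigma>)" using b e by (simp add: simplices_def singular_chain_of)
  consider "p = 0" | "p = 1" | q where "p = Suc (Suc q)" by (cases p) (auto, metis not0_implies_Suc)
  then show "bd (bd (gen b)) = 0"
  proof cases
    case 1
    then show ?thesis by (simp add: e bd_gen_0 flinearD(4)[OF flinear_bd])
  next
    case 2
    have "gen b \<in> gcomp (simplices X) (Suc 0)" using b e 2 by simp
    from bd_gcomp_0[OF bd_gcomp[OF this]] show ?thesis .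
  next
    case 3
    have "chain_boundary (Suc q) (chain_boundary (Suc (Suc q)) (frag_of \<sigma>)) = 0"
      using chain_boundary_boundary_alt[of "Suc q" X "frag_of \<sigma>"] s 3 by simp
    then have "toF q (chain_boundary (Suc q) (chain_boundary (Suc (Suc q)) (frag_of \<sigma>))) = 0" by simp
    then show ?thesis by (simp add: toF_boundary e 3)
  qed
qed

lemma push_vec_gen [simp]: "push_vec g (gen b) = gen (push_simplex g b)" by (simp add: push_vec_def)

lemma push_vec_gcomp:
  "continuous_map T X g \<Longrightarrow> v \<in> gcomp (simplices T) p \<Longrightarrow> push_vec g v \<in> gcomp (simplices X) p"
  by (rule flinear_gcomp[OF flinear_push_vec]) (auto intro: push_simplex_in)

lemma push_vec_eq:
  assumes "v \<in> free_on (simplices T)" "\<And>x. x \<in> topspace T \<Longrightarrow> g (f x) = k x"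
  shows "push_vec g (push_vec f v) = push_vec k v"
proof (rule flinear_eq_free_on[OF flinear_compose[OF flinear_push_vec flinear_push_vec] flinear_push_vec _ assms(1)])
  fix b assume b: "b \<in> simplices T"
  obtain q \<tau> where e: "b = (q, \<tau>)" by (cases b)
  have "\<tau> t \<in> topspace T" if "t \<in> standard_simplex q" for t
    using b e that by (auto simp: simplices_def singular_simplex_def continuous_map_def)
  then have "simplex_map q g (simplex_map q f \<tau>) = simplex_map q k \<tau>"
    using assms(2) by (auto simp: simplex_map_def restrict_def)
  then show "push_vec g (push_vec f (gen b)) = push_vec k (gen b)" by (simp add: e push_simplex_def)
qed

lemma push_vec_id: "v \<in> free_on (simplices T) \<Longrightarrow> push_vec id v = v"
proof (rule flinear_eq_free_on[OF flinear_push_vec flinear_id])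
  fix b assume "b \<in> simplices T"
  then obtain q \<tau> where "b = (q, \<tau>)" "singular_simplex q T \<tau>" by (cases b) (auto simp: simplices_def)
  then show "push_vec id (gen b) = gen b"
    using simplex_map_id_gen[of q T \<tau> id] by (simp add: push_simplex_def del: simplex_map_id)
qed

section \<open>Prism operators by acyclic models\<close>

abbreviation "cyl X \<equiv> prod_topology (top_of_set {0..1::real}) X"

definition times_map :: "('b \<Rightarrow> 'a) \<Rightarrow> real \<times> 'b \<Rightarrow> real \<times> 'a" where
  "times_map \<sigma> z = (fst z, \<sigma> (snd z))"

text \<open>By naturality an operator from chains of X to chains of the cylinder is given by its
  value \<open>k\<close> on the identity simplex.\<close>

definition cyl_op :: "((real \<times> (nat \<Rightarrow> real)) simplex, 'f::field) gvec \<Rightarrow> ('a simplex, 'f) gvec \<Rightarrow> ((real \<times> 'a) simplex, 'f) gvec" where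
  "cyl_op k = lin_ext (\<lambda>b. push_vec (times_map (snd b)) k)"

lemma flinear_cyl_op: "flinear (cyl_op k)" by (simp add: cyl_op_def flinear_lin_ext)

lemma continuous_times_map:
  assumes "continuous_map T X \<sigma>" shows "continuous_map (cyl T) (cyl X) (times_map \<sigma>)"
  unfolding times_map_def continuous_map_pairwise o_def fst_conv snd_conv
  using continuous_map_compose[OF continuous_map_snd assms] continuous_map_fst by (auto simp: o_def)

lemma push_times_incl: "push_vec (times_map \<sigma>) (push_vec (Pair c) v) = push_vec (Pair c) (push_vec \<sigma> v)"
proof (rule flinear_eq_on[OF flinear_compose[OF flinear_push_vec flinear_push_vec] flinear_compose[OF flinear_push_vec flinear_push_vec]])
  fix b
  have "simplex_map q (times_map \<sigma>) (simplex_map q (Pair c) \<tau>) = simplex_map q (Pair c) (simplex_map q \<sigma> \<tau>)" for q \<tau>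
    by (auto simp: simplex_map_def restrict_def times_map_def)
  then show "push_vec (times_map \<sigma>) (push_vec (Pair c) (gen b)) = push_vec (Pair c) (push_vec \<sigma> (gen b))"
    by (simp add: push_simplex_def case_prod_beta)
qed

lemma push_times_cyl_op:
  assumes k: "k \<in> gcomp (simplices (cyl (std_space q))) r" and v: "v \<in> gcomp S q"
  shows "push_vec (times_map \<sigma>) (cyl_op k v) = cyl_op k (push_vec \<sigma> v)"
proof (rule flinear_eq_free_on[OF flinear_compose[OF flinear_push_vec flinear_cyl_op] flinear_compose[OF flinear_cyl_op flinear_push_vec] _ v[unfolded gcomp_def]])
  fix b assume b: "b \<in> {b \<in> S. fst b = q}"
  then obtain \<rho> where e: "b = (q, \<rho>)" by (cases b) auto
  have "push_vec (times_map \<sigma>) (push_vec (times_map \<rho>) k) = push_vec (times_map (simplex_map q \<sigma> \<rho>)) k"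
    by (rule push_vec_eq[OF gcomp_free_on[OF k]]) (auto simp: times_map_def simplex_map_def std_space_def)
  then show "push_vec (times_map \<sigma>) (cyl_op k (gen b)) = cyl_op k (push_vec \<sigma> (gen b))"
    by (simp add: cyl_op_def e push_simplex_def)
qed

lemma cyl_op_gcomp:
  assumes k: "k \<in> gcomp (simplices (cyl (std_space p))) q" and v: "v \<in> gcomp (simplices X) p"
  shows "cyl_op k v \<in> gcomp (simplices (cyl X)) q"
proof (rule flinear_gcomp[OF flinear_cyl_op _ v])
  fix b assume b: "b \<in> simplices X" "fst b = p"
  then obtain \<sigma> where e: "b = (p, \<sigma>)" by (cases b) auto
  have "continuous_map (cyl (std_space p)) (cyl X) (times_map \<sigma>)"
    by (rule continuous_times_map[OF simplex_continuous]) (use b e in auto)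
  then show "cyl_op k (gen b) \<in> gcomp (simplices (cyl X)) q"
    using push_vec_gcomp[OF _ k] by (simp add: cyl_op_def e)
qed

lemma vertex_proj_gen: "vertex_proj a (gen b) = (if fst b = 0 then gen (base_vertex a) else 0)"
  by (simp add: vertex_proj_def)

lemma vertex_proj_pos: "v \<in> gcomp S p \<Longrightarrow> 0 < p \<Longrightarrow> vertex_proj a v = 0"
  unfolding gcomp_def
  by (rule flinear_eq_free_on[OF flinear_vertex_proj flinear_zero]) (auto simp: vertex_proj_def)

lemma cyl_contractible: "contractible_space (cyl (std_space p))"
  by (simp add: contractible_space_prod_topology std_space_contractible convex_imp_contractible)

text \<open>The cylinder over a simplex is contractible; in dimension 0 a chain bounds only if its
  augmentation vanishes, hence the extra condition.\<close>

lemma cyl_acyclic: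
  fixes z :: "((real \<times> (nat \<Rightarrow> real)) simplex, 'f::field) gvec"
  assumes z: "z \<in> gcomp (simplices (cyl (std_space p))) q" "bd z = 0" and v: "q = 0 \<Longrightarrow> \<forall>a. vertex_proj a z = 0"
  shows "\<exists>y\<in>gcomp (simplices (cyl (std_space p))) (Suc q). bd y = z"
proof -
  have ne: "topspace (cyl (std_space p)) \<noteq> {}" using std_space_nonempty[of p] by auto
  obtain a and h :: "((real \<times> (nat \<Rightarrow> real)) simplex, 'f) gvec \<Rightarrow> _" where h: "flinear h" "\<forall>v\<in>gcomp (simplices (cyl (std_space p))) q. h v \<in> gcomp (simplices (cyl (std_space p))) (Suc q)"
    "\<forall>v\<in>free_on (simplices (cyl (std_space p))). bd (h v) + h (bd v) = v - vertex_proj a v"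
    using contractible_contraction[OF cyl_contractible ne] by metis
  have "vertex_proj a z = 0"
  proof (cases "q = 0")
    case True
    then show ?thesis using v by blast
  next
    case False
    then show ?thesis using vertex_proj_pos[OF z(1)] by blast
  qed
  then have "bd (h z) = z" using h(3) gcomp_free_on[OF z(1)] z(2) flinearD(4)[OF h(1)] by fastforce
  then show ?thesis using h(2) z(1) by blast
qed

text \<open>Naturality reduces the prism identity to the identity simplex. \<open>e\<close> and
  \<open>e'\<close> are the operator of the previous dimension on the simplex and on X; in dimension
  0 both are 0.\<close>

lemma prism_step:
  assumes k: "k \<in> gcomp (simplices (cyl (std_space p))) (Suc p)"
    and b: "bd k = push_vec (Pair 1) (gen (id_simplex p)) - push_vec (Pair 0) (gen (id_simplex p)) - e (bd (gen (id_simplex p)))"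
    and e: "\<And>\<sigma>. (p, \<sigma>) \<in> simplices X \<Longrightarrow> push_vec (times_map \<sigma>) (e (bd (gen (id_simplex p)))) = e' (push_vec \<sigma> (bd (gen (id_simplex p))))"
    and l: "flinear e'" and v: "v \<in> gcomp (simplices X) p"
  shows "bd (cyl_op k v) = push_vec (Pair 1) v - push_vec (Pair 0) v - e' (bd v)"
proof (rule flinear_eq_free_on[OF flinear_compose[OF flinear_bd flinear_cyl_op] _ _ v[unfolded gcomp_def]])
  show "flinear (\<lambda>v. push_vec (Pair 1) v - push_vec (Pair 0) v - e' (bd v))"
    by (intro flinear_diff flinear_push_vec flinear_compose[OF l flinear_bd])
  fix b assume "b \<in> {b \<in> simplices X. fst b = p}"
  then obtain \<sigma> where b': "b = (p, \<sigma>)" "(p, \<sigma>) \<in> simplices X" by (cases b) auto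
  have i: "push_vec \<sigma> (gen (id_simplex p)) = gen b" by (simp add: push_id_simplex[OF b'(2)] b'(1))
  have "bd (cyl_op k (gen b)) = push_vec (times_map \<sigma>) (bd k)"
    by (simp add: cyl_op_def b'(1) push_vec_bd)
  also have "\<dots> = push_vec (Pair 1) (gen b) - push_vec (Pair 0) (gen b) - e' (bd (gen b))"
    unfolding b flinearD(3)[OF flinear_push_vec] push_times_incl e[OF b'(2)] push_vec_bd i ..
  finally show "bd (cyl_op k (gen b)) = push_vec (Pair 1) (gen b) - push_vec (Pair 0) (gen b) - e' (bd (gen b))" .
qed

lemma id_simplex_gcomp: "gen (id_simplex p) \<in> gcomp (simplices (std_space p)) p"
  using id_simplex_in by (simp add: id_simplex_def)

lemma continuous_Pair: "c \<in> {0..1} \<Longrightarrow> continuous_map X (cyl X) (Pair c)"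
  by (auto simp: continuous_map_pairwise o_def)

text \<open>Top minus bottom minus the prism over the boundary is a cycle in an acyclic complex, and
  \<kappa> is a chain bounding it. The last conjunct of the invariant \<open>P\<close> makes the
  next such expression a cycle.\<close>

lemma prism_exists:
  "\<exists>\<kappa> :: nat \<Rightarrow> ((real \<times> (nat \<Rightarrow> real)) simplex, 'f::field) gvec. \<forall>p. \<kappa> p \<in> gcomp (simplices (cyl (std_space p))) (Suc p) \<and>
     (p = 0 \<longrightarrow> bd (\<kappa> 0) = push_vec (Pair 1) (gen (id_simplex 0)) - push_vec (Pair 0) (gen (id_simplex 0))) \<and>
     bd (\<kappa> (Suc p)) = push_vec (Pair 1) (gen (id_simplex (Suc p))) - push_vec (Pair 0) (gen (id_simplex (Suc p))) - cyl_op (\<kappa> p) (bd (gen (id_simplex (Suc p))))"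
proof -
  define I where "I = (\<lambda>v. push_vec (Pair (1::real)) v - push_vec (Pair 0) (v :: ((nat \<Rightarrow> real) simplex, 'f) gvec))"
  define ii where "ii = (\<lambda>p. gen (id_simplex p) :: ((nat \<Rightarrow> real) simplex, 'f) gvec)"
  define P where "P = (\<lambda>p k. k \<in> gcomp (simplices (cyl (std_space p))) (Suc p) \<and> (p = 0 \<longrightarrow> bd k = I (ii 0)) \<and>
     bd (cyl_op k (bd (ii (Suc p)))) = I (bd (ii (Suc p))))"
  define Q where "Q = (\<lambda>p k k'. bd k' = I (ii (Suc p)) - cyl_op k (bd (ii (Suc p))))"
  have Ig: "I v \<in> gcomp (simplices (cyl X)) q" if "v \<in> gcomp (simplices X) q" for v X q
    unfolding I_def by (intro gcomp_diff push_vec_gcomp[OF continuous_Pair that]) auto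
  have Ib: "bd (I v) = I (bd v)" for v
    by (simp add: I_def flinearD[OF flinear_bd] push_vec_bd)
  have iib: "bd (ii (Suc p)) \<in> gcomp (simplices (std_space (Suc p))) p" for p
    unfolding ii_def by (rule bd_gcomp[OF id_simplex_gcomp])
  have "\<exists>\<kappa>. \<forall>p. P p (\<kappa> p) \<and> Q p (\<kappa> p) (\<kappa> (Suc p))"
  proof (rule dependent_nat_choice)
    have g: "I (ii 0) \<in> gcomp (simplices (cyl (std_space 0))) 0" by (rule Ig) (simp add: ii_def id_simplex_gcomp del: gcomp_gen)
    have "vertex_proj a (I (ii 0)) = 0" for a
      by (simp add: I_def ii_def flinearD[OF flinear_vertex_proj] vertex_proj_gen id_simplex_def)
    moreover have "bd (I (ii 0)) = 0" by (rule bd_gcomp_0[OF g])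
    ultimately obtain k where k: "k \<in> gcomp (simplices (cyl (std_space 0))) (Suc 0)" "bd k = I (ii 0)"
      using cyl_acyclic[OF g] by blast
    have "bd (cyl_op k (bd (ii (Suc 0)))) = I (bd (ii (Suc 0)))"
      using prism_step[OF k(1) _ _ flinear_zero iib, of "\<lambda>_. 0"] k(2)
      by (simp add: I_def ii_def flinearD(4)[OF flinear_push_vec])
    then show "\<exists>k. P 0 k" using k by (auto simp: P_def)
  next
    fix k p assume "P p k"
    then have k: "k \<in> gcomp (simplices (cyl (std_space p))) (Suc p)"
      "bd (cyl_op k (bd (ii (Suc p)))) = I (bd (ii (Suc p)))" by (auto simp: P_def)
    define z where "z = I (ii (Suc p)) - cyl_op k (bd (ii (Suc p)))"
    have zg: "z \<in> gcomp (simplices (cyl (std_space (Suc p)))) (Suc p)"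
      unfolding z_def by (intro gcomp_diff Ig cyl_op_gcomp[OF k(1) iib]) (simp add: ii_def id_simplex_gcomp del: gcomp_gen)
    have "bd z = 0" by (simp add: z_def flinearD[OF flinear_bd] Ib k(2))
    from cyl_acyclic[OF zg this] obtain k' where k': "k' \<in> gcomp (simplices (cyl (std_space (Suc p)))) (Suc (Suc p))" "bd k' = z" by auto
    have "bd (cyl_op k' (bd (ii (Suc (Suc p))))) = push_vec (Pair 1) (bd (ii (Suc (Suc p)))) - push_vec (Pair 0) (bd (ii (Suc (Suc p)))) - cyl_op k (bd (bd (ii (Suc (Suc p)))))"
    proof (rule prism_step[OF k'(1) _ _ flinear_cyl_op iib])
      show "bd k' = push_vec (Pair 1) (gen (id_simplex (Suc p))) - push_vec (Pair 0) (gen (id_simplex (Suc p))) - cyl_op k (bd (gen (id_simplex (Suc p))))"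
        by (simp add: k'(2) z_def I_def ii_def)
      show "push_vec (times_map \<sigma>) (cyl_op k (bd (gen (id_simplex (Suc p))))) = cyl_op k (push_vec \<sigma> (bd (gen (id_simplex (Suc p)))))" for \<sigma> :: "_ \<Rightarrow> (nat \<Rightarrow> real)"
        by (rule push_times_cyl_op[OF k(1) iib[unfolded ii_def]])
    qed
    moreover have "bd (bd (ii (Suc (Suc p)))) = 0"
      unfolding ii_def by (rule bd_bd[OF gcomp_free_on[OF id_simplex_gcomp]])
    ultimately have "P (Suc p) k'" using k' by (simp add: P_def I_def flinearD(4)[OF flinear_cyl_op])
    moreover have "Q p k k'" using k'(2) by (simp add: Q_def z_def)
    ultimately show "\<exists>k'. P (Suc p) k' \<and> Q p k k'" by blast
  qed
  then obtain \<kappa> where "\<forall>p. P p (\<kappa> p) \<and> Q p (\<kappa> p) (\<kappa> (Suc p))" by blast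
  then show ?thesis by (intro exI[of _ \<kappa>]) (auto simp: P_def Q_def I_def ii_def)
qed

text \<open>A homotopy is a map out of the cylinder; pushing the prism operators forward along it
  gives the chain homotopy.\<close>

lemma homotopic_chain_maps:
  fixes f :: "'a \<Rightarrow> 'b"
  assumes "homotopic_with (\<lambda>_. True) X Y f g"
  shows "\<exists>T :: ('a simplex, 'f::field) gvec \<Rightarrow> ('b simplex, 'f) gvec. flinear T \<and>
    (\<forall>p. \<forall>v\<in>gcomp (simplices X) p. T v \<in> gcomp (simplices Y) (Suc p)) \<and>
    (\<forall>v\<in>free_on (simplices X). bd (T v) + T (bd v) = push_vec g v - push_vec f v)"
proof -
  obtain h where h: "continuous_map (cyl X) Y h" "\<And>x. h (0, x) = f x" "\<And>x. h (1, x) = g x"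
    using assms unfolding homotopic_with_def by blast
  obtain \<kappa> :: "nat \<Rightarrow> ((real \<times> (nat \<Rightarrow> real)) simplex, 'f) gvec" where
    k: "\<And>p. \<kappa> p \<in> gcomp (simplices (cyl (std_space p))) (Suc p)"
    and k0: "bd (\<kappa> 0) = push_vec (Pair 1) (gen (id_simplex 0)) - push_vec (Pair 0) (gen (id_simplex 0))"
    and kS: "\<And>p. bd (\<kappa> (Suc p)) = push_vec (Pair 1) (gen (id_simplex (Suc p))) - push_vec (Pair 0) (gen (id_simplex (Suc p))) - cyl_op (\<kappa> p) (bd (gen (id_simplex (Suc p))))"
    using prism_exists by metis
  define K where "K = lin_ext (\<lambda>b. cyl_op (\<kappa> (fst b)) (gen b :: ('a simplex, 'f) gvec))"
  have lK: "flinear K" by (simp add: K_def flinear_lin_ext)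
  have Kp: "K v = cyl_op (\<kappa> p) v" if "v \<in> gcomp S p" for v p S
    unfolding K_def by (rule homogeneous_ext[OF flinear_cyl_op that])
  have bK: "bd (K v) + K (bd v) = push_vec (Pair 1) v - push_vec (Pair 0) v" if v: "v \<in> gcomp (simplices X) p" for v p
  proof (cases p)
    case 0
    have "bd (cyl_op (\<kappa> 0) v) = push_vec (Pair 1) v - push_vec (Pair 0) v - 0"
      by (rule prism_step[OF k _ _ flinear_zero v[unfolded 0], where e = "\<lambda>_. 0"]) (simp_all add: k0 flinearD(4)[OF flinear_push_vec])
    moreover have "bd v = 0" using bd_gcomp_0[OF v[unfolded 0]] .
    ultimately show ?thesis using Kp[OF v] 0 by (simp add: flinearD(4)[OF lK])
  next
    case (Suc q)
    have "bd (cyl_op (\<kappa> (Suc q)) v) = push_vec (Pair 1) v - push_vec (Pair 0) v - cyl_op (\<kappa> q) (bd v)"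
      by (rule prism_step[where p = "Suc q" and k = "\<kappa> (Suc q)" and e = "cyl_op (\<kappa> q)" and e' = "cyl_op (\<kappa> q)",
            OF k kS _ flinear_cyl_op v[unfolded Suc]]) (rule push_times_cyl_op[OF k bd_gcomp[OF id_simplex_gcomp]])
    then show ?thesis using Kp[OF v] Kp[OF bd_gcomp[OF v[unfolded Suc]]] Suc by simp
  qed
  define T where "T = (\<lambda>v. push_vec h (K v))"
  have lT: "flinear T" unfolding T_def by (rule flinear_compose[OF flinear_push_vec lK])
  moreover have "T v \<in> gcomp (simplices Y) (Suc p)" if "v \<in> gcomp (simplices X) p" for v p
    unfolding T_def Kp[OF that] by (rule push_vec_gcomp[OF h(1) cyl_op_gcomp[OF k that]])
  moreover have "bd (T v) + T (bd v) = push_vec g v - push_vec f v" if "v \<in> free_on (simplices X)" for v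
  proof (rule free_on_gen_eq[OF _ _ _ that])
    show "flinear (\<lambda>v. bd (T v) + T (bd v))" "flinear (\<lambda>v. push_vec g v - push_vec f v)"
      by (rule flinear_plus flinear_diff flinear_compose[OF flinear_bd lT] flinear_compose[OF lT flinear_bd] flinear_push_vec)+
    fix p and v :: "('a simplex, 'f) gvec" assume v: "v \<in> gcomp (simplices X) p"
    have "bd (T v) + T (bd v) = push_vec h (bd (K v) + K (bd v))"
      by (simp add: T_def push_vec_bd flinearD[OF flinear_push_vec])
    also have "\<dots> = push_vec h (push_vec (Pair 1) v) - push_vec h (push_vec (Pair 0) v)"
      by (simp add: bK[OF v] flinearD[OF flinear_push_vec])
    also have "\<dots> = push_vec g v - push_vec f v"
      using push_vec_eq[OF gcomp_free_on[OF v], of h "Pair 1" g] push_vec_eq[OF gcomp_free_on[OF v], of h "Pair 0" f] h by simp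
    finally show "bd (T v) + T (bd v) = push_vec g v - push_vec f v" .
  qed
  ultimately show ?thesis by blast
qed

lemma homotopic_id_cycle:
  fixes z :: "('a simplex, 'f::field) gvec"
  assumes "homotopic_with (\<lambda>_. True) X X k id" "z \<in> cycles (simplices X) bd p"
  shows "z - push_vec k z \<in> boundaries (simplices X) bd p"
proof -
  obtain T :: "('a simplex, 'f) gvec \<Rightarrow> ('a simplex, 'f) gvec" where T: "flinear T" "\<And>p v. v \<in> gcomp (simplices X) p \<Longrightarrow> T v \<in> gcomp (simplices X) (Suc p)"
    "\<And>v. v \<in> free_on (simplices X) \<Longrightarrow> bd (T v) + T (bd v) = push_vec id v - push_vec k v"
    using homotopic_chain_maps[OF assms(1)] by metis
  have z: "z \<in> gcomp (simplices X) p" "bd z = 0" using assms(2) by (auto simp: cycles_def)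
  have "z - push_vec k z = bd (T z)"
    using T(3)[OF gcomp_free_on[OF z(1)]] by (simp add: z(2) flinearD(4)[OF T(1)] push_vec_id[OF gcomp_free_on[OF z(1)]])
  then show ?thesis using T(2)[OF z(1)] by (auto simp: boundaries_def)
qed

lemma push_chain_morphism:
  "continuous_map X Y f \<Longrightarrow> chain_morphism (simplices X) bd (simplices Y) bd (push_vec f)"
  by (auto simp: chain_morphism_def flinear_push_vec push_vec_gcomp push_vec_bd)

lemma homotopy_equivalence_homology_iso:
  assumes f: "continuous_map X Y f" and g: "continuous_map Y X g"
    and gf: "homotopic_with (\<lambda>_. True) X X (g \<circ> f) id" and fg: "homotopic_with (\<lambda>_. True) Y Y (f \<circ> g) id"
  shows "induces_homology_iso (simplices X) bd (simplices Y) bd (push_vec f)"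
  unfolding induces_homology_iso_def
proof (intro allI conjI ballI impI)
  fix p z assume z: "z \<in> cycles (simplices X) bd p" and b: "push_vec f z \<in> boundaries (simplices Y) bd p"
  have "push_vec g (push_vec f z) \<in> boundaries (simplices X) bd p"
    by (rule boundaries_chain[OF push_chain_morphism[OF g] b])
  moreover have "push_vec g (push_vec f z) = push_vec (g \<circ> f) z"
    by (rule push_vec_eq[of _ X]) (use z in \<open>auto simp: cycles_def gcomp_free_on\<close>)
  ultimately have "(z - push_vec (g \<circ> f) z) + push_vec (g \<circ> f) z \<in> boundaries (simplices X) bd p"
    using homotopic_id_cycle[OF gf z] by (intro boundaries_add[OF flinear_bd]) auto
  then show "z \<in> boundaries (simplices X) bd p" by simp
next
  fix p z assume z: "z \<in> cycles (simplices Y) bd p"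
  have "push_vec f (push_vec g z) = push_vec (f \<circ> g) z"
    by (rule push_vec_eq[of _ Y]) (use z in \<open>auto simp: cycles_def gcomp_free_on\<close>)
  then have "z - push_vec f (push_vec g z) \<in> boundaries (simplices Y) bd p" using homotopic_id_cycle[OF fg z] by simp
  then show "\<exists>y\<in>cycles (simplices X) bd p. z - push_vec f y \<in> boundaries (simplices Y) bd p"
    using cycles_chain[OF push_chain_morphism[OF g] z] by blast
qed

subsection \<open>Comparing two approximations to the diagonal\<close>

lemma push_simplex_comp:
  assumes "b \<in> simplices (std_space q)"
  shows "push_simplex g (push_simplex \<tau> b) = push_simplex (simplex_map q g \<tau>) b"
proof -
  obtain r \<rho> where b: "b = (r, \<rho>)" by (cases b)
  have r: "singular_simplex r (std_space q) \<rho>" using assms by (simp add: simplices_def b)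
  then have "\<rho> t \<in> standard_simplex q" if "t \<in> standard_simplex r" for t
    using that by (auto simp: singular_simplex_def std_space_def continuous_map_def)
  then have "simplex_map r g (simplex_map r \<tau> \<rho>) = simplex_map r (simplex_map q g \<tau>) \<rho>"
    by (auto simp: simplex_map_def restrict_def)
  then show ?thesis by (simp add: push_simplex_def b)
qed

lemma push_alg_push:
  assumes "Y \<in> homs (simplices (std_space q))"
  shows "push_alg g (push_alg \<tau> Y) = push_alg (simplex_map q g \<tau>) Y"
proof -
  have "push_alg g (push_alg \<tau> Y) = amap (\<lambda>b. word [push_simplex g (push_simplex \<tau> b)]) Y"
    by (simp add: push_alg_def amap_comp)
  also have "\<dots> = push_alg (simplex_map q g \<tau>) Y"
    unfolding push_alg_def by (rule amap_eq_homs[OF assms]) (simp add: push_simplex_comp)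
  finally show ?thesis .
qed

text \<open>The natural family of elements determined by its values on the identity simplices.\<close>

definition nat_ext :: "(nat \<Rightarrow> ((nat \<Rightarrow> real) simplex, 'f::field) talg) \<Rightarrow> nat \<times> 'a simplex \<Rightarrow> ('a simplex, 'f) talg" where
  "nat_ext \<phi> b = push_alg (snd b) (\<phi> (fst b))"

abbreviation "std p \<equiv> simplices (std_space p)"

text \<open>The differential of a p-simplex involves only dimensions up to p
  (\<open>sing_id_low\<close>), so the morphism equation in dimension p sees only values up to
  p.\<close>

definition low :: "nat \<Rightarrow> (nat \<times> 'a simplex) set \<Rightarrow> (nat \<times> 'a simplex) set" where
  "low p S = {b \<in> S. fst b \<le> p}"

lemma nat_ext_push:
  assumes "\<And>s. s \<le> q \<Longrightarrow> \<phi> s \<in> homs (std s)" "Y \<in> homs (low q (std r))"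
  shows "amap (nat_ext \<phi>) (push_alg \<sigma> Y) = push_alg \<sigma> (amap (nat_ext \<phi>) Y)"
proof -
  have "amap (nat_ext \<phi>) (push_alg \<sigma> Y) = amap (\<lambda>b. nat_ext \<phi> (push_simplex \<sigma> b)) Y"
    by (simp add: push_alg_def amap_comp)
  also have "\<dots> = amap (\<lambda>b. push_alg \<sigma> (nat_ext \<phi> b)) Y"
  proof (rule amap_eq_homs[OF assms(2)])
    fix b assume "b \<in> low q (std r)"
    then have "\<phi> (fst b) \<in> homs (std (fst b))" using assms(1) by (simp add: low_def)
    then show "nat_ext \<phi> (push_simplex \<sigma> b) = push_alg \<sigma> (nat_ext \<phi> b)"
      by (simp add: nat_ext_def push_alg_push push_simplex_def case_prod_beta)
  qed
  also have "\<dots> = push_alg \<sigma> (amap (nat_ext \<phi>) Y)" by (simp add: push_alg_def amap_comp)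
  finally show ?thesis .
qed

lemma nat_ext_homog:
  assumes "b \<in> simplices X" "\<phi> (fst b) \<in> homog (std (fst b)) 1 e"
  shows "nat_ext \<phi> b \<in> homog (simplices X) 1 e"
proof -
  have "continuous_map (std_space (fst b)) X (snd b)" using simplex_continuous[of "fst b" "snd b" X] assms(1) by simp
  then show ?thesis unfolding nat_ext_def push_alg_def
    by (intro amap_hom[OF assms(2)] hom_word) (auto intro: push_simplex_in)
qed

lemma nat_ext_nth0:
  assumes "b \<in> simplices X" "\<phi> (fst b) $ 0 = gen [id_simplex (fst b)]"
  shows "nat_ext \<phi> b $ 0 = gen [b]"
proof -
  have "agree 1 (\<phi> (fst b)) (word [id_simplex (fst b)])" using assms(2) by (simp add: agree_def word_def)
  from agree_tlin[OF tlin_push_alg this, of "snd b"]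
  have "nat_ext \<phi> b $ 0 = (push_alg (snd b) (word [id_simplex (fst b)]) :: ('a simplex, 'b) talg) $ 0"
    by (simp add: agree_def nat_ext_def)
  also have "push_alg (snd b) (word [id_simplex (fst b)]) = (word [b] :: ('a simplex, 'b) talg)"
    using push_id_simplex[of "fst b" "snd b" X] assms(1) by (simp add: push_alg_def)
  also have "word [b] $ 0 = gen [b]" by (simp add: word_def)
  finally show ?thesis .
qed

lemma bd_low: "bd (gen (id_simplex (Suc p))) \<in> free_on (low p (std (Suc p)))"
  using bd_gcomp[OF id_simplex_gcomp] by (auto simp: gcomp_def low_def free_on_def)

context approximation begin

lemma sing_split: "sing D b = emb (bd (gen b)) + fps_X * fps_const (sig (diag D (gen b)))"
  by (simp add: sing_def conv_dg)

lemma fps_const_homs: "y \<in> free_on {w. set w \<subseteq> S} \<Longrightarrow> fps_const y \<in> homs S"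
  by (auto simp: homs_def fsupp_def free_on_def fps_const_def)

text \<open>Two natural numbers with sum p are both at most p.\<close>

lemma diag_id_low: "fps_const (sig (diag D (gen (id_simplex p)))) \<in> homs (low p (std p))"
proof (rule fps_const_homs, unfold sig_free_on)
  have "D p \<in> free_on {w. set w \<subseteq> low p (std p)}"
  proof -
    have "set w \<subseteq> low p (std p)" if "length w = 2" "set w \<subseteq> std p" "wdeg w = int p" for w
    proof -
      have w: "w = [w ! 0, w ! 1]" by (rule nth_equalityI) (use that(1) in \<open>auto simp: less_2_cases_iff\<close>)
      have "int (fst (w ! 0)) + int (fst (w ! 1)) = int p" using arg_cong[OF w, of wdeg] that(3) by simp
      moreover have "set w = {w ! 0, w ! 1}" using arg_cong[OF w, of set] by simp
      ultimately show ?thesis using that(2) by (auto simp: low_def)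
    qed
    then show ?thesis using approx by (auto simp: diagonal_approximation_def tcomp_def free_on_def)
  qed
  then have "push (restrict id (standard_simplex p)) (D p) \<in> free_on {w. set w \<subseteq> low p (std p)}"
  proof (rule flinear_free_on[OF flinear_push, rotated])
    fix w assume w: "w \<in> {w. set w \<subseteq> low p (std p)}"
    have "push_simplex (restrict id (standard_simplex p)) b \<in> low p (std p)" if "b \<in> low p (std p)" for b
      using that push_simplex_in[of b "std_space p" "std_space p"] simplex_continuous[of p _ "std_space p"] id_simplex_in[of p]
      by (auto simp: low_def id_simplex_def)
    then show "push (restrict id (standard_simplex p)) (gen w) \<in> free_on {w. set w \<subseteq> low p (std p)}"
      using w by (auto simp: push_eq)
  qed
  then show "diag D (gen (id_simplex p)) \<in> free_on {w. set w \<subseteq> low p (std p)}"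
    by (simp add: diag_def id_simplex_def)
qed

lemma sing_id_low: "sing D (id_simplex p) \<in> homs (low p (std p))"
  unfolding sing_split
proof (rule homs_add)
  have "bd (gen (id_simplex p)) \<in> free_on (low p (std p))"
  proof (cases p)
    case 0
    then show ?thesis by (simp add: id_simplex_def bd_gen_0)
  next
    case (Suc q)
    then show ?thesis using bd_low[of q] by (auto simp: low_def free_on_def)
  qed
  then have "letter (bd (gen (id_simplex p))) \<in> free_on {w. set w \<subseteq> low p (std p)}"
    by (rule flinear_free_on[OF flinear_letter, rotated]) simp
  then show "emb (bd (gen (id_simplex p))) \<in> homs (low p (std p))"
    unfolding emb_def by (rule fps_const_homs)
  show "fps_X * fps_const (sig (diag D (gen (id_simplex p)))) \<in> homs (low p (std p))"
    using homs_X_power[OF diag_id_low, of 1] by simp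
qed

lemma sing_id_0: "sing D (id_simplex 0) = fps_X * fps_const (sig (gen [id_simplex 0, id_simplex 0]))"
proof -
  have D0: "D 0 = gen [id_simplex 0, id_simplex 0]" using approx by (simp add: diagonal_approximation_def id_simplex_def)
  have "push_simplex (restrict id (standard_simplex 0)) (id_simplex 0) = id_simplex 0"
    using push_id_simplex[OF id_simplex_in[of 0, unfolded id_simplex_def]] by (simp add: id_simplex_def)
  then have "diag D (gen (id_simplex 0)) = gen [id_simplex 0, id_simplex 0]"
    by (simp add: diag_def id_simplex_def[of 0] D0 push_eq)
  moreover have "bd (gen (id_simplex 0)) = (0 :: ((nat \<Rightarrow> real) simplex, 'f) gvec)" by (simp add: id_simplex_def bd_gen_0)
  ultimately show ?thesis by (simp add: sing_split)
qed

lemma lpart_sing: "lpart (sing D) v = bd v"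
  by (rule flinear_eq_on[OF flinear_lpart flinear_bd]) (simp add: sing_split emb_def)

end

lemma std_acyclic:
  fixes z :: "((nat \<Rightarrow> real) simplex, 'f::field) gvec"
  assumes z: "z \<in> gcomp (std p) q" "bd z = 0" "0 < q"
  shows "\<exists>y\<in>gcomp (std p) (Suc q). bd y = z"
proof -
  obtain a and h :: "((nat \<Rightarrow> real) simplex, 'f) gvec \<Rightarrow> _" where h: "flinear h" "\<forall>v\<in>gcomp (std p) q. h v \<in> gcomp (std p) (Suc q)"
    "\<forall>v\<in>free_on (std p). bd (h v) + h (bd v) = v - vertex_proj a v"
    using contractible_contraction[OF std_space_contractible std_space_nonempty] by metis
  have "bd (h z) = z" using h(3) gcomp_free_on[OF z(1)] z(2) flinearD(4)[OF h(1)] vertex_proj_pos[OF z(1,3)] by fastforce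
  then show ?thesis using h(2) z(1) by blast
qed

locale two_approximations = A: approximation D + B: approximation D'
  for D D' :: "nat \<Rightarrow> ((nat \<Rightarrow> real) simplex, 'f::field) gten"
begin

text \<open>Admissible values on the identity p-simplex, given the values in lower dimensions. The
  equation contains \<open>\<phi>(p := r)\<close> because the diagonal may return the p-simplex
  itself. The linear part is fixed to be the identity, which gives a quasi-isomorphism, and in
  dimension 0 the whole value is fixed so that the morphism descends to reduced chains.\<close>

definition good :: "(nat \<Rightarrow> ((nat \<Rightarrow> real) simplex, 'f) talg) \<Rightarrow> nat \<Rightarrow> ((nat \<Rightarrow> real) simplex, 'f) talg \<Rightarrow> bool" where
  "good \<phi> p r \<longleftrightarrow> r \<in> homog (std p) 1 (int p - 1) \<and> r $ 0 = gen [id_simplex p] \<and>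
     (p = 0 \<longrightarrow> r = word [id_simplex 0]) \<and>
     der (sing D') r = amap (nat_ext (\<phi>(p := r))) (sing D (id_simplex p))"

lemma good_cong:
  assumes "\<And>q. q < p \<Longrightarrow> \<phi> q = \<psi> q" shows "good \<phi> p r = good \<psi> p r"
proof -
  have "amap (nat_ext (\<phi>(p := r))) (sing D (id_simplex p)) = amap (nat_ext (\<psi>(p := r))) (sing D (id_simplex p))"
    by (rule amap_eq_homs[OF A.sing_id_low]) (use assms in \<open>auto simp: low_def nat_ext_def\<close>)
  then show ?thesis by (simp add: good_def)
qed

text \<open>Failure of the morphism equation on any simplex is pushed forward from the identity
  simplex, so one equation in each dimension is enough.\<close>

lemma good_natural:
  assumes g: "\<And>s. s \<le> q \<Longrightarrow> \<phi> s \<in> homs (std s)" and b: "b \<in> simplices X" "fst b = q"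
  shows "der (sing D') (nat_ext \<phi> b) - amap (nat_ext \<phi>) (sing D b) =
    push_alg (snd b) (der (sing D') (\<phi> q) - amap (nat_ext \<phi>) (sing D (id_simplex q)))"
proof -
  have "sing D b = push_alg (snd b) (sing D (id_simplex q))" using A.sing_pushed[of q "snd b" X] b by auto
  then show ?thesis using nat_ext_push[OF g A.sing_id_low, where \<sigma> = "snd b"] b(2)
    by (simp add: nat_ext_def[of \<phi> b] B.push_alg_der[symmetric] tlin_diff[OF tlin_push_alg])
qed

lemma good_0: "good \<phi> 0 (word [id_simplex 0])"
proof -
  let ?i = "id_simplex 0" and ?F = "nat_ext (\<phi>(0 := word [id_simplex 0]))"
  have F: "?F ?i = word [?i]"
    using push_id_simplex[OF id_simplex_in[of 0, unfolded id_simplex_def]]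
    by (simp add: nat_ext_def push_alg_def, simp add: id_simplex_def)
  have "fps_const (sig (gen [?i, ?i])) \<in> homs {?i}" by (rule A.fps_const_homs, unfold sig_free_on) simp
  then have "sing D ?i \<in> homs {?i}" using homs_X_power[of _ "{?i}" 1] unfolding A.sing_id_0 by simp
  then have "amap ?F (sing D ?i) = amap (\<lambda>b. word [b]) (sing D ?i)"
    by (rule amap_eq_homs) (use F in auto)
  then have "amap ?F (sing D ?i) = sing D' ?i" by (simp add: amap_id A.sing_id_0 B.sing_id_0)
  moreover have "word [?i] \<in> homog (std 0) 1 (int 0 - 1)" by (rule hom_word) (auto simp: id_simplex_in)
  moreover have "word [?i] $ 0 = (gen [?i] :: ((nat \<Rightarrow> real) simplex, 'f) gten)" by (simp add: word_def)
  ultimately show ?thesis unfolding good_def by (simp only: der_letter) simp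
qed

text \<open>Split off the linear differential: the equation becomes d0 r = u1 + G r, where G r
  starts in length two and d0 of the identity simplex is u1. The candidate is a fixed point of r = i
  + HH (G r). Its defect e satisfies e = HH (E u2 - t e), whose right side has higher order than e,
  so e = 0.\<close>

lemma good_step:
  assumes p: "0 < p" and IH: "\<And>q. q < p \<Longrightarrow> good \<phi> q (\<phi> q)"
  shows "\<exists>r. good \<phi> p r"
proof -
  obtain M :: "(nat \<times> ((nat \<Rightarrow> real) simplex, 'f) gvec) set" and proj incl h where
    "split_complex (std p) (sing D') M proj incl h"
    using split_exists[OF B.ainf_sing] by blast
  then interpret L: split_complex "std p" "sing D'" M proj incl h .
  define i where "i = id_simplex p"
  have iS: "i \<in> std p" by (simp add: i_def id_simplex_in)
  \<comment> \<open>A standard simplex has no homology in positive degrees.\<close>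
  have M0: "m = 0" if m: "m \<in> gcomp M q" and q0: "0 < q" for m :: "_ \<Rightarrow>\<^sub>0 'f" and q
  proof -
    have c: "incl m \<in> gcomp (std p) q" "bd (incl m) = 0"
      using L.incl_gcomp[OF m] L.d_incl[OF gcomp_free_on[OF m]] by (auto simp: B.lpart_sing)
    obtain y where y: "y \<in> gcomp (std p) (Suc q)" "bd y = incl m" using std_acyclic[OF c q0] by blast
    have "proj (incl m) = 0" using L.proj_d[OF gcomp_free_on[OF y(1)]] y(2) by (simp add: B.lpart_sing)
    then show ?thesis using L.proj_incl[OF gcomp_free_on[OF m]] by simp
  qed
  have ip0: "L.ip b = 0" if "b \<in> std p" "0 < fst b" for b
    using M0[OF L.proj_gcomp[of "gen b" "fst b"]] that by (simp add: L.ip_def flinearD(4)[OF L.lin(2)])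
  \<comment> \<open>Without constant term all words have length at least two. Their total degree p -
    1 + k, with k > 0, is then positive, so some letter has positive dimension and is killed by
    \<open>ip\<close>.\<close>
  have IP0: "L.IP X = 0" if X: "X \<in> homog (std p) 1 (int p - 2)" "X $ 0 = 0" for X
  proof (rule tlin_eq[OF L.tlins(2) tlin_zero])
    fix k w assume w: "w \<in> Poly_Mapping.keys (X $ k)"
    then have "k \<noteq> 0" using X(2) by (cases "k = 0") auto
    have ww: "set w \<subseteq> std p" "length w = 1 + k" "sdeg w = int p - 2" using X(1) w by (auto simp: homog_def fsupp_def)
    then have "wdeg w > 0" using p \<open>k \<noteq> 0\<close> by (simp add: sdeg_def)
    moreover have "\<forall>b\<in>set w. fst b = 0 \<Longrightarrow> wdeg w = 0" by (induction w) auto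
    ultimately have "\<exists>b\<in>set w. 0 < fst b" by fastforce
    then show "L.IP (word w) = 0" using ww(1)
    proof (induction w)
      case (Cons c w)
      show ?case
      proof (cases "0 < fst c")
        case True
        then show ?thesis using Cons.prems by (simp add: L.IP_def amap_word_Cons ip0)
      next
        case False
        then have "\<exists>b\<in>set w. 0 < fst b" using Cons.prems by auto
        then have "L.IP (word w) = 0" using Cons by simp
        then show ?thesis by (simp add: L.IP_def amap_word_Cons)
      qed
    qed simp
  qed
  define S where "S = low p (std p)"
  have SS: "homs S \<subseteq> homs (std p)" by (auto simp: homs_def fsupp_def S_def low_def)
  define F where "F = (\<lambda>r. nat_ext (\<phi>(p := r)) :: _ \<Rightarrow> ((nat \<Rightarrow> real) simplex, 'f) talg)"
  define u1 where "u1 = emb (bd (gen i) :: ((nat \<Rightarrow> real) simplex, 'f) gvec)"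
  define u2 where "u2 = fps_X * fps_const (sig (diag D (gen i)))"
  have u: "sing D i = u1 + u2" by (simp add: A.sing_split u1_def u2_def)
  have u2S: "u2 \<in> homs S" unfolding u2_def S_def i_def using homs_X_power[OF A.diag_id_low, of 1] by simp
  have uS: "sing D i \<in> homs S" unfolding S_def i_def by (rule A.sing_id_low)
  have u1S: "u1 \<in> homs S" using homs_diff[OF uS u2S] by (simp add: u)
  have u20: "u2 $ 0 = 0" by (simp add: u2_def)
  have homog_low: "X \<in> homog S l e" if "X \<in> homog (std p) l e" "X \<in> homs S" for X l e
    using that by (auto simp: homog_def homs_def fsupp_def)
  have fi [simp]: "fst i = p" by (simp add: i_def)
  have sdegi: "sdeg [i] = int p - 1" by simp
  have uh: "sing D i \<in> homog S 1 (int p - 2)"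
    using homog_low[OF ainf_homog[OF A.ainf_sing iS] uS] by (simp add: sdegi)
  have bdg: "bd (gen i) \<in> gcomp (std p) (p - 1)" using bd_gcomp[of "gen i" "std_space p" "p - 1"] iS p by (simp add: i_def)
  have u1h: "u1 \<in> homog (std p) 1 (int p - 2)" unfolding u1_def by (rule emb_homog[OF bdg]) (use p in simp)
  have u2h: "u2 \<in> homog S 1 (int p - 2)" using hom_diff[OF uh homog_low[OF u1h u1S]] by (simp add: u)
  have Fh: "F r b \<in> homog (std p) 1 (sdeg [b])" if "r \<in> homog (std p) 1 (int p - 1)" "b \<in> S" for r b
  proof -
    have "(\<phi>(p := r)) (fst b) \<in> homog (std (fst b)) 1 (sdeg [b])"
      using that IH[of "fst b"] by (auto simp: S_def low_def good_def)
    then show ?thesis unfolding F_def using that(2) by (intro nat_ext_homog) (auto simp: S_def low_def)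
  qed
  have Fagree: "agree n (F r b) (F r' b)" if "agree n r r'" for n r r' b
    unfolding F_def nat_ext_def by (rule agree_tlin[OF tlin_push_alg]) (use that in auto)
  define c where "c = amap (F 0) u1"
  define S' where "S' = {b \<in> std p. fst b = p - 1}"
  have u1S': "u1 \<in> homs S'"
  proof -
    have "letter (bd (gen i)) \<in> free_on {w. set w \<subseteq> S'}"
      by (rule flinear_free_on[OF flinear_letter _ bdg[unfolded gcomp_def]]) (auto simp: S'_def)
    then show ?thesis unfolding u1_def emb_def by (rule A.fps_const_homs)
  qed
  \<comment> \<open>The boundary involves only dimension p - 1, so this part of the equation is
    independent of the unknown \<open>r\<close>.\<close>
  have cF: "amap (F r) u1 = c" for r
    unfolding c_def by (rule amap_eq_homs[OF u1S']) (use p in \<open>auto simp: F_def nat_ext_def S'_def\<close>)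
  have ch: "c \<in> homog (std p) 1 (int p - 2)"
    unfolding c_def by (rule amap_hom[OF homog_low[OF u1h u1S] Fh]) auto
  have c0: "c $ 0 = u1 $ 0"
  proof -
    have "agree 1 (amap (F 0) u1) (amap (\<lambda>b. word [b]) u1)"
    proof (rule agree_amap[OF u1S'])
      fix b assume b: "b \<in> S'"
      have "nat_ext (\<phi>(p := 0)) b $ 0 = gen [b]"
        by (rule nat_ext_nth0[of _ "std_space p"]) (use b IH[of "p - 1"] p in \<open>auto simp: S'_def good_def\<close>)
      then show "agree 1 (F 0 b) (word [b])" by (simp add: agree_def F_def word_def)
    qed
    then show ?thesis by (simp add: c_def amap_id agree_def)
  qed
  \<comment> \<open>All terms of the equation beyond the linear one; the constant terms of
    \<open>c\<close> and \<open>u1\<close> cancel because the lower values have identity linear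
    part.\<close>
  define G where "G = (\<lambda>r. c + amap (F r) u2 - der L.t r - u1)"
  have Gh: "G r \<in> homog (std p) 1 (int p - 2)" if r: "r \<in> homog (std p) 1 (int p - 1)" for r
    unfolding G_def using L.der_t_homog[OF r] by (intro hom_diff hom_add ch u1h amap_hom[OF u2h Fh[OF r]]) auto
  define Q where "Q = (\<lambda>(_::unit) n w. set w \<subseteq> std p \<and> length w = 1 + n \<and> sdeg w = int p - 1)"
  have Q: "fsupp (Q j) = homog (std p) 1 (int p - 1)" for j by (simp add: Q_def homog_def)
  have wi: "word [i] \<in> homog (std p) 1 (int p - 1)" by (rule hom_word) (use iS sdegi in auto)
  have "\<exists>g. (\<forall>j. (\<lambda>g j. word [i] + L.HH (G (g j))) g j = g j) \<and> (\<forall>j. g j \<in> fsupp (Q j))"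
  proof (rule fps_fixed_point)
    fix n :: nat and g g' :: "unit \<Rightarrow> ((nat \<Rightarrow> real) simplex, 'f) talg"
    assume g: "\<forall>j. g j \<in> fsupp (Q j)" "\<forall>j. g' j \<in> fsupp (Q j)" and ag: "\<forall>j. agree n (g j) (g' j)"
    show "\<forall>j. agree (Suc n) (word [i] + L.HH (G (g j))) (word [i] + L.HH (G (g' j)))"
    proof
      fix j
      have h: "g j \<in> homs (std p)" "g' j \<in> homs (std p)" using g Q hom_homs by blast+
      have "agree (Suc n) (amap (F (g j)) u2) (amap (F (g' j)) u2)"
        by (rule agree_Suc_amap[OF u2S u20]) (use Fagree ag in blast)
      moreover have "agree (Suc n) (der L.t (g j)) (der L.t (g' j))"
        by (rule agree_tlin_raise[OF tlin_der _ h L.der_t_word0]) (use ag in blast)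
      ultimately show "agree (Suc n) (word [i] + L.HH (G (g j))) (word [i] + L.HH (G (g' j)))"
        unfolding G_def by (intro agree_add agree_refl agree_tlin[OF L.tlins(1)] agree_diff)
    qed
  next
    fix g :: "unit \<Rightarrow> ((nat \<Rightarrow> real) simplex, 'f) talg"
    assume g: "\<forall>j. g j \<in> fsupp (Q j)"
    show "\<forall>j. word [i] + L.HH (G (g j)) \<in> fsupp (Q j)"
    proof
      fix j
      have "g j \<in> homog (std p) 1 (int p - 1)" using g Q by blast
      from L.HH_homog[OF Gh[OF this]] have "L.HH (G (g j)) \<in> homog (std p) 1 (int p - 1)" by simp
      then show "word [i] + L.HH (G (g j)) \<in> fsupp (Q j)" unfolding Q by (intro hom_add wi)
    qed
  qed
  then obtain r where r: "r = word [i] + L.HH (G r)" and rh: "r \<in> homog (std p) 1 (int p - 1)"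
    unfolding Q by metis
  have rhs: "r \<in> homs (std p)" by (rule hom_homs[OF rh])
  have "agree 1 (amap (F r) u2) 0"
    using agree_tlin[OF tlin_amap, of 1 u2 0 "F r"] u20 by (simp add: agree_def tlin_0[OF tlin_amap])
  then have G0: "G r $ 0 = 0" using c0 L.der_t_nth0[OF rhs] by (simp add: G_def agree_def)
  have "agree 1 (L.HH (G r)) 0"
    using agree_tlin[OF L.tlins(1), of 1 "G r" 0] G0 by (simp add: agree_def tlin_0[OF L.tlins(1)])
  then have "(word [i] + L.HH (G r)) $ 0 = gen [i]" by (simp add: agree_def word_def)
  then have r0: "r $ 0 = gen [i]" using r by simp
  define \<psi> where "\<psi> = \<phi>(p := r)"
  have \<psi>h: "\<psi> s \<in> homs (std s)" if "s \<le> p" for s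
    using that rhs IH[of s] by (auto simp: \<psi>_def good_def intro: hom_homs)
  have FF: "F r = nat_ext \<psi>" by (simp add: F_def \<psi>_def)
  \<comment> \<open>The defect on all words. On letters below dimension p it vanishes by induction;
    on letters of dimension p it is, up to sign, pushed forward from \<open>e\<close>.\<close>
  define E where "E = (\<lambda>X. amap (F r) (der (sing D) X) - der (sing D') (amap (F r) X))"
  have tE: "tlin E" unfolding E_def by (intro tlin_intros)
  have Econs: "E (word (b # w)) = E (word [b]) * amap (F r) (word w) + smap (F r b) * E (word w)" if "b \<in> S" for b w
    unfolding E_def by (rule defect_mor_cons[OF Fh[OF rh] that])
  define e where "e = der (sing D') r - amap (F r) (sing D i)"
  have Enat: "E (word [b]) = - push_alg (snd b) (der (sing D') (\<psi> q) - amap (F r) (sing D (id_simplex q)))"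
    if "b \<in> std p" "fst b = q" "q \<le> p" for b q
  proof -
    have "der (sing D') (nat_ext \<psi> b) - amap (nat_ext \<psi>) (sing D b) =
      push_alg (snd b) (der (sing D') (\<psi> q) - amap (nat_ext \<psi>) (sing D (id_simplex q)))"
      by (rule good_natural[OF \<psi>h that(1,2)]) (use that(3) in auto)
    then show ?thesis unfolding E_def FF by (simp add: der_letter del: der_word_eq) (metis minus_diff_eq)
  qed
  have Elow: "E (word [b]) = 0" if "b \<in> std p" "fst b < p" for b
  proof -
    define q where "q = fst b"
    have q: "q < p" using that by (simp add: q_def)
    have "amap (F r) (sing D (id_simplex q)) = amap (nat_ext \<phi>) (sing D (id_simplex q))"
      by (rule amap_eq_homs[OF A.sing_id_low]) (use q in \<open>auto simp: F_def nat_ext_def low_def\<close>)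
    moreover have "der (sing D') (\<phi> q) = amap (nat_ext \<phi>) (sing D (id_simplex q))"
      using IH[OF q] by (simp add: good_def)
    ultimately show ?thesis
      using Enat[OF that(1) q_def[symmetric]] q by (simp add: \<psi>_def tlin_0[OF tlin_push_alg])
  qed
  have Ep: "E (word [b]) = - push_alg (snd b) e" if "b \<in> std p" "fst b = p" for b
    using Enat[OF that] by (simp add: e_def \<psi>_def i_def)
  have d0: "der L.d0 (word [i]) = u1"
    by (simp add: der_letter L.d0_def B.lpart_sing u1_def del: der_word_eq lpart_gen)
  have d0u1: "der L.d0 u1 = 0"
    unfolding d0[symmetric] by (rule L.d0_d0[OF homs_word]) (use iS in simp)
  have Ghs: "G r \<in> homs (std p)" by (rule hom_homs[OF Gh[OF rh]])
  have "der L.d0 (L.HH (G r)) = G r - L.HH (der L.d0 (G r))"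
    using L.homotopy_tensor[OF Ghs] IP0[OF Gh[OF rh] G0] by (simp add: algebra_simps)
  then have d0r: "der L.d0 r = u1 + G r - L.HH (der L.d0 (G r))"
    using arg_cong[OF r, of "der L.d0"] by (simp add: tlin_add[OF tlin_der] d0 algebra_simps del: der_word_eq)
  have e1: "e = - L.HH (der L.d0 (G r))"
    by (simp add: e_def L.der_split d0r u tlin_add[OF tlin_amap] cF) (simp add: G_def)
  have ehs: "e \<in> homs (std p)"
    unfolding e_def using L.der_d_homs[OF rhs] amap_homs[OF uS hom_homs[OF Fh[OF rh]]] by (intro homs_diff) auto
  have "der L.d0 r = u1 + G r + e" using d0r e1 by simp
  then have "der L.d0 (der L.d0 r) = der L.d0 (G r) + der L.d0 e"
    by (simp add: tlin_add[OF tlin_der] d0u1)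
  then have "der L.d0 (G r) = - der L.d0 e" using L.d0_d0[OF rhs] by (simp add: eq_neg_iff_add_eq_0)
  then have "L.HH (der L.d0 (G r)) = - L.HH (der L.d0 e)" by (simp only: tlin_neg[OF L.tlins(1)])
  \<comment> \<open>The homotopy identity gives e = - HH (d0 (G r)), and squaring d0 on r shows that
    d0 (G r) = - d0 e.\<close>
  then have e2: "e = L.HH (der L.d0 e)" unfolding e1[symmetric] using e1 by (metis minus_minus)
  have "0 = der (sing D') (der (sing D') r)" using ainf_der_der[OF B.ainf_sing rhs] by simp
  also have "der (sing D') r = e + amap (F r) (sing D i)" by (simp add: e_def)
  also have "der (sing D') \<dots> = der L.d0 e + der L.t e + der (sing D') (amap (F r) (sing D i))"
    by (simp add: tlin_add[OF tlin_der] L.der_split[of e])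
  also have "der (sing D') (amap (F r) (sing D i)) = - E (sing D i)"
  proof -
    have "der (sing D) (sing D i) = 0" using A.ainf_sing iS unfolding ainf_def by blast
    then show ?thesis by (simp add: E_def tlin_0[OF tlin_amap])
  qed
  also have "E (sing D i) = E u2"
  proof -
    have "E u1 = emb ((\<lambda>_. 0 :: ((nat \<Rightarrow> real) simplex, 'f) gvec) (bd (gen i) :: ((nat \<Rightarrow> real) simplex, 'f) gvec))"
      unfolding u1_def
      by (rule tlin_emb[OF tE flinear_zero]) (use bdg p Elow in \<open>auto simp: gcomp_def free_on_def\<close>)
    then have "E u1 = 0" by simp
    then show ?thesis by (simp add: u tlin_add[OF tE])
  qed
  finally have "der L.d0 e = E u2 - der L.t e" by (simp add: algebra_simps)
  with e2 have e3: "e = L.HH (E u2 - der L.t e)" by simp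
  have "agree n e 0" for n
  proof (induction n)
    case (Suc n)
    \<comment> \<open>\<open>u2\<close> has no constant term, so the defect on it has one order more
      than on letters, where it is 0 or comes from \<open>e\<close>.\<close>
    have "agree (Suc n) (E u2) 0"
    proof (rule defect_agree(2)[OF tE _ Econs _ u2S u20])
      show "E 1 = 0" by (simp add: E_def tlin_0[OF tlin_amap])
      fix b assume b: "b \<in> S"
      show "agree n (E (word [b])) 0"
      proof (cases "fst b < p")
        case True
        then show ?thesis using Elow b by (simp add: S_def low_def)
      next
        case False
        then have "E (word [b]) = - push_alg (snd b) e" using Ep b by (simp add: S_def low_def)
        moreover have "agree n (- push_alg (snd b) e) (- push_alg (snd b) 0)"
          by (intro agree_uminus agree_tlin[OF tlin_push_alg] Suc)
        ultimately show ?thesis by (simp add: tlin_0[OF tlin_push_alg])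
      qed
    qed
    moreover have "agree (Suc n) (der L.t e) (der L.t 0)"
      by (rule agree_tlin_raise[OF tlin_der Suc ehs homs_0 L.der_t_word0])
    ultimately have "agree (Suc n) (L.HH (E u2 - der L.t e)) (L.HH (0 - der L.t 0))"
      by (intro agree_tlin[OF L.tlins(1)] agree_diff)
    then show ?case using e3 by (simp add: tlin_0[OF tlin_der] tlin_0[OF L.tlins(1)])
  qed simp
  then have "e = 0" by (intro agree_all)
  then have "good \<phi> p r" using rh r0 p by (simp add: good_def e_def F_def i_def)
  then show ?thesis by blast
qed

lemma natural_morphism:
  "\<exists>\<phi>. \<forall>p. good \<phi> p (\<phi> p)"
proof (rule dependent_wf_choice[of "{(q, p). q < p}" good])
  show "wf {(q, p). q < (p::nat)}" by (rule wf_less)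
  show "good f x r = good g x r" if "\<And>z. (z, x) \<in> {(q, p). q < p} \<Longrightarrow> f z = g z" for f g x r
    by (rule good_cong) (use that in auto)
  show "\<exists>r. good f x r" if "\<And>y. (y, x) \<in> {(q, p). q < p} \<Longrightarrow> good f y (f y)" for x f
  proof (cases x)
    case 0
    then show ?thesis using good_0 by blast
  next
    case (Suc n)
    then show ?thesis using good_step[of x f] that by auto
  qed
qed

text \<open>The natural morphism has the identity as linear part, and the linear differential does
  not depend on the diagonal.\<close>

lemma diagonal_change:
  fixes X :: "'a topology"
  shows "\<exists>F. qi (reduced_simplices X x) (rsing D x) (reduced_simplices X x) (rsing D' x) F"
proof -
  obtain \<phi> where "\<And>p. good \<phi> p (\<phi> p)" using natural_morphism by blast
  then have g: "\<phi> p \<in> homog (std p) 1 (int p - 1)" "\<phi> p $ 0 = gen [id_simplex p]" "\<phi> 0 = word [id_simplex 0]"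
    "der (sing D') (\<phi> p) = amap (nat_ext \<phi>) (sing D (id_simplex p))" for p
    by (auto simp: good_def)
  define F where "F = (nat_ext \<phi> :: nat \<times> 'a simplex \<Rightarrow> ('a simplex, 'f) talg)"
  have Fh: "F b \<in> homog (simplices X) 1 (sdeg [b])" if "b \<in> simplices X" for b
    unfolding F_def by (rule nat_ext_homog[OF that]) (use g in auto)
  have F0: "F b $ 0 = gen [b]" if "b \<in> simplices X" for b
    unfolding F_def by (rule nat_ext_nth0[OF that]) (rule g(2))
  have "mor (reduced_simplices X x) (rsing D x) (reduced_simplices X x) (rsing D' x) (\<lambda>b. drop_alg x (F b))"
  proof (rule reduced_mor[OF A.approx B.approx Fh])
    fix b assume b: "b \<in> simplices X"
    show "der (sing D') (F b) = amap F (sing D b)"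
      using good_natural[OF hom_homs[OF g(1)] b refl] unfolding F_def by (simp add: g(4) tlin_0[OF tlin_push_alg])
  next
    have "push_simplex (snd (base_vertex x)) (id_simplex 0) = base_vertex x"
      by (auto simp: push_simplex_def id_simplex_def base_vertex_def simplex_map_def restrict_def)
    moreover have "fst (base_vertex x) = 0" by (simp add: base_vertex_def)
    ultimately have "F (base_vertex x) = word [base_vertex x]"
      by (simp add: F_def nat_ext_def g(3) push_alg_def)
    then show "drop_alg x (F (base_vertex x)) = 0" by (simp add: drop_alg_word)
  qed
  moreover have "induces_homology_iso (reduced_simplices X x) (lpart (rsing D x)) (reduced_simplices X x) (lpart (rsing D' x)) (lpart (\<lambda>b. drop_alg x (F b)))"
  proof -
    have l: "lpart (\<lambda>b. drop_alg x (F b)) v = v" if "v \<in> free_on (reduced_simplices X x)" for v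
    proof (rule flinear_eq_free_on[OF flinear_lpart flinear_id _ that])
      fix b assume b: "b \<in> reduced_simplices X x"
      then have bX: "b \<in> simplices X" "b \<noteq> base_vertex x" by (auto simp: reduced_simplices_def)
      have "agree 1 (F b) (word [b])" using F0[OF bX(1)] by (simp add: agree_def word_def)
      from agree_tlin[OF tlin_drop_alg this, of x] have "drop_alg x (F b) $ 0 = gen [b]"
        using bX(2) by (auto simp: agree_def drop_alg_word) (simp add: word_def)
      then show "lpart (\<lambda>b. drop_alg x (F b)) (gen b) = gen b" by simp
    qed
    have e: "lpart (rsing D' x) = lpart (rsing D x)" by (rule ext) (simp add: lpart_rsing)
    have z0: "0 \<in> boundaries (reduced_simplices X x) (lpart (rsing D x)) p" for p
      unfolding boundaries_def by (rule image_eqI[where x = 0]) (auto simp: flinearD(4)[OF flinear_lpart])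
    show ?thesis unfolding induces_homology_iso_def e
    proof (intro allI conjI ballI impI)
      fix p z assume z: "z \<in> cycles (reduced_simplices X x) (lpart (rsing D x)) p"
      then have lz: "lpart (\<lambda>b. drop_alg x (F b)) z = z" by (intro l) (auto simp: cycles_def gcomp_free_on)
      show "z \<in> boundaries (reduced_simplices X x) (lpart (rsing D x)) p"
        if "lpart (\<lambda>b. drop_alg x (F b)) z \<in> boundaries (reduced_simplices X x) (lpart (rsing D x)) p"
        using that lz by simp
      show "\<exists>y\<in>cycles (reduced_simplices X x) (lpart (rsing D x)) p. z - lpart (\<lambda>b. drop_alg x (F b)) y \<in> boundaries (reduced_simplices X x) (lpart (rsing D x)) p"
        by (rule bexI[OF _ z]) (use lz z0 in simp)
    qed
  qed
  ultimately show ?thesis unfolding qi_def by blast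
qed

end

subsection \<open>Pointed homotopy equivalences\<close>

definition drop_vec :: "'a \<Rightarrow> ('a simplex, 'f::field) gvec \<Rightarrow> ('a simplex, 'f) gvec" where
  "drop_vec x = lin_ext (\<lambda>b. if b = base_vertex x then 0 else gen b)"

lemma flinear_drop_vec: "flinear (drop_vec x)" by (simp add: drop_vec_def flinear_lin_ext)

lemma drop_vec_gen: "drop_vec x (gen b) = (if b = base_vertex x then 0 else gen b)"
  by (simp add: drop_vec_def)

lemma drop_vec_letter: "unletter (drop_base x (letter v)) = drop_vec x v"
  by (rule flinear_eq_on[OF flinear_compose[OF flinear_unletter flinear_compose[OF flinear_drop_base flinear_letter]] flinear_drop_vec])
    (simp add: drop_base_def drop_vec_gen flinearD(4)[OF flinear_unletter])

lemma reduced_bd_eq: "reduced_bd x v = drop_vec x (bd v)"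
  by (simp add: reduced_bd_def drop_vec_letter)

lemma drop_vec_split: "v = drop_vec x v + fscale (Poly_Mapping.lookup v (base_vertex x)) (gen (base_vertex x))"
proof -
  have l: "flinear (\<lambda>v. fscale (Poly_Mapping.lookup v (base_vertex x)) (gen (base_vertex x)))"
    by unfold_locales (auto simp: lookup_add fscale_add_left fscale_fscale)
  show ?thesis
    by (rule flinear_eq_on[OF flinear_id flinear_plus[OF flinear_drop_vec l]])
      (simp add: drop_vec_gen lookup_single when_def)
qed

lemma drop_vec_reduced: "v \<in> free_on (reduced_simplices X x) \<Longrightarrow> drop_vec x v = v"
  by (rule flinear_eq_free_on[OF flinear_drop_vec flinear_id]) (auto simp: drop_vec_gen reduced_simplices_def)

lemma drop_vec_gcomp: "v \<in> gcomp (simplices X) p \<Longrightarrow> drop_vec x v \<in> gcomp (reduced_simplices X x) p"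
  by (rule flinear_gcomp[OF flinear_drop_vec]) (auto simp: drop_vec_gen reduced_simplices_def)

lemma reduced_gcomp: "v \<in> gcomp (reduced_simplices X x) p \<Longrightarrow> v \<in> gcomp (simplices X) p"
  by (auto simp: gcomp_def free_on_def reduced_simplices_def)

lemma gcomp_Suc_reduced: "v \<in> gcomp (simplices X) (Suc p) \<Longrightarrow> v \<in> gcomp (reduced_simplices X x) (Suc p)"
  by (auto simp: gcomp_def free_on_def reduced_simplices_def base_vertex_def)

lemma lookup_base_vertex: "v \<in> gcomp S p \<Longrightarrow> 0 < p \<Longrightarrow> Poly_Mapping.lookup v (base_vertex x) = 0"
  by (auto simp: gcomp_def free_on_def base_vertex_def in_keys_iff)

lemma vertex_proj_bd: "v \<in> gcomp (simplices X) (Suc 0) \<Longrightarrow> vertex_proj x (bd v) = 0"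
  unfolding gcomp_def
proof (rule flinear_eq_free_on[OF flinear_compose[OF flinear_vertex_proj flinear_bd] flinear_zero])
  fix b assume "b \<in> {b \<in> simplices X. fst b = Suc 0}"
  then obtain \<sigma> where b: "b = (Suc 0, \<sigma>)" by (cases b) auto
  show "vertex_proj x (bd (gen b)) = 0"
    by (simp add: b bd_gen flinearD[OF flinear_vertex_proj] vertex_proj_gen fscale_minus_left)
qed

lemma vertex_proj_base: "vertex_proj x (fscale c (gen (base_vertex x))) = fscale c (gen (base_vertex x))"
  by (simp add: flinearD(2)[OF flinear_vertex_proj] vertex_proj_gen base_vertex_def)

text \<open>The unreduced boundary is a multiple of the base vertex. The multiple is 0: in dimension
  1 by augmentation, otherwise by degree.\<close>

lemma reduced_cycle:
  assumes z: "z \<in> cycles (reduced_simplices X x) (reduced_bd x) p"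
  shows "z \<in> cycles (simplices X) bd p"
proof -
  have g: "z \<in> gcomp (simplices X) p" and d: "drop_vec x (bd z) = 0"
    using z reduced_gcomp by (auto simp: cycles_def reduced_bd_eq)
  have s: "bd z = fscale (Poly_Mapping.lookup (bd z) (base_vertex x)) (gen (base_vertex x))"
    using drop_vec_split[of "bd z" x] d by simp
  consider "p = 0" | "p = Suc 0" | q where "p = Suc (Suc q)" by (cases p) (auto, metis not0_implies_Suc)
  then have "bd z = 0"
  proof cases
    case 1
    then show ?thesis using bd_gcomp_0 g by blast
  next
    case 2
    then have "vertex_proj x (bd z) = 0" using vertex_proj_bd[of z X x] g by simp
    then show ?thesis using s vertex_proj_base by metis
  next
    case 3
    have "Poly_Mapping.lookup (bd z) (base_vertex x) = 0"
      by (rule lookup_base_vertex[OF bd_gcomp[OF g[unfolded 3]]]) simp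
    then show ?thesis using s by (metis fscale_0_left)
  qed
  then show ?thesis using g by (simp add: cycles_def)
qed

lemma bd_base_vertex: "bd (gen (base_vertex x)) = 0"
  by (simp add: base_vertex_def bd_gen_0)

text \<open>Representatives in the quotient lift to honest cycles up to multiples of the base
  vertex, and \<open>f\<close> carries base vertex to base vertex, so the corrections match on both
  sides.\<close>

lemma reduced_homology_iso:
  fixes X :: "'a topology" and Y :: "'b topology" and x :: 'a
  assumes f: "continuous_map X Y f" "f x = y" and x: "x \<in> topspace X"
    and iso: "induces_homology_iso (simplices X) (bd :: ('a simplex, 'f::field) gvec \<Rightarrow> _) (simplices Y) bd (push_vec f)"
    and k: "\<And>v. v \<in> free_on (reduced_simplices X x) \<Longrightarrow> k v = drop_vec y (push_vec f v)"
  shows "induces_homology_iso (reduced_simplices X x) (reduced_bd x :: ('a simplex, 'f) gvec \<Rightarrow> _) (reduced_simplices Y y) (reduced_bd y) k"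
proof -
  have bx: "push_simplex f (base_vertex x) = base_vertex y"
    using f(2) by (auto simp: push_simplex_def base_vertex_def simplex_map_def restrict_def)
  have bxg: "gen (base_vertex x) \<in> gcomp (simplices X) 0" using base_vertex_in[OF x] by (simp add: base_vertex_def)
  show ?thesis unfolding induces_homology_iso_def
  proof (intro allI conjI ballI impI)
    fix p z assume z: "z \<in> cycles (reduced_simplices X x) (reduced_bd x :: ('a simplex, 'f) gvec \<Rightarrow> _) p"
      and b: "k z \<in> boundaries (reduced_simplices Y y) (reduced_bd y) p"
    have zr: "z \<in> gcomp (reduced_simplices X x) p" using z by (simp add: cycles_def)
    have zX: "z \<in> gcomp (simplices X) p" "bd z = 0" using reduced_cycle[OF z] by (auto simp: cycles_def)
    from b obtain w where w: "w \<in> gcomp (reduced_simplices Y y) (Suc p)" "k z = drop_vec y (bd w)"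
      by (auto simp: boundaries_def reduced_bd_eq)
    have wY: "w \<in> gcomp (simplices Y) (Suc p)" by (rule reduced_gcomp[OF w(1)])
    define c where "c = Poly_Mapping.lookup (push_vec f z - bd w) (base_vertex y)"
    have "drop_vec y (push_vec f z - bd w) = 0"
      using w(2) k[OF gcomp_free_on[OF zr]] by (simp add: flinearD[OF flinear_drop_vec])
    then have e: "push_vec f z - bd w = fscale c (gen (base_vertex y))"
      using drop_vec_split[of "push_vec f z - bd w" y] by (simp add: c_def)
    have pg: "push_vec f z - bd w \<in> gcomp (simplices Y) p"
      by (intro gcomp_diff push_vec_gcomp[OF f(1) zX(1)] bd_gcomp[OF wY])
    have c0: "c = 0" if "0 < p" unfolding c_def by (rule lookup_base_vertex[OF pg that])
    \<comment> \<open>The correction turns the image of \<open>z\<close> from a boundary up to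
      \<open>c\<close> base vertices into a boundary; in the reduced complex it is
      invisible.\<close>
    define z' where "z' = z - fscale c (gen (base_vertex x))"
    have "fscale c (gen (base_vertex x)) \<in> gcomp (simplices X) p"
      using c0 bxg by (cases "p = 0") (auto intro: gcomp_fscale simp del: gcomp_gen)
    then have z': "z' \<in> cycles (simplices X) bd p"
      unfolding z'_def cycles_def using zX by (simp add: gcomp_diff flinearD[OF flinear_bd] bd_base_vertex)
    have "push_vec f z' = bd w"
      using e by (simp add: z'_def flinearD[OF flinear_push_vec] bx) (simp add: algebra_simps)
    then have "push_vec f z' \<in> boundaries (simplices Y) bd p" using wY by (auto simp: boundaries_def)
    then have "z' \<in> boundaries (simplices X) bd p" using iso z' unfolding induces_homology_iso_def by blast
    then obtain u where u: "u \<in> gcomp (simplices X) (Suc p)" "z' = bd u" by (auto simp: boundaries_def)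
    have "z = drop_vec x z'"
      unfolding z'_def using drop_vec_reduced[OF gcomp_free_on[OF zr]] by (simp add: flinearD[OF flinear_drop_vec] drop_vec_gen)
    then have "z = reduced_bd x u" by (simp add: reduced_bd_eq u(2))
    then show "z \<in> boundaries (reduced_simplices X x) (reduced_bd x) p"
      using gcomp_Suc_reduced[OF u(1)] by (auto simp: boundaries_def)
  next
    fix p z' assume z': "z' \<in> cycles (reduced_simplices Y y) (reduced_bd y :: ('b simplex, 'f) gvec \<Rightarrow> _) p"
    have zr: "z' \<in> gcomp (reduced_simplices Y y) p" using z' by (simp add: cycles_def)
    obtain z where z: "z \<in> cycles (simplices X) bd p" "z' - push_vec f z \<in> boundaries (simplices Y) bd p"
      using iso reduced_cycle[OF z'] unfolding induces_homology_iso_def by blast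
    then obtain w where w: "w \<in> gcomp (simplices Y) (Suc p)" "z' - push_vec f z = bd w" by (auto simp: boundaries_def)
    define c where "c = Poly_Mapping.lookup z (base_vertex x)"
    define z0 where "z0 = drop_vec x z"
    have z0: "z = z0 + fscale c (gen (base_vertex x))" unfolding z0_def c_def by (rule drop_vec_split)
    have z0g: "z0 \<in> gcomp (reduced_simplices X x) p" unfolding z0_def by (rule drop_vec_gcomp) (use z in \<open>simp add: cycles_def\<close>)
    have "bd z = 0" using z by (simp add: cycles_def)
    then have "bd z0 = 0" using arg_cong[OF z0, of bd] by (simp add: flinearD[OF flinear_bd] bd_base_vertex)
    then have "z0 \<in> cycles (reduced_simplices X x) (reduced_bd x) p"
      using z0g by (simp add: cycles_def reduced_bd_eq flinearD(4)[OF flinear_drop_vec])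
    moreover have "z' - k z0 = reduced_bd y w"
    proof -
      have "drop_vec y (push_vec f z) = drop_vec y (push_vec f z0)"
        using arg_cong[OF z0, of "push_vec f"] by (simp add: flinearD[OF flinear_push_vec] flinearD[OF flinear_drop_vec] bx drop_vec_gen)
      then show ?thesis
        using w(2)[symmetric] k[OF gcomp_free_on[OF z0g]] drop_vec_reduced[OF gcomp_free_on[OF zr]]
        by (simp add: reduced_bd_eq flinearD[OF flinear_drop_vec])
    qed
    then have "z' - k z0 \<in> boundaries (reduced_simplices Y y) (reduced_bd y) p"
      using gcomp_Suc_reduced[OF w(1)] by (auto simp: boundaries_def)
    ultimately show "\<exists>z\<in>cycles (reduced_simplices X x) (reduced_bd x) p. z' - k z \<in> boundaries (reduced_simplices Y y) (reduced_bd y) p"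
      by blast
  qed
qed

text \<open>The homotopy equivalence acts on unreduced homology, and \<open>f\<close> alone descends
  to the quotients. So \<open>g\<close> and the homotopies are free, as they are for the whisker and
  for a given homotopy equivalence.\<close>

lemma (in approximation) pointed_equivalence_qi:
  fixes X :: "'a topology" and Y :: "'b topology"
  assumes f: "continuous_map X Y f" "f x = y" and x: "x \<in> topspace X" and g: "continuous_map Y X g"
    and gf: "homotopic_with (\<lambda>_. True) X X (g \<circ> f) id" and fg: "homotopic_with (\<lambda>_. True) Y Y (f \<circ> g) id"
  shows "\<exists>F. qi (reduced_simplices X x) (rsing D x) (reduced_simplices Y y) (rsing D y) F"
proof -
  define F where "F = (\<lambda>b. drop_alg y (word [push_simplex f b]) :: ('b simplex, 'f) talg)"
  have bx: "push_simplex f (base_vertex x) = base_vertex y"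
    using f(2) by (auto simp: push_simplex_def base_vertex_def simplex_map_def restrict_def)
  have "mor (reduced_simplices X x) (rsing D x) (reduced_simplices Y y) (rsing D y) F"
    unfolding F_def
  proof (rule reduced_mor[OF approx approx])
    fix b assume "b \<in> simplices X"
    then show "word [push_simplex f b] \<in> homog (simplices Y) 1 (sdeg [b])"
      by (intro hom_word) (auto intro: push_simplex_in[OF _ f(1)])
    show "der (sing D) (word [push_simplex f b]) = amap (\<lambda>b. word [push_simplex f b]) (sing D b)"
      using push_alg_sing[of f b] by (simp add: der_letter push_alg_def del: der_word_eq)
  qed (simp add: drop_alg_word bx)
  moreover have "lpart F v = drop_vec y (push_vec f v)" for v
    by (rule flinear_eq_on[OF flinear_lpart flinear_compose[OF flinear_drop_vec flinear_push_vec]])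
      (simp add: F_def drop_alg_word drop_vec_gen flinearD(4)[OF flinear_unletter], simp add: word_def)
  moreover have "lpart (rsing D x) = reduced_bd x" "lpart (rsing D y) = reduced_bd y" by (auto simp: lpart_rsing)
  ultimately show ?thesis
    using reduced_homology_iso[OF f x homotopy_equivalence_homology_iso[OF f(1) g gf fg]]
    unfolding qi_def by metis
qed

subsection \<open>Changing the base point\<close>

text \<open>Realised inside the product with the interval, so that no quotient topology enters. The
  base point will be the free end \<open>(a, 1)\<close>.\<close>

definition whisker :: "'b topology \<Rightarrow> 'b \<Rightarrow> ('b \<times> real) topology" where
  "whisker Y a = subtopology (prod_topology Y (top_of_set {0..1})) {z. snd z = 0 \<or> fst z = a}"

definition slide :: "(real \<Rightarrow> 'b) \<Rightarrow> 'b \<times> real \<Rightarrow> 'b" where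
  "slide \<gamma> z = (if snd z = 0 then fst z else \<gamma> (snd z))"

lemma topspace_whisker: "topspace (whisker Y a) = {z. fst z \<in> topspace Y \<and> snd z \<in> {0..1} \<and> (snd z = 0 \<or> fst z = a)}"
  by (auto simp: whisker_def)

lemma continuous_whisker_fst: "continuous_map (whisker Y a) Y fst"
  unfolding whisker_def by (intro continuous_map_from_subtopology continuous_map_fst)

lemma continuous_whisker_incl: "continuous_map Y (whisker Y a) (\<lambda>y. (y, 0))"
  unfolding whisker_def continuous_map_in_subtopology
  by (auto simp: continuous_map_pairwise o_def)

lemma continuous_slide:
  assumes "continuous_map (top_of_set {0..1}) Y \<gamma>" "\<gamma> 0 = a"
  shows "continuous_map (whisker Y a) Y (slide \<gamma>)"
  unfolding continuous_map_def
proof (intro conjI allI impI)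
  have g: "\<gamma> t \<in> topspace Y" if "t \<in> {0..1}" for t using assms(1) that by (auto simp: continuous_map_def)
  show "slide \<gamma> \<in> topspace (whisker Y a) \<rightarrow> topspace Y"
    using g by (auto simp: topspace_whisker slide_def)
  fix U assume U: "openin Y U"
  define V where "V = {t \<in> topspace (top_of_set {0..1::real}). \<gamma> t \<in> U}"
  have V: "openin (top_of_set {0..1}) V" unfolding V_def by (rule openin_continuous_map_preimage[OF assms(1) U])
  have pos: "openin (top_of_set {0..1::real}) ({0..1} \<inter> {0<..})" by (rule openin_open_Int) simp
  \<comment> \<open>The closed pasting argument fails because \<open>{a}\<close> may not be closed
    in Y, so an open set with the right trace is written down. The second rectangle covers the
    whisker away from its foot; the first covers the copy of Y and, when \<open>a\<close> lies in U,
    is narrowed to V so as not to admit wrong whisker points.\<close>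
  define W where "W = U \<times> (if a \<in> U then V else {0..1}) \<union> topspace Y \<times> (V \<inter> ({0..1} \<inter> {0<..}))"
  have "openin (top_of_set {0..1::real}) {0..1}" by simp
  then have "openin (prod_topology Y (top_of_set {0..1})) W"
    unfolding W_def by (intro openin_Un openin_prod_Times_iff[THEN iffD2] disjI2 conjI openin_Int U V pos) (auto simp: V)
  moreover have "{z \<in> topspace (whisker Y a). slide \<gamma> z \<in> U} = W \<inter> {z. snd z = 0 \<or> fst z = a}"
    using openin_subset[OF U] assms(2)
    by (auto simp: topspace_whisker slide_def W_def V_def split: if_splits)
  ultimately show "openin (whisker Y a) {z \<in> topspace (whisker Y a). slide \<gamma> z \<in> U}"
    unfolding whisker_def openin_subtopology by blast
qed

lemma whisker_contract:
  "homotopic_with (\<lambda>_. True) (whisker Y a) (whisker Y a) ((\<lambda>y. (y, 0)) \<circ> fst) id"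
proof -
  let ?P = "prod_topology (top_of_set {0..1::real}) (whisker Y a)"
  define h where "h = (\<lambda>(s :: real, z :: 'a \<times> real). (fst z, s * snd z))"
  have f: "continuous_map ?P euclideanreal fst"
    using continuous_map_fst[of "top_of_set {0..1::real}" "whisker Y a"] by (rule continuous_map_into_fulltopology)
  have "continuous_map (whisker Y a) (top_of_set {0..1}) snd"
    unfolding whisker_def by (intro continuous_map_from_subtopology continuous_map_snd)
  then have "continuous_map (whisker Y a) euclideanreal snd" by (rule continuous_map_into_fulltopology)
  from continuous_map_compose[OF continuous_map_snd this]
  have s: "continuous_map ?P euclideanreal (\<lambda>z. snd (snd z))" by (simp add: o_def)
  have y: "continuous_map ?P Y (\<lambda>z. fst (snd z))"
    using continuous_map_compose[OF continuous_map_snd continuous_whisker_fst] by (simp add: o_def)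
  have m: "continuous_map ?P euclideanreal (\<lambda>z. fst z * snd (snd z))"
    by (intro continuous_map_real_mult f s)
  have r: "fst z * snd (snd z) \<in> {0..1}" "snd (snd z) = 0 \<or> fst (snd z) = a" if "z \<in> topspace ?P" for z
    using that by (auto simp: topspace_whisker mult_le_one)
  have "continuous_map ?P (top_of_set {0..1}) (\<lambda>z. fst z * snd (snd z))"
    using m r(1) by (auto simp: continuous_map_in_subtopology)
  then have "continuous_map ?P (prod_topology Y (top_of_set {0..1})) h"
    using y by (simp add: continuous_map_pairwise h_def o_def case_prod_beta)
  then have "continuous_map ?P (whisker Y a) h"
    using r(2) by (auto simp: whisker_def continuous_map_in_subtopology h_def)
  then show ?thesis
    unfolding homotopic_with_def by (intro exI[of _ h]) (auto simp: h_def)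
qed

lemma (in approximation) base_change_span:
  fixes Y :: "'b topology"
  assumes "path_component_of Y a y"
  shows "\<exists>F G. qi (reduced_simplices (whisker Y a) (a, 1)) (rsing D (a, 1)) (reduced_simplices Y a) (rsing D a) F \<and>
     qi (reduced_simplices (whisker Y a) (a, 1)) (rsing D (a, 1)) (reduced_simplices Y y) (rsing D y) G"
proof -
  obtain \<gamma> where "pathin Y \<gamma>" and \<gamma>': "\<gamma> 0 = a" "\<gamma> 1 = y"
    using assms unfolding path_component_of_def by blast
  then have \<gamma>: "continuous_map (top_of_set {0..1}) Y \<gamma>" "\<gamma> 0 = a" "\<gamma> 1 = y" by (simp_all add: pathin_def)
  let ?W = "whisker Y a" and ?i = "\<lambda>y. (y, 0::real)"
  have aY: "a \<in> topspace Y" using \<gamma> by (auto simp: continuous_map_def)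
  have w: "(a, 1) \<in> topspace ?W" using aY by (simp add: topspace_whisker)
  note i = continuous_whisker_incl[of Y a] and c = continuous_whisker_fst[of Y a] and r = continuous_slide[OF \<gamma>(1,2)]
  have id1: "(fst :: 'b \<times> real \<Rightarrow> 'b) \<circ> ?i = id" "slide \<gamma> \<circ> ?i = id" by (auto simp: slide_def)
  have ic: "homotopic_with (\<lambda>_. True) ?W ?W (?i \<circ> fst) id" by (rule whisker_contract)
  \<comment> \<open>\<open>slide\<close> is a left inverse of the inclusion, so composing the
    contraction with inclusion after slide fixes one end. Hence inclusion after slide is homotopic
    to inclusion after projection, and thus to the identity.\<close>
  have "homotopic_with (\<lambda>_. True) ?W ?W ((?i \<circ> slide \<gamma>) \<circ> (?i \<circ> fst)) ((?i \<circ> slide \<gamma>) \<circ> id)"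
    by (rule homotopic_with_compose_continuous_map_left[OF ic continuous_map_compose[OF r i]]) auto
  moreover have "(?i \<circ> slide \<gamma>) \<circ> (?i \<circ> fst) = ?i \<circ> (fst :: 'b \<times> real \<Rightarrow> 'b)" by (auto simp: slide_def fun_eq_iff)
  ultimately have "homotopic_with (\<lambda>_. True) ?W ?W (?i \<circ> fst) (?i \<circ> slide \<gamma>)" by (simp only: comp_id)
  then have ir: "homotopic_with (\<lambda>_. True) ?W ?W (?i \<circ> slide \<gamma>) id"
    using ic homotopic_with_trans homotopic_with_symD by metis
  have idY: "homotopic_with (\<lambda>_. True) Y Y id id" by (simp add: homotopic_with_refl)
  have 1: "\<exists>F. qi (reduced_simplices ?W (a, 1)) (rsing D (a, 1)) (reduced_simplices Y a) (rsing D a) F"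
    by (rule pointed_equivalence_qi[OF c _ w i ic]) (use idY id1 in auto)
  have 2: "\<exists>F. qi (reduced_simplices ?W (a, 1)) (rsing D (a, 1)) (reduced_simplices Y y) (rsing D y) F"
    by (rule pointed_equivalence_qi[OF r _ w i ir]) (use idY id1 \<gamma>(3) in \<open>auto simp: slide_def\<close>)
  show ?thesis using 1 2 by blast
qed

subsection \<open>Transferred structures\<close>

lemma homology_iso_cong:
  assumes "\<And>v. v \<in> free_on S \<Longrightarrow> \<delta> v = \<delta>\<^sub>2 v" "\<And>v. v \<in> free_on S' \<Longrightarrow> \<delta>' v = \<delta>'\<^sub>2 v" "\<And>v. v \<in> free_on S \<Longrightarrow> g v = g\<^sub>2 v"
  shows "induces_homology_iso S \<delta> S' \<delta>' g \<longleftrightarrow> induces_homology_iso S \<delta>\<^sub>2 S' \<delta>'\<^sub>2 g\<^sub>2"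
proof -
  have c: "cycles S \<delta> p = cycles S \<delta>\<^sub>2 p" "cycles S' \<delta>' p = cycles S' \<delta>'\<^sub>2 p" for p
    using assms gcomp_free_on by (fastforce simp: cycles_def)+
  have b: "boundaries S \<delta> p = boundaries S \<delta>\<^sub>2 p" "boundaries S' \<delta>' p = boundaries S' \<delta>'\<^sub>2 p" for p
    unfolding boundaries_def by (rule image_cong[OF refl], rule assms, erule gcomp_free_on)+
  have "g z = g\<^sub>2 z" if "z \<in> cycles S \<delta>\<^sub>2 p" for z p
    using that assms(3) gcomp_free_on unfolding cycles_def by blast
  then show ?thesis unfolding induces_homology_iso_def c b by simp
qed

lemma graded_ops_conv:
  fixes \<Delta> :: "nat \<Rightarrow> ('b, 'f::field) gvec \<Rightarrow> ('c, 'f) gten"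
  assumes "\<And>n. flinear (\<Delta> n)" and h: "\<And>b. b \<in> S \<Longrightarrow> conv \<Delta> b \<in> homog S' 1 (int (fst b) - e)"
  shows "graded_ops S S' e \<Delta>"
  unfolding graded_ops_def
proof (intro allI impI conjI ballI assms(1))
  fix n b assume n: "1 \<le> (n::nat)" and b: "b \<in> S"
  then obtain m where m: "n = Suc m" by (cases n) auto
  have "conv \<Delta> b $ m \<in> free_on {w. set w \<subseteq> S' \<and> length w = 1 + m \<and> sdeg w = int (fst b) - e}"
    using h[OF b] by (simp only: homog_def fsupp_iff)
  then show "\<Delta> n (gen b) \<in> tcomp S' n (int (fst b) + int n - e)"
    unfolding conv_nth sig_free_on m by (auto simp: tcomp_def sdeg_def free_on_def)
qed

lemma quasi_iso_qi:
  assumes g: "graded_ops S S 2 \<Delta>" "graded_ops S' S' 2 \<Delta>'" and f: "ainf_quasi_iso S \<Delta> S' \<Delta>' f"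
  shows "qi S (conv \<Delta>) S' (conv \<Delta>') (conv f)"
proof -
  have gf: "graded_ops S S' 1 f" using f unfolding ainf_quasi_iso_def ainf_morphism_def graded_ops_iff by blast
  have "induces_homology_iso S (unletter \<circ> \<Delta> 1) S' (unletter \<circ> \<Delta>' 1) (unletter \<circ> f 1)"
    using f by (simp add: ainf_quasi_iso_def)
  then have "induces_homology_iso S (lpart (conv \<Delta>)) S' (lpart (conv \<Delta>')) (lpart (conv f))"
    by (subst homology_iso_cong) (auto simp only: lpart_conv[OF g(1)] lpart_conv[OF g(2)] lpart_conv[OF gf] comp_apply)
  moreover have "mor S (conv \<Delta>) S' (conv \<Delta>') (conv f)"
    using f ainf_morphism_iff_mor[OF g gf] by (simp add: ainf_quasi_iso_def)
  ultimately show ?thesis by (simp add: qi_def)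
qed

lemma (in approximation) graded_ops_reduced:
  fixes x :: 'a
  shows "graded_ops (reduced_simplices X x) (reduced_simplices X x) 2 (ainf_of_dg (reduced_bd x) (reduced_diag D x))"
proof (rule graded_ops_conv)
  fix n
  have l: "flinear (reduced_bd x :: ('a simplex, 'f) gvec \<Rightarrow> _)"
    using flinear_compose[OF flinear_unletter flinear_compose[OF flinear_drop_base flinear_compose[OF flinear_letter flinear_bd]]]
    by (simp add: reduced_bd_def comp_def)
  then show "flinear (ainf_of_dg (reduced_bd x) (reduced_diag D x) n)"
    using flinear_compose[OF flinear_letter l] flinear_zero flinear_compose[OF flinear_drop_base flinear_diag]
    by (auto simp: ainf_of_dg_def comp_def reduced_diag_def)
next
  fix b assume "b \<in> reduced_simplices X x"
  from ainf_homog[OF ainf_rsing this]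
  show "conv (ainf_of_dg (reduced_bd x) (reduced_diag D x)) b \<in> homog (reduced_simplices X x) 1 (int (fst b) - 2)"
    by (simp add: rsing_def)
qed

lemma ainf_graded_ops: "ainf_coalgebra S \<Delta> \<Longrightarrow> graded_ops S S 2 \<Delta>"
  by (auto simp: ainf_coalgebra_def graded_ops_iff)

lemma transferred_ainf: "transferred X x H \<Delta> \<Longrightarrow> ainf_coalgebra H \<Delta>"
  by (simp add: transferred_def)

lemma transferred_mini: "transferred X x H \<Delta> \<Longrightarrow> mini H (conv \<Delta>)"
  by (auto simp: transferred_def minimal_def mini_def flinearD(4)[OF flinear_sig])

text \<open>Normalises the direction of the quasi-isomorphism so that it always starts at the
  minimal structure.\<close>

lemma transferred_qi:
  fixes \<Delta> :: "nat \<Rightarrow> ('h, 'f::field) gvec \<Rightarrow> ('h, 'f) gten"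
  assumes t: "transferred X x H \<Delta>"
  obtains D F where "diagonal_approximation D" "qi H (conv \<Delta>) (reduced_simplices X x) (rsing D x) F"
proof -
  let ?S = "reduced_simplices X x"
  obtain D where D: "diagonal_approximation D"
    and q: "quasi_isomorphic H \<Delta> ?S (ainf_of_dg (reduced_bd x) (reduced_diag D x))"
    using t by (auto simp: transferred_def)
  interpret approximation D by unfold_locales (rule D)
  note a = conv_ainf[OF transferred_ainf[OF t]]
  note g = ainf_graded_ops[OF transferred_ainf[OF t]] graded_ops_reduced[of X x]
  have "\<exists>F. qi H (conv \<Delta>) ?S (rsing D x) F"
    using q unfolding quasi_isomorphic_def
  proof (elim disjE exE)
    fix f assume "ainf_quasi_iso H \<Delta> ?S (ainf_of_dg (reduced_bd x) (reduced_diag D x)) f"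
    from quasi_iso_qi[OF g this] show ?thesis unfolding rsing_def by blast
  next
    fix f assume "ainf_quasi_iso ?S (ainf_of_dg (reduced_bd x) (reduced_diag D x)) H \<Delta> f"
    from quasi_iso_qi[OF g(2,1) this] show ?thesis
      unfolding rsing_def[symmetric] by (rule minimal_model_reverse[OF a transferred_mini[OF t] ainf_rsing])
  qed
  then show ?thesis using D that by blast
qed

text \<open>The arrows run from H to the chains at x, at f x, back to the whisker, on to y, then to
  the other diagonal, where K arrives too. The one backward arrow is handled by
  \<open>minimal_model_span\<close>.\<close>

lemma transferred_isomorphic:
  fixes \<Delta> :: "nat \<Rightarrow> ('h, 'f::field) gvec \<Rightarrow> ('h, 'f) gten" and X :: "'a topology" and Y :: "'b topology"
  assumes t: "transferred X x H \<Delta>" "transferred Y y K \<Theta>" and x: "x \<in> topspace X"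
    and f: "continuous_map X Y f" and g: "continuous_map Y X g"
    and h: "homotopic_with (\<lambda>_. True) X X (g \<circ> f) id" "homotopic_with (\<lambda>_. True) Y Y (f \<circ> g) id"
    and p: "path_component_of Y (f x) y"
  shows "\<exists>R. qi H (conv \<Delta>) K (conv \<Theta>) R"
proof -
  obtain D F where D: "diagonal_approximation D" and F: "qi H (conv \<Delta>) (reduced_simplices X x) (rsing D x) F"
    using transferred_qi[OF t(1)] .
  obtain D' G where D': "diagonal_approximation D'" and G: "qi K (conv \<Theta>) (reduced_simplices Y y) (rsing D' y) G"
    using transferred_qi[OF t(2)] .
  interpret two_approximations D D' by unfold_locales (use D D' in auto)
  note H = conv_ainf[OF transferred_ainf[OF t(1)]] transferred_mini[OF t(1)]
  note K = conv_ainf[OF transferred_ainf[OF t(2)]] transferred_mini[OF t(2)]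
  obtain P where P: "qi (reduced_simplices X x) (rsing D x) (reduced_simplices Y (f x)) (rsing D (f x)) P"
    using A.pointed_equivalence_qi[OF f refl x g h] by blast
  obtain L M where LM: "qi (reduced_simplices (whisker Y (f x)) (f x, 1)) (rsing D (f x, 1)) (reduced_simplices Y (f x)) (rsing D (f x)) L"
    "qi (reduced_simplices (whisker Y (f x)) (f x, 1)) (rsing D (f x, 1)) (reduced_simplices Y y) (rsing D y) M"
    using A.base_change_span[OF p] by blast
  have W: "ainf (reduced_simplices (whisker Y (f x)) (f x, 1)) (rsing D (f x, 1))" by (rule A.ainf_rsing)
  have Xr: "ainf (reduced_simplices X x) (rsing D x)" by (rule A.ainf_rsing)
  have Yr: "ainf (reduced_simplices Y (f x)) (rsing D (f x))" "ainf (reduced_simplices Y y) (rsing D y)"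
    "ainf (reduced_simplices Y y) (rsing D' y)" by (rule A.ainf_rsing A.ainf_rsing B.ainf_rsing)+
  note FP = qi_comp[OF H(1) Xr Yr(1) F P]
  obtain B where B: "qi H (conv \<Delta>) (reduced_simplices Y y) (rsing D y) B"
    using minimal_model_span[OF H Yr(1,2) W FP LM] ..
  obtain C where C: "qi (reduced_simplices Y y) (rsing D y) (reduced_simplices Y y) (rsing D' y) C"
    using diagonal_change ..
  note BC = qi_comp[OF H(1) Yr(2,3) B C]
  show ?thesis by (rule minimal_models_isomorphic[OF H K Yr(3) BC G])
qed

subsection \<open>Leading terms\<close>

definition lead :: "(nat \<times> 'b \<Rightarrow> ('c, 'f::field) talg) \<Rightarrow> nat \<Rightarrow> ('b, 'f) gvec \<Rightarrow> ('c, 'f) gten" where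
  "lead d n = lin_ext (\<lambda>b. d b $ n)"

lemma flinear_lead: "flinear (lead d n)" by (simp add: lead_def flinear_lin_ext)

lemma lead_gen [simp]: "lead d n (gen b) = d b $ n" by (simp add: lead_def)

lemma lead_conv: "graded_ops S S' e \<Delta> \<Longrightarrow> v \<in> free_on S \<Longrightarrow> lead (conv \<Delta>) n v = sig (\<Delta> (Suc n) v)"
  by (rule flinear_eq_free_on[OF flinear_lead flinear_compose[OF flinear_sig graded_opsD(1)]]) auto

definition vanishes_below :: "(nat \<times> 'b) set \<Rightarrow> (nat \<times> 'b \<Rightarrow> ('b, 'f::field) talg) \<Rightarrow> nat \<Rightarrow> bool" where
  "vanishes_below S d n \<longleftrightarrow> (\<forall>b\<in>S. \<forall>j<n. d b $ j = 0)"

lemma vanishes_below_lead: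
  fixes d :: "nat \<times> 'b \<Rightarrow> ('b, 'f::field) talg"
  assumes "vanishes_below S d n" "j < n" "v \<in> free_on S" shows "lead d j v = 0"
  by (rule flinear_eq_free_on[OF flinear_lead flinear_zero _ assms(3)]) (use assms in \<open>auto simp: vanishes_below_def\<close>)

text \<open>Only the lowest coefficients contribute to the \<open>n\<close>-th coefficient of the morphism equation.\<close>

lemma lead_lpart:
  fixes d :: "nat \<times> 'b \<Rightarrow> ('b, 'f::field) talg" and e :: "nat \<times> 'c \<Rightarrow> ('c, 'f) talg"
  assumes R: "mor H d K e R" and z: "vanishes_below H d n" "vanishes_below K e n" and v: "v \<in> free_on H"
  shows "lead e n (lpart R v) = lin_ext (\<lambda>w. amap R (word w) $ 0) (lead d n v)"
proof (rule flinear_eq_free_on[OF flinear_compose[OF flinear_lead flinear_lpart] flinear_compose[OF flinear_lin_ext flinear_lead] _ v])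
  fix b assume b: "b \<in> H"
  have 1: "amap R (d b) $ n = lin_ext (\<lambda>w. amap R (word w) $ 0) (d b $ n)"
  proof -
    have "amap R (d b) $ n = (\<Sum>k\<le>n. if k = n then lin_ext (\<lambda>w. amap R (word w) $ 0) (d b $ n) else 0)"
      unfolding tlin_nth[OF tlin_amap, of _ "d b"] using z(1) b by (intro sum.cong) (auto simp: vanishes_below_def)
    then show ?thesis by simp
  qed
  have dw: "der e (word w) $ j = 0" if "set w \<subseteq> K" "j < n" for w j
  proof -
    have "e (w ! a) $ j = 0" if "a < length w" for a
      using z(2) \<open>set w \<subseteq> K\<close> \<open>j < n\<close> nth_mem[OF that] by (auto simp: vanishes_below_def)
    then show ?thesis by (simp add: der_word_nth)
  qed
  have "der e (R b) $ n = (\<Sum>k\<le>n. if k = 0 then lin_ext (\<lambda>w. der e (word w) $ n) (R b $ 0) else 0)"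
    unfolding tlin_nth[OF tlin_der, of _ "R b"]
  proof (rule sum.cong[OF refl])
    fix k assume k: "k \<in> {..n}"
    have "R b $ k \<in> free_on {w. set w \<subseteq> K \<and> length w = 1 + k \<and> sdeg w = sdeg [b]}"
      using mor_homog[OF R b] by (simp only: homog_def fsupp_iff)
    then have "lin_ext (\<lambda>w. der e (word w) $ (n - k)) (R b $ k) = lin_ext (\<lambda>w. 0) (R b $ k)" if "k \<noteq> 0"
      using that k by (intro lin_ext_cong dw) (auto simp: free_on_def)
    then show "lin_ext (\<lambda>w. der e (word w) $ (n - k)) (R b $ k) = (if k = 0 then lin_ext (\<lambda>w. der e (word w) $ n) (R b $ 0) else 0)"
      by (auto simp: lin_ext_def)
  qed
  then have "der e (R b) $ n = lin_ext (\<lambda>w. der e (word w) $ n) (letter (lpart R (gen b)))"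
    using unletter_nth0(1)[OF mor_homog[OF R b]] by simp
  also have "\<dots> = lead e n (lpart R (gen b))"
    by (rule flinear_eq_on[OF flinear_compose[OF flinear_lin_ext flinear_letter] flinear_lead])
      (simp add: der_letter del: der_word_eq)
  finally show "lead e n (lpart R (gen b)) = lin_ext (\<lambda>w. amap R (word w) $ 0) (lead d n (gen b))"
    using 1 R b by (simp add: mor_def)
qed

text \<open>If one more coefficient vanishes on H, \<open>lead_lpart\<close> makes the corresponding
  one vanish on the image of the linear part, and by \<open>J\<close> that image contains all of
  \<open>free_on K\<close>.\<close>

lemma vanishes_below_transfer:
  fixes d :: "nat \<times> 'b \<Rightarrow> ('b, 'f::field) talg" and e :: "nat \<times> 'c \<Rightarrow> ('c, 'f) talg"
  assumes R: "mor H d K e R" and J: "\<And>v. v \<in> free_on K \<Longrightarrow> J v \<in> free_on H" "\<And>v. v \<in> free_on K \<Longrightarrow> lpart R (J v) = v"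
  shows "vanishes_below H d n \<Longrightarrow> vanishes_below K e n"
proof (induction n)
  case (Suc n)
  then have z: "vanishes_below H d n" "vanishes_below K e n" by (auto simp: vanishes_below_def)
  have "e b $ n = 0" if b: "b \<in> K" for b
  proof -
    have g: "gen b \<in> free_on K" using b by simp
    have "lead d n (J (gen b)) = 0" by (rule vanishes_below_lead[OF Suc.prems _ J(1)[OF g]]) simp
    then show ?thesis using lead_lpart[OF R z J(1)[OF g]] by (simp only: J(2)[OF g] lead_gen lin_ext_0)
  qed
  then show ?case using z(2) by (auto simp: vanishes_below_def less_Suc_eq)
qed (simp add: vanishes_below_def)

text \<open>Comparison with finite arities determines the value and treats the infinite case
  uniformly.\<close>

lemma first_nonzero_ge:
  "enat m \<le> first_nonzero H \<Delta> \<longleftrightarrow> (\<forall>j\<ge>1. j < m \<longrightarrow> (\<forall>v\<in>free_on H. \<Delta> j v = 0))"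
proof (cases "\<exists>n\<ge>1. \<exists>v\<in>free_on H. \<Delta> n v \<noteq> 0")
  case True
  let ?P = "\<lambda>n. n \<ge> 1 \<and> (\<exists>v\<in>free_on H. \<Delta> n v \<noteq> 0)"
  have "?P (LEAST n. ?P n)" by (rule LeastI_ex[of ?P]) (use True in blast)
  moreover have "\<And>j. ?P j \<Longrightarrow> (LEAST n. ?P n) \<le> j" by (rule Least_le)
  ultimately have "m \<le> (LEAST n. ?P n) \<longleftrightarrow> (\<forall>j. ?P j \<longrightarrow> m \<le> j)" by (meson le_trans)
  then show ?thesis using True unfolding first_nonzero_def by (auto simp: not_le[symmetric])
qed (auto simp: first_nonzero_def)

lemma first_nonzero_vanishes:
  fixes \<Delta> :: "nat \<Rightarrow> ('h, 'f::field) gvec \<Rightarrow> ('h, 'f) gten"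
  assumes g: "graded_ops H H 2 \<Delta>"
  shows "enat (Suc n) \<le> first_nonzero H \<Delta> \<longleftrightarrow> vanishes_below H (conv \<Delta>) n"
  unfolding first_nonzero_ge
proof
  assume *: "\<forall>j\<ge>1. j < Suc n \<longrightarrow> (\<forall>v\<in>free_on H. \<Delta> j v = 0)"
  show "vanishes_below H (conv \<Delta>) n"
    unfolding vanishes_below_def
  proof (intro ballI allI impI)
    fix b j assume "b \<in> H" "j < n"
    then show "conv \<Delta> b $ j = 0" using *[rule_format, of "Suc j" "gen b"] by (simp add: flinearD(4)[OF flinear_sig])
  qed
next
  assume v: "vanishes_below H (conv \<Delta>) n"
  show "\<forall>j\<ge>1. j < Suc n \<longrightarrow> (\<forall>v\<in>free_on H. \<Delta> j v = 0)"
  proof (intro allI impI ballI)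
    fix j and u :: "('h, 'f) gvec" assume j: "1 \<le> j" "j < Suc n" and u: "u \<in> free_on H"
    then obtain i where i: "j = Suc i" "i < n" by (cases j) auto
    have "sig (\<Delta> j u) = sig 0" 
      using vanishes_below_lead[OF v i(2) u] lead_conv[OF g u, of i] i by (simp add: flinearD(4)[OF flinear_sig])
    then show "\<Delta> j u = 0" by (simp only: sig_inj)
  qed
qed

lemma enat_eqI:
  assumes "\<And>m. enat m \<le> a \<longleftrightarrow> enat m \<le> b" shows "a = (b :: enat)"
proof -
  have le: "a \<le> b" if "\<And>m. enat m \<le> a \<Longrightarrow> enat m \<le> b" for a b :: enat
  proof (cases a)
    case infinity
    then show ?thesis using that[of "Suc (the_enat b)"] by (cases b) auto
  next
    case (enat k)
    then show ?thesis using that[of k] by simp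
  qed
  show ?thesis by (rule antisym; rule le) (simp_all only: assms)
qed

text \<open>A basis goes to a basis of the image with the same cardinality; if it is infinite, both
  dimensions are 0 by the convention for \<open>card\<close>.\<close>

lemma dim_injective_image:
  assumes g: "flinear g" and V: "V \<subseteq> free_on S" "inj_on g (free_on S)"
  shows "fv.dim (g ` V) = fv.dim V"
proof -
  obtain B where B: "B \<subseteq> V" "fv.independent B" "V \<subseteq> fv.span B" "card B = fv.dim V" by (rule fv.basis_exists)
  have "fv.subspace (free_on S)" by (auto simp: fv.subspace_def free_on_add free_on_fscale)
  then have s: "fv.span B \<subseteq> free_on S" using B(1) V(1) by (intro fv.span_minimal) auto
  have "fv.independent (g ` B)" by (rule fvp.linear_independent_injective_image[OF g B(2) inj_on_subset[OF V(2) s]])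
  moreover have "g ` V \<subseteq> fv.span (g ` B)" by (rule fvp.linear_spans_image[OF g B(3)])
  ultimately have "card (g ` B) = fv.dim (g ` V)" using B(1) by (intro fv.basis_card_eq_dim) auto
  moreover have "card (g ` B) = card B" using B(1) V by (intro card_image inj_on_subset[OF V(2)]) auto
  ultimately show ?thesis using B(4) by simp
qed

lemma ker_dim_lead:
  assumes "graded_ops H H 2 \<Delta>"
  shows "ker_dim H \<Delta> (Suc n) p = fv.dim {v \<in> gcomp H p. lead (conv \<Delta>) n v = 0}"
proof -
  have "\<Delta> (Suc n) v = 0 \<longleftrightarrow> lead (conv \<Delta>) n v = 0" if "v \<in> gcomp H p" for v
    unfolding lead_conv[OF assms gcomp_free_on[OF that]] by (metis flinearD(4)[OF flinear_sig] sig_sig)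
  then show ?thesis unfolding ker_dim_def by (intro arg_cong[of _ _ fv.dim]) blast
qed

text \<open>The linear part is inverted by the linear part of the inverse morphism, so the identity
  between leading terms can be used in both directions.\<close>

lemma qi_invariants:
  fixes \<Delta> :: "nat \<Rightarrow> ('h, 'f::field) gvec \<Rightarrow> ('h, 'f) gten" and \<Theta> :: "nat \<Rightarrow> ('k, 'f) gvec \<Rightarrow> ('k, 'f) gten"
  assumes a: "ainf_coalgebra H \<Delta>" "ainf_coalgebra K \<Theta>" and m: "mini H (conv \<Delta>)" "mini K (conv \<Theta>)"
    and R: "qi H (conv \<Delta>) K (conv \<Theta>) R"
  shows "\<exists>\<phi>. ainf_isomorphism H \<Delta> K \<Theta> \<phi>"
    and "first_nonzero K \<Theta> = first_nonzero H \<Delta>"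
    and "1 \<le> l \<Longrightarrow> enat l \<le> first_nonzero H \<Delta> \<Longrightarrow> ker_dim K \<Theta> l p = ker_dim H \<Delta> l p"
proof -
  note A = conv_ainf[OF a(1)] conv_ainf[OF a(2)]
  note g = ainf_graded_ops[OF a(1)] ainf_graded_ops[OF a(2)]
  have M: "mor H (conv \<Delta>) K (conv \<Theta>) R" using R by (simp add: qi_def)
  from mini_qi_linear_inverse[OF A m R] obtain J where J: "flinear J" "\<And>p v. v \<in> gcomp K p \<Longrightarrow> J v \<in> gcomp H p"
    "\<And>v. v \<in> free_on K \<Longrightarrow> lpart R (J v) = v" "\<And>v. v \<in> free_on H \<Longrightarrow> J (lpart R v) = v" by metis
  from mor_inverse[OF A M J] obtain G where G: "mor K (conv \<Theta>) H (conv \<Delta>) G"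
    "\<And>b. b \<in> K \<Longrightarrow> G b $ 0 = letter (J (gen b))" by blast
  have GJ: "lpart G v = J v" if "v \<in> free_on K" for v
    by (rule flinear_eq_free_on[OF flinear_lpart J(1) _ that]) (simp add: G(2))
  have Jf: "J v \<in> free_on H" if "v \<in> free_on K" for v
    by (rule flinear_free_on[OF J(1) _ that]) (rule gcomp_free_on[OF J(2)], auto)
  have Rf: "lpart R v \<in> free_on K" if "v \<in> free_on H" for v
    by (rule flinear_free_on[OF flinear_lpart _ that]) (rule gcomp_free_on[OF lpart_gcomp[OF mor_homog[OF M]]], auto)
  have GR: "lpart G (lpart R v) = v" if "v \<in> free_on H" for v using GJ[OF Rf[OF that]] J(4)[OF that] by simp
  have inj: "inj_on (lpart R) (free_on H)" by (rule inj_on_inverseI[of _ J]) (rule J(4))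
  have low: "vanishes_below K (conv \<Theta>) n \<longleftrightarrow> vanishes_below H (conv \<Delta>) n" for n
    using vanishes_below_transfer[OF M, of J n] vanishes_below_transfer[OF G(1), of "lpart R" n] Jf J(3) Rf GR by blast
  show "first_nonzero K \<Theta> = first_nonzero H \<Delta>"
  proof (rule enat_eqI)
    fix m show "enat m \<le> first_nonzero K \<Theta> \<longleftrightarrow> enat m \<le> first_nonzero H \<Delta>"
      by (cases m) (simp_all add: first_nonzero_vanishes[OF g(1)] first_nonzero_vanishes[OF g(2)] low enat_0)
  qed
  show "ker_dim K \<Theta> l p = ker_dim H \<Delta> l p" if l: "1 \<le> l" "enat l \<le> first_nonzero H \<Delta>"
  proof -
    obtain n where n: "l = Suc n" using l by (cases l) auto
    have z: "vanishes_below H (conv \<Delta>) n" "vanishes_below K (conv \<Theta>) n"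
      using l first_nonzero_vanishes[OF g(1)] low by (auto simp: n)
    have iff: "lead (conv \<Theta>) n (lpart R v) = 0 \<longleftrightarrow> lead (conv \<Delta>) n v = 0" if v: "v \<in> free_on H" for v
      using lead_lpart[OF M z v] lead_lpart[OF G(1) z(2,1) Rf[OF v]] GR[OF v] by (auto simp: lin_ext_0)
    have "{v \<in> gcomp K p. lead (conv \<Theta>) n v = 0} = lpart R ` {v \<in> gcomp H p. lead (conv \<Delta>) n v = 0}"
    proof (intro equalityI subsetI)
      fix v assume v: "v \<in> {v \<in> gcomp K p. lead (conv \<Theta>) n v = 0}"
      then have "v = lpart R (J v)" "J v \<in> gcomp H p" using J gcomp_free_on by (fastforce, blast)
      then show "v \<in> lpart R ` {v \<in> gcomp H p. lead (conv \<Delta>) n v = 0}"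
        using v iff[of "J v"] gcomp_free_on by fastforce
    qed (use iff gcomp_free_on lpart_gcomp[OF mor_homog[OF M]] in blast)
    moreover have "{v \<in> gcomp H p. lead (conv \<Delta>) n v = 0} \<subseteq> free_on H" using gcomp_free_on by blast
    ultimately show ?thesis
      unfolding n ker_dim_lead[OF g(1)] ker_dim_lead[OF g(2)]
      using dim_injective_image[OF flinear_lpart _ inj] by simp
  qed
  \<comment> \<open>Undoes \<open>conv\<close>: arity \<open>k\<close> sits in coefficient
    \<open>k - 1\<close>, and \<open>sig\<close>, being an involution, restores the signs.\<close>
  define \<phi> where "\<phi> k = lin_ext (\<lambda>b. sig (R b $ (k - 1)))" for k
  have c: "conv \<phi> = R" by (rule ext, rule fps_ext) (simp add: \<phi>_def)
  have p: "graded_ops H K 1 \<phi>"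
    by (rule graded_ops_conv) (use mor_homog[OF M] in \<open>auto simp: c \<phi>_def flinear_lin_ext\<close>)
  have p1: "\<phi> 1 v = letter (lpart R v)" if "v \<in> free_on H" for v
  proof (rule flinear_eq_free_on[OF _ flinear_compose[OF flinear_letter flinear_lpart] _ that])
    fix b assume "b \<in> H"
    then have "R b $ 0 = letter (lpart R (gen b))" using unletter_nth0(1)[OF mor_homog[OF M]] by simp
    then show "\<phi> 1 (gen b) = letter (lpart R (gen b))" by (simp add: \<phi>_def del: lpart_gen)
  qed (simp add: \<phi>_def flinear_lin_ext)
  have "bij_betw (\<phi> 1) (free_on H) (tpow K 1)"
  proof (rule bij_betw_byWitness[where f' = "\<lambda>x. J (unletter x)"])
    show "\<forall>v\<in>free_on H. J (unletter (\<phi> 1 v)) = v" using p1 J(4) by simp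
    have u: "unletter x \<in> free_on K" "letter (unletter x) = x" if "x \<in> tpow K 1" for x :: "('k, 'f) gten"
    proof -
      show "unletter x \<in> free_on K"
        by (rule flinear_free_on[OF flinear_unletter _ that[unfolded tpow_def]]) (auto simp: length_Suc_conv)
      show "letter (unletter x) = x" by (rule letter_unletter) (use that in \<open>auto simp: tpow_def free_on_def\<close>)
    qed
    then show "\<forall>x\<in>tpow K 1. \<phi> 1 (J (unletter x)) = x" using p1[OF Jf] J(3) by simp
    show "(\<lambda>x. J (unletter x)) ` tpow K 1 \<subseteq> free_on H" using Jf u by blast
    show "\<phi> 1 ` free_on H \<subseteq> tpow K 1"
    proof (intro image_subsetI)
      fix v :: "('h, 'f) gvec" assume v: "v \<in> free_on H"
      show "\<phi> 1 v \<in> tpow K 1"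
        unfolding p1[OF v] tpow_def by (rule flinear_free_on[OF flinear_letter _ Rf[OF v]]) auto
    qed
  qed
  then have "ainf_isomorphism H \<Delta> K \<Theta> \<phi>"
    using ainf_morphism_iff_mor[OF g p] M by (simp add: ainf_isomorphism_def c)
  then show "\<exists>\<phi>. ainf_isomorphism H \<Delta> K \<Theta> \<phi>" by blast
qed

theorem corollary3p3:
  fixes X :: "'a topology" and x0 :: 'a
    and H :: "(nat \<times> 'h) set" and \<Delta> :: "nat \<Rightarrow> ('h, 'f::field) gvec \<Rightarrow> ('h, 'f) gten"
  assumes fin: "\<And>p. fin_dim_homology (simplices X) (bd :: ('a simplex, 'f) gvec \<Rightarrow> _) p"
    and x0: "x0 \<in> topspace X"
    and tr: "transferred X x0 H \<Delta>"
  shows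
    "(\<forall>\<Delta>' :: nat \<Rightarrow> ('h, 'f) gvec \<Rightarrow> ('h, 'f) gten.
        transferred X x0 H \<Delta>' \<longrightarrow>
        first_nonzero H \<Delta>' = first_nonzero H \<Delta> \<and>
        (\<forall>m p. 1 \<le> m \<and> enat m \<le> first_nonzero H \<Delta> \<longrightarrow> ker_dim H \<Delta>' m p = ker_dim H \<Delta> m p)) \<and>
     (\<forall>(Y :: 'b topology) y0 f g (K :: (nat \<times> 'k) set) (\<Theta> :: nat \<Rightarrow> ('k, 'f) gvec \<Rightarrow> ('k, 'f) gten).
        continuous_map X Y f \<and> continuous_map Y X g \<and>
        homotopic_with (\<lambda>_. True) X X (g \<circ> f) id \<and> homotopic_with (\<lambda>_. True) Y Y (f \<circ> g) id \<and>
        path_component_of Y (f x0) y0 \<and>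
        transferred Y y0 K \<Theta> \<longrightarrow>
        (\<exists>\<phi>. ainf_isomorphism H \<Delta> K \<Theta> \<phi>) \<and>
        first_nonzero K \<Theta> = first_nonzero H \<Delta> \<and>
        (\<forall>m p. 1 \<le> m \<and> enat m \<le> first_nonzero H \<Delta> \<longrightarrow> ker_dim K \<Theta> m p = ker_dim H \<Delta> m p))"
proof (intro conjI allI impI)
  fix \<Delta>' :: "nat \<Rightarrow> ('h, 'f) gvec \<Rightarrow> ('h, 'f) gten"
  assume tr': "transferred X x0 H \<Delta>'"
  \<comment> \<open>Independence of the choice is the case of the identity equivalence of X and of a
    path that stays at \<open>x0\<close>.\<close>
  have h: "homotopic_with (\<lambda>_. True) X X (id \<circ> id) id" by (simp add: homotopic_with_refl)
  have "path_component_of X (id x0) x0" using x0 by (simp add: path_component_of_refl)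
  from transferred_isomorphic[OF tr tr' x0 continuous_map_id continuous_map_id h h this]
  obtain R where R: "qi H (conv \<Delta>) H (conv \<Delta>') R" by blast
  note inv = qi_invariants[OF transferred_ainf[OF tr] transferred_ainf[OF tr'] transferred_mini[OF tr] transferred_mini[OF tr'] R]
  show "first_nonzero H \<Delta>' = first_nonzero H \<Delta>" by (rule inv(2))
  show "ker_dim H \<Delta>' m p = ker_dim H \<Delta> m p" if "1 \<le> m \<and> enat m \<le> first_nonzero H \<Delta>" for m p
    using inv(3) that by blast
next
  fix Y :: "'b topology" and y0 f g and K :: "(nat \<times> 'k) set" and \<Theta> :: "nat \<Rightarrow> ('k, 'f) gvec \<Rightarrow> ('k, 'f) gten"
  assume *: "continuous_map X Y f \<and> continuous_map Y X g \<and>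
        homotopic_with (\<lambda>_. True) X X (g \<circ> f) id \<and> homotopic_with (\<lambda>_. True) Y Y (f \<circ> g) id \<and>
        path_component_of Y (f x0) y0 \<and> transferred Y y0 K \<Theta>"
  then have t: "transferred Y y0 K \<Theta>" by blast
  have "\<exists>R. qi H (conv \<Delta>) K (conv \<Theta>) R"
    by (rule transferred_isomorphic[OF tr t x0, of f g]) (use * in auto)
  then obtain R where R: "qi H (conv \<Delta>) K (conv \<Theta>) R" by blast
  note inv = qi_invariants[OF transferred_ainf[OF tr] transferred_ainf[OF t] transferred_mini[OF tr] transferred_mini[OF t] R]
  show "\<exists>\<phi>. ainf_isomorphism H \<Delta> K \<Theta> \<phi>" by (rule inv(1))
  show "first_nonzero K \<Theta> = first_nonzero H \<Delta>" by (rule inv(2))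
  show "ker_dim K \<Theta> m p = ker_dim H \<Delta> m p" if "1 \<le> m \<and> enat m \<le> first_nonzero H \<Delta>" for m p
    using inv(3) that by blast
qed

end
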